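(* Let $T>0$, $n\ge1$, $\alpha\in(0,1)$, $\varphi\in BV_{\mathrm{loc}}(\mathbb{R}^n)$, and let $X\in\mathcal{C}^\alpha([0,T],\mathbb{R}^n)$ be a path which is $(s,p)$-variable with respect to $\varphi$ for some $s\in(0,1)$ and $p\in(\frac1{\alpha s},+\infty]$. Then $\varphi\circ X$ has a (unique) Borel version which is Hölder continuous of any order less than $\alpha s-\frac1p$. If in addition $Y\in\mathcal{C}^\gamma([0,T],\mathbb{R})$ for some $\gamma\in(0,1)$ with $\gamma>1-\alpha s+\frac1p$, where $\frac1{+\infty}:=0$, then both the generalized Lebesgue-Stieltjes integral $\int_0^T\varphi(X_u)\,dY_u$ and the Riemann-Stieltjes integral of $\varphi(X)$ with respect to $Y$ over $[0,T]$ exist and agree. Moreover, if in this case we are given $0<\varepsilon<\alpha s-1/p-1+\gamma$, a refining sequence $(\pi_k)_{k\ge1}$ of finite partitions $\pi_k=\{0=t_0^{(k)}<t_1^{(k)}<\dots<t_{N_k}^{(k)}=T\}$ of $[0,T]$ and points $\xi_i^{(k)}\in[t_{i-1}^{(k)},t_i^{(k)}]$, then $$\left|\int_0^T\varphi(X)\,dY-\sum_{i=1}^{N_k}\varphi(X_{\xi_i^{(k)}})\big(Y_{t_i^{(k)}}-Y_{t_{i-1}^{(k)}}\big)\right|\le c\,|\pi_k|^{\alpha s-1/p-1+\gamma-\varepsilon}$$ for all $k$, where $|\pi_k|=\max_i(t_i^{(k)}-t_{i-1}^{(k)})$ is the mesh of $\pi_k$ and $c>0$ is a constant (not depending on $k$)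 depending on $\alpha,\gamma,s,p$ and $Y$.
   Context: **BV and variability.** $\varphi\in L^1_{\mathrm{loc}}(\mathbb{R}^n)$ is in $BV_{\mathrm{loc}}(\mathbb{R}^n)$ if its distributional partial derivatives are signed Radon measures; $\|D\varphi\|$ is the total variation measure of the vector measure $D\varphi$. A path is a continuous function $X:[0,T]\to\mathbb{R}^n$. For $p\in[1,+\infty]$, $s\in(0,1)$, $X$ is $(s,p)$-variable w.r.t. $\varphi$ if there is a relatively compact open neighborhood $\mathcal{U}$ of $X([0,T])$ such that $t\mapsto\int_{\mathcal{U}}|X_t-z|^{-n+1-s}\|D\varphi\|(dz)$ is in $L^p(0,T)$. **Composition.** $\varphi\in L^1_{\mathrm{loc}}(\mathbb{R}^n)$ has approximate limit $\lambda_\varphi(x)$ at $x$ if $\lim_{r\to0}\mathcal{L}^n(B(x,r))^{-1}\int_{B(x,r)}|\varphi(y)-\lambda_\varphi(x)|dy=0$; $S_\varphi$ is the set of $x$ where no approximate limit exists. A Lebesgue representative of $\varphi$ is a Borel function $\widetilde\varphi$ with $\widetilde\varphi=\lambda_\varphi$ on $\mathbb{R}^n\setminus S_\varphi$. $\varphi\circ X=\varphi(X)$ is the $\mathcal{L}^1$-a.e. class of $t\mapsto\widetilde\varphi(X_t)$ (independent of the choice of $\widetilde\varphi$ for variable $X$). In the Riemann-Stieltjes integral and sums, $\varphi(X_t)$ is the value at $t$ of the Hölder continuous version of $\varphi\circ X$. **Function spaces.** $\mathcal{C}^\theta([0,T],\mathbb{R}^m)$: Hölder functions of order $\theta\in(0,1)$.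 $W^{\theta,1}_0(0,T)$: measurable $f$ with $\int_0^T\frac{|f(t)|}{t^\theta}dt+\int_0^T\int_0^T\frac{|f(t)-f(u)|}{|t-u|^{1+\theta}}du\,dt<\infty$. $W^{\theta,\infty}_T(0,T)$: measurable $f$ such that $f(T-)$ exists and $\sup_{t}\frac{|f(T-)-f(t)|}{(T-t)^\theta}+\sup_t\int_t^T\frac{|f(t)-f(u)|}{|t-u|^{1+\theta}}du<\infty$. **Generalized Lebesgue-Stieltjes integral.** For $f\in W_0^{\theta,1}(0,T)$, $g\in W_T^{1-\theta,\infty}(0,T)$, $\theta\in(0,1)$, $$\int_0^Tf_t\,dg_t=(-1)^\theta\int_0^TD^\theta_{0+}f(t)\,D^{1-\theta}_{T-}(g-g(T-))(t)\,dt,$$ where $D^\theta_{0+}f(t)=\frac1{\Gamma(1-\theta)}\Big(\frac{f(t)}{t^\theta}+\theta\int_0^t\frac{f(t)-f(s)}{(t-s)^{\theta+1}}ds\Big)$ and $D^\theta_{T-}g(t)=\frac{(-1)^\theta}{\Gamma(1-\theta)}\Big(\frac{g(t)}{(T-t)^\theta}+\theta\int_t^T\frac{g(t)-g(s)}{(s-t)^{\theta+1}}ds\Big)$ (the complex prefactors combine to $-1$). The value does not depend on the admissible $\theta$.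
   Formalization: The constant c may depend on all the fixed data, including φ, X and ε (not on k, the partitions or the points): dependence on α, γ, s, p and Y alone is impossible, since replacing φ by λφ multiplies the left side by |λ| and leaves those data unchanged. *)

theory Defs
  imports "HOL-Analysis.Analysis"
begin

section \<open>Functions of locally bounded variation\<close>

definition locally_integrable :: "(real ^ 'n \<Rightarrow> real) \<Rightarrow> bool" where
  "locally_integrable \<phi> \<longleftrightarrow> (\<forall>K. compact K \<longrightarrow> set_integrable lebesgue K \<phi>)"

primrec Ck :: "nat \<Rightarrow> (real ^ 'n \<Rightarrow> real) \<Rightarrow> bool" where
  "Ck 0 \<psi> \<longleftrightarrow> continuous_on UNIV \<psi>"
| "Ck (Suc k) \<psi> \<longleftrightarrow> (\<forall>x. \<psi> differentiable (at x)) \<and>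
     (\<forall>b\<in>Basis. Ck k (\<lambda>x. frechet_derivative \<psi> (at x) b))"

definition test_function :: "(real ^ 'n \<Rightarrow> real) \<Rightarrow> bool" where
  "test_function \<psi> \<longleftrightarrow> (\<forall>k. Ck k \<psi>) \<and> compact (closure {x. \<psi> x \<noteq> 0})"

definition radon_measure :: "(real ^ 'n) measure \<Rightarrow> bool" where
  "radon_measure M \<longleftrightarrow> sets M = sets borel \<and> (\<forall>K. compact K \<longrightarrow> emeasure M K < \<infinity>)"

text \<open>
  A signed Radon measure on the whole space is given as a difference of two positive Radon
  measures \<open>P\<close> and \<open>N\<close>. Since both may have infinite total mass, \<open>P - N\<close> is in general
  defined only on bounded Borel sets and on compactly supported functions.
\<close>

definition distr_partial_deriv ::
    "(real ^ 'n \<Rightarrow> real) \<Rightarrow> 'n \<Rightarrow> (real ^ 'n) measure \<Rightarrow> (real ^ 'n) measure \<Rightarrow> bool" where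
  "distr_partial_deriv \<phi> i P N \<longleftrightarrow> radon_measure P \<and> radon_measure N \<and>
     (\<forall>\<psi>. test_function \<psi> \<longrightarrow>
        (LINT x|lebesgue. \<phi> x * frechet_derivative \<psi> (at x) (axis i 1)) =
        - ((LINT x|P. \<psi> x) - (LINT x|N. \<psi> x)))"

definition BV_loc :: "(real ^ 'n \<Rightarrow> real) \<Rightarrow> bool" where
  "BV_loc \<phi> \<longleftrightarrow> locally_integrable \<phi> \<and> (\<forall>i. \<exists>P N. distr_partial_deriv \<phi> i P N)"

text \<open>
  The values of the vector measure on bounded Borel sets. The pair \<open>(P, N)\<close> is not unique, but
  the difference on bounded Borel sets is, so that the choice is immaterial.
\<close>

definition partial_measure :: "(real ^ 'n \<Rightarrow> real) \<Rightarrow> 'n \<Rightarrow> (real ^ 'n) set \<Rightarrow> real" where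
  "partial_measure \<phi> i A =
     (let (P, N) = (SOME PN. distr_partial_deriv \<phi> i (fst PN) (snd PN))
      in measure P A - measure N A)"

definition gradient_measure :: "(real ^ 'n \<Rightarrow> real) \<Rightarrow> (real ^ 'n) set \<Rightarrow> real ^ 'n" where
  "gradient_measure \<phi> A = (\<chi> i. partial_measure \<phi> i A)"

text \<open>
  Total variation of the vector measure: supremum over countable Borel partitions. The pieces are
  bounded because the vector measure is defined only on bounded sets; every Borel set has
  such a partition.
\<close>

definition total_variation :: "(real ^ 'n \<Rightarrow> real) \<Rightarrow> (real ^ 'n) measure" where
  "total_variation \<phi> = measure_of UNIV (sets borel)
     (\<lambda>A. SUP E \<in> {E :: nat \<Rightarrow> (real ^ 'n) set. disjoint_family E \<and>
                   (\<forall>j. E j \<in> sets borel \<and> bounded (E j)) \<and> (\<Union>j. E j) = A}.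
            (\<Sum>j. ennreal (norm (gradient_measure \<phi> (E j)))))"

section \<open>Variability\<close>

definition in_Lp :: "ennreal \<Rightarrow> real \<Rightarrow> (real \<Rightarrow> ennreal) \<Rightarrow> bool" where
  "in_Lp p T f \<longleftrightarrow> f \<in> borel_measurable (lebesgue_on {0<..<T}) \<and>
     (if p = \<infinity> then \<exists>C::real. AE t in lebesgue_on {0<..<T}. f t \<le> ennreal C
      else (AE t in lebesgue_on {0<..<T}. f t < \<infinity>) \<and>
           (\<integral>\<^sup>+t. ennreal (enn2real (f t) powr enn2real p) \<partial>lebesgue_on {0<..<T}) < \<infinity>)"

text \<open>
  The exponent \<open>- n + 1 - s\<close> is negative, so the kernel is infinite on the diagonal, whereas
  \<open>0 powr a = 0\<close>. The diagonal matters for \<open>n = 1\<close>, where the variation measure may have atoms.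
\<close>

definition variability_kernel :: "real \<Rightarrow> real ^ 'n \<Rightarrow> real ^ 'n \<Rightarrow> ennreal" where
  "variability_kernel s x z =
     (if z = x then \<infinity> else ennreal (norm (x - z) powr (- real CARD('n) + 1 - s)))"

definition variable_wrt ::
    "real \<Rightarrow> ennreal \<Rightarrow> real \<Rightarrow> (real ^ 'n \<Rightarrow> real) \<Rightarrow> (real \<Rightarrow> real ^ 'n) \<Rightarrow> bool" where
  "variable_wrt s p T \<phi> X \<longleftrightarrow>
     (\<exists>U. open U \<and> compact (closure U) \<and> X ` {0..T} \<subseteq> U \<and>
        in_Lp p T (\<lambda>t. \<integral>\<^sup>+z\<in>U. variability_kernel s (X t) z \<partial>total_variation \<phi>))"

definition holder_on :: "real \<Rightarrow> real set \<Rightarrow> (real \<Rightarrow> 'a::metric_space) \<Rightarrow> bool" where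
  "holder_on \<theta> S f \<longleftrightarrow> (\<exists>C. \<forall>t\<in>S. \<forall>u\<in>S. dist (f t) (f u) \<le> C * \<bar>t - u\<bar> powr \<theta>)"

section \<open>Composition\<close>

definition approx_limit :: "(real ^ 'n \<Rightarrow> real) \<Rightarrow> real ^ 'n \<Rightarrow> real \<Rightarrow> bool" where
  "approx_limit \<phi> x l \<longleftrightarrow>
     ((\<lambda>r. (LINT y:ball x r|lebesgue. \<bar>\<phi> y - l\<bar>) / measure lebesgue (ball x r)) \<longlongrightarrow> 0) (at_right 0)"

definition lebesgue_representative :: "(real ^ 'n \<Rightarrow> real) \<Rightarrow> (real ^ 'n \<Rightarrow> real) \<Rightarrow> bool" where
  "lebesgue_representative \<phi> \<phi>' \<longleftrightarrow>
     \<phi>' \<in> borel_measurable borel \<and> (\<forall>x l. approx_limit \<phi> x l \<longrightarrow> \<phi>' x = l)"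

text \<open>
  \<open>Z\<close> is a Borel function in the a.e. class of the composition of \<open>\<phi>\<close> and \<open>X\<close>. The composition is
  a well-defined class, so \<open>Z\<close> has to agree with every Lebesgue representative along \<open>X\<close>, and the
  first conjunct makes the condition non-vacuous.
\<close>

definition composition_version ::
    "real \<Rightarrow> (real ^ 'n \<Rightarrow> real) \<Rightarrow> (real \<Rightarrow> real ^ 'n) \<Rightarrow> (real \<Rightarrow> real) \<Rightarrow> bool" where
  "composition_version T \<phi> X Z \<longleftrightarrow>
     (\<exists>\<phi>'. lebesgue_representative \<phi> \<phi>') \<and>
     Z \<in> borel_measurable (restrict_space borel {0..T}) \<and>
     (\<forall>\<phi>'. lebesgue_representative \<phi> \<phi>' \<longrightarrow> (AE t in lebesgue_on {0..T}. Z t = \<phi>' (X t)))"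

section \<open>Generalized Lebesgue-Stieltjes integral\<close>

definition W0 :: "real \<Rightarrow> real \<Rightarrow> (real \<Rightarrow> real) \<Rightarrow> bool" where
  "W0 \<theta> T f \<longleftrightarrow> f \<in> borel_measurable (lebesgue_on {0<..<T}) \<and>
     (\<integral>\<^sup>+t\<in>{0<..<T}. ennreal (\<bar>f t\<bar> / t powr \<theta>) \<partial>lebesgue) +
     (\<integral>\<^sup>+t\<in>{0<..<T}. (\<integral>\<^sup>+u\<in>{0<..<T}. ennreal (\<bar>f t - f u\<bar> / \<bar>t - u\<bar> powr (1 + \<theta>)) \<partial>lebesgue) \<partial>lebesgue)
       < \<infinity>"

definition left_lim :: "(real \<Rightarrow> real) \<Rightarrow> real \<Rightarrow> real" where
  "left_lim f T = Lim (at_left T) f"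

definition WT :: "real \<Rightarrow> real \<Rightarrow> (real \<Rightarrow> real) \<Rightarrow> bool" where
  "WT \<theta> T f \<longleftrightarrow> f \<in> borel_measurable (lebesgue_on {0<..<T}) \<and>
     (\<exists>l. (f \<longlongrightarrow> l) (at_left T)) \<and>
     (SUP t\<in>{0<..<T}. ennreal (\<bar>left_lim f T - f t\<bar> / (T - t) powr \<theta>)) +
     (SUP t\<in>{0<..<T}. \<integral>\<^sup>+u\<in>{t<..<T}. ennreal (\<bar>f t - f u\<bar> / \<bar>t - u\<bar> powr (1 + \<theta>)) \<partial>lebesgue)
       < \<infinity>"

definition left_frac_deriv :: "real \<Rightarrow> (real \<Rightarrow> real) \<Rightarrow> real \<Rightarrow> real" where
  "left_frac_deriv \<theta> f t = 1 / Gamma (1 - \<theta>) *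
     (f t / t powr \<theta> + \<theta> * (LINT s:{0<..<t}|lebesgue. (f t - f s) / (t - s) powr (\<theta> + 1)))"

text \<open>
  The right-sided derivative is taken without its complex prefactor \<open>(-1)\<^sup>\<theta>\<close>. In the integral below
  the prefactors \<open>(-1)\<^sup>\<theta>\<close> and \<open>(-1)\<^sup>1\<^sup>-\<^sup>\<theta>\<close> combine to the factor \<open>-1\<close>.
\<close>

definition right_frac_deriv :: "real \<Rightarrow> real \<Rightarrow> (real \<Rightarrow> real) \<Rightarrow> real \<Rightarrow> real" where
  "right_frac_deriv T \<theta> g t = 1 / Gamma (1 - \<theta>) *
     (g t / (T - t) powr \<theta> + \<theta> * (LINT s:{t<..<T}|lebesgue. (g t - g s) / (s - t) powr (\<theta> + 1)))"

definition gls_formula :: "real \<Rightarrow> real \<Rightarrow> (real \<Rightarrow> real) \<Rightarrow> (real \<Rightarrow> real) \<Rightarrow> real" where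
  "gls_formula \<theta> T f g =
     - (LINT t:{0<..<T}|lebesgue.
          left_frac_deriv \<theta> f t * right_frac_deriv T (1 - \<theta>) (\<lambda>u. g u - left_lim g T) t)"

definition gls_admissible :: "real \<Rightarrow> real \<Rightarrow> (real \<Rightarrow> real) \<Rightarrow> (real \<Rightarrow> real) \<Rightarrow> bool" where
  "gls_admissible \<theta> T f g \<longleftrightarrow> 0 < \<theta> \<and> \<theta> < 1 \<and> W0 \<theta> T f \<and> WT (1 - \<theta>) T g"

text \<open>The integral exists if some order is admissible; its value is the same for all such orders.\<close>

definition has_gls_integral :: "real \<Rightarrow> (real \<Rightarrow> real) \<Rightarrow> (real \<Rightarrow> real) \<Rightarrow> real \<Rightarrow> bool" where
  "has_gls_integral T f g I \<longleftrightarrow>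
     (\<exists>\<theta>. gls_admissible \<theta> T f g) \<and> (\<forall>\<theta>. gls_admissible \<theta> T f g \<longrightarrow> gls_formula \<theta> T f g = I)"

section \<open>Partitions and the Riemann-Stieltjes integral\<close>

text \<open>
  A partition with \<open>N\<close> intervals is a sequence of which only the entries \<open>0, \<dots>, N\<close> are used, the
  tags are the entries \<open>1, \<dots>, N\<close> of another sequence.
\<close>

definition is_partition :: "real \<Rightarrow> nat \<Rightarrow> (nat \<Rightarrow> real) \<Rightarrow> bool" where
  "is_partition T N t \<longleftrightarrow> t 0 = 0 \<and> t N = T \<and> (\<forall>i\<in>{1..N}. t (i - 1) < t i)"

definition are_tags :: "nat \<Rightarrow> (nat \<Rightarrow> real) \<Rightarrow> (nat \<Rightarrow> real) \<Rightarrow> bool" where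
  "are_tags N t \<xi> \<longleftrightarrow> (\<forall>i\<in>{1..N}. \<xi> i \<in> {t (i - 1)..t i})"

definition mesh :: "nat \<Rightarrow> (nat \<Rightarrow> real) \<Rightarrow> real" where
  "mesh N t = Max ((\<lambda>i. t i - t (i - 1)) ` {1..N})"

definition rs_sum ::
    "(real \<Rightarrow> real) \<Rightarrow> (real \<Rightarrow> real) \<Rightarrow> nat \<Rightarrow> (nat \<Rightarrow> real) \<Rightarrow> (nat \<Rightarrow> real) \<Rightarrow> real" where
  "rs_sum f g N t \<xi> = (\<Sum>i=1..N. f (\<xi> i) * (g (t i) - g (t (i - 1))))"

definition has_rs_integral :: "real \<Rightarrow> (real \<Rightarrow> real) \<Rightarrow> (real \<Rightarrow> real) \<Rightarrow> real \<Rightarrow> bool" where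
  "has_rs_integral T f g I \<longleftrightarrow>
     (\<forall>e>0. \<exists>d>0. \<forall>N t \<xi>. is_partition T N t \<and> are_tags N t \<xi> \<and> mesh N t < d \<longrightarrow>
        \<bar>rs_sum f g N t \<xi> - I\<bar> < e)"

definition refining_partitions :: "real \<Rightarrow> (nat \<Rightarrow> nat) \<Rightarrow> (nat \<Rightarrow> nat \<Rightarrow> real) \<Rightarrow> bool" where
  "refining_partitions T N t \<longleftrightarrow>
     (\<forall>k\<ge>1. is_partition T (N k) (t k) \<and> t k ` {0..N k} \<subseteq> t (Suc k) ` {0..N (Suc k)})"

section \<open>The regular version of the composition\<close>

definition regular_version ::
    "real \<Rightarrow> (real ^ 'n \<Rightarrow> real) \<Rightarrow> (real \<Rightarrow> real ^ 'n) \<Rightarrow> real \<Rightarrow> (real \<Rightarrow> real) \<Rightarrow> bool" where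
  "regular_version T \<phi> X \<beta> Z \<longleftrightarrow>
     composition_version T \<phi> X Z \<and> (\<forall>\<theta>. 0 < \<theta> \<and> \<theta> < \<beta> \<longrightarrow> holder_on \<theta> {0..T} Z)"

end

(*
Mollification turns the distributional definition of the gradient measure into the translation
estimate INT_B |phi(y + h) - phi(y)| dy <= n |h| |D phi|(B'), hence into a Poincare inequality on
balls. If the potential V(x) = INT |x - z|^(1 - n - s) |D phi|(dz) is finite, the mean oscillation
of phi on B(x, r) is therefore at most C r^s V(x), and Campanato's telescoping argument yields the
approximate limit lambda(x) together with
|lambda(x) - lambda(y)| <= C |x - y|^s (V(x) + V(y)).
Along the path this is a Hajlasz inequality of order alpha s with weight V(X_t) in L^p, and chaining
through points where the weight is at most its mean gives Hoelder continuity of order alpha s - 1/p.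

For Hoelder functions f, g with orders adding up to more than 1 the averages
(1/h) INT f(t) (g(t + h) - g(t)) dt converge along h/2^j, additively in the interval and with a
local error of order > 1; this gives the Riemann-Stieltjes integral and the rate. For an arbitrary
admissible order theta, the generalized Lebesgue-Stieltjes integral depends only on the
cross-correlation C(r) = INT f(t) (g(t + r) - g(T)) dt: the two fractional derivatives compose to
-C'(0+) because the power kernels t^(-theta) / Gamma(1 - theta) and t^(theta - 1) / Gamma(theta)
convolve to 1, and -C'(0+) is minus the limit of the averages above. Averaging C twice makes
this computation absolutely convergent, and continuity of translations in L^1 removes the averaging.
*)
theory Submission
  imports Defs
begin

section \<open>Translation in the mean\<close>

text \<open>The potential may be infinite at many times, and nothing is known about
  \<open>\<phi>\<close> at those points of the path. Approximate limits are obtained only at the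
  good times, a dense set of full measure, and the regular version is the extension from there. The
  weight at a good time is finite but uncontrolled, so the chain uses it only to identify its limit;
  the loss 1/p is the price of finding small weights on short intervals by Chebyshev's inequality.
  The value of the generalized integral is required for every admissible \<theta>, not only for
  orders between 1 - b and a, where a and b are the Hoelder orders of f and g. The fractional
  derivatives are then not controlled by Hoelder bounds: the left one is just integrable, the right
  one just bounded. Their kernels are not integrable at 0, so Fubini applies only while kernels and
  increments stay together. Shifting g by a + b and integrating (a, b) over a square of side h lets
  the differences move from the kernel variables to h; after that the kernels can be integrated
  out.\<close>

lemma lborel_integrable_shift:
  fixes f :: "'a::euclidean_space \<Rightarrow> real"
  shows "integrable lborel (\<lambda>x. f (x + h)) \<longleftrightarrow> integrable lborel f"
proof -
  have *: "integrable lborel (\<lambda>x. g (x + c))" if "integrable lborel g" for g :: "'a \<Rightarrow> real" and c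
  proof -
    have "integrable (distr lborel borel ((+) c)) g" using that by (simp add: lborel_distr_plus)
    then have "integrable lborel (\<lambda>x. g (c + x))"
      using that by (subst (asm) integrable_distr_eq) auto
    then show ?thesis by (simp add: add.commute)
  qed
  show ?thesis using *[of f h] *[of "\<lambda>x. f (x + h)" "- h"] by auto
qed

lemma lborel_integral_shift:
  fixes f :: "'a::euclidean_space \<Rightarrow> real"
  assumes [measurable]: "f \<in> borel_measurable borel"
  shows "(LINT x|lborel. f (x + h)) = (LINT x|lborel. f x)"
proof -
  have "(LINT x|lborel. f x) = (LINT x|distr lborel borel ((+) h). f x)" by (simp add: lborel_distr_plus)
  also have "\<dots> = (LINT x|lborel. f (h + x))" by (subst integral_distr) auto
  finally show ?thesis by (simp add: add.commute)
qed

lemma lborel_nn_integral_shift: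
  fixes f :: "'a::euclidean_space \<Rightarrow> ennreal"
  assumes [measurable]: "f \<in> borel_measurable borel"
  shows "(\<integral>\<^sup>+x. f (x + h) \<partial>lborel) = (\<integral>\<^sup>+x. f x \<partial>lborel)"
proof -
  have "(\<integral>\<^sup>+x. f x \<partial>lborel) = (\<integral>\<^sup>+x. f x \<partial>distr lborel borel ((+) h))" by (simp add: lborel_distr_plus)
  also have "\<dots> = (\<integral>\<^sup>+x. f (h + x) \<partial>lborel)" by (subst nn_integral_distr) auto
  finally show ?thesis by (simp add: add.commute)
qed

text \<open>Continuity of translation at 0 in the L1 norm, in sequential form so that dominated
  convergence applies directly to a shifted indicator.\<close>

definition shift_continuous :: "('a::euclidean_space \<Rightarrow> real) \<Rightarrow> bool" where
  "shift_continuous f \<longleftrightarrow>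
     (\<forall>h. h \<longlonglongrightarrow> 0 \<longrightarrow> (\<lambda>k::nat. LINT x|lborel. \<bar>f (x + h k) - f x\<bar>) \<longlonglongrightarrow> 0)"

text \<open>The property is closed under L1 limits: by translation invariance the shifted
  approximation error equals the unshifted one, so two errors of e/4 and the shift error of
  \<open>g\<close> add up to less than e.\<close>

lemma shift_continuous_approx:
  fixes f :: "'a::euclidean_space \<Rightarrow> real"
  assumes f: "integrable lborel f"
    and g: "\<And>e. e > 0 \<Longrightarrow> \<exists>g. integrable lborel g \<and> shift_continuous g \<and> (LINT x|lborel. \<bar>f x - g x\<bar>) \<le> e"
  shows "shift_continuous f"
  unfolding shift_continuous_def
proof (intro allI impI)
  fix h :: "nat \<Rightarrow> 'a" assume h: "h \<longlonglongrightarrow> 0"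
  show "(\<lambda>k. LINT x|lborel. \<bar>f (x + h k) - f x\<bar>) \<longlonglongrightarrow> 0"
  proof (rule LIMSEQ_I)
    fix e :: real assume "e > 0"
    then obtain g where gi: "integrable lborel g" and gs: "shift_continuous g"
      and fg: "(LINT x|lborel. \<bar>f x - g x\<bar>) \<le> e / 4" using g[of "e/4"] by auto
    have fm: "f \<in> borel_measurable borel" "g \<in> borel_measurable borel" using f gi by auto
    have "(\<lambda>k. LINT x|lborel. \<bar>g (x + h k) - g x\<bar>) \<longlonglongrightarrow> 0"
      using gs h by (auto simp: shift_continuous_def)
    from LIMSEQ_D[OF this, of "e/4"] \<open>e > 0\<close> obtain N where
      N: "\<And>k. k \<ge> N \<Longrightarrow> (LINT x|lborel. \<bar>g (x + h k) - g x\<bar>) < e/4" by fastforce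
    have "(LINT x|lborel. \<bar>f (x + h k) - f x\<bar>) < e" if "k \<ge> N" for k
    proof -
      have i: "integrable lborel (\<lambda>x. f (x + h k))" "integrable lborel (\<lambda>x. g (x + h k))"
        using f gi by (auto simp: lborel_integrable_shift)
      have "(LINT x|lborel. \<bar>f (x + h k) - f x\<bar>) \<le>
         (LINT x|lborel. \<bar>f (x + h k) - g (x + h k)\<bar> + \<bar>g (x + h k) - g x\<bar> + \<bar>f x - g x\<bar>)"
        by (rule integral_mono) (auto intro!: i f gi integrable_abs Bochner_Integration.integrable_diff Bochner_Integration.integrable_add)
      also have "\<dots> = (LINT x|lborel. \<bar>f (x + h k) - g (x + h k)\<bar>) + (LINT x|lborel. \<bar>g (x + h k) - g x\<bar>) + (LINT x|lborel. \<bar>f x - g x\<bar>)"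
        by (simp add: i f gi)
      also have "(LINT x|lborel. \<bar>f (x + h k) - g (x + h k)\<bar>) = (LINT x|lborel. \<bar>f x - g x\<bar>)"
        by (rule lborel_integral_shift[where f="\<lambda>x. \<bar>f x - g x\<bar>"]) (use fm in measurable)
      finally show ?thesis using N[OF that] fg \<open>e > 0\<close> by linarith
    qed
    then show "\<exists>N. \<forall>k\<ge>N. norm ((LINT x|lborel. \<bar>f (x + h k) - f x\<bar>) - 0) < e"
      by (auto intro!: exI[of _ N])
  qed
qed

text \<open>Only one half converges pointwise: a point of an open set stays in it under small
  shifts, so the positive part of the indicator minus its shift tends to 0 and is dominated by the
  indicator. The other half has the same integral, because the indicator and its shift have equal
  integrals.\<close>

lemma shift_continuous_indicator_open:
  fixes S :: "'a::euclidean_space set"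
  assumes S: "open S" "emeasure lborel S < \<infinity>"
  shows "shift_continuous (indicat_real S)"
  unfolding shift_continuous_def
proof (intro allI impI)
  fix h :: "nat \<Rightarrow> 'a" assume h: "h \<longlonglongrightarrow> 0"
  let ?f = "indicat_real S"
  have Sm[measurable]: "S \<in> sets borel" using S by auto
  have fi: "integrable lborel ?f" using S by (auto intro!: integrable_real_indicator)
  have fh: "integrable lborel (\<lambda>x. ?f (x + h k))" for k using fi by (simp add: lborel_integrable_shift)
  have "(\<lambda>k. LINT x|lborel. max 0 (?f x - ?f (x + h k))) \<longlonglongrightarrow> (LINT x::'a|lborel. 0)"
  proof (rule integral_dominated_convergence[where w="?f"])
    show "AE x in lborel. (\<lambda>k. max 0 (?f x - ?f (x + h k))) \<longlonglongrightarrow> 0"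
    proof (intro AE_I2)
      fix x :: 'a
      show "(\<lambda>k. max 0 (?f x - ?f (x + h k))) \<longlonglongrightarrow> 0"
      proof (cases "x \<in> S")
        case True
        have "(\<lambda>k. x + h k) \<longlonglongrightarrow> x" using tendsto_add[OF tendsto_const h, of x] by simp
        then have "\<forall>\<^sub>F k in sequentially. x + h k \<in> S" using S(1) True by (rule topological_tendstoD)
        then have "\<forall>\<^sub>F k in sequentially. max 0 (?f x - ?f (x + h k)) = 0" by eventually_elim (auto simp: True)
        then show ?thesis by (simp add: tendsto_eventually)
      qed (auto simp: indicator_def of_bool_def max_def intro!: tendsto_eventually always_eventually)
    qed
  qed (use fi in \<open>auto simp: indicator_def max_def\<close>)
  then have "(\<lambda>k. 2 * (LINT x|lborel. max 0 (?f x - ?f (x + h k)))) \<longlonglongrightarrow> 2 * 0" by (intro tendsto_intros) simp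
  moreover have "(LINT x|lborel. \<bar>?f (x + h k) - ?f x\<bar>) = 2 * (LINT x|lborel. max 0 (?f x - ?f (x + h k)))" for k
  proof -
    have mi: "integrable lborel (\<lambda>x. max 0 (?f x - ?f (x + h k)))"
      using fi fh by (intro integrable_max) auto
    have "(LINT x|lborel. \<bar>?f (x + h k) - ?f x\<bar>) = (LINT x|lborel. 2 * max 0 (?f x - ?f (x + h k)) + (?f (x + h k) - ?f x))"
      by (intro Bochner_Integration.integral_cong) (auto simp: max_def)
    also have "\<dots> = (LINT x|lborel. 2 * max 0 (?f x - ?f (x + h k))) + ((LINT x|lborel. ?f (x + h k)) - (LINT x|lborel. ?f x))"
      using mi fi fh by simp
    also have "(LINT x|lborel. ?f (x + h k)) = (LINT x|lborel. ?f x)"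
      by (rule lborel_integral_shift) measurable
    finally show ?thesis by simp
  qed
  ultimately show "(\<lambda>k. LINT x|lborel. \<bar>?f (x + h k) - ?f x\<bar>) \<longlonglongrightarrow> 0" by simp
qed

text \<open>Outer regularity: the L1 distance to the indicator of an open superset is the measure of
  the difference.\<close>

lemma shift_continuous_indicator:
  fixes S :: "'a::euclidean_space set"
  assumes S: "S \<in> sets lborel" "emeasure lborel S < \<infinity>"
  shows "shift_continuous (indicat_real S)"
proof (rule shift_continuous_approx)
  show fi: "integrable lborel (indicat_real S)" using S by (auto intro!: integrable_real_indicator)
  fix e :: real assume "e > 0"
  have "S \<in> sets lebesgue" using S by auto
  then obtain U where U: "open U" "S \<subseteq> U" "U - S \<in> lmeasurable" "emeasure lebesgue (U - S) < ennreal e"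
    using sets_lebesgue_outer_open \<open>e > 0\<close> by blast
  have Um: "U \<in> sets borel" "S \<in> sets borel" using U S by auto
  then have D: "U - S \<in> sets borel" by auto
  have em: "emeasure lborel (U - S) < ennreal e" using U(4) D by simp
  have "emeasure lborel U \<le> emeasure lborel (U - S) + emeasure lborel S"
    using emeasure_subadditive[of "U - S" lborel S] Um D U(2) by (simp add: Un_absorb2)
  also have "\<dots> < \<infinity>" using em S(2) by (auto simp: less_top[symmetric] ennreal_add_eq_top)
  finally have Uf: "emeasure lborel U < \<infinity>" .
  have ui: "integrable lborel (indicat_real U)" using Um Uf by (auto intro!: integrable_real_indicator)
  have "(LINT x|lborel. \<bar>indicat_real S x - indicat_real U x\<bar>) = (LINT x|lborel. indicat_real (U - S) x)"
    using U(2) by (intro Bochner_Integration.integral_cong) (auto simp: indicator_def)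
  also have "\<dots> = measure lborel (U - S)" using D by simp
  also have "\<dots> \<le> e" using em \<open>e > 0\<close> by (simp add: measure_def enn2real_leI less_imp_le)
  finally show "\<exists>g. integrable lborel g \<and> shift_continuous g \<and> (LINT x|lborel. \<bar>indicat_real S x - g x\<bar>) \<le> e"
    using ui shift_continuous_indicator_open[OF U(1) Uf] by blast
qed

lemma shift_continuous_integrable:
  fixes f :: "'a::euclidean_space \<Rightarrow> real"
  assumes "integrable lborel f"
  shows "shift_continuous f"
  using assms
proof (induction rule: integrable_induct)
  case (base A c)
  have "(LINT x|lborel. \<bar>indicat_real A (x + y) *\<^sub>R c - indicat_real A x *\<^sub>R c\<bar>)
      = \<bar>c\<bar> * (LINT x|lborel. \<bar>indicat_real A (x + y) - indicat_real A x\<bar>)" for y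
    by (subst integral_mult_right_zero[symmetric]) (simp add: abs_mult[symmetric] algebra_simps)
  with shift_continuous_indicator[OF base] show ?case
    by (auto simp: shift_continuous_def intro!: tendsto_mult_right_zero)
next
  case (add f g)
  show ?case unfolding shift_continuous_def
  proof (intro allI impI)
    fix h :: "nat \<Rightarrow> 'a" assume h: "h \<longlonglongrightarrow> 0"
    have i: "integrable lborel (\<lambda>x. f (x + h k))" "integrable lborel (\<lambda>x. g (x + h k))" for k
      using add by (auto simp: lborel_integrable_shift)
    have l: "(\<lambda>k. (LINT x|lborel. \<bar>f (x + h k) - f x\<bar>) + (LINT x|lborel. \<bar>g (x + h k) - g x\<bar>)) \<longlonglongrightarrow> 0 + 0"
      using add h by (intro tendsto_add) (auto simp: shift_continuous_def)
    show "(\<lambda>k. LINT x|lborel. \<bar>f (x + h k) + g (x + h k) - (f x + g x)\<bar>) \<longlonglongrightarrow> 0"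
    proof (rule tendsto_sandwich[OF _ _ tendsto_const])
      show "\<forall>\<^sub>F k in sequentially. (LINT x|lborel. \<bar>f (x + h k) + g (x + h k) - (f x + g x)\<bar>) \<le>
         (LINT x|lborel. \<bar>f (x + h k) - f x\<bar>) + (LINT x|lborel. \<bar>g (x + h k) - g x\<bar>)"
      proof (intro always_eventually allI)
        fix k
        have "(LINT x|lborel. \<bar>f (x + h k) + g (x + h k) - (f x + g x)\<bar>) \<le>
          (LINT x|lborel. \<bar>f (x + h k) - f x\<bar> + \<bar>g (x + h k) - g x\<bar>)"
          by (rule integral_mono) (auto intro!: i add integrable_abs Bochner_Integration.integrable_diff Bochner_Integration.integrable_add)
        then show "(LINT x|lborel. \<bar>f (x + h k) + g (x + h k) - (f x + g x)\<bar>) \<le>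
         (LINT x|lborel. \<bar>f (x + h k) - f x\<bar>) + (LINT x|lborel. \<bar>g (x + h k) - g x\<bar>)"
          by (simp add: i add)
      qed
    qed (use l in \<open>auto intro!: always_eventually\<close>)
  qed
next
  case (lim f s)
  show ?case
  proof (rule shift_continuous_approx[OF lim(4)])
    fix e :: real assume "e > 0"
    have "(\<lambda>i. LINT x|lborel. \<bar>f x - s i x\<bar>) \<longlonglongrightarrow> (LINT x::'a|lborel. 0)"
    proof (rule integral_dominated_convergence[where w="\<lambda>x. 3 * \<bar>f x\<bar>"])
      show "AE x in lborel. (\<lambda>i. \<bar>f x - s i x\<bar>) \<longlonglongrightarrow> 0"
      proof (intro AE_I2 tendsto_rabs_zero)
        fix x :: 'a
        have "(\<lambda>i. f x - s i x) \<longlonglongrightarrow> f x - f x" by (intro tendsto_intros lim(2)) auto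
        then show "(\<lambda>i. f x - s i x) \<longlonglongrightarrow> 0" by simp
      qed
      show "AE x in lborel. norm \<bar>f x - s i x\<bar> \<le> 3 * \<bar>f x\<bar>" for i
        using lim(3)[of _ i] by (intro AE_I2) (force simp: abs_if split: if_splits)
    qed (use lim in auto)
    then have "(\<lambda>i. LINT x|lborel. \<bar>f x - s i x\<bar>) \<longlonglongrightarrow> 0" by simp
    from LIMSEQ_D[OF this \<open>e > 0\<close>] obtain i where "norm ((LINT x|lborel. \<bar>f x - s i x\<bar>) - 0) < e" by auto
    then have "(LINT x|lborel. \<bar>f x - s i x\<bar>) \<le> e" by simp
    then show "\<exists>g. integrable lborel g \<and> shift_continuous g \<and> (LINT x|lborel. \<bar>f x - g x\<bar>) \<le> e"
      using lim(1,5) by blast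
  qed
qed

text \<open>Shifts that violate the bound at every scale 1 / (k + 1) would form a null sequence,
  against the sequential statement.\<close>

lemma L1_shift_small:
  fixes f :: "'a::euclidean_space \<Rightarrow> real"
  assumes "integrable lborel f" and "e > 0"
  shows "\<exists>d>0. \<forall>h. norm h < d \<longrightarrow> (LINT x|lborel. \<bar>f (x + h) - f x\<bar>) < e"
proof (rule ccontr)
  assume "\<not> ?thesis"
  then have "\<forall>k::nat. \<exists>h. norm h < 1 / Suc k \<and> \<not> (LINT x|lborel. \<bar>f (x + h) - f x\<bar>) < e"
    by (auto simp del: of_nat_Suc)
  then obtain h where h: "\<And>k::nat. norm (h k) < 1 / Suc k" "\<And>k. \<not> (LINT x|lborel. \<bar>f (x + h k) - f x\<bar>) < e"
    by metis
  have "h \<longlonglongrightarrow> 0"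
    by (rule Lim_null_comparison[OF _ LIMSEQ_inverse_real_of_nat])
      (use h(1) in \<open>auto intro!: always_eventually less_imp_le simp: inverse_eq_divide simp del: of_nat_Suc\<close>)
  then have "(\<lambda>k. LINT x|lborel. \<bar>f (x + h k) - f x\<bar>) \<longlonglongrightarrow> 0"
    using shift_continuous_integrable[OF assms(1)] by (auto simp: shift_continuous_def)
  from LIMSEQ_D[OF this \<open>e > 0\<close>] h(2) show False by fastforce
qed

lemma integrable_bounded_support:
  fixes g :: "'a::euclidean_space \<Rightarrow> real"
  assumes [measurable]: "g \<in> borel_measurable borel" and "\<And>u. \<bar>g u\<bar> \<le> C" and "\<And>u. u \<notin> cball x r \<Longrightarrow> g u = 0"
  shows "integrable lborel g"
proof (rule Bochner_Integration.integrable_bound)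
  show "integrable lborel (\<lambda>u. C * indicat_real (cball x r) u)"
    using emeasure_lborel_cball_finite[of x r] by (intro integrable_mult_right integrable_real_indicator) auto
  show "AE u in lborel. norm (g u) \<le> norm (C * indicat_real (cball x r) u)"
    using assms(3) order.trans[OF assms(2) abs_ge_self] by (intro AE_I2) (auto simp: indicator_def)
qed auto

section \<open>Functions of bounded variation\<close>

definition bounded_partitions :: "(real ^ 'n) set \<Rightarrow> (nat \<Rightarrow> (real ^ 'n) set) set" where
  "bounded_partitions A = {E. disjoint_family E \<and> (\<forall>j. E j \<in> sets borel \<and> bounded (E j)) \<and> (\<Union>j. E j) = A}"

lemma bounded_partitions_nonempty:
  assumes "A \<in> sets borel"
  shows "bounded_partitions (A :: (real ^ 'n) set) \<noteq> {}"
proof -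
  define E where "E = disjointed (\<lambda>j. A \<inter> ball 0 (real j))"
  have "disjoint_family E" by (simp add: E_def disjoint_family_disjointed)
  moreover have "E j \<in> sets borel" for j
    unfolding E_def disjointed_def using assms by (auto intro!: sets.Diff sets.finite_UN)
  moreover have "bounded (E j)" for j
    using disjointed_subset[of "\<lambda>j. A \<inter> ball 0 (real j)" j] unfolding E_def
    by (rule bounded_subset[rotated]) auto
  moreover have "(\<Union>j. E j) = A"
  proof -
    have "(\<Union>j. ball (0::real ^ 'n) (real j)) = UNIV" using reals_Archimedean2 by (auto simp: dist_norm)
    then show ?thesis unfolding E_def UN_disjointed_eq by auto
  qed
  ultimately show ?thesis by (auto simp: bounded_partitions_def)
qed

lemma ennreal_suminf_swap:
  "(\<Sum>i. \<Sum>j. f i j :: ennreal) = (\<Sum>j. \<Sum>i. f i j)" for f :: "nat \<Rightarrow> nat \<Rightarrow> ennreal"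
proof -
  have "(\<Sum>i. \<Sum>j. f i j) = (\<integral>\<^sup>+i. (\<Sum>j. f i j) \<partial>count_space UNIV)" by (simp add: nn_integral_count_space_nat)
  also have "\<dots> = (\<Sum>j. \<integral>\<^sup>+i. f i j \<partial>count_space UNIV)" by (rule nn_integral_suminf) auto
  finally show ?thesis by (simp add: nn_integral_count_space_nat)
qed

text \<open>Additivity of \<open>\<nu>\<close> is not needed: countable subadditivity on bounded sets suffices.\<close>

lemma emeasure_variation:
  fixes \<nu> :: "(real ^ 'n) set \<Rightarrow> ennreal"
  assumes emp: "\<nu> {} = 0"
    and sub: "\<And>E. disjoint_family E \<Longrightarrow> (\<And>j::nat. E j \<in> sets borel) \<Longrightarrow> bounded (\<Union>j. E j) \<Longrightarrow> \<nu> (\<Union>j. E j) \<le> (\<Sum>j. \<nu> (E j))"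
  defines "\<mu> \<equiv> \<lambda>A. SUP E \<in> bounded_partitions A. (\<Sum>j. \<nu> (E j))"
  shows "emeasure (measure_of UNIV (sets borel) \<mu>) A = (if A \<in> sets borel then \<mu> A else 0)"
proof -
  define M where "M = measure_of UNIV (sets (borel :: (real ^ 'n) measure)) \<mu>"
  have sM: "sets M = sets borel" by (simp add: M_def sets.sigma_sets_eq[of borel, simplified])
  have pos: "positive (sets M) \<mu>"
  proof -
    have "\<mu> {} \<le> 0" unfolding \<mu>_def by (rule SUP_least) (auto simp: bounded_partitions_def emp)
    then show ?thesis by (simp add: positive_def)
  qed
  have ca: "countably_additive (sets M) \<mu>"
  proof (rule countably_additiveI)
    fix A :: "nat \<Rightarrow> (real ^ 'n) set"
    assume "range A \<subseteq> sets M" and dA: "disjoint_family A"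
    then have A: "A i \<in> sets borel" for i using sM by auto
    show "(\<Sum>i. \<mu> (A i)) = \<mu> (\<Union>i. A i)"
    proof (rule antisym)
      have "(\<Sum>j. \<nu> (E j)) \<le> (\<Sum>i. \<mu> (A i))" if E: "E \<in> bounded_partitions (\<Union>i. A i)" for E
      proof -
        have EE: "disjoint_family E" "\<And>j. E j \<in> sets borel" "\<And>j. bounded (E j)" "(\<Union>j. E j) = (\<Union>i. A i)"
          using E by (auto simp: bounded_partitions_def)
        \<comment> \<open>Cutting each piece along the disjoint sets \<open>A i\<close> can only
          increase the sum; this is where subadditivity of \<open>\<nu>\<close> on bounded sets
          enters.\<close>
        have "(\<Sum>j. \<nu> (E j)) \<le> (\<Sum>j. \<Sum>i. \<nu> (E j \<inter> A i))"
        proof (intro suminf_le)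
          fix j
          have un: "(\<Union>i. E j \<inter> A i) = E j" using EE(4) by blast
          have "\<nu> (\<Union>i. E j \<inter> A i) \<le> (\<Sum>i. \<nu> (E j \<inter> A i))"
            by (rule sub) (use dA A EE(2,3) in \<open>auto simp: un disjoint_family_on_def\<close>)
          then show "\<nu> (E j) \<le> (\<Sum>i. \<nu> (E j \<inter> A i))" by (simp only: un)
        qed auto
        also have "\<dots> = (\<Sum>i. \<Sum>j. \<nu> (E j \<inter> A i))" by (rule ennreal_suminf_swap)
        also have "\<dots> \<le> (\<Sum>i. \<mu> (A i))"
        proof (intro suminf_le)
          fix i
          have "(\<lambda>j. E j \<inter> A i) \<in> bounded_partitions (A i)"
            using EE A by (auto simp: bounded_partitions_def disjoint_family_on_def intro: bounded_subset)
          then show "(\<Sum>j. \<nu> (E j \<inter> A i)) \<le> \<mu> (A i)" unfolding \<mu>_def by (rule SUP_upper2) simp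
        qed auto
        finally show ?thesis .
      qed
      then show "\<mu> (\<Union>i. A i) \<le> (\<Sum>i. \<mu> (A i))" unfolding \<mu>_def by (intro SUP_least)
      \<comment> \<open>Partitions of the single sets are enumerated, through the pairing of the
        naturals, into one partition of the union.\<close>
      have comb: "(\<Sum>i. \<Sum>j. \<nu> (F i j)) \<le> \<mu> (\<Union>i. A i)" if F: "\<And>i. F i \<in> bounded_partitions (A i)" for F
      proof -
        have FF: "\<And>i. disjoint_family (F i)" "\<And>i j. F i j \<in> sets borel" "\<And>i j. bounded (F i j)" "\<And>i. (\<Union>j. F i j) = A i"
          using F by (auto simp: bounded_partitions_def)
        define G where "G = (\<lambda>k. case_prod F (prod_decode k))"
        have "(\<Sum>k. \<nu> (G k)) = (\<Sum>i. \<Sum>j. \<nu> (F i j))"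
          using suminf_ennreal_2dimen[of "\<lambda>i. \<Sum>j. \<nu> (F i j)" "\<lambda>(i,j). \<nu> (F i j)"]
          by (simp add: G_def case_prod_beta)
        moreover have "G \<in> bounded_partitions (\<Union>i. A i)"
        proof -
          have "disjoint_family G"
          proof (unfold disjoint_family_on_def, intro ballI impI)
            fix k l :: nat assume "k \<noteq> l"
            obtain i j i' j' where d: "prod_decode k = (i, j)" "prod_decode l = (i', j')" by fastforce
            have "(i, j) \<noteq> (i', j')" using \<open>k \<noteq> l\<close> d by (metis prod_decode_inverse)
            then show "G k \<inter> G l = {}"
            proof (cases "i = i'")
              case True
              then show ?thesis using FF(1)[of i] \<open>(i, j) \<noteq> (i', j')\<close> by (auto simp: G_def d disjoint_family_on_def)
            next
              case False
              have "F i j \<subseteq> A i" "F i' j' \<subseteq> A i'" using FF(4) by auto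
              moreover have "A i \<inter> A i' = {}" using dA False by (auto simp: disjoint_family_on_def)
              ultimately show ?thesis by (auto simp: G_def d)
            qed
          qed
          moreover have "(\<Union>k. G k) = (\<Union>i. A i)"
          proof -
            have "(\<Union>k. G k) = (\<Union>x\<in>range prod_decode. case_prod F x)" by (auto simp: G_def)
            also have "\<dots> = (\<Union>x. case_prod F x)" using surj_prod_decode by simp
            also have "\<dots> = (\<Union>i. \<Union>j. F i j)" by auto
            finally show ?thesis using FF(4) by simp
          qed
          ultimately show ?thesis using FF by (auto simp: bounded_partitions_def G_def split: prod.splits)
        qed
        ultimately show ?thesis unfolding \<mu>_def by (metis (no_types, lifting) SUP_upper)
      qed
      show "(\<Sum>i. \<mu> (A i)) \<le> \<mu> (\<Union>i. A i)"
      proof (cases "\<exists>i. \<mu> (A i) = \<infinity>")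
        case False
        show ?thesis
        proof (rule ennreal_le_epsilon)
          fix e :: real assume "0 < e"
          \<comment> \<open>Near-optimal partitions with errors e / 2^(i + 1), which sum to
            e.\<close>
          have "\<exists>E\<in>bounded_partitions (A i). \<mu> (A i) < (\<Sum>j. \<nu> (E j)) + ennreal (e * (1 / 2) ^ Suc i)" for i
            by (rule SUP_approx_ennreal) (use False \<open>0 < e\<close> bounded_partitions_nonempty[OF A] in \<open>auto simp: \<mu>_def\<close>)
          then obtain F where F: "\<And>i. F i \<in> bounded_partitions (A i)"
            "\<And>i. \<mu> (A i) < (\<Sum>j. \<nu> (F i j)) + ennreal (e * (1 / 2) ^ Suc i)" by metis
          have "(\<Sum>i. \<mu> (A i)) \<le> (\<Sum>i. (\<Sum>j. \<nu> (F i j)) + ennreal (e * (1 / 2) ^ Suc i))"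
            using F(2) by (intro suminf_le) (auto intro: less_imp_le)
          also have "\<dots> = (\<Sum>i. \<Sum>j. \<nu> (F i j)) + (\<Sum>i. ennreal (e * (1 / 2) ^ Suc i))"
            by (rule suminf_add[symmetric]) auto
          also have "(\<Sum>i. ennreal (e * (1 / 2) ^ Suc i)) = ennreal (e * 1)"
            using \<open>0 < e\<close> by (intro suminf_ennreal_eq sums_mult power_half_series) auto
          finally show "(\<Sum>i. \<mu> (A i)) \<le> \<mu> (\<Union>i. A i) + ennreal e"
            using comb[OF F(1)] by (auto intro: order.trans add_right_mono)
        qed
      next
        case True
        then obtain i where i: "\<mu> (A i) = \<infinity>" by blast
        \<comment> \<open>An infinite supremum has no near-optimal partition. Instead the partition
          of that one set is varied, while the other sets keep arbitrary fixed partitions.\<close>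
        have "\<forall>i. \<exists>E. E \<in> bounded_partitions (A i)" using bounded_partitions_nonempty[OF A] by blast
        then obtain F0 where F0: "\<And>i. F0 i \<in> bounded_partitions (A i)" by metis
        have "\<mu> (A i) \<le> \<mu> (\<Union>i. A i)"
        proof -
          have "(\<Sum>j. \<nu> (E j)) \<le> \<mu> (\<Union>i. A i)" if "E \<in> bounded_partitions (A i)" for E
          proof -
            have "(\<Sum>j. \<nu> (E j)) = (\<Sum>k\<in>{i}. \<Sum>j. \<nu> ((F0(i := E)) k j))" by simp
            also have "\<dots> \<le> (\<Sum>k. \<Sum>j. \<nu> ((F0(i := E)) k j))" by (rule sum_le_suminf) auto
            also have "\<dots> \<le> \<mu> (\<Union>i. A i)" by (rule comb) (use F0 that in auto)
            finally show ?thesis .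
          qed
          then show ?thesis unfolding \<mu>_def by (intro SUP_least)
        qed
        then show ?thesis using i by (simp add: top_unique)
      qed
    qed
  qed
  show ?thesis
  proof (cases "A \<in> sets borel")
    case True
    then have "emeasure M A = \<mu> A" using sM by (intro emeasure_measure_of[OF M_def _ pos ca]) auto
    then show ?thesis using True by (simp add: M_def)
  next
    case False
    then show ?thesis using sM emeasure_notin_sets[of A M] by (simp add: M_def)
  qed
qed

lemma sets_total_variation [measurable_cong]: "sets (total_variation \<phi>) = sets borel"
  by (simp add: total_variation_def sets.sigma_sets_eq[of borel, simplified])

lemma radon_finite:
  assumes "radon_measure M" "bounded A" "A \<in> sets borel"
  shows "emeasure M A < \<infinity>"
proof -
  obtain r where "\<forall>x\<in>A. norm x \<le> r" using assms(2) unfolding bounded_iff by blast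
  then have "A \<subseteq> cball 0 r" by auto
  then have "emeasure M A \<le> emeasure M (cball 0 r)" using assms(1) by (intro emeasure_mono) (auto simp: radon_measure_def)
  also have "\<dots> < \<infinity>" using assms(1) by (auto simp: radon_measure_def)
  finally show ?thesis .
qed

text \<open>On bounded sets the difference of \<open>P i\<close> and \<open>N i\<close> is a
  component of the vector measure, hence at most the variation; cutting into bounded pieces extends
  this to all Borel sets. The inequalities are additive because all terms may be infinite there.
  Finiteness on bounded sets comes from bounding the norm of the vector by the sum of its
  components, hence by the sum of all \<open>P i\<close> and \<open>N i\<close>.\<close>

lemma total_variation_properties:
  fixes \<phi> :: "real ^ 'n \<Rightarrow> real"
  assumes "BV_loc \<phi>"
  obtains P N where "\<And>i. distr_partial_deriv \<phi> i (P i) (N i)"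
    "\<And>i A. A \<in> sets borel \<Longrightarrow> emeasure (P i) A \<le> emeasure (N i) A + emeasure (total_variation \<phi>) A"
    "\<And>i A. A \<in> sets borel \<Longrightarrow> emeasure (N i) A \<le> emeasure (P i) A + emeasure (total_variation \<phi>) A"
    "\<And>A. A \<in> sets borel \<Longrightarrow> bounded A \<Longrightarrow> emeasure (total_variation \<phi>) A < \<infinity>"
proof -
  \<comment> \<open>The same choice as in \<open>partial_measure\<close>, so that \<open>pm\<close>
    below holds by unfolding.\<close>
  define PN where "PN = (\<lambda>i. SOME PN. distr_partial_deriv \<phi> i (fst PN) (snd PN))"
  define P where "P = (\<lambda>i. fst (PN i))"
  define N where "N = (\<lambda>i. snd (PN i))"
  have d: "distr_partial_deriv \<phi> i (P i) (N i)" for i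
    unfolding P_def N_def PN_def by (rule someI_ex[where P="\<lambda>PN. distr_partial_deriv \<phi> i (fst PN) (snd PN)"])
      (use assms in \<open>auto simp: BV_loc_def\<close>)
  then have rad: "radon_measure (P i)" "radon_measure (N i)" for i by (auto simp: distr_partial_deriv_def)
  have s: "sets (P i) = sets borel" "sets (N i) = sets borel" for i using rad by (auto simp: radon_measure_def)
  have pm: "partial_measure \<phi> i A = measure (P i) A - measure (N i) A" for i A
    by (simp add: partial_measure_def P_def N_def PN_def case_prod_beta Let_def)
  define \<nu> where "\<nu> = (\<lambda>A. ennreal (norm (gradient_measure \<phi> A)))"
  \<comment> \<open>On bounded sets the vector values are countably additive; the triangle
    inequality for the partial sums and continuity of the norm give subadditivity of the
    norm.\<close>
  have sub: "\<nu> (\<Union>j. E j) \<le> (\<Sum>j. \<nu> (E j))"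
    if E: "disjoint_family E" "\<And>j::nat. E j \<in> sets borel" "bounded (\<Union>j. E j)" for E
  proof -
    have um: "(\<Union>j. E j) \<in> sets borel" using E(2) by auto
    have "(\<lambda>j. partial_measure \<phi> i (E j)) sums partial_measure \<phi> i (\<Union>j. E j)" for i
      unfolding pm
      by (intro sums_diff measure_UNION) (use E s radon_finite[OF rad(1) E(3) um, of i] radon_finite[OF rad(2) E(3) um, of i] in auto)
    then have "(\<lambda>n. \<Sum>j<n. gradient_measure \<phi> (E j)) \<longlonglongrightarrow> gradient_measure \<phi> (\<Union>j. E j)"
      by (intro vec_tendstoI) (auto simp: gradient_measure_def sums_def)
    then have l: "(\<lambda>n. ennreal (norm (\<Sum>j<n. gradient_measure \<phi> (E j)))) \<longlonglongrightarrow> \<nu> (\<Union>j. E j)"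
      unfolding \<nu>_def by (intro tendsto_intros)
    show ?thesis
    proof (rule LIMSEQ_le_const2[OF l], intro exI allI impI)
      fix n
      have "ennreal (norm (\<Sum>j<n. gradient_measure \<phi> (E j))) \<le> ennreal (\<Sum>j<n. norm (gradient_measure \<phi> (E j)))"
        by (intro ennreal_leI norm_sum)
      also have "\<dots> = (\<Sum>j<n. \<nu> (E j))" by (simp add: \<nu>_def)
      also have "\<dots> \<le> (\<Sum>j. \<nu> (E j))" by (rule sum_le_suminf) auto
      finally show "ennreal (norm (\<Sum>j<n. gradient_measure \<phi> (E j))) \<le> (\<Sum>j. \<nu> (E j))" .
    qed
  qed
  have g0: "gradient_measure \<phi> {} = 0" by (simp add: vec_eq_iff gradient_measure_def pm)
  have em: "emeasure (total_variation \<phi>) A = (SUP E \<in> bounded_partitions A. (\<Sum>j. \<nu> (E j)))" if "A \<in> sets borel" for A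
  proof -
    have tv: "total_variation \<phi> = measure_of UNIV (sets borel) (\<lambda>A. SUP E \<in> bounded_partitions A. (\<Sum>j. \<nu> (E j)))"
      unfolding total_variation_def bounded_partitions_def \<nu>_def ..
    have "\<nu> {} = 0" unfolding \<nu>_def g0 by simp
    moreover have "\<nu> (\<Union>j. E j) \<le> (\<Sum>j. \<nu> (E j))"
      if "disjoint_family E" "\<And>j::nat. E j \<in> sets borel" "bounded (\<Union>j. E j)" for E
      using that by (rule sub)
    ultimately have "emeasure (total_variation \<phi>) A = (if A \<in> sets borel then SUP E \<in> bounded_partitions A. (\<Sum>j. \<nu> (E j)) else 0)"
      unfolding tv by (rule emeasure_variation[where \<nu>=\<nu> and A=A])
    then show ?thesis using that by simp
  qed
  have vle: "\<nu> A \<le> emeasure (total_variation \<phi>) A" if A: "A \<in> sets borel" "bounded A" for A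
  proof -
    \<comment> \<open>The partition whose only nonempty piece is \<open>A\<close> places the norm
      below the supremum.\<close>
    define E where "E = (\<lambda>j::nat. if j = 0 then A else {})"
    have "E \<in> bounded_partitions A" using A by (auto simp: bounded_partitions_def E_def disjoint_family_on_def split: if_splits)
    moreover have "(\<Sum>j. \<nu> (E j)) = (\<Sum>j\<in>{0}. \<nu> (E j))"
      by (rule suminf_finite) (auto simp: E_def \<nu>_def g0)
    then have "(\<Sum>j. \<nu> (E j)) = \<nu> A" by (simp add: E_def)
    ultimately show ?thesis unfolding em[OF A(1)] by (metis (no_types, lifting) SUP_upper)
  qed
  have le: "emeasure (P i) A \<le> emeasure (N i) A + emeasure (total_variation \<phi>) A \<and>
      emeasure (N i) A \<le> emeasure (P i) A + emeasure (total_variation \<phi>) A" if A: "A \<in> sets borel" "bounded A" for i A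
  proof -
    have f: "emeasure (P i) A = ennreal (measure (P i) A)" "emeasure (N i) A = ennreal (measure (N i) A)"
      using radon_finite[OF rad(1) A(2,1), of i] radon_finite[OF rad(2) A(2,1), of i] by (auto simp: emeasure_eq_ennreal_measure)
    have "\<bar>measure (P i) A - measure (N i) A\<bar> \<le> norm (gradient_measure \<phi> A)"
      using component_le_norm_cart[of "gradient_measure \<phi> A" i] by (simp add: gradient_measure_def pm)
    then have "ennreal (measure (P i) A) \<le> ennreal (measure (N i) A) + \<nu> A" "ennreal (measure (N i) A) \<le> ennreal (measure (P i) A) + \<nu> A"
      by (auto simp: \<nu>_def ennreal_plus[symmetric] simp del: ennreal_plus intro!: ennreal_leI)
    then show ?thesis using vle[OF A] by (auto simp: f intro: order.trans add_left_mono)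
  qed
  have le_all: "emeasure M1 A \<le> emeasure M2 A + emeasure (total_variation \<phi>) A"
    if A: "A \<in> sets borel" and M: "sets M1 = sets borel" "sets M2 = sets borel"
      and l: "\<And>A. A \<in> sets borel \<Longrightarrow> bounded A \<Longrightarrow> emeasure M1 A \<le> emeasure M2 A + emeasure (total_variation \<phi>) A" for M1 M2 A
  proof -
    obtain E where "E \<in> bounded_partitions A" using bounded_partitions_nonempty[OF A] by blast
    then have E: "disjoint_family E" "\<And>j. E j \<in> sets borel" "\<And>j. bounded (E j)" "(\<Union>j. E j) = A"
      by (auto simp: bounded_partitions_def)
    have u: "(\<Sum>j. emeasure K (E j)) = emeasure K A" if "sets K = sets borel" for K
      unfolding E(4)[symmetric] by (rule suminf_emeasure) (use E that in auto)
    have "emeasure M1 A = (\<Sum>j. emeasure M1 (E j))" using u M by simp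
    also have "\<dots> \<le> (\<Sum>j. emeasure M2 (E j) + emeasure (total_variation \<phi>) (E j))"
      by (intro suminf_le l E) auto
    also have "\<dots> = (\<Sum>j. emeasure M2 (E j)) + (\<Sum>j. emeasure (total_variation \<phi>) (E j))"
      by (rule suminf_add[symmetric]) auto
    finally show ?thesis unfolding u[OF M(2)] u[OF sets_total_variation] .
  qed
  have fin: "emeasure (total_variation \<phi>) A < \<infinity>" if A: "A \<in> sets borel" "bounded A" for A
  proof -
    have "emeasure (total_variation \<phi>) A \<le> (\<Sum>i\<in>UNIV. emeasure (P i) A + emeasure (N i) A)"
      unfolding em[OF A(1)]
    proof (rule SUP_least)
      fix E assume "E \<in> bounded_partitions A"
      then have E: "disjoint_family E" "\<And>j. E j \<in> sets borel" "\<And>j. bounded (E j)" "(\<Union>j. E j) = A"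
        by (auto simp: bounded_partitions_def)
      have u: "(\<Sum>j. emeasure K (E j)) = emeasure K A" if "sets K = sets borel" for K
        unfolding E(4)[symmetric] by (rule suminf_emeasure) (use E that in auto)
      have "\<nu> B \<le> (\<Sum>i\<in>UNIV. emeasure (P i) B + emeasure (N i) B)" if B: "B \<in> sets borel" "bounded B" for B
      proof -
        have "\<nu> B \<le> ennreal (\<Sum>i\<in>UNIV. \<bar>gradient_measure \<phi> B $ i\<bar>)" unfolding \<nu>_def by (intro ennreal_leI norm_le_l1_cart)
        also have "\<dots> \<le> ennreal (\<Sum>i\<in>UNIV. measure (P i) B + measure (N i) B)"
          by (intro ennreal_leI sum_mono) (auto simp: gradient_measure_def pm abs_le_iff intro: add_nonneg_nonneg order.trans[of _ 0])
        also have "\<dots> = (\<Sum>i\<in>UNIV. ennreal (measure (P i) B) + ennreal (measure (N i) B))"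
          by (simp add: sum_ennreal[symmetric] del: sum_ennreal)
        also have "\<dots> = (\<Sum>i\<in>UNIV. emeasure (P i) B + emeasure (N i) B)"
          using radon_finite[OF rad(1) B(2,1)] radon_finite[OF rad(2) B(2,1)] by (simp add: emeasure_eq_ennreal_measure less_top)
        finally show ?thesis .
      qed
      then have "(\<Sum>j. \<nu> (E j)) \<le> (\<Sum>j. \<Sum>i\<in>UNIV. emeasure (P i) (E j) + emeasure (N i) (E j))"
        using E by (intro suminf_le) auto
      also have "\<dots> = (\<Sum>i\<in>UNIV. \<Sum>j. emeasure (P i) (E j) + emeasure (N i) (E j))"
        by (rule suminf_sum) auto
      also have "\<dots> = (\<Sum>i\<in>UNIV. (\<Sum>j. emeasure (P i) (E j)) + (\<Sum>j. emeasure (N i) (E j)))"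
        by (intro sum.cong refl suminf_add[symmetric]) auto
      finally show "(\<Sum>j. \<nu> (E j)) \<le> (\<Sum>i\<in>UNIV. emeasure (P i) A + emeasure (N i) A)" using u s by simp
    qed
    also have "\<dots> < \<infinity>"
      using radon_finite[OF rad(1) A(2,1)] radon_finite[OF rad(2) A(2,1)] by (auto simp: ennreal_sum_less_top)
    finally show ?thesis .
  qed
  show ?thesis
  proof (rule that[of P N])
    fix i and A :: "(real ^ 'n) set" assume A: "A \<in> sets borel"
    show "emeasure (P i) A \<le> emeasure (N i) A + emeasure (total_variation \<phi>) A"
      by (rule le_all[OF A s(1) s(2) conjunct1[OF le]])
    show "emeasure (N i) A \<le> emeasure (P i) A + emeasure (total_variation \<phi>) A"
      by (rule le_all[OF A s(2) s(1) conjunct2[OF le]])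
  qed (rule d fin; assumption)+
qed

section \<open>Smooth bump functions with compact support\<close>

definition exp_inv :: "nat \<Rightarrow> real \<Rightarrow> real" where
  "exp_inv m u = (if u > 0 then exp (- 1 / u) / u ^ m else 0)"

lemma exp_inv_nonneg: "0 \<le> exp_inv m u"
  by (simp add: exp_inv_def)

text \<open>Comparing exp (1/u) with the single term of order m + 1 of its series gives exp (- 1/u)
  \<le> (m + 1)! u^(m + 1). A linear bound is just what differentiability at 0 requires.\<close>

lemma exp_inv_le: "\<bar>exp_inv m u\<bar> \<le> fact (Suc m) * \<bar>u\<bar>"
proof (cases "u > 0")
  case True
  define x where "x = 1 / u"
  have x: "x > 0" using True by (simp add: x_def)
  have "(\<Sum>n\<in>{Suc m}. x ^ n /\<^sub>R fact n) \<le> (\<Sum>n. x ^ n /\<^sub>R fact n)"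
    using x by (intro sum_le_suminf summable_exp_generic) auto
  then have "x ^ Suc m / fact (Suc m) \<le> exp x" by (simp add: exp_def divide_inverse_commute del: fact_Suc power_Suc)
  then have "exp (- x) \<le> fact (Suc m) / x ^ Suc m"
    using x by (simp add: exp_minus field_simps del: fact_Suc power_Suc)
  also have "\<dots> = fact (Suc m) * u ^ Suc m" by (simp add: x_def power_divide del: fact_Suc power_Suc)
  finally have "exp (- 1 / u) / u ^ m \<le> fact (Suc m) * u ^ Suc m / u ^ m"
    using True by (intro divide_right_mono) (auto simp: x_def)
  also have "\<dots> = fact (Suc m) * u" using True by simp
  finally show ?thesis using True by (simp add: exp_inv_def)
next
  case False
  have "0 \<le> fact (Suc m) * \<bar>u\<bar>" by (intro mult_nonneg_nonneg) (simp_all del: fact_Suc)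
  with False show ?thesis by (simp add: exp_inv_def del: fact_Suc)
qed

text \<open>The powers of 1/u in \<open>exp_inv\<close> make the family closed under
  differentiation, with indices m + 1 and m + 2. At 0 the difference quotient is
  \<open>exp_inv\<close> of index m + 1, which the linear bound sends to 0.\<close>

lemma exp_inv_has_derivative:
  "(exp_inv m has_real_derivative (exp_inv (m + 2) u - real m * exp_inv (m + 1) u)) (at u)"
proof -
  consider "u > 0" | "u < 0" | "u = 0" by linarith
  then show ?thesis
  proof cases
    case 1
    have "((\<lambda>u. exp (- 1 / u) / u ^ m) has_real_derivative (exp_inv (m + 2) u - real m * exp_inv (m + 1) u)) (at u)"
    proof (cases m)
      case 0
      then show ?thesis using 1 by (auto intro!: derivative_eq_intros simp: exp_inv_def field_simps power2_eq_square)
    next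
      case (Suc k)
      have "((\<lambda>u. exp (- 1 / u) / u ^ Suc k) has_real_derivative
        (exp (- 1 / u) * (1 / u\<^sup>2) * u ^ Suc k - exp (- 1 / u) * (real (Suc k) * u ^ k)) / (u ^ Suc k * u ^ Suc k)) (at u)"
        using 1 by (auto intro!: derivative_eq_intros simp: power2_eq_square simp del: of_nat_Suc power_Suc)
      also have "(exp (- 1 / u) * (1 / u\<^sup>2) * u ^ Suc k - exp (- 1 / u) * (real (Suc k) * u ^ k)) / (u ^ Suc k * u ^ Suc k)
        = exp_inv (m + 2) u - real m * exp_inv (m + 1) u"
        using 1 Suc by (simp add: exp_inv_def field_simps power2_eq_square)
      finally show ?thesis using Suc by simp
    qed
    then show ?thesis
      by (rule has_field_derivative_transform_within_open[where S="{0<..}"]) (use 1 in \<open>auto simp: exp_inv_def\<close>)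
  next
    case 2
    have "((\<lambda>_. 0) has_real_derivative (exp_inv (m + 2) u - real m * exp_inv (m + 1) u)) (at u)"
      using 2 by (auto simp: exp_inv_def)
    then show ?thesis
      by (rule has_field_derivative_transform_within_open[where S="{..<0}"]) (use 2 in \<open>auto simp: exp_inv_def\<close>)
  next
    case 3
    have "((\<lambda>h. exp_inv m h / h) \<longlongrightarrow> 0) (at 0)"
    proof (rule Lim_null_comparison)
      show "((\<lambda>h. fact (Suc (Suc m)) * \<bar>h\<bar>) \<longlongrightarrow> 0) (at (0::real))" by (auto intro!: tendsto_eq_intros)
      have "norm (exp_inv m h / h) \<le> fact (Suc (Suc m)) * \<bar>h\<bar>" for h
      proof -
        have "norm (exp_inv m h / h) \<le> \<bar>exp_inv (Suc m) h\<bar>"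
          by (auto simp: exp_inv_def abs_mult field_simps)
        then show ?thesis using exp_inv_le[of "Suc m" h] by linarith
      qed
      then show "\<forall>\<^sub>F h in at 0. norm (exp_inv m h / h) \<le> fact (Suc (Suc m)) * \<bar>h\<bar>" by (intro always_eventually allI)
    qed
    then show ?thesis using 3 by (simp add: DERIV_def exp_inv_def[of _ 0])
  qed
qed

text \<open>That the directional derivatives are again polynomials is what keeps the induction in
  \<open>Ck_bump\<close> within one class of functions.\<close>

lemma real_polynomial_derivative:
  assumes "real_polynomial_function p"
  shows "\<exists>D. (\<forall>x. (p has_derivative D x) (at x)) \<and> (\<forall>b. real_polynomial_function (\<lambda>x. D x b))"
  using assms
proof induction
  case (linear f)
  then show ?case
    by (intro exI[of _ "\<lambda>_. f"]) (auto intro: bounded_linear_imp_has_derivative real_polynomial_function.intros(2))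
next
  case (const c)
  then show ?case by (intro exI[of _ "\<lambda>_ _. 0"]) (auto intro: real_polynomial_function.intros(2))
next
  case (add f g)
  then obtain D E where "\<forall>x. (f has_derivative D x) (at x)" "\<forall>b. real_polynomial_function (\<lambda>x. D x b)"
    "\<forall>x. (g has_derivative E x) (at x)" "\<forall>b. real_polynomial_function (\<lambda>x. E x b)" by blast
  then show ?case
    by (intro exI[of _ "\<lambda>x b. D x b + E x b"]) (auto intro!: derivative_intros real_polynomial_function.intros(3))
next
  case (mult f g)
  then obtain D E where "\<forall>x. (f has_derivative D x) (at x)" "\<forall>b. real_polynomial_function (\<lambda>x. D x b)"
    "\<forall>x. (g has_derivative E x) (at x)" "\<forall>b. real_polynomial_function (\<lambda>x. E x b)" by blast
  then show ?case using mult.hyps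
    by (intro exI[of _ "\<lambda>x b. f x * E x b + D x b * g x"])
      (auto intro!: derivative_intros real_polynomial_function.intros(3) real_polynomial_function.intros(4))
qed

lemma Ck_add: "Ck k f \<Longrightarrow> Ck k g \<Longrightarrow> Ck k (\<lambda>x. f x + g x)"
proof (induction k arbitrary: f g)
  case 0 then show ?case by (auto intro: continuous_intros)
next
  case (Suc k)
  have "(\<lambda>b. frechet_derivative f (at x) b + frechet_derivative g (at x) b) = frechet_derivative (\<lambda>x. f x + g x) (at x)" for x
  proof (rule frechet_derivative_at)
    show "((\<lambda>x. f x + g x) has_derivative (\<lambda>b. frechet_derivative f (at x) b + frechet_derivative g (at x) b)) (at x)"
      using Suc.prems by (intro has_derivative_add) (auto simp: frechet_derivative_works[symmetric])
  qed
  note this[symmetric]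
  then show ?case using Suc by (auto intro!: differentiable_add)
qed

lemma times_exp_inv_has_derivative:
  assumes "(P has_derivative DP) (at x)" "(q has_derivative Dq) (at x)"
  shows "((\<lambda>x. P x * exp_inv m (q x)) has_derivative
    (\<lambda>b. P x * ((exp_inv (m + 2) (q x) - real m * exp_inv (m + 1) (q x)) * Dq b) + DP b * exp_inv m (q x))) (at x)"
proof -
  have "((\<lambda>x. exp_inv m (q x)) has_derivative (\<lambda>b. (exp_inv (m + 2) (q x) - real m * exp_inv (m + 1) (q x)) * Dq b)) (at x)"
    using diff_chain_at[OF assms(2) exp_inv_has_derivative[of m "q x", unfolded has_field_derivative_def]]
    by (simp add: o_def)
  then show ?thesis using assms(1) by (rule has_derivative_mult[rotated])
qed

text \<open>Generalised over the polynomial \<open>P\<close> and the index \<open>m\<close>: every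
  directional derivative is a sum of three functions of the same form, so the induction hypothesis
  applies to each of them.\<close>

lemma Ck_bump:
  fixes q :: "real ^ 'n \<Rightarrow> real"
  assumes q: "real_polynomial_function q"
  shows "real_polynomial_function P \<Longrightarrow> Ck k (\<lambda>x. P x * exp_inv m (q x))"
proof (induction k arbitrary: P m)
  case 0
  obtain DP where DP: "\<And>x. (P has_derivative DP x) (at x)" using real_polynomial_derivative[OF 0] by blast
  obtain Dq where Dq: "\<And>x. (q has_derivative Dq x) (at x)" using real_polynomial_derivative[OF q] by blast
  have "isCont (\<lambda>x. P x * exp_inv m (q x)) x" for x
    by (rule has_derivative_continuous[OF times_exp_inv_has_derivative[OF DP Dq]])
  then show ?case by (simp add: continuous_at_imp_continuous_on)
next
  case (Suc k)
  obtain DP where DP: "\<And>x. (P has_derivative DP x) (at x)" "\<And>b. real_polynomial_function (\<lambda>x. DP x b)"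
    using real_polynomial_derivative[OF Suc.prems] by blast
  obtain Dq where Dq: "\<And>x. (q has_derivative Dq x) (at x)" "\<And>b. real_polynomial_function (\<lambda>x. Dq x b)"
    using real_polynomial_derivative[OF q] by blast
  note D = times_exp_inv_has_derivative[OF DP(1) Dq(1)]
  have "Ck k (\<lambda>x. frechet_derivative (\<lambda>x. P x * exp_inv m (q x)) (at x) b)" for b
  proof -
    have "(\<lambda>x. frechet_derivative (\<lambda>x. P x * exp_inv m (q x)) (at x) b) =
      (\<lambda>x. ((P x * Dq x b) * exp_inv (m + 2) (q x) + (- real m * (P x * Dq x b)) * exp_inv (m + 1) (q x)) + DP x b * exp_inv m (q x))"
      using frechet_derivative_at[OF D, symmetric] by (auto simp: algebra_simps)
    then show ?thesis
      by (simp only:) (intro Ck_add Suc.IH real_polynomial_function.intros(4) real_polynomial_function.intros(2) Suc.prems DP Dq)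
  qed
  then show ?case using D by (auto simp: differentiable_def)
qed

text \<open>The squared norm is a polynomial, so \<open>Ck_bump\<close> gives all derivatives; the
  support lies in the closed ball of radius \<bar>e\<bar> about \<open>w\<close>.\<close>

lemma test_function_bump:
  fixes w :: "real ^ 'n"
  shows "test_function (\<lambda>z. c * exp_inv 0 (e\<^sup>2 - (norm (z - w))\<^sup>2))"
proof -
  have q: "real_polynomial_function (\<lambda>z::real^'n. e\<^sup>2 - (norm (z - w))\<^sup>2)"
  proof -
    have c: "real_polynomial_function (\<lambda>z::real^'n. z $ i - w $ i)" for i
      by (intro real_polynomial_function_diff real_polynomial_function.intros(2)) (rule real_polynomial_function.intros(1)[OF bounded_linear_vec_nth])
    have "(\<lambda>z::real^'n. e\<^sup>2 - (norm (z - w))\<^sup>2) = (\<lambda>z. e\<^sup>2 - (\<Sum>i\<in>UNIV. (z $ i - w $ i)\<^sup>2))"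
      by (simp add: norm_vec_def L2_set_def sum_nonneg)
    then show ?thesis
      by (auto intro!: real_polynomial_function_diff real_polynomial_function.intros(2) real_polynomial_function_sum real_polynomial_function_power c)
  qed
  have "{z. c * exp_inv 0 (e\<^sup>2 - (norm (z - w))\<^sup>2) \<noteq> 0} \<subseteq> cball w \<bar>e\<bar>"
    by (auto simp: exp_inv_def dist_norm norm_minus_commute abs_le_square_iff[symmetric] split: if_splits dest!: less_imp_le)
  then have "closure {z. c * exp_inv 0 (e\<^sup>2 - (norm (z - w))\<^sup>2) \<noteq> 0} \<subseteq> cball w \<bar>e\<bar>"
    by (rule closure_minimal) auto
  then have "compact (closure {z. c * exp_inv 0 (e\<^sup>2 - (norm (z - w))\<^sup>2) \<noteq> 0})"
    unfolding compact_eq_bounded_closed using bounded_subset[OF bounded_cball] closed_closure by blast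
  then show ?thesis using Ck_bump[OF q real_polynomial_function.intros(2)[where c=c], of _ 0] by (simp add: test_function_def)
qed

lemma continuous_on_exp_inv: "continuous_on S (exp_inv m)"
  by (rule continuous_at_imp_continuous_on) (use exp_inv_has_derivative DERIV_isCont in blast)

lemma borel_measurable_exp_inv [measurable]: "exp_inv m \<in> borel_measurable borel"
  by (rule borel_measurable_continuous_onI[OF continuous_on_exp_inv])

text \<open>The mass depends on the dimension, which is visible only in the type; hence the
  \<open>itself\<close> argument.\<close>

definition bump_mass :: "real \<Rightarrow> (real ^ 'n) itself \<Rightarrow> real" where
  "bump_mass e (_ :: (real ^ 'n) itself) = (LINT v::real^'n|lborel. exp_inv 0 (e\<^sup>2 - (norm v)\<^sup>2))"

definition bump :: "real \<Rightarrow> real ^ 'n \<Rightarrow> real" where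
  "bump e u = 1 / bump_mass e TYPE(real ^ 'n) * exp_inv 0 (e\<^sup>2 - (norm u)\<^sup>2)"

text \<open>The index 2 comes from differentiating \<open>exp_inv 0\<close>, and the factor -2 with
  the inner product from differentiating minus the squared norm.\<close>

definition bump_deriv :: "real \<Rightarrow> real ^ 'n \<Rightarrow> real ^ 'n \<Rightarrow> real" where
  "bump_deriv e u b = - 2 * (1 / bump_mass e TYPE(real ^ 'n)) * exp_inv 2 (e\<^sup>2 - (norm u)\<^sup>2) * (u \<bullet> b)"

lemma exp_inv_outside: "e > 0 \<Longrightarrow> norm u \<ge> e \<Longrightarrow> exp_inv m (e\<^sup>2 - (norm u)\<^sup>2) = 0"
  using power_mono[of e "norm u" 2] by (simp add: exp_inv_def not_less[symmetric])

lemma exp_inv_ball_bound: "e > 0 \<Longrightarrow> \<bar>exp_inv m (e\<^sup>2 - (norm u)\<^sup>2)\<bar> \<le> fact (Suc m) * e\<^sup>2"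
proof (cases "norm u \<ge> e")
  case False
  assume "e > 0"
  have "\<bar>e\<^sup>2 - (norm u)\<^sup>2\<bar> \<le> e\<^sup>2" using False by (auto simp: abs_le_iff power_mono less_imp_le)
  then show ?thesis using exp_inv_le[of m "e\<^sup>2 - (norm u)\<^sup>2"]
    by (meson fact_ge_zero mult_left_mono order_trans)
qed (simp add: exp_inv_outside)

text \<open>A nonnegative function with integral 0 vanishes almost everywhere, but this one is
  positive on an open ball, which has positive volume.\<close>

lemma bump_mass_pos:
  assumes "e > 0"
  shows "bump_mass e TYPE(real ^ 'n) > 0"
proof -
  let ?g = "\<lambda>v::real^'n. exp_inv 0 (e\<^sup>2 - (norm v)\<^sup>2)"
  have i: "integrable lborel ?g"
    by (rule integrable_bounded_support[where C="fact (Suc 0) * e\<^sup>2" and x=0 and r=e])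
      (use assms exp_inv_ball_bound[of e 0] in \<open>auto intro: exp_inv_outside\<close>)
  have "bump_mass e TYPE(real ^ 'n) \<noteq> 0"
  proof
    assume "bump_mass e TYPE(real ^ 'n) = 0"
    then have "AE v in lborel. ?g v = 0"
      using integral_nonneg_eq_0_iff_AE[OF i] exp_inv_nonneg by (auto simp: bump_mass_def)
    then have "AE v in lborel. v \<notin> ball (0::real^'n) e"
    proof eventually_elim
      case (elim v)
      show ?case
      proof
        assume "v \<in> ball 0 e"
        then have "(norm v)\<^sup>2 < e\<^sup>2" by (intro power_strict_mono) auto
        then show False using elim by (auto simp: exp_inv_def)
      qed
    qed
    then have "ball (0::real^'n) e \<in> null_sets lborel" by (subst AE_iff_null_sets) auto
    then have "emeasure lborel (ball (0::real^'n) e) = 0" by auto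
    moreover have "unit_ball_vol (real CARD('n)) * e ^ CARD('n) > 0" using assms by simp
    ultimately show False using assms by (simp add: emeasure_ball ennreal_eq_0_iff)
  qed
  moreover have "bump_mass e TYPE(real ^ 'n) \<ge> 0" unfolding bump_mass_def by (simp add: exp_inv_nonneg)
  ultimately show ?thesis by simp
qed

lemma bump_nonneg: "e > 0 \<Longrightarrow> bump e (u :: real ^ 'n) \<ge> 0"
  using bump_mass_pos[of e, where 'n='n] by (simp add: bump_def exp_inv_nonneg)

lemma bump_outside: "e > 0 \<Longrightarrow> norm u \<ge> e \<Longrightarrow> bump e u = 0"
  by (simp add: bump_def exp_inv_outside)

lemma bump_measurable [measurable]: "bump e \<in> borel_measurable borel"
  unfolding bump_def[abs_def] by measurable

lemma bump_minus: "bump e (- u) = bump e u"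
  by (simp add: bump_def)

lemma bump_bounded:
  assumes "e > 0" obtains C where "\<And>u::real^'n. \<bar>bump e u\<bar> \<le> C"
proof (rule that)
  show "\<bar>bump e (u::real^'n)\<bar> \<le> 1 / bump_mass e TYPE(real ^ 'n) * (fact (Suc 0) * e\<^sup>2)" for u
    unfolding bump_def abs_mult using exp_inv_ball_bound[OF assms, of 0] bump_mass_pos[OF assms, where 'n='n]
    by (intro mult_mono) auto
qed

lemma bump_integrable: "e > 0 \<Longrightarrow> integrable lborel (bump e :: real^'n \<Rightarrow> real)"
  by (rule bump_bounded[where 'n='n], assumption, rule integrable_bounded_support[where x=0 and r=e])
    (auto intro: bump_outside)

lemma bump_integral:
  assumes "e > 0" shows "(LINT u::real^'n|lborel. bump e u) = 1"
proof -
  have "(LINT u::real^'n|lborel. bump e u) = 1 / bump_mass e TYPE(real ^ 'n) * bump_mass e TYPE(real ^ 'n)"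
    unfolding bump_def[abs_def] bump_mass_def by simp
  then show ?thesis using bump_mass_pos[OF assms, where 'n='n] by simp
qed

lemma bump_nn_integral:
  assumes "e > 0" shows "(\<integral>\<^sup>+u. ennreal (bump e (u::real^'n)) \<partial>lborel) = 1"
  using nn_integral_eq_integral[OF bump_integrable[OF assms, where 'n='n]] bump_nonneg[OF assms, where 'n='n] bump_integral[OF assms, where 'n='n]
  by simp

lemma bump_has_derivative: "(bump e has_derivative bump_deriv e u) (at (u :: real ^ 'n))"
proof -
  let ?c = "1 / bump_mass e TYPE(real ^ 'n)"
  have q: "((\<lambda>u::real^'n. e\<^sup>2 - (norm u)\<^sup>2) has_derivative (\<lambda>b. - 2 * (u \<bullet> b))) (at u)" for u
    unfolding power2_norm_eq_inner by (auto intro!: derivative_eq_intros simp: inner_commute)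
  have "((\<lambda>u. ?c * exp_inv 0 (e\<^sup>2 - (norm u)\<^sup>2)) has_derivative
     (\<lambda>b. ?c * ((exp_inv (0 + 2) (e\<^sup>2 - (norm u)\<^sup>2) - real 0 * exp_inv (0 + 1) (e\<^sup>2 - (norm u)\<^sup>2)) * (- 2 * (u \<bullet> b))) + 0 * exp_inv 0 (e\<^sup>2 - (norm u)\<^sup>2))) (at u)"
    by (rule times_exp_inv_has_derivative[OF has_derivative_const q])
  also have "(\<lambda>b. ?c * ((exp_inv (0 + 2) (e\<^sup>2 - (norm u)\<^sup>2) - real 0 * exp_inv (0 + 1) (e\<^sup>2 - (norm u)\<^sup>2)) * (- 2 * (u \<bullet> b))) + 0 * exp_inv 0 (e\<^sup>2 - (norm u)\<^sup>2)) = bump_deriv e u"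
    by (auto simp: bump_deriv_def numeral_2_eq_2)
  finally show ?thesis by (simp add: bump_def[abs_def])
qed

lemma bump_deriv_continuous: "continuous_on S (\<lambda>u. bump_deriv e u b)"
  unfolding bump_deriv_def
  by (intro continuous_intros continuous_on_compose2[OF continuous_on_exp_inv[of UNIV]]) auto

lemma bump_deriv_outside: "e > 0 \<Longrightarrow> norm u \<ge> e \<Longrightarrow> bump_deriv e u b = 0"
  by (simp add: bump_deriv_def exp_inv_outside)

lemma bump_deriv_bounded:
  assumes "e > 0" obtains C where "C \<ge> 0" "\<And>u::real^'n. \<bar>bump_deriv e u b\<bar> \<le> C"
proof (rule that)
  let ?c = "1 / bump_mass e TYPE(real ^ 'n)"
  have c: "?c > 0" using bump_mass_pos[OF assms, where 'n='n] by simp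
  show "0 \<le> 2 * ?c * (fact 3 * e\<^sup>2) * (e * norm b)" using c assms by (intro mult_nonneg_nonneg) auto
  show "\<bar>bump_deriv e u b\<bar> \<le> 2 * ?c * (fact 3 * e\<^sup>2) * (e * norm b)" for u :: "real^'n"
  proof (cases "norm u \<ge> e")
    case True
    then show ?thesis using c assms by (simp add: bump_deriv_outside)
  next
    case False
    have "\<bar>bump_deriv e u b\<bar> = 2 * ?c * \<bar>exp_inv 2 (e\<^sup>2 - (norm u)\<^sup>2)\<bar> * \<bar>u \<bullet> b\<bar>"
      using c by (simp add: bump_deriv_def abs_mult)
    also have "\<dots> \<le> 2 * ?c * (fact 3 * e\<^sup>2) * (e * norm b)"
    proof (intro mult_mono)
      show "\<bar>exp_inv 2 (e\<^sup>2 - (norm u)\<^sup>2)\<bar> \<le> fact 3 * e\<^sup>2"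
        using exp_inv_ball_bound[OF assms, of 2 u] by (simp add: numeral_3_eq_3 numeral_2_eq_2)
      have "\<bar>u \<bullet> b\<bar> \<le> norm u * norm b" by (rule Cauchy_Schwarz_ineq2)
      also have "\<dots> \<le> e * norm b" using False by (intro mult_right_mono) auto
      finally show "\<bar>u \<bullet> b\<bar> \<le> e * norm b" .
    qed (use c assms in auto)
    finally show ?thesis .
  qed
qed

lemma bump_shift_test_function: "test_function (\<lambda>z::real^'n. bump e (z - w))"
  unfolding bump_def by (rule test_function_bump)

lemma bump_shift_derivative:
  "frechet_derivative (\<lambda>z::real^'n. bump e (z - w)) (at z) b = bump_deriv e (z - w) b"
proof -
  have "((\<lambda>z. bump e (z - w)) has_derivative bump_deriv e (z - w)) (at z)"
    by (rule has_derivative_compose[where f="\<lambda>z. z - w" and f'="\<lambda>b. b" and g="bump e"])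
      (auto intro!: derivative_eq_intros bump_has_derivative)
  then show ?thesis by (simp add: frechet_derivative_at[symmetric])
qed

section \<open>Mollification and the translation estimate\<close>

lemma nn_integral_le_add:
  assumes s: "sets M1 = sets M" "sets M2 = sets M"
    and le: "\<And>A. A \<in> sets M \<Longrightarrow> emeasure M1 A \<le> emeasure M2 A + emeasure M A"
    and u: "u \<in> borel_measurable M"
  shows "integral\<^sup>N M1 u \<le> integral\<^sup>N M2 u + integral\<^sup>N M u"
  using u
proof (induction rule: borel_measurable_induct)
  \<comment> \<open>Induction along the construction of measurable functions avoids forming the sum
    of \<open>M2\<close> and \<open>M\<close> as a measure.\<close>
  case (cong f g)
  have "space M1 = space M" "space M2 = space M" by (rule sets_eq_imp_space_eq[OF s(1)] sets_eq_imp_space_eq[OF s(2)])+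
  then have "integral\<^sup>N M1 f = integral\<^sup>N M1 g" "integral\<^sup>N M2 f = integral\<^sup>N M2 g" "integral\<^sup>N M f = integral\<^sup>N M g"
    using cong by (auto intro!: nn_integral_cong)
  then show ?case using cong by simp
next
  case (set A)
  then show ?case using le s by simp
next
  case (mult u c)
  note [measurable_cong] = s
  show ?case using mult mult_left_mono[OF mult.IH, of c] by (simp add: nn_integral_cmult distrib_left)
next
  case (add u v)
  note [measurable_cong] = s
  show ?case using add add_mono[OF add.IH] by (simp add: nn_integral_add add_ac)
next
  case (seq U)
  note [measurable_cong] = s
  have "integral\<^sup>N K (SUP i. U i) = (SUP i. integral\<^sup>N K (U i))" if "sets K = sets M" for K
  proof -
    have [measurable]: "U i \<in> borel_measurable K" for i using seq that measurable_cong_sets by blast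
    have "integral\<^sup>N K (\<lambda>x. SUP i. U i x) = (SUP i. integral\<^sup>N K (U i))"
      using seq by (intro nn_integral_monotone_convergence_SUP) auto
    moreover have "(SUP i. U i) = (\<lambda>x. SUP i. U i x)" by (simp add: fun_eq_iff image_comp)
    ultimately show ?thesis by simp
  qed
  note SUPe = this
  show ?case unfolding SUPe[OF s(1)]
  proof (rule SUP_least)
    fix i
    have "integral\<^sup>N M1 (U i) \<le> integral\<^sup>N M2 (U i) + integral\<^sup>N M (U i)" using seq by auto
    also have "\<dots> \<le> integral\<^sup>N M2 (SUP i. U i) + integral\<^sup>N M (SUP i. U i)"
      unfolding SUPe[OF s(2)] SUPe[OF refl] by (intro add_mono SUP_upper) auto
    finally show "integral\<^sup>N M1 (U i) \<le> integral\<^sup>N M2 (SUP i. U i) + integral\<^sup>N M (SUP i. U i)" .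
  qed
qed

text \<open>\<open>f\<close> stands for a Borel version of \<open>\<phi>\<close>, since Fubini is
  applied to Borel measures, and \<open>M\<close> for the total variation. Beyond Borel sets and
  sigma-finiteness, the latter is represented only by its domination of the difference of
  \<open>P i\<close> and \<open>N i\<close>, written additively because the values may be
  infinite.\<close>

locale variation_dominated =
  fixes f :: "real ^ 'n \<Rightarrow> real" and M :: "(real ^ 'n) measure" and P N :: "'n \<Rightarrow> (real ^ 'n) measure"
  assumes f_borel [measurable]: "f \<in> borel_measurable borel"
    and f_local: "\<And>x r. integrable lborel (\<lambda>z. indicat_real (cball x r) z * f z)"
    and sets_M [measurable_cong]: "sets M = sets borel" and sf_M: "sigma_finite_measure M"
    and radon: "\<And>i. radon_measure (P i)" "\<And>i. radon_measure (N i)"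
    and weak: "\<And>i \<psi>. test_function \<psi> \<Longrightarrow>
       (LINT z|lborel. f z * frechet_derivative \<psi> (at z) (axis i 1)) = - ((LINT x|P i. \<psi> x) - (LINT x|N i. \<psi> x))"
    and dom: "\<And>i A. A \<in> sets borel \<Longrightarrow> emeasure (P i) A \<le> emeasure (N i) A + emeasure M A"
      "\<And>i A. A \<in> sets borel \<Longrightarrow> emeasure (N i) A \<le> emeasure (P i) A + emeasure M A"
begin

lemma sets_PN: "sets (P i) = sets borel" "sets (N i) = sets borel"
  using radon by (auto simp: radon_measure_def)

text \<open>Bounded support makes the integrals over \<open>P i\<close> and \<open>N i\<close>
  finite, so the additive comparison of the measures can be rearranged into a bound for the
  difference.\<close>

lemma integral_difference_le:
  assumes [measurable]: "\<psi> \<in> borel_measurable borel" and "\<And>z. 0 \<le> \<psi> z" and b: "\<And>z. \<psi> z \<le> C" and supp: "\<And>z. z \<notin> cball w r \<Longrightarrow> \<psi> z = 0"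
  shows "ennreal \<bar>(LINT x|P i. \<psi> x) - (LINT x|N i. \<psi> x)\<bar> \<le> (\<integral>\<^sup>+x. ennreal (\<psi> x) \<partial>M)"
proof -
  have fin: "(\<integral>\<^sup>+x. ennreal (\<psi> x) \<partial>K) < \<infinity>" and int: "(\<integral>\<^sup>+x. ennreal (\<psi> x) \<partial>K) = ennreal (LINT x|K. \<psi> x)"
    if K: "radon_measure K" for K
  proof -
    have [measurable_cong]: "sets K = sets borel" using K by (simp add: radon_measure_def)
    have "(\<integral>\<^sup>+x. ennreal (\<psi> x) \<partial>K) \<le> (\<integral>\<^sup>+x. ennreal C * indicator (cball w r) x \<partial>K)"
      using b supp by (intro nn_integral_mono) (auto simp: indicator_def intro: ennreal_leI)
    also have "\<dots> = ennreal C * emeasure K (cball w r)" by (intro nn_integral_cmult_indicator) auto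
    also have "\<dots> < \<infinity>" using K by (auto simp: radon_measure_def ennreal_mult_less_top)
    finally show *: "(\<integral>\<^sup>+x. ennreal (\<psi> x) \<partial>K) < \<infinity>" .
    have "integrable K \<psi>" using * assms(2) by (intro integrableI_nonneg) auto
    then show "(\<integral>\<^sup>+x. ennreal (\<psi> x) \<partial>K) = ennreal (LINT x|K. \<psi> x)"
      using assms(2) by (intro nn_integral_eq_integral) auto
  qed
  note fin = fin[OF radon(1), of i] fin[OF radon(2), of i] and int = int[OF radon(1), of i] int[OF radon(2), of i]
  have "ennreal (LINT x|P i. \<psi> x) \<le> ennreal (LINT x|N i. \<psi> x) + (\<integral>\<^sup>+x. ennreal (\<psi> x) \<partial>M)"
    unfolding int[symmetric] by (rule nn_integral_le_add) (use sets_PN sets_M dom in auto)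
  moreover have "ennreal (LINT x|N i. \<psi> x) \<le> ennreal (LINT x|P i. \<psi> x) + (\<integral>\<^sup>+x. ennreal (\<psi> x) \<partial>M)"
    unfolding int[symmetric] by (rule nn_integral_le_add) (use sets_PN sets_M dom in auto)
  moreover have "(LINT x|P i. \<psi> x) \<ge> 0" "(LINT x|N i. \<psi> x) \<ge> 0" using assms(2) by auto
  ultimately show ?thesis
    by (cases "\<integral>\<^sup>+x. ennreal (\<psi> x) \<partial>M")
      (auto simp: ennreal_plus[symmetric] simp del: ennreal_plus intro!: ennreal_leI)
qed

text \<open>Convolution with the bump kernel. For fixed \<open>y\<close> the kernel is a translated
  test function of \<open>z\<close>, so that \<open>weak\<close> applies to it as it stands.\<close>

definition smooth :: "real \<Rightarrow> real ^ 'n \<Rightarrow> real" where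
  "smooth e y = (LINT z|lborel. f z * bump e (z - y))"

lemma integrable_times_bounded:
  assumes [measurable]: "g \<in> borel_measurable borel" and "\<And>z. \<bar>g z\<bar> \<le> C" and "\<And>z. z \<notin> cball w r \<Longrightarrow> g z = 0"
  shows "integrable lborel (\<lambda>z. f z * g z)"
proof (rule Bochner_Integration.integrable_bound)
  show "integrable lborel (\<lambda>z. C * \<bar>indicat_real (cball w r) z * f z\<bar>)"
    by (intro integrable_mult_right integrable_abs f_local)
  have C: "C \<ge> 0" using assms(2)[of 0] by linarith
  show "AE z in lborel. norm (f z * g z) \<le> norm (C * \<bar>indicat_real (cball w r) z * f z\<bar>)"
  proof (intro AE_I2)
    fix z
    show "norm (f z * g z) \<le> norm (C * \<bar>indicat_real (cball w r) z * f z\<bar>)"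
      using assms(3)[of z] mult_right_mono[OF assms(2)[of z], of "\<bar>f z\<bar>"] C
      by (cases "z \<in> cball w r") (auto simp: abs_mult mult.commute)
  qed
qed measurable

text \<open>The weak formulation bounds each coordinate derivative by the smoothed variation.
  Expanding \<open>h\<close> in coordinates, each at most \<open>norm h\<close>, produces the factor
  n.\<close>

lemma smooth_gradient:
  assumes e: "e > 0"
  shows "ennreal \<bar>LINT z|lborel. f z * bump_deriv e (z - w) h\<bar>
    \<le> ennreal (real CARD('n) * norm h) * (\<integral>\<^sup>+z. ennreal (bump e (z - w)) \<partial>M)"
proof -
  let ?V = "\<integral>\<^sup>+z. ennreal (bump e (z - w)) \<partial>M"
  obtain C where C: "\<And>u::real^'n. \<bar>bump e u\<bar> \<le> C" using bump_bounded[OF e] by blast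
  have [measurable]: "(\<lambda>z. bump_deriv e (z - w) b) \<in> borel_measurable borel" for b
    by (intro borel_measurable_continuous_onI continuous_on_compose2[OF bump_deriv_continuous[of UNIV]] continuous_intros) auto
  have comp: "ennreal \<bar>LINT z|lborel. f z * bump_deriv e (z - w) (axis i 1)\<bar> \<le> ?V" for i
  proof -
    have "(LINT z|lborel. f z * bump_deriv e (z - w) (axis i 1)) =
      - ((LINT z|P i. bump e (z - w)) - (LINT z|N i. bump e (z - w)))"
      using weak[OF bump_shift_test_function[of e w], of i] by (simp add: bump_shift_derivative)
    moreover have "ennreal \<bar>(LINT z|P i. bump e (z - w)) - (LINT z|N i. bump e (z - w))\<bar> \<le> ?V"
    proof (rule integral_difference_le)
      show "bump e (z - w) \<le> C" for z using C[of "z - w"] by linarith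
      show "z \<notin> cball w e \<Longrightarrow> bump e (z - w) = 0" for z
        using e by (intro bump_outside) (auto simp: dist_norm norm_minus_commute)
    qed (use e bump_nonneg in auto)
    ultimately show ?thesis by (simp only: abs_minus_cancel)
  qed
  have int: "integrable lborel (\<lambda>z. f z * bump_deriv e (z - w) b)" for b
  proof -
    obtain D where D: "D \<ge> 0" "\<And>u::real^'n. \<bar>bump_deriv e u b\<bar> \<le> D" using bump_deriv_bounded[OF e] by blast
    show ?thesis
      by (rule integrable_times_bounded[where C=D and w=w and r=e])
        (use D e in \<open>auto simp: dist_norm norm_minus_commute intro: bump_deriv_outside\<close>)
  qed
  have bd: "bump_deriv e u h = (\<Sum>i\<in>UNIV. h $ i * bump_deriv e u (axis i 1))" for u
  proof -
    have "u \<bullet> h = (\<Sum>i\<in>UNIV. h $ i * (u \<bullet> axis i 1))" proof -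
      have ia: "u \<bullet> axis i 1 = u $ i" for i by (simp add: inner_axis)
      show ?thesis unfolding ia by (simp add: inner_vec_def mult.commute)
    qed
    then show ?thesis unfolding bump_deriv_def by (simp only: sum_distrib_left) (simp add: mult_ac)
  qed
  have "(LINT z|lborel. f z * bump_deriv e (z - w) h) =
     (LINT z|lborel. (\<Sum>i\<in>UNIV. h $ i * (f z * bump_deriv e (z - w) (axis i 1))))"
    unfolding bd by (simp add: sum_distrib_left mult_ac)
  also have "\<dots> = (\<Sum>i\<in>UNIV. h $ i * (LINT z|lborel. f z * bump_deriv e (z - w) (axis i 1)))"
    by (subst Bochner_Integration.integral_sum) (auto intro!: int)
  finally have "\<bar>LINT z|lborel. f z * bump_deriv e (z - w) h\<bar> \<le>
     (\<Sum>i\<in>UNIV. \<bar>h $ i * (LINT z|lborel. f z * bump_deriv e (z - w) (axis i 1))\<bar>)"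
    by simp
  also have "\<dots> \<le> (\<Sum>i\<in>UNIV. norm h * \<bar>LINT z|lborel. f z * bump_deriv e (z - w) (axis i 1)\<bar>)"
    unfolding abs_mult by (intro sum_mono mult_right_mono component_le_norm_cart) auto
  finally have "ennreal \<bar>LINT z|lborel. f z * bump_deriv e (z - w) h\<bar> \<le>
     ennreal (\<Sum>i\<in>UNIV. norm h * \<bar>LINT z|lborel. f z * bump_deriv e (z - w) (axis i 1)\<bar>)" by (rule ennreal_leI)
  also have "\<dots> = (\<Sum>i\<in>UNIV. ennreal (norm h) * ennreal \<bar>LINT z|lborel. f z * bump_deriv e (z - w) (axis i 1)\<bar>)"
    by (simp add: sum_ennreal[symmetric] ennreal_mult'' del: sum_ennreal)
  also have "\<dots> \<le> (\<Sum>i\<in>(UNIV::'n set). ennreal (norm h) * ?V)"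
    by (intro sum_mono mult_left_mono comp) auto
  also have "\<dots> = ennreal (real CARD('n) * norm h) * ?V"
    by (simp add: ennreal_mult'' ennreal_of_nat_eq_real_of_nat mult.assoc)
  finally show ?thesis .
qed

text \<open>Fundamental theorem of calculus along the segment from y to y + h, applied to the kernel
  and not to \<open>smooth\<close> itself, followed by an exchange of the integrals in z and
  t.\<close>

lemma smooth_difference:
  assumes e: "e > 0"
  shows "ennreal \<bar>smooth e (y + h) - smooth e y\<bar> \<le> ennreal (real CARD('n) * norm h) *
    (\<integral>\<^sup>+t. indicator {0..1} t * (\<integral>\<^sup>+z. ennreal (bump e (z - y - t *\<^sub>R h)) \<partial>M) \<partial>lborel)"
proof -
  obtain C where C: "\<And>u::real^'n. \<bar>bump e u\<bar> \<le> C" using bump_bounded[OF e] by blast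
  obtain D where D: "D \<ge> 0" "\<And>u::real^'n. \<bar>bump_deriv e u h\<bar> \<le> D" using bump_deriv_bounded[OF e] by blast
  have [measurable]: "(\<lambda>u. bump_deriv e u h) \<in> borel_measurable borel"
    by (intro borel_measurable_continuous_onI bump_deriv_continuous)
  \<comment> \<open>This ball contains the supports of all kernels centred on the segment, so local
    integrability of \<open>f\<close> dominates the double integral.\<close>
  define K where "K = cball y (e + norm h)"
  have outside: "bump_deriv e (z - y - t *\<^sub>R h) h = 0" if "z \<notin> K" "t \<in> {0..1}" for z t
  proof (rule bump_deriv_outside[OF e])
    have "norm (t *\<^sub>R h) \<le> norm h" using that by (auto intro: mult_left_le_one_le)
    moreover have "norm (z - y) > e + norm h" using that by (simp add: K_def dist_norm norm_minus_commute)
    ultimately show "norm (z - y - t *\<^sub>R h) \<ge> e" using norm_triangle_ineq2[of "z - y" "t *\<^sub>R h"] by linarith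
  qed
  have ftc: "bump e (z - (y + h)) - bump e (z - y) = (LINT t|lborel. - bump_deriv e (z - y - t *\<^sub>R h) h * indicator {0..1} t)" for z
  proof -
    have "((\<lambda>t. bump e (z - y - t *\<^sub>R h)) has_real_derivative - bump_deriv e (z - y - t *\<^sub>R h) h) (at t)" for t
    proof -
      have "((\<lambda>t. bump e (z - y - t *\<^sub>R h)) has_derivative (\<lambda>s. bump_deriv e (z - y - t *\<^sub>R h) (- s *\<^sub>R h))) (at t)"
        by (rule has_derivative_compose[where f="\<lambda>t. z - y - t *\<^sub>R h" and f'="\<lambda>s. - s *\<^sub>R h" and g="bump e"])
          (auto intro!: derivative_eq_intros bump_has_derivative)
      moreover have "(\<lambda>s. bump_deriv e (z - y - t *\<^sub>R h) (- s *\<^sub>R h)) = (*) (- bump_deriv e (z - y - t *\<^sub>R h) h)"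
        by (simp add: fun_eq_iff bump_deriv_def mult_ac)
      ultimately show ?thesis by (simp add: has_field_derivative_def)
    qed
    moreover have "isCont (\<lambda>t. - bump_deriv e (z - y - t *\<^sub>R h) h) t" for t
      by (intro continuous_on_interior[of UNIV] continuous_intros continuous_on_compose2[OF bump_deriv_continuous[of UNIV]]) auto
    ultimately have "(LINT t|lborel. - bump_deriv e (z - y - t *\<^sub>R h) h * indicator {0..1} t) =
      bump e (z - y - 1 *\<^sub>R h) - bump e (z - y - 0 *\<^sub>R h)"
      by (intro integral_FTC_Icc_real) auto
    then show ?thesis by (simp add: algebra_simps)
  qed
  define F where "F = (\<lambda>z t. f z * (- bump_deriv e (z - y - t *\<^sub>R h) h * indicat_real {0..1} t))"
  have Fm[measurable]: "(\<lambda>(z, t). F z t) \<in> borel_measurable (lborel \<Otimes>\<^sub>M lborel)" unfolding F_def by measurable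
  have Fb: "\<bar>F z t\<bar> \<le> \<bar>indicat_real K z * f z\<bar> * D * indicat_real {0..1} t" for z t
    using D outside[of z t] mult_left_mono[OF D(2)[of "z - y - t *\<^sub>R h"], of "\<bar>f z\<bar>"]
    by (auto simp: F_def indicator_def abs_mult)
  have fK: "integrable lborel (\<lambda>z. indicat_real K z * f z)" unfolding K_def by (rule f_local)
  have i01: "integrable lborel (indicat_real {0..1::real})" by (intro integrable_real_indicator) auto
  have intF: "integrable lborel (F z)" for z
    by (rule Bochner_Integration.integrable_bound[OF integrable_mult_right[OF i01, of "\<bar>indicat_real K z * f z\<bar> * D"]])
      (use Fb D in \<open>auto simp: F_def abs_mult\<close>)
  have prod: "integrable (lborel \<Otimes>\<^sub>M lborel) (\<lambda>(z, t). F z t)"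
  proof (rule lborel_pair.Fubini_integrable)
    show "integrable lborel (\<lambda>z. LINT t|lborel. norm (case (z, t) of (z, t) \<Rightarrow> F z t))"
    proof (rule Bochner_Integration.integrable_bound)
      show "integrable lborel (\<lambda>z. \<bar>indicat_real K z * f z\<bar> * D)" by (intro integrable_mult_left integrable_abs fK)
      show "AE z in lborel. norm (LINT t|lborel. norm (case (z, t) of (z, t) \<Rightarrow> F z t)) \<le> norm (\<bar>indicat_real K z * f z\<bar> * D)"
      proof (intro AE_I2)
        fix z
        have "(LINT t|lborel. \<bar>F z t\<bar>) \<le> (LINT t|lborel. \<bar>indicat_real K z * f z\<bar> * D * indicat_real {0..1} (t::real))"
        proof (rule Bochner_Integration.integral_mono)
          show "integrable lborel (\<lambda>t. \<bar>F z t\<bar>)" by (rule integrable_abs[OF intF])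
          show "integrable lborel (\<lambda>t::real. \<bar>indicat_real K z * f z\<bar> * D * indicat_real {0..1} t)"
            by (intro integrable_mult_right i01)
          show "\<bar>F z t\<bar> \<le> \<bar>indicat_real K z * f z\<bar> * D * indicat_real {0..1} t" for t by (rule Fb)
        qed
        also have "\<dots> = \<bar>indicat_real K z * f z\<bar> * D" by simp
        finally show "norm (LINT t|lborel. norm (case (z, t) of (z, t) \<Rightarrow> F z t)) \<le> norm (\<bar>indicat_real K z * f z\<bar> * D)"
          using D by (simp add: abs_mult)
      qed
    qed measurable
  qed (use intF in auto)
  have intb: "integrable lborel (\<lambda>z. f z * bump e (z - w))" for w
    by (rule integrable_times_bounded[where C=C and w=w and r=e])
      (use C e in \<open>auto simp: dist_norm norm_minus_commute intro: bump_outside\<close>)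
  have "smooth e (y + h) - smooth e y = (LINT z|lborel. f z * bump e (z - (y + h)) - f z * bump e (z - y))"
    unfolding smooth_def by (intro Bochner_Integration.integral_diff[symmetric] intb)
  also have "\<dots> = (LINT z|lborel. f z * (bump e (z - (y + h)) - bump e (z - y)))" by (simp add: right_diff_distrib)
  also have "\<dots> = (LINT z|lborel. (LINT t|lborel. F z t))" unfolding ftc F_def by simp
  also have "\<dots> = (LINT t|lborel. (LINT z|lborel. F z t))" by (rule lborel_pair.Fubini_integral[symmetric, OF prod])
  finally have eq: "smooth e (y + h) - smooth e y = (LINT t|lborel. (LINT z|lborel. F z t))" .
  have "ennreal \<bar>smooth e (y + h) - smooth e y\<bar> \<le> (\<integral>\<^sup>+t. ennreal (norm (LINT z|lborel. F z t)) \<partial>lborel)"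
    unfolding eq real_norm_def[symmetric] by (rule integral_norm_bound_ennreal) (use lborel_pair.integrable_snd[OF prod] in auto)
  also have "\<dots> \<le> (\<integral>\<^sup>+t. ennreal (real CARD('n) * norm h) * (indicator {0..1} t * (\<integral>\<^sup>+z. ennreal (bump e (z - y - t *\<^sub>R h)) \<partial>M)) \<partial>lborel)"
  proof (rule nn_integral_mono)
    fix t :: real
    have "(LINT z|lborel. F z t) = - indicat_real {0..1} t * (LINT z|lborel. f z * bump_deriv e (z - (y + t *\<^sub>R h)) h)"
      unfolding F_def by (subst integral_mult_right_zero[symmetric]) (simp add: algebra_simps)
    then have "ennreal (norm (LINT z|lborel. F z t)) = indicator {0..1} t * ennreal \<bar>LINT z|lborel. f z * bump_deriv e (z - (y + t *\<^sub>R h)) h\<bar>"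
      by (auto simp: indicator_def)
    also have "\<dots> \<le> indicator {0..1} t * (ennreal (real CARD('n) * norm h) * (\<integral>\<^sup>+z. ennreal (bump e (z - (y + t *\<^sub>R h))) \<partial>M))"
      by (intro mult_left_mono smooth_gradient e) auto
    finally show "ennreal (norm (LINT z|lborel. F z t)) \<le> ennreal (real CARD('n) * norm h) * (indicator {0..1} t * (\<integral>\<^sup>+z. ennreal (bump e (z - y - t *\<^sub>R h)) \<partial>M))"
      by (simp add: mult_ac diff_diff_eq)
  qed
  also have "\<dots> = ennreal (real CARD('n) * norm h) * (\<integral>\<^sup>+t. indicator {0..1} t * (\<integral>\<^sup>+z. ennreal (bump e (z - y - t *\<^sub>R h)) \<partial>M) \<partial>lborel)"
  proof (rule nn_integral_cmult)
    interpret sigma_finite_measure M by (rule sf_M)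
    show "(\<lambda>t. indicator {0..1} t * (\<integral>\<^sup>+z. ennreal (bump e (z - y - t *\<^sub>R h)) \<partial>M)) \<in> borel_measurable lborel"
      by measurable
  qed
  finally show ?thesis .
qed

text \<open>Exchanging integrals puts the integral over the centre y inside: there the kernel has
  mass at most 1, and it vanishes unless z lies within r + norm h + e of x.\<close>

lemma smooth_translation:
  assumes e: "e > 0"
  shows "(\<integral>\<^sup>+y. indicator (ball x r) y * ennreal \<bar>smooth e (y + h) - smooth e y\<bar> \<partial>lborel)
    \<le> ennreal (real CARD('n) * norm h) * emeasure M (ball x (r + norm h + e))"
proof -
  interpret M: sigma_finite_measure M by (rule sf_M)
  interpret LM: pair_sigma_finite lborel M ..
  let ?c = "ennreal (real CARD('n) * norm h)" and ?R = "r + norm h + e"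
  have [measurable]: "ball x r \<in> sets borel" by simp
  define \<Phi> where "\<Phi> = (\<lambda>y t. indicator {0..1} t * (\<integral>\<^sup>+z. ennreal (bump e (z - y - t *\<^sub>R h)) \<partial>M))"
  have [measurable]: "(\<lambda>(y, t). \<Phi> y t) \<in> borel_measurable (lborel \<Otimes>\<^sub>M lborel)" unfolding \<Phi>_def by measurable
  then have [measurable]: "(\<lambda>p. \<Phi> (fst p) (snd p)) \<in> borel_measurable (lborel \<Otimes>\<^sub>M lborel)" by (simp add: split_beta')
  have [measurable]: "(\<lambda>y. \<Phi> y t) \<in> borel_measurable borel" for t unfolding \<Phi>_def by measurable
  have inner: "(\<integral>\<^sup>+y. indicator (ball x r) y * \<Phi> y t \<partial>lborel) \<le> indicator {0..1} t * emeasure M (ball x ?R)" for t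
  proof (cases "t \<in> {0..1}")
    case True
    have "(\<integral>\<^sup>+y. indicator (ball x r) y * \<Phi> y t \<partial>lborel) =
       (\<integral>\<^sup>+y. (\<integral>\<^sup>+z. indicator (ball x r) y * ennreal (bump e (z - y - t *\<^sub>R h)) \<partial>M) \<partial>lborel)"
      using True by (intro nn_integral_cong) (simp add: \<Phi>_def nn_integral_cmult)
    also have "\<dots> = (\<integral>\<^sup>+z. (\<integral>\<^sup>+y. indicator (ball x r) y * ennreal (bump e (z - y - t *\<^sub>R h)) \<partial>lborel) \<partial>M)"
    proof (rule LM.Fubini'[symmetric])
      have eq: "sets (lborel \<Otimes>\<^sub>M M) = sets (borel \<Otimes>\<^sub>M borel)" by (rule sets_pair_measure_cong) (simp_all add: sets_M)
      have [measurable]: "ball x r \<in> sets borel" by simp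
      show "(\<lambda>(y, z). indicator (ball x r) y * ennreal (bump e (z - y - t *\<^sub>R h))) \<in> borel_measurable (lborel \<Otimes>\<^sub>M M)"
        unfolding measurable_cong_sets[OF eq refl] by measurable
    qed
    also have "\<dots> \<le> (\<integral>\<^sup>+z. indicator (ball x ?R) z \<partial>M)"
    proof (rule nn_integral_mono)
      fix z
      have bz: "bump e (z - y - t *\<^sub>R h) = bump e (y + (t *\<^sub>R h - z))" for y
        using bump_minus[of e "z - y - t *\<^sub>R h"] by (simp add: algebra_simps)
      have "indicator (ball x r) y * ennreal (bump e (z - y - t *\<^sub>R h)) \<le>
         indicator (ball x ?R) z * ennreal (bump e (y + (t *\<^sub>R h - z)))" for y
      proof (cases "y \<in> ball x r \<and> norm (z - y - t *\<^sub>R h) < e")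
        case T: True
        have "norm (t *\<^sub>R h) \<le> norm h" using True by (auto intro: mult_left_le_one_le)
        moreover have "z - x = (z - y - t *\<^sub>R h) + (y - x) + t *\<^sub>R h" by simp
        then have "norm (z - x) \<le> norm (z - y - t *\<^sub>R h) + norm (y - x) + norm (t *\<^sub>R h)"
          by (metis norm_triangle_le norm_triangle_ineq add_mono order_refl)
        ultimately have "z \<in> ball x ?R" using T by (auto simp: dist_norm norm_minus_commute)
        then show ?thesis using T by (simp add: bz)
      next
        case False
        then show ?thesis using e by (auto simp: bump_outside indicator_def)
      qed
      then have "(\<integral>\<^sup>+y. indicator (ball x r) y * ennreal (bump e (z - y - t *\<^sub>R h)) \<partial>lborel) \<le>
         (\<integral>\<^sup>+y. indicator (ball x ?R) z * ennreal (bump e (y + (t *\<^sub>R h - z))) \<partial>lborel)"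
        by (intro nn_integral_mono)
      also have "\<dots> = indicator (ball x ?R) z * (\<integral>\<^sup>+y. ennreal (bump e (y + (t *\<^sub>R h - z))) \<partial>lborel)"
        by (rule nn_integral_cmult) measurable
      also have "(\<integral>\<^sup>+y. ennreal (bump e (y + (t *\<^sub>R h - z))) \<partial>lborel) = (\<integral>\<^sup>+y. ennreal (bump e (y::real^'n)) \<partial>lborel)"
        by (rule lborel_nn_integral_shift) measurable
      finally show "(\<integral>\<^sup>+y. indicator (ball x r) y * ennreal (bump e (z - y - t *\<^sub>R h)) \<partial>lborel) \<le> indicator (ball x ?R) z"
        using bump_nn_integral[OF e, where 'n='n] by simp
    qed
    also have "\<dots> = emeasure M (ball x ?R)" by (simp add: sets_M)
    finally show ?thesis using True by simp
  qed (simp add: \<Phi>_def)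
  have "(\<integral>\<^sup>+y. indicator (ball x r) y * ennreal \<bar>smooth e (y + h) - smooth e y\<bar> \<partial>lborel) \<le>
    (\<integral>\<^sup>+y. ?c * (\<integral>\<^sup>+t. indicator (ball x r) y * \<Phi> y t \<partial>lborel) \<partial>lborel)"
  proof (rule nn_integral_mono)
    fix y
    show "indicator (ball x r) y * ennreal \<bar>smooth e (y + h) - smooth e y\<bar> \<le> ?c * (\<integral>\<^sup>+t. indicator (ball x r) y * \<Phi> y t \<partial>lborel)"
      using smooth_difference[OF e, of y h] by (auto simp: indicator_def \<Phi>_def)
  qed
  also have "\<dots> = ?c * (\<integral>\<^sup>+y. (\<integral>\<^sup>+t. indicator (ball x r) y * \<Phi> y t \<partial>lborel) \<partial>lborel)"
    by (rule nn_integral_cmult) measurable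
  also have "(\<integral>\<^sup>+y. (\<integral>\<^sup>+t. indicator (ball x r) y * \<Phi> y t \<partial>lborel) \<partial>lborel) =
     (\<integral>\<^sup>+t. (\<integral>\<^sup>+y. indicator (ball x r) y * \<Phi> y t \<partial>lborel) \<partial>lborel)"
    by (rule lborel_pair.Fubini'[symmetric]) measurable
  also have "\<dots> \<le> (\<integral>\<^sup>+t. emeasure M (ball x ?R) * indicator {0..1::real} t \<partial>lborel)"
    using inner by (intro nn_integral_mono) (simp add: mult.commute)
  also have "\<dots> = emeasure M (ball x ?R)" by (simp add: nn_integral_cmult_indicator)
  finally show ?thesis by (simp add: mult_left_mono)
qed

text \<open>The mollification error is at most an average of L1 translation errors over shifts
  shorter than e. Truncating \<open>f\<close> to radius r + 1 makes it integrable, and e < 1 keeps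
  the truncation invisible from the ball of radius r.\<close>

lemma smooth_approx:
  assumes "\<delta> > 0"
  shows "\<exists>d>0. \<forall>e. 0 < e \<and> e < d \<longrightarrow>
    (\<integral>\<^sup>+y. indicator (ball x r) y * ennreal \<bar>smooth e y - f y\<bar> \<partial>lborel) \<le> ennreal \<delta>"
proof -
  define g where "g = (\<lambda>z. indicat_real (cball x (r + 1)) z * f z)"
  have gi: "integrable lborel g" unfolding g_def by (rule f_local)
  have gm [measurable]: "g \<in> borel_measurable borel" using gi by auto
  obtain d where d: "d > 0" "\<And>u. norm u < d \<Longrightarrow> (LINT y|lborel. \<bar>g (y + u) - g y\<bar>) < \<delta>"
    using L1_shift_small[OF gi assms] by blast
  have "(\<integral>\<^sup>+y. indicator (ball x r) y * ennreal \<bar>smooth e y - f y\<bar> \<partial>lborel) \<le> ennreal \<delta>"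
    if e: "0 < e" "e < min d 1" for e
  proof -
    have gu: "(\<integral>\<^sup>+y. ennreal \<bar>g (y + u) - g y\<bar> \<partial>lborel) \<le> ennreal \<delta>" if "norm u < e" for u
    proof -
      have i: "integrable lborel (\<lambda>y. \<bar>g (y + u) - g y\<bar>)"
        using gi by (intro integrable_abs Bochner_Integration.integrable_diff) (auto simp: lborel_integrable_shift)
      then show ?thesis using d(2)[of u] that e by (subst nn_integral_eq_integral) (auto intro!: ennreal_leI)
    qed
    obtain C where C: "\<And>u::real^'n. \<bar>bump e u\<bar> \<le> C" using bump_bounded[OF e(1)] by blast
    have pt: "indicator (ball x r) y * ennreal \<bar>smooth e y - f y\<bar> \<le>
       (\<integral>\<^sup>+u. ennreal (bump e u) * ennreal \<bar>g (y + u) - g y\<bar> \<partial>lborel)" for y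
    proof (cases "y \<in> ball x r")
      case True
      have gy: "g y = f y" using True by (auto simp: g_def)
      have "smooth e y = (LINT u|lborel. f (u + y) * bump e (u + y - y))"
        unfolding smooth_def by (rule lborel_integral_shift[symmetric]) measurable
      also have "\<dots> = (LINT u|lborel. g (u + y) * bump e u)"
      proof (intro Bochner_Integration.integral_cong refl)
        fix u
        show "f (u + y) * bump e (u + y - y) = g (u + y) * bump e u"
        proof (cases "norm u < e")
          case T: True
          have "dist x (u + y) \<le> dist x y + norm u" using norm_triangle_ineq4[of "x - y" u] by (simp add: dist_norm algebra_simps)
          then show ?thesis using True T e by (simp add: g_def indicator_def)
        qed (use e in \<open>simp add: bump_outside\<close>)
      qed
      finally have s1: "smooth e y = (LINT u|lborel. g (u + y) * bump e u)" .
      have s2: "f y = (LINT u::real^'n|lborel. g y * bump e u)" using bump_integral[OF e(1), where 'n='n] by (simp add: gy)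
      have i1: "integrable lborel (\<lambda>u. g (u + y) * bump e u)"
      proof (rule Bochner_Integration.integrable_bound)
        show "integrable lborel (\<lambda>u. C * \<bar>g (u + y)\<bar>)" using gi by (intro integrable_mult_right integrable_abs) (simp add: lborel_integrable_shift)
        show "AE u in lborel. norm (g (u + y) * bump e u) \<le> norm (C * \<bar>g (u + y)\<bar>)"
        proof (intro AE_I2)
          fix u
          show "norm (g (u + y) * bump e u) \<le> norm (C * \<bar>g (u + y)\<bar>)"
            using C[of 0] mult_right_mono[OF C[of u], of "\<bar>g (u + y)\<bar>"] by (simp add: abs_mult mult.commute)
        qed
      qed measurable
      have "smooth e y - f y = (LINT u|lborel. g (u + y) * bump e u - g y * bump e u)"
        unfolding s1 s2 by (rule Bochner_Integration.integral_diff[symmetric, OF i1 integrable_mult_right[OF bump_integrable[OF e(1)]]])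
      then have "ennreal \<bar>smooth e y - f y\<bar> \<le> (\<integral>\<^sup>+u. ennreal (norm (g (u + y) * bump e u - g y * bump e u)) \<partial>lborel)"
        by (simp only: real_norm_def[symmetric])
          (intro integral_norm_bound_ennreal Bochner_Integration.integrable_diff i1 integrable_mult_right bump_integrable e)
      also have "\<dots> = (\<integral>\<^sup>+u. ennreal (bump e u) * ennreal \<bar>g (y + u) - g y\<bar> \<partial>lborel)"
      proof (intro nn_integral_cong)
        fix u
        have "g (u + y) * bump e u - g y * bump e u = bump e u * (g (y + u) - g y)" by (simp add: algebra_simps)
        then show "ennreal (norm (g (u + y) * bump e u - g y * bump e u)) = ennreal (bump e u) * ennreal \<bar>g (y + u) - g y\<bar>"
          using bump_nonneg[OF e(1), of u] by (simp add: abs_mult ennreal_mult)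
      qed
      finally show ?thesis using True by simp
    qed simp
    have "(\<integral>\<^sup>+y. indicator (ball x r) y * ennreal \<bar>smooth e y - f y\<bar> \<partial>lborel) \<le>
      (\<integral>\<^sup>+y. (\<integral>\<^sup>+u. ennreal (bump e u) * ennreal \<bar>g (y + u) - g y\<bar> \<partial>lborel) \<partial>lborel)"
      by (intro nn_integral_mono pt)
    also have "\<dots> = (\<integral>\<^sup>+u. (\<integral>\<^sup>+y. ennreal (bump e u) * ennreal \<bar>g (y + u) - g y\<bar> \<partial>lborel) \<partial>lborel)"
      by (rule lborel_pair.Fubini'[symmetric]) measurable
    also have "\<dots> \<le> (\<integral>\<^sup>+u. ennreal (bump e u) * ennreal \<delta> \<partial>(lborel :: (real^'n) measure))"
    proof (rule nn_integral_mono)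
      fix u
      have "(\<integral>\<^sup>+y. ennreal (bump e u) * ennreal \<bar>g (y + u) - g y\<bar> \<partial>lborel) =
        ennreal (bump e u) * (\<integral>\<^sup>+y. ennreal \<bar>g (y + u) - g y\<bar> \<partial>lborel)"
        by (rule nn_integral_cmult) measurable
      also have "\<dots> \<le> ennreal (bump e u) * ennreal \<delta>"
        using gu[of u] bump_outside[OF e(1), of u] by (cases "norm u < e") (auto intro: mult_left_mono)
      finally show "(\<integral>\<^sup>+y. ennreal (bump e u) * ennreal \<bar>g (y + u) - g y\<bar> \<partial>lborel) \<le> ennreal (bump e u) * ennreal \<delta>" .
    qed
    also have "\<dots> = (\<integral>\<^sup>+u. ennreal (bump e (u::real^'n)) \<partial>lborel) * ennreal \<delta>"
      by (rule nn_integral_multc) measurable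
    finally show ?thesis using bump_nn_integral[OF e(1), where 'n='n] by simp
  qed
  then show ?thesis using d(1) by (intro exI[of _ "min d 1"]) auto
qed

lemma translation_estimate:
  assumes "h \<noteq> 0"
  shows "(\<integral>\<^sup>+y. indicator (ball x r) y * ennreal \<bar>f (y + h) - f y\<bar> \<partial>lborel)
    \<le> ennreal (real CARD('n) * norm h) * emeasure M (ball x (r + 2 * norm h))"
proof (rule ennreal_le_epsilon)
  fix \<delta> :: real assume "\<delta> > 0"
  have [measurable]: "ball x r \<in> sets borel" "ball x (r + norm h) \<in> sets borel" by simp_all
  have sm[measurable]: "smooth e \<in> borel_measurable borel" for e unfolding smooth_def by measurable
  obtain d1 where d1: "d1 > 0" "\<And>e. 0 < e \<Longrightarrow> e < d1 \<Longrightarrow>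
    (\<integral>\<^sup>+y. indicator (ball x r) y * ennreal \<bar>smooth e y - f y\<bar> \<partial>lborel) \<le> ennreal (\<delta>/2)"
    using smooth_approx[of "\<delta>/2" x r] \<open>\<delta> > 0\<close> by auto
  obtain d2 where d2: "d2 > 0" "\<And>e. 0 < e \<Longrightarrow> e < d2 \<Longrightarrow>
    (\<integral>\<^sup>+y. indicator (ball x (r + norm h)) y * ennreal \<bar>smooth e y - f y\<bar> \<partial>lborel) \<le> ennreal (\<delta>/2)"
    using smooth_approx[of "\<delta>/2" x "r + norm h"] \<open>\<delta> > 0\<close> by auto
  \<comment> \<open>Below both thresholds and at most \<open>norm h\<close>, so that the radius r +
    norm h + e is at most r + 2 norm h, whatever the error \<delta>.\<close>
  define e where "e = min (norm h) (min d1 d2) / 2"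
  have e: "0 < e" "e < d1" "e < d2" "e \<le> norm h" using assms d1(1) d2(1) by (auto simp: e_def min_def)
  have "(\<integral>\<^sup>+y. indicator (ball x r) y * ennreal \<bar>f (y + h) - f y\<bar> \<partial>lborel) \<le>
    (\<integral>\<^sup>+y. indicator (ball x (r + norm h)) (y + h) * ennreal \<bar>smooth e (y + h) - f (y + h)\<bar> +
      (indicator (ball x r) y * ennreal \<bar>smooth e (y + h) - smooth e y\<bar> + indicator (ball x r) y * ennreal \<bar>smooth e y - f y\<bar>) \<partial>lborel)"
  proof (rule nn_integral_mono)
    fix y
    show "indicator (ball x r) y * ennreal \<bar>f (y + h) - f y\<bar> \<le> indicator (ball x (r + norm h)) (y + h) * ennreal \<bar>smooth e (y + h) - f (y + h)\<bar> +
      (indicator (ball x r) y * ennreal \<bar>smooth e (y + h) - smooth e y\<bar> + indicator (ball x r) y * ennreal \<bar>smooth e y - f y\<bar>)"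
    proof (cases "y \<in> ball x r")
      case True
      have "dist x (y + h) \<le> dist x y + norm h" using norm_triangle_ineq4[of "x - y" h] by (simp add: dist_norm algebra_simps)
      then have "y + h \<in> ball x (r + norm h)" using True by simp
      then show ?thesis using True
        by (simp add: ennreal_plus[symmetric] del: ennreal_plus)
    qed simp
  qed
  also have "\<dots> = (\<integral>\<^sup>+y. indicator (ball x (r + norm h)) (y + h) * ennreal \<bar>smooth e (y + h) - f (y + h)\<bar> \<partial>lborel) +
     ((\<integral>\<^sup>+y. indicator (ball x r) y * ennreal \<bar>smooth e (y + h) - smooth e y\<bar> \<partial>lborel) +
      (\<integral>\<^sup>+y. indicator (ball x r) y * ennreal \<bar>smooth e y - f y\<bar> \<partial>lborel))"
    by (simp add: nn_integral_add)
  also have "(\<integral>\<^sup>+y. indicator (ball x (r + norm h)) (y + h) * ennreal \<bar>smooth e (y + h) - f (y + h)\<bar> \<partial>lborel)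
     = (\<integral>\<^sup>+y. indicator (ball x (r + norm h)) y * ennreal \<bar>smooth e y - f y\<bar> \<partial>lborel)"
    by (rule lborel_nn_integral_shift) measurable
  also have "\<dots> + ((\<integral>\<^sup>+y. indicator (ball x r) y * ennreal \<bar>smooth e (y + h) - smooth e y\<bar> \<partial>lborel) +
      (\<integral>\<^sup>+y. indicator (ball x r) y * ennreal \<bar>smooth e y - f y\<bar> \<partial>lborel))
     \<le> ennreal (\<delta>/2) + (ennreal (real CARD('n) * norm h) * emeasure M (ball x (r + norm h + e)) + ennreal (\<delta>/2))"
    using e by (intro add_mono d1 d2 smooth_translation)
  also have "\<dots> \<le> ennreal (\<delta>/2) + (ennreal (real CARD('n) * norm h) * emeasure M (ball x (r + 2 * norm h)) + ennreal (\<delta>/2))"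
  proof (intro add_mono mult_left_mono order.refl)
    have "ball x (r + norm h + e) \<subseteq> ball x (r + 2 * norm h)" using e by (intro subset_ball) simp
    then show "emeasure M (ball x (r + norm h + e)) \<le> emeasure M (ball x (r + 2 * norm h))"
      by (rule emeasure_mono) (simp add: sets_M)
  qed auto
  also have "\<dots> = ennreal (real CARD('n) * norm h) * emeasure M (ball x (r + 2 * norm h)) + (ennreal (\<delta>/2) + ennreal (\<delta>/2))"
    by (simp add: add_ac)
  also have "ennreal (\<delta>/2) + ennreal (\<delta>/2) = ennreal \<delta>" using \<open>\<delta> > 0\<close> by (simp add: ennreal_plus[symmetric] del: ennreal_plus)
  finally show "(\<integral>\<^sup>+y. indicator (ball x r) y * ennreal \<bar>f (y + h) - f y\<bar> \<partial>lborel) \<le>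
     ennreal (real CARD('n) * norm h) * emeasure M (ball x (r + 2 * norm h)) + ennreal \<delta>" .
qed

end

section \<open>The Riemann-Stieltjes integral of Hoelder functions\<close>

text \<open>Telescoping against a geometric series. The tail bound at every index is what the
  halving of scales, Campanato's argument and the chaining along the path have in common.\<close>

lemma geometric_limit:
  fixes x :: "nat \<Rightarrow> real"
  assumes d: "\<And>j. \<bar>x j - x (Suc j)\<bar> \<le> c * r ^ j" and r: "0 \<le> r" "r < 1"
  obtains l where "x \<longlonglongrightarrow> l" "\<And>j. \<bar>x j - l\<bar> \<le> c * r ^ j / (1 - r)"
proof -
  have c: "c \<ge> 0" using d[of 0] by simp
  have s: "summable (\<lambda>j. c * r ^ j)" using r by (intro summable_mult summable_geometric) auto
  have *: "summable (\<lambda>i. x (j + i) - x (Suc (j + i)))" for j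
  proof (rule summable_comparison_test'[where N=0])
    show "summable (\<lambda>i. c * r ^ j * r ^ i)" using r by (intro summable_mult summable_geometric) auto
    show "norm (x (j + i) - x (Suc (j + i))) \<le> c * r ^ j * r ^ i" for i
      using d[of "j + i"] by (simp add: power_add mult.assoc)
  qed
  have t: "(\<Sum>i<m. x (j + i) - x (Suc (j + i))) = x j - x (j + m)" for j m by (induction m) auto
  from *[of 0] have "(\<lambda>m. \<Sum>i<m. x (0 + i) - x (Suc (0 + i))) \<longlonglongrightarrow> (\<Sum>i. x (0 + i) - x (Suc (0 + i)))"
    by (rule summable_LIMSEQ)
  then have "(\<lambda>m. x 0 - x m) \<longlonglongrightarrow> (\<Sum>i. x (0 + i) - x (Suc (0 + i)))" unfolding t by simp
  then obtain L where L: "(\<lambda>m. x 0 - x m) \<longlonglongrightarrow> L" by blast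
  have l: "x \<longlonglongrightarrow> x 0 - L" using tendsto_diff[OF tendsto_const[of "x 0"] L] by simp
  have "\<bar>x j - (x 0 - L)\<bar> \<le> c * r ^ j / (1 - r)" for j
  proof (rule LIMSEQ_le_const2)
    show "(\<lambda>m. \<bar>x j - x (j + m)\<bar>) \<longlonglongrightarrow> \<bar>x j - (x 0 - L)\<bar>"
      using LIMSEQ_ignore_initial_segment[OF l, of j] by (intro tendsto_intros) (simp add: add.commute)
    have "\<bar>x j - x (j + m)\<bar> \<le> c * r ^ j / (1 - r)" for m
    proof -
      have "\<bar>x j - x (j + m)\<bar> \<le> (\<Sum>i<m. c * r ^ j * r ^ i)"
        unfolding t[symmetric] by (rule order.trans[OF sum_abs sum_mono])
          (use d in \<open>auto simp: power_add[symmetric] mult.assoc\<close>)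
      also have "\<dots> = c * r ^ j * (\<Sum>i<m. r ^ i)" by (simp add: sum_distrib_left)
      also have "\<dots> \<le> c * r ^ j * (1 / (1 - r))"
        using c r by (intro mult_left_mono) (auto simp: sum_gp_strict divide_right_mono)
      finally show ?thesis by simp
    qed
    then show "\<exists>N. \<forall>m\<ge>N. \<bar>x j - x (j + m)\<bar> \<le> c * r ^ j / (1 - r)" by blast
  qed
  with l show ?thesis using that by blast
qed

section \<open>Averages of increments under halving of the scale\<close>

definition holder_bound :: "real \<Rightarrow> real \<Rightarrow> (real \<Rightarrow> real) \<Rightarrow> bool" where
  "holder_bound A a f \<longleftrightarrow> (\<forall>t u. \<bar>f t - f u\<bar> \<le> A * \<bar>t - u\<bar> powr a)"

lemma holder_bound_continuous:
  assumes "holder_bound A a f" "a > 0"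
  shows "continuous_on S f"
proof -
  have "isCont f t" for t
  proof -
    have "((\<lambda>u. A * \<bar>u - t\<bar> powr a) \<longlongrightarrow> A * \<bar>t - t\<bar> powr a) (at t)"
      using assms(2) by (intro tendsto_intros) auto
    then have "((\<lambda>u. f u - f t) \<longlongrightarrow> 0) (at t)"
      using assms by - (rule Lim_null_comparison[where g="\<lambda>u. A * \<bar>u - t\<bar> powr a"], auto simp: holder_bound_def)
    then show ?thesis by (simp add: isCont_def LIM_zero_iff)
  qed
  then show ?thesis by (simp add: continuous_at_imp_continuous_on)
qed

text \<open>The forward regularisation of the integral of f against g. Unlike a Riemann sum it is
  exactly additive in the interval, and its limits inherit this.\<close>

definition diff_integral :: "(real \<Rightarrow> real) \<Rightarrow> (real \<Rightarrow> real) \<Rightarrow> real \<Rightarrow> real \<Rightarrow> real \<Rightarrow> real" where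
  "diff_integral f g h p q = integral {p..q} (\<lambda>t. f t * (g (t + h) - g t)) / h"

lemma abs_integral_le:
  fixes f :: "real \<Rightarrow> real"
  assumes "continuous_on {p..q} f" "p \<le> q" "\<And>t. t \<in> {p..q} \<Longrightarrow> \<bar>f t\<bar> \<le> M"
  shows "\<bar>integral {p..q} f\<bar> \<le> M * (q - p)"
  using integral_bound[of p q f M] assms by auto

lemma continuous_on_shift: "continuous_on UNIV f \<Longrightarrow> continuous_on S (\<lambda>t. f (t + k :: real) :: real)"
  by (rule continuous_on_compose2[of UNIV f]) (auto intro!: continuous_intros)

lemma integral_shift':
  fixes f :: "real \<Rightarrow> real"
  assumes "continuous_on UNIV f"
  shows "integral {p..q} (\<lambda>t. f (t + k)) = integral {p+k..q+k} f"
  using integral_shift[of p k q f] continuous_on_subset[OF assms] by (simp add: o_def)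

lemma integral_window:
  fixes f :: "real \<Rightarrow> real"
  assumes c: "continuous_on UNIV f" and "p \<le> q" "k \<ge> 0"
  shows "integral {p+k..q+k} f - integral {p..q} f = integral {q..q+k} f - integral {p..p+k} f"
proof -
  have i: "f integrable_on {x..y}" for x y by (rule integrable_continuous_real[OF continuous_on_subset[OF c]]) auto
  have "integral {p..p+k} f + integral {p+k..q+k} f = integral {p..q+k} f"
    using assms by (intro Henstock_Kurzweil_Integration.integral_combine i) auto
  moreover have "integral {p..q} f + integral {q..q+k} f = integral {p..q+k} f"
    using assms by (intro Henstock_Kurzweil_Integration.integral_combine i) auto
  ultimately show ?thesis by simp
qed

lemma holder_boundD: "holder_bound A a f \<Longrightarrow> \<bar>f t - f u\<bar> \<le> A * \<bar>t - u\<bar> powr a"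
  by (simp add: holder_bound_def)

lemma holder_bound_nonneg: "holder_bound A a f \<Longrightarrow> 0 \<le> A"
  using holder_boundD[of A a f 1 0] by simp

text \<open>With D t = g (t + k) - g t the increment over 2 k is D (t + k) + D t, so the two
  averages differ by the integral of f t (D (t + k) - D t) divided by 2 k. A change of variables
  moves the difference onto f, which gives an integrand of order k^(a + b), and leaves two boundary
  windows of length k, which give the second term.\<close>

lemma diff_integral_halve:
  assumes f: "holder_bound A a f" and g: "holder_bound B b g" and ab: "0 < a" "0 < b"
    and "p \<le> q" "k > 0" and M: "\<And>t. t \<in> {p..q+k} \<Longrightarrow> \<bar>f t\<bar> \<le> M"
  shows "\<bar>diff_integral f g (2 * k) p q - diff_integral f g k p q\<bar>
    \<le> A * B / 2 * (q - p) * k powr (a + b - 1) + M * B * k powr b"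
proof -
  define D where "D = (\<lambda>t. g (t + k) - g t)"
  have cf: "continuous_on S f" for S using holder_bound_continuous[OF f ab(1)] .
  have cg: "continuous_on S g" for S using holder_bound_continuous[OF g ab(2)] .
  have cg': "continuous_on S (\<lambda>t. g (t + c))" for S c by (rule continuous_on_shift[OF cg])
  have cD: "continuous_on S D" for S unfolding D_def by (intro continuous_intros cg' cg)
  have cD': "continuous_on S (\<lambda>t. D (t + c))" for S c by (rule continuous_on_shift[OF cD])
  have cf': "continuous_on S (\<lambda>t. f (t - c))" for S c using continuous_on_shift[OF cf, where k="-c"] by simp
  have Db: "\<bar>D t\<bar> \<le> B * k powr b" for t using holder_boundD[OF g, of "t+k" t] \<open>k > 0\<close> by (simp add: D_def)
  have B: "B \<ge> 0" "A \<ge> 0" using holder_bound_nonneg f g by auto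
  have M0: "M \<ge> 0" using M[of p] assms by force
  have i: "u integrable_on {x..y}" if "\<And>S. continuous_on S u" for u :: "real \<Rightarrow> real" and x y
    by (rule integrable_continuous_real[OF that])
  have "2 * k * (diff_integral f g (2 * k) p q - diff_integral f g k p q)
     = integral {p..q} (\<lambda>t. f t * (g (t + 2 * k) - g t)) - 2 * integral {p..q} (\<lambda>t. f t * (g (t + k) - g t))"
    using \<open>k > 0\<close> by (simp add: diff_integral_def field_simps)
  also have "\<dots> = integral {p..q} (\<lambda>t. f t * (g (t + 2 * k) - g t)) - integral {p..q} (\<lambda>t. 2 * (f t * (g (t + k) - g t)))"
    by simp
  also have "\<dots> = integral {p..q} (\<lambda>t. f t * (g (t + 2 * k) - g t) - 2 * (f t * (g (t + k) - g t)))"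
    by (rule integral_diff[symmetric]; intro i continuous_intros cf cg cg')
  also have "\<dots> = integral {p..q} (\<lambda>t. f t * D (t + k) - f t * D t)"
    by (intro Henstock_Kurzweil_Integration.integral_cong) (auto simp: D_def algebra_simps)
  also have "\<dots> = integral {p..q} (\<lambda>t. f t * D (t + k)) - integral {p..q} (\<lambda>t. f t * D t)"
    by (rule integral_diff; intro i continuous_intros cf cD cD')
  also have "integral {p..q} (\<lambda>t. f t * D (t + k)) = integral {p+k..q+k} (\<lambda>t. f (t - k) * D t)"
    using integral_shift'[of "\<lambda>t. f (t - k) * D t" p q k] by (simp add: continuous_on_mult cf' cD)
  also have "\<dots> = integral {p+k..q+k} (\<lambda>t. (f (t - k) - f t) * D t + f t * D t)"
    by (simp add: algebra_simps)
  also have "\<dots> = integral {p+k..q+k} (\<lambda>t. (f (t - k) - f t) * D t) + integral {p+k..q+k} (\<lambda>t. f t * D t)"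
    by (rule integral_add; intro i continuous_intros cf cf' cD)
  finally have eq: "2 * k * (diff_integral f g (2 * k) p q - diff_integral f g k p q)
     = integral {p+k..q+k} (\<lambda>t. (f (t - k) - f t) * D t)
       + (integral {q..q+k} (\<lambda>t. f t * D t) - integral {p..p+k} (\<lambda>t. f t * D t))"
    using integral_window[of "\<lambda>t. f t * D t" p q k] assms by (simp add: continuous_on_mult cf cD)
  have 1: "\<bar>integral {p+k..q+k} (\<lambda>t. (f (t - k) - f t) * D t)\<bar> \<le> (A * k powr a * (B * k powr b)) * (q + k - (p + k))"
  proof (rule abs_integral_le)
    fix t
    have "\<bar>f (t - k) - f t\<bar> \<le> A * k powr a" using holder_boundD[OF f, of "t-k" t] \<open>k > 0\<close> by simp
    then show "\<bar>(f (t - k) - f t) * D t\<bar> \<le> A * k powr a * (B * k powr b)"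
      unfolding abs_mult using Db B by (intro mult_mono) auto
  qed (use assms in \<open>auto intro!: continuous_intros cf cf' cD\<close>)
  have 2: "\<bar>integral {x..x+k} (\<lambda>t. f t * D t)\<bar> \<le> (M * (B * k powr b)) * (x + k - x)" if "x = p \<or> x = q" for x
  proof (rule abs_integral_le)
    fix t assume "t \<in> {x..x+k}"
    then have "\<bar>f t\<bar> \<le> M" using that assms by (intro M) auto
    then show "\<bar>f t * D t\<bar> \<le> M * (B * k powr b)"
      unfolding abs_mult using Db M0 by (intro mult_mono) auto
  qed (use assms in \<open>auto intro!: continuous_intros cf cD\<close>)
  have "2 * k * \<bar>diff_integral f g (2 * k) p q - diff_integral f g k p q\<bar> =
    \<bar>2 * k * (diff_integral f g (2 * k) p q - diff_integral f g k p q)\<bar>"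
    using \<open>k > 0\<close> by (simp add: abs_mult)
  also have "\<dots> \<le> A * k powr a * (B * k powr b) * (q - p) + 2 * (M * (B * k powr b) * k)"
    unfolding eq using 1 2[of p] 2[of q] by simp
  finally have "\<bar>diff_integral f g (2 * k) p q - diff_integral f g k p q\<bar> \<le>
     (A * k powr a * (B * k powr b) * (q - p) + 2 * (M * (B * k powr b) * k)) / (2 * k)"
    using \<open>k > 0\<close> by (simp add: field_simps)
  also have "\<dots> = A * B / 2 * (q - p) * (k powr a * k powr b / k) + M * B * k powr b"
    using \<open>k > 0\<close> by (simp add: field_simps)
  also have "k powr a * k powr b / k = k powr (a + b - 1)" using \<open>k > 0\<close> by (simp add: powr_diff powr_add)
  finally show ?thesis .
qed

lemma integral_mean_limit:
  assumes g: "holder_bound B b g" "b > 0" and "k > 0"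
  shows "\<bar>integral {q..q+k} g / k - g q\<bar> \<le> B * k powr b"
proof -
  have cg: "continuous_on S g" for S using holder_bound_continuous[OF g] .
  have "\<bar>integral {q..q+k} (\<lambda>t. g t - g q)\<bar> \<le> (B * k powr b) * (q + k - q)"
  proof (rule abs_integral_le)
    fix t assume "t \<in> {q..q+k}"
    then have "B * \<bar>t - q\<bar> powr b \<le> B * k powr b"
      using holder_bound_nonneg[OF g(1)] g(2) by (intro mult_left_mono powr_mono2) auto
    then show "\<bar>g t - g q\<bar> \<le> B * k powr b" using holder_boundD[OF g(1), of t q] by linarith
  qed (use assms in \<open>auto intro!: continuous_intros cg\<close>)
  also have "integral {q..q+k} (\<lambda>t. g t - g q) = integral {q..q+k} g - k * g q"
    using \<open>k > 0\<close> by (subst integral_diff) (auto intro!: integrable_continuous_real cg)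
  finally have "\<bar>(integral {q..q+k} g - k * g q) / k\<bar> \<le> B * k powr b"
    using \<open>k > 0\<close> by (simp add: abs_divide pos_divide_le_eq)
  moreover have "(integral {q..q+k} g - k * g q) / k = integral {q..q+k} g / k - g q"
    using \<open>k > 0\<close> by (simp add: diff_divide_distrib)
  ultimately show ?thesis by simp
qed

text \<open>For constant f the average is c times the difference of the means of g over windows of
  length h at the two ends.\<close>

lemma diff_integral_const:
  assumes g: "holder_bound B b g" "b > 0" and "p \<le> q" and h: "\<And>j. h j > 0" "h \<longlonglongrightarrow> 0"
  shows "(\<lambda>j::nat. diff_integral (\<lambda>_. c) g (h j) p q) \<longlonglongrightarrow> c * (g q - g p)"
proof -
  have cg: "continuous_on S g" for S using holder_bound_continuous[OF g] .
  have eq: "diff_integral (\<lambda>_. c) g k p q = c * (integral {q..q+k} g / k - integral {p..p+k} g / k)" if "k > 0" for k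
  proof -
    have "integral {p..q} (\<lambda>t. g (t + k) - g t) = integral {p..q} (\<lambda>t. g (t + k)) - integral {p..q} g"
      by (intro integral_diff integrable_continuous_real continuous_on_shift[OF cg] cg)
    also have "\<dots> = integral {q..q+k} g - integral {p..p+k} g"
      using integral_shift'[OF cg, of p q k] integral_window[OF cg, of p q k] that \<open>p \<le> q\<close> by simp
    finally show ?thesis by (simp add: diff_integral_def diff_divide_distrib[symmetric] )
  qed
  have m: "(\<lambda>j. integral {x..x+h j} g / h j) \<longlonglongrightarrow> g x" for x
  proof -
    have "(\<lambda>j. B * h j powr b) \<longlonglongrightarrow> B * 0"
      by (intro tendsto_mult tendsto_const tendsto_zero_powrI[OF h(2) tendsto_const _ g(2)])
        (use h(1) in \<open>auto intro!: always_eventually less_imp_le\<close>)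
    then have "(\<lambda>j. integral {x..x+h j} g / h j - g x) \<longlonglongrightarrow> 0"
      using integral_mean_limit[OF g h(1)] by - (rule Lim_null_comparison[where g="\<lambda>j. B * h j powr b"], auto)
    then show ?thesis by (simp add: LIM_zero_iff)
  qed
  have "(\<lambda>j. c * (integral {q..q+h j} g / h j - integral {p..p+h j} g / h j)) \<longlonglongrightarrow> c * (g q - g p)"
    by (intro tendsto_intros m)
  then show ?thesis using eq h(1) by simp
qed

text \<open>Both halving errors are made geometric with ratio 2^(1 - a - b); for the boundary term
  this uses k^b \<le> h^(1 - a) k^(a + b - 1), valid for k \<le> h and a \<le> 1.\<close>

lemma diff_integral_halving_limit:
  assumes f: "holder_bound A a f" and g: "holder_bound B b g" and ab: "0 < a" "a \<le> 1" "0 < b" "1 < a + b"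
    and "p \<le> q" "h > 0" and M: "\<And>t. t \<in> {p..q+h} \<Longrightarrow> \<bar>f t\<bar> \<le> M"
  obtains l where "(\<lambda>j. diff_integral f g (h / 2 ^ j) p q) \<longlonglongrightarrow> l"
    "\<bar>diff_integral f g h p q - l\<bar> \<le>
      (A * B / 2 * (q - p) + M * B * h powr (1 - a)) * h powr (a + b - 1) / (1 - 2 powr (1 - a - b))"
proof -
  define d where "d = a + b - 1"
  define r where "r = (2::real) powr (- d)"
  define c where "c = (A * B / 2 * (q - p) + M * B * h powr (1 - a)) * h powr d"
  have d: "d > 0" using ab by (simp add: d_def)
  have r: "0 < r" "r < 1" using d by (auto simp: r_def intro: powr_less_one)
  have B: "A \<ge> 0" "B \<ge> 0" using f g holder_bound_nonneg by auto
  have M0: "M \<ge> 0" using M[of p] assms by force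
  have "\<bar>diff_integral f g (h / 2 ^ j) p q - diff_integral f g (h / 2 ^ Suc j) p q\<bar> \<le> c * r ^ j" for j
  proof -
    define k where "k = h / 2 ^ Suc j"
    have k: "k > 0" "h / 2 ^ j = 2 * k" using \<open>h > 0\<close> by (auto simp: k_def)
    have "k \<le> h / 1" unfolding k_def using \<open>h > 0\<close> one_le_power[of "2::real" "Suc j"] by (intro divide_left_mono) auto
    then have kh: "k \<le> h" by simp
    have kd: "k powr d \<le> h powr d * r ^ j"
    proof -
      have "k powr d = h powr d / (2 ^ Suc j) powr d" using \<open>h > 0\<close> by (simp add: k_def powr_divide)
      also have "(2 ^ Suc j :: real) powr d = (2 powr d) ^ Suc j"
        by (simp add: powr_realpow[symmetric] powr_powr mult.commute del: power_Suc)
      also have "h powr d / \<dots> = h powr d * r ^ Suc j"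
        by (simp add: r_def powr_minus power_inverse divide_inverse del: power_Suc)
      also have "\<dots> \<le> h powr d * r ^ j" using r by (intro mult_left_mono) (auto simp: mult_le_cancel_right1)
      finally show ?thesis .
    qed
    have kb: "k powr b \<le> h powr (1 - a) * k powr d"
    proof -
      have "k powr b = k powr (1 - a) * k powr d" using k by (simp add: d_def powr_add[symmetric])
      also have "\<dots> \<le> h powr (1 - a) * k powr d" using k kh ab by (intro mult_right_mono powr_mono2) auto
      finally show ?thesis .
    qed
    have "\<bar>diff_integral f g (2 * k) p q - diff_integral f g k p q\<bar>
       \<le> A * B / 2 * (q - p) * k powr (a + b - 1) + M * B * k powr b"
      using kh by (intro diff_integral_halve[OF f g] M) (use assms k in auto)
    also have "\<dots> \<le> A * B / 2 * (q - p) * k powr d + M * B * (h powr (1 - a) * k powr d)"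
      unfolding d_def[symmetric] using kb M0 B by (intro add_left_mono mult_left_mono) auto
    also have "\<dots> = (A * B / 2 * (q - p) + M * B * h powr (1 - a)) * k powr d" by (simp add: algebra_simps)
    also have "\<dots> \<le> (A * B / 2 * (q - p) + M * B * h powr (1 - a)) * (h powr d * r ^ j)"
      using kd B M0 \<open>p \<le> q\<close> by (intro mult_left_mono) auto
    finally show ?thesis unfolding k(2) k_def[symmetric] by (simp add: c_def)
  qed
  from geometric_limit[OF this less_imp_le[OF r(1)] r(2)] obtain l where
    l: "(\<lambda>j. diff_integral f g (h / 2 ^ j) p q) \<longlonglongrightarrow> l" and le: "\<And>j. \<bar>diff_integral f g (h / 2 ^ j) p q - l\<bar> \<le> c * r ^ j / (1 - r)"
    by blast
  then show ?thesis using that[OF l] le[of 0] by (simp add: c_def r_def d_def diff_diff_eq)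
qed

lemma diff_integral_add_const:
  assumes "holder_bound A a f" "a > 0" "holder_bound B b g" "b > 0"
  shows "diff_integral f g k p q = diff_integral (\<lambda>t. f t - c) g k p q + diff_integral (\<lambda>_. c) g k p q"
proof -
  have cf: "continuous_on S f" for S using holder_bound_continuous[OF assms(1,2)] .
  have cg: "continuous_on S g" for S using holder_bound_continuous[OF assms(3,4)] .
  have cg': "continuous_on S (\<lambda>t. g (t + c))" for S c by (rule continuous_on_shift[OF cg])
  have "integral {p..q} (\<lambda>t. f t * (g (t + k) - g t)) =
    integral {p..q} (\<lambda>t. (f t - c) * (g (t + k) - g t) + c * (g (t + k) - g t))"
    by (simp add: algebra_simps)
  also have "\<dots> = integral {p..q} (\<lambda>t. (f t - c) * (g (t + k) - g t)) + integral {p..q} (\<lambda>t. c * (g (t + k) - g t))"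
    by (intro integral_add integrable_continuous_real continuous_intros cf cg cg')
  finally show ?thesis by (simp add: diff_integral_def add_divide_distrib)
qed

text \<open>Limits are known only along h / 2^j. An interval of length L is treated at the largest
  such scale not above L, which is comparable to L.\<close>

lemma dyadic_scale:
  assumes "0 < L" "L \<le> (h::real)"
  obtains j where "h / 2 ^ j \<le> L" "L \<le> 2 * (h / 2 ^ j)"
proof -
  have ex: "\<exists>j. h / 2 ^ j \<le> L"
  proof -
    obtain j where "h / L < 2 ^ j" using real_arch_pow[of 2 "h / L"] by auto
    then show ?thesis using \<open>0 < L\<close> by (intro exI[of _ j]) (simp add: field_simps)
  qed
  define j where "j = (LEAST j. h / 2 ^ j \<le> L)"
  have 1: "h / 2 ^ j \<le> L" unfolding j_def using ex by (rule LeastI_ex)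
  have "L \<le> 2 * (h / 2 ^ j)"
  proof (cases j)
    case 0 then show ?thesis using assms by simp
  next
    case (Suc i)
    then have "\<not> h / 2 ^ i \<le> L" using not_less_Least[of i "\<lambda>j. h / 2 ^ j \<le> L"] by (simp add: j_def)
    then show ?thesis using Suc by (simp add: field_simps)
  qed
  with 1 show ?thesis by (rule that)
qed

text \<open>The 2 bounds the average at a scale comparable to the interval length L. The fraction
  sums the halving errors: 1/2 belongs to the bulk term, and 2^a to the boundary windows, where f
  differs from f x by at most A (2 L)^a.\<close>

definition young_const :: "real \<Rightarrow> real \<Rightarrow> real" where
  "young_const a b = 2 + (1 / 2 + 2 powr a) / (1 - 2 powr (1 - a - b))"

lemma young_const_nonneg: "1 < a + b \<Longrightarrow> 0 \<le> young_const a b"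
  using powr_less_one[of 2 "1 - a - b"] by (auto simp: young_const_def intro!: add_nonneg_nonneg divide_nonneg_nonneg)

text \<open>Subtracting the constant f x leaves an integrand of size L^a, with L = q - p. Halving
  starts at a scale k comparable to L and not at h, so that every contribution has order L^(a + b);
  in the limit the constant contributes exactly f x (g q - g p).\<close>

lemma diff_integral_local_estimate:
  assumes f: "holder_bound A a f" and g: "holder_bound B b g" and ab: "0 < a" "a \<le> 1" "0 < b" "b \<le> 1" "1 < a + b"
    and pq: "p < q" "q - p \<le> h" "x \<in> {p..q}"
    and l: "(\<lambda>j. diff_integral f g (h / 2 ^ j) p q) \<longlonglongrightarrow> l"
  shows "\<bar>l - f x * (g q - g p)\<bar> \<le> young_const a b * A * B * (q - p) powr (a + b)"
proof -
  define L where "L = q - p"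
  have L: "0 < L" "L \<le> h" using pq by (auto simp: L_def)
  obtain i where i: "h / 2 ^ i \<le> L" "L \<le> 2 * (h / 2 ^ i)" by (rule dyadic_scale[OF L]) auto
  define k where "k = h / 2 ^ i"
  have k: "0 < k" "k \<le> L" "L \<le> 2 * k" using i L by (auto simp: k_def)
  define F where "F = (\<lambda>t. f t - f x)"
  have F: "holder_bound A a F" using f by (simp add: holder_bound_def F_def)
  have B: "A \<ge> 0" "B \<ge> 0" using f g holder_bound_nonneg by auto
  define r where "r = 1 - 2 powr (1 - a - b)"
  have r: "0 < r" using ab by (auto simp: r_def intro: powr_less_one)
  have cg: "continuous_on S g" for S using holder_bound_continuous[OF g ab(3)] .
  have cg': "continuous_on S (\<lambda>t. g (t + c))" for S c by (rule continuous_on_shift[OF cg])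
  have cF: "continuous_on S F" for S using holder_bound_continuous[OF F ab(1)] .
  have FM: "\<bar>F t\<bar> \<le> A * (2 * L) powr a" if "t \<in> {p..q+k}" for t
  proof -
    have "A * \<bar>t - x\<bar> powr a \<le> A * (2 * L) powr a"
      using B ab that pq k by (intro mult_left_mono powr_mono2) (auto simp: L_def)
    then show ?thesis using holder_boundD[OF f, of t x] by (simp add: F_def)
  qed
  obtain l' where l': "(\<lambda>j. diff_integral F g (k / 2 ^ j) p q) \<longlonglongrightarrow> l'"
    and e: "\<bar>diff_integral F g k p q - l'\<bar> \<le>
      (A * B / 2 * (q - p) + A * (2 * L) powr a * B * k powr (1 - a)) * k powr (a + b - 1) / r"
    unfolding r_def using pq ab k by (elim diff_integral_halving_limit[OF F g, rotated -1, where p=p and q=q and h=k and M="A * (2 * L) powr a"])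
      (use FM in auto)
  have e2: "\<bar>diff_integral F g k p q\<bar> \<le> 2 * A * B * L powr (a + b)"
  proof -
    have "\<bar>integral {p..q} (\<lambda>t. F t * (g (t + k) - g t))\<bar> \<le> (A * L powr a * (B * k powr b)) * (q - p)"
    proof (rule abs_integral_le)
      fix t assume t: "t \<in> {p..q}"
      have "A * \<bar>t - x\<bar> powr a \<le> A * L powr a"
        using B ab t pq k by (intro mult_left_mono powr_mono2) (auto simp: L_def)
      then have "\<bar>F t\<bar> \<le> A * L powr a" using holder_boundD[OF f, of t x] by (simp add: F_def)
      moreover have "\<bar>g (t + k) - g t\<bar> \<le> B * k powr b" using holder_boundD[OF g, of "t+k" t] k by simp
      ultimately show "\<bar>F t * (g (t + k) - g t)\<bar> \<le> A * L powr a * (B * k powr b)"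
        unfolding abs_mult using B by (intro mult_mono) auto
    qed (use pq in \<open>auto intro!: continuous_intros cF cg cg'\<close>)
    then have "\<bar>diff_integral F g k p q\<bar> \<le> (A * L powr a * (B * k powr b)) * L / k"
      using k by (simp add: diff_integral_def L_def divide_right_mono)
    also have "\<dots> = A * B * L powr a * k powr b * (L / k)" by simp
    also have "\<dots> \<le> A * B * L powr a * L powr b * 2"
      using B k ab by (intro mult_mono powr_mono2) (auto simp: field_simps)
    finally show ?thesis using L by (simp add: powr_add mult_ac)
  qed
  have "(A * B / 2 * (q - p) + A * (2 * L) powr a * B * k powr (1 - a)) * k powr (a + b - 1) / r
    \<le> (A * B / 2 * L + A * (2 * L) powr a * B * L powr (1 - a)) * L powr (a + b - 1) / r"
    unfolding L_def[symmetric] using B L k ab r by (intro divide_right_mono mult_mono add_mono powr_mono2) auto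
  also have "\<dots> = A * B * (1 / 2 * L + 2 powr a * (L powr a * L powr (1 - a))) * L powr (a + b - 1) / r"
    using L by (simp add: powr_mult algebra_simps)
  also have "L powr a * L powr (1 - a) = L" using L by (simp add: powr_add[symmetric])
  also have "A * B * (1 / 2 * L + 2 powr a * L) * L powr (a + b - 1) / r
     = A * B * ((1 / 2 + 2 powr a) / r) * (L * L powr (a + b - 1))" by (simp add: algebra_simps add_divide_distrib)
  also have "L * L powr (a + b - 1) = L powr (a + b)" using L by (simp add: powr_diff)
  finally have "\<bar>l'\<bar> \<le> A * B * ((1 / 2 + 2 powr a) / r) * L powr (a + b) + 2 * A * B * L powr (a + b)"
    using e e2 by linarith
  also have "\<dots> = young_const a b * A * B * (q - p) powr (a + b)"
    by (simp add: young_const_def r_def L_def algebra_simps)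
  finally have fin: "\<bar>l'\<bar> \<le> young_const a b * A * B * (q - p) powr (a + b)" .
  have "(\<lambda>j. diff_integral (\<lambda>_. f x) g (k / 2 ^ j) p q) \<longlonglongrightarrow> f x * (g q - g p)"
  proof (rule diff_integral_const[OF g ab(3)])
    show "(\<lambda>j. k / 2 ^ j) \<longlonglongrightarrow> 0" by (rule LIMSEQ_divide_realpow_zero) auto
  qed (use pq k in auto)
  with l' have "(\<lambda>j. diff_integral F g (k / 2 ^ j) p q + diff_integral (\<lambda>_. f x) g (k / 2 ^ j) p q) \<longlonglongrightarrow> l' + f x * (g q - g p)"
    by (rule tendsto_add)
  then have "(\<lambda>j. diff_integral f g (k / 2 ^ j) p q) \<longlonglongrightarrow> l' + f x * (g q - g p)"
    unfolding F_def diff_integral_add_const[OF f ab(1) g ab(3), symmetric] .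
  \<comment> \<open>Since k = h / 2^i, the scales k / 2^j form a tail of the scales h / 2^j.\<close>
  moreover have "(\<lambda>j. diff_integral f g (k / 2 ^ j) p q) \<longlonglongrightarrow> l"
    using LIMSEQ_ignore_initial_segment[OF l, of i] by (simp add: k_def power_add mult.commute)
  ultimately have "l = l' + f x * (g q - g p)" by (metis LIMSEQ_unique)
  then show ?thesis using fin by simp
qed

lemma diff_integral_combine:
  assumes f: "holder_bound A a f" "a > 0" "holder_bound B b g" "b > 0" and "p \<le> m" "m \<le> q"
  shows "diff_integral f g k p m + diff_integral f g k m q = diff_integral f g k p q"
proof -
  have cf: "continuous_on S f" for S using holder_bound_continuous[OF f(1,2)] .
  have cg: "continuous_on S g" for S using holder_bound_continuous[OF f(3,4)] .
  have cg': "continuous_on S (\<lambda>t. g (t + c))" for S c by (rule continuous_on_shift[OF cg])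
  show ?thesis unfolding diff_integral_def add_divide_distrib[symmetric] using assms
    by (subst Henstock_Kurzweil_Integration.integral_combine)
      (auto intro!: integrable_continuous_real continuous_intros cf cg cg')
qed

section \<open>Riemann-Stieltjes sums\<close>

lemma partition_facts:
  assumes "is_partition T N t" "0 < T"
  shows "N \<ge> 1" "\<And>i. i \<in> {1..N} \<Longrightarrow> t (i - 1) < t i \<and> t i - t (i - 1) \<le> mesh N t"
    "i \<le> j \<Longrightarrow> j \<le> N \<Longrightarrow> t i \<le> t j" "0 < mesh N t" "mesh N t \<le> T"
proof -
  show N: "N \<ge> 1" using assms by (cases N) (auto simp: is_partition_def)
  have mono: "t i \<le> t j" if "i \<le> j" "j \<le> N" for i j
    using that
  proof (induction j)
    case (Suc j)
    then have "t j < t (Suc j)" using assms(1) by (auto simp: is_partition_def dest!: bspec[of _ _ "Suc j"])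
    with Suc show ?case by (cases "i = Suc j") auto
  qed auto
  show "i \<le> j \<Longrightarrow> j \<le> N \<Longrightarrow> t i \<le> t j" by (rule mono)
  show st: "t (i - 1) < t i \<and> t i - t (i - 1) \<le> mesh N t" if "i \<in> {1..N}" for i
    using assms that by (auto simp: is_partition_def mesh_def intro!: Max_ge)
  show "0 < mesh N t" using st[of 1] N by auto
  have "t i - t (i - 1) \<le> T" if "i \<in> {1..N}" for i
    using mono[of i N] mono[of 0 "i - 1"] that assms by (auto simp: is_partition_def) linarith
  then show "mesh N t \<le> T" using N by (auto simp: mesh_def)
qed

text \<open>The comparison step of the sewing lemma: the local errors have order length^(1 + d), of
  which length^d is bounded by the mesh and the remaining factor sums to T.\<close>

lemma additive_rs_estimate:
  fixes J :: "real \<Rightarrow> real \<Rightarrow> real"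
  assumes P: "is_partition T N t" "are_tags N t \<xi>" "0 < T" and "mesh N t \<le> h" "C \<ge> 0" "d > 0"
    and add: "\<And>p m q. p \<le> m \<Longrightarrow> m \<le> q \<Longrightarrow> J p m + J m q = J p q"
    and loc: "\<And>p q x. p < q \<Longrightarrow> q - p \<le> h \<Longrightarrow> x \<in> {p..q} \<Longrightarrow> \<bar>J p q - f x * (g q - g p)\<bar> \<le> C * (q - p) powr (1 + d)"
  shows "\<bar>J 0 T - rs_sum f g N t \<xi>\<bar> \<le> C * T * mesh N t powr d"
proof -
  note pf = partition_facts[OF P(1,3)]
  have t0: "t 0 = 0" "t N = T" using P(1) by (auto simp: is_partition_def)
  have J0: "J 0 0 = 0" using add[of 0 0 0] by simp
  have "J 0 (t n) = (\<Sum>i=1..n. J (t (i - 1)) (t i))" if "n \<le> N" for n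
    using that
  proof (induction n)
    case (Suc n)
    then have "J 0 (t n) + J (t n) (t (Suc n)) = J 0 (t (Suc n))"
      using pf(3)[of 0 n] pf(3)[of n "Suc n"] t0 by (intro add) auto
    with Suc show ?case by simp
  qed (simp add: t0 J0)
  from this[of N] have "J 0 T - rs_sum f g N t \<xi> = (\<Sum>i=1..N. J (t (i - 1)) (t i) - f (\<xi> i) * (g (t i) - g (t (i - 1))))"
    using t0 by (simp add: rs_sum_def sum_subtractf)
  also have "\<bar>\<dots>\<bar> \<le> (\<Sum>i=1..N. C * mesh N t powr d * (t i - t (i - 1)))"
  proof (intro order.trans[OF sum_abs sum_mono])
    fix i assume i: "i \<in> {1..N}"
    define D where "D = t i - t (i - 1)"
    have D: "0 < D" "D \<le> mesh N t" using pf(2)[OF i] by (auto simp: D_def)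
    have "\<bar>J (t (i - 1)) (t i) - f (\<xi> i) * (g (t i) - g (t (i - 1)))\<bar> \<le> C * D powr (1 + d)"
      unfolding D_def using pf(2)[OF i] assms(4) P(2) i by (intro loc) (auto simp: are_tags_def)
    also have "D powr (1 + d) = D powr d * D" using D by (simp add: powr_add)
    also have "C * (D powr d * D) \<le> C * (mesh N t powr d * D)"
      using D assms by (intro mult_left_mono mult_right_mono powr_mono2) auto
    finally show "\<bar>J (t (i - 1)) (t i) - f (\<xi> i) * (g (t i) - g (t (i - 1)))\<bar> \<le> C * mesh N t powr d * (t i - t (i - 1))"
      by (simp add: D_def mult.assoc)
  qed
  also have "\<dots> = C * mesh N t powr d * (t N - t 0)"
    unfolding sum_distrib_left[symmetric] using sum_telescope''[of 0 N t] by simp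
  finally show ?thesis by (simp add: t0 mult_ac)
qed

text \<open>\<open>J h\<close> is the limit along h / 2^j. It is additive and locally close to the
  summands on intervals of length at most h, so sums of mesh at most h approximate it. Fine uniform
  partitions serve two scales at once and show that the limit is the same for all h, which upgrades
  convergence along dyadic sequences to convergence as h tends to 0.\<close>

lemma young_integral:
  assumes f: "holder_bound A a f" and g: "holder_bound B b g" and ab: "0 < a" "a \<le> 1" "0 < b" "b \<le> 1" "1 < a + b"
    and M: "\<And>t. \<bar>f t\<bar> \<le> M" and T: "0 < T"
  obtains I C where "C \<ge> 0"
    "\<And>N t \<xi>. is_partition T N t \<Longrightarrow> are_tags N t \<xi> \<Longrightarrow> \<bar>I - rs_sum f g N t \<xi>\<bar> \<le> C * mesh N t powr (a + b - 1)"
    "((\<lambda>h. diff_integral f g h 0 T) \<longlongrightarrow> I) (at_right 0)"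
proof -
  have B: "A \<ge> 0" "B \<ge> 0" using f g holder_bound_nonneg by auto
  define r where "r = 1 - 2 powr (1 - a - b)"
  have r: "0 < r" using ab by (auto simp: r_def intro: powr_less_one)
  define J where "J = (\<lambda>h p q. lim (\<lambda>j. diff_integral f g (h / 2 ^ j) p q))"
  have J: "(\<lambda>j. diff_integral f g (h / 2 ^ j) p q) \<longlonglongrightarrow> J h p q"
     "\<bar>diff_integral f g h p q - J h p q\<bar> \<le>
      (A * B / 2 * (q - p) + M * B * h powr (1 - a)) * h powr (a + b - 1) / r" if hpq: "h > 0" "p \<le> q" for h p q
  proof -
    obtain l where l: "(\<lambda>j. diff_integral f g (h / 2 ^ j) p q) \<longlonglongrightarrow> l"
     "\<bar>diff_integral f g h p q - l\<bar> \<le>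
      (A * B / 2 * (q - p) + M * B * h powr (1 - a)) * h powr (a + b - 1) / r"
      unfolding r_def using diff_integral_halving_limit[OF f g ab(1,2,3,5) hpq(2,1) M] by metis
    have "J h p q = l" unfolding J_def using l(1) by (rule limI)
    with l show "(\<lambda>j. diff_integral f g (h / 2 ^ j) p q) \<longlonglongrightarrow> J h p q"
     "\<bar>diff_integral f g h p q - J h p q\<bar> \<le>
      (A * B / 2 * (q - p) + M * B * h powr (1 - a)) * h powr (a + b - 1) / r" by auto
  qed
  have add: "J h p m + J h m q = J h p q" if "p \<le> m" "m \<le> q" "h > 0" for h p m q
  proof (rule LIMSEQ_unique)
    show "(\<lambda>j. diff_integral f g (h / 2 ^ j) p m + diff_integral f g (h / 2 ^ j) m q) \<longlonglongrightarrow> J h p m + J h m q"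
      using that by (intro tendsto_add J) auto
    show "(\<lambda>j. diff_integral f g (h / 2 ^ j) p m + diff_integral f g (h / 2 ^ j) m q) \<longlonglongrightarrow> J h p q"
      unfolding diff_integral_combine[OF f ab(1) g ab(3) that(1,2)] using that by (intro J) auto
  qed
  define C where "C = young_const a b * A * B"
  have C: "C \<ge> 0" using B young_const_nonneg[OF ab(5)] by (simp add: C_def)
  have est: "\<bar>J h 0 T - rs_sum f g N t \<xi>\<bar> \<le> C * T * mesh N t powr (a + b - 1)"
    if "h > 0" "is_partition T N t" "are_tags N t \<xi>" "mesh N t \<le> h" for h N t \<xi>
  proof (rule additive_rs_estimate[OF that(2,3) T that(4) C])
    fix p q x :: real assume *: "p < q" "q - p \<le> h" "x \<in> {p..q}"
    show "\<bar>J h p q - f x * (g q - g p)\<bar> \<le> C * (q - p) powr (1 + (a + b - 1))"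
      using diff_integral_local_estimate[OF f g ab * J(1)] * that(1) by (simp add: C_def)
  qed (use ab add that in auto)
  have eq: "J h 0 T = J T 0 T" if "h > 0" for h
  proof -
    have "(\<lambda>n. 2 * (C * T * (T / real (Suc n)) powr (a + b - 1))) \<longlonglongrightarrow> 2 * (C * T * 0)"
    proof (intro tendsto_mult tendsto_const tendsto_zero_powrI)
      show "(\<lambda>n. T / real (Suc n)) \<longlonglongrightarrow> 0" by (rule LIMSEQ_Suc[OF lim_const_over_n])
      show "\<forall>\<^sub>F n in sequentially. 0 \<le> T / real (Suc n)" using T by (auto intro!: always_eventually)
    qed (use ab in auto)
    moreover have "\<forall>\<^sub>F n in sequentially. T / real (Suc n) < h"
      using order_tendstoD(2)[OF LIMSEQ_Suc[OF lim_const_over_n] that] .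
    then have "\<forall>\<^sub>F n in sequentially. \<bar>J h 0 T - J T 0 T\<bar> \<le> 2 * (C * T * (T / real (Suc n)) powr (a + b - 1))"
    proof eventually_elim
      case (elim n)
      define N where "N = Suc n"
      define t where "t = (\<lambda>i. real i * (T / real N))"
      have tN: "t i - t (i - 1) = T / real N" if "i \<in> {1..N}" for i
        using that by (cases i) (auto simp: t_def field_simps)
      have P: "is_partition T N t" unfolding is_partition_def
      proof (intro conjI ballI)
        fix i assume i: "i \<in> {1..N}"
        have "0 < T / real N" using T by (simp add: N_def)
        with tN[OF i] show "t (i - 1) < t i" by linarith
      qed (auto simp: t_def N_def)
      have "mesh N t = Max ((\<lambda>i. T / real N) ` {1..N})" unfolding mesh_def using tN by (intro arg_cong[of _ _ Max] image_cong) auto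
      also have "(\<lambda>i. T / real N) ` {1..N} = {T / real N}" by (auto simp: N_def image_iff intro!: bexI[of _ 1])
      finally have m: "mesh N t = T / real N" by simp
      have tg: "are_tags N t t" using P by (auto simp: are_tags_def is_partition_def less_imp_le)
      have "mesh N t \<le> h" "mesh N t \<le> T" unfolding m using elim partition_facts(5)[OF P T, unfolded m] by (simp_all add: N_def)
      from est[OF that P tg this(1)] est[OF T P tg this(2)] show ?case unfolding m unfolding N_def by linarith
    qed
    ultimately have "\<bar>J h 0 T - J T 0 T\<bar> \<le> 2 * (C * T * 0)"
      by (rule tendsto_lowerbound) simp
    then show ?thesis by simp
  qed
  show ?thesis
  proof (rule that[of "C * T" "J T 0 T"])
    show "\<bar>J T 0 T - rs_sum f g N t \<xi>\<bar> \<le> C * T * mesh N t powr (a + b - 1)"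
      if "is_partition T N t" "are_tags N t \<xi>" for N t \<xi>
      using est[OF T that partition_facts(5)[OF that(1) T]] .
    have id: "((\<lambda>h::real. h) \<longlongrightarrow> 0) (at_right 0)" by (rule tendsto_ident_at)
    have ev: "\<forall>\<^sub>F h in at_right (0::real). h > 0" by (auto simp: eventually_at_filter)
    have h0: "((\<lambda>h. h powr e) \<longlongrightarrow> 0) (at_right 0)" if "e > 0" for e :: real
      by (rule tendsto_zero_powrI[OF id tendsto_const _ that]) (use ev in \<open>auto elim: eventually_mono\<close>)
    have e: "((\<lambda>h. (A * B / 2 * T * h powr (a + b - 1) + M * B * h powr b) / r) \<longlongrightarrow> (A * B / 2 * T * 0 + M * B * 0) / r) (at_right 0)"
      using ab r by (intro tendsto_intros h0) auto
    have "((\<lambda>h. diff_integral f g h 0 T - J T 0 T) \<longlongrightarrow> 0) (at_right 0)"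
    proof (rule Lim_null_comparison)
      show "((\<lambda>h. (A * B / 2 * T * h powr (a + b - 1) + M * B * h powr b) / r) \<longlongrightarrow> 0) (at_right 0)" using e by simp
      show "\<forall>\<^sub>F h in at_right 0. norm (diff_integral f g h 0 T - J T 0 T) \<le> (A * B / 2 * T * h powr (a + b - 1) + M * B * h powr b) / r"
        using ev
      proof eventually_elim
        case (elim h)
        have "h powr (1 - a) * h powr (a + b - 1) = h powr b" by (simp add: powr_add[symmetric])
        then show ?case using J(2)[OF elim, of 0 T] T eq[OF elim] by (simp add: distrib_right mult.assoc)
      qed
    qed
    then show "((\<lambda>h. diff_integral f g h 0 T) \<longlongrightarrow> J T 0 T) (at_right 0)" by (simp add: LIM_zero_iff)
  qed (use C T in auto)
qed

section \<open>Mean oscillation and approximate limits\<close>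

lemma measure_ball_cart: "r \<ge> 0 \<Longrightarrow> measure lborel (ball (x :: real ^ 'n) r) = unit_ball_vol (real CARD('n)) * r ^ CARD('n)"
  by (simp add: measure_def emeasure_ball)

context variation_dominated
begin

text \<open>With z = y + h the double integral becomes an integral of translation errors over shifts
  shorter than 2 r. The translation estimate enlarges the radius by 2 norm h, from r to at most 5 r,
  which is the origin of the factor 5.\<close>

lemma double_oscillation:
  assumes r: "r > 0"
  shows "(\<integral>\<^sup>+y. indicator (ball x r) y * (\<integral>\<^sup>+z. indicator (ball x r) z * ennreal \<bar>f z - f y\<bar> \<partial>lborel) \<partial>lborel)
    \<le> ennreal (unit_ball_vol (real CARD('n)) * (2 * r) ^ CARD('n) * (real CARD('n) * (2 * r))) * emeasure M (ball x (5 * r))"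
proof -
  let ?B = "ball x r" and ?n = "real CARD('n)"
  have [measurable]: "?B \<in> sets borel" "ball (0::real^'n) (2 * r) \<in> sets borel" by simp_all
  have "(\<integral>\<^sup>+y. indicator ?B y * (\<integral>\<^sup>+z. indicator ?B z * ennreal \<bar>f z - f y\<bar> \<partial>lborel) \<partial>lborel) \<le>
     (\<integral>\<^sup>+y. (\<integral>\<^sup>+h. indicator ?B y * (indicator (ball 0 (2 * r)) h * ennreal \<bar>f (y + h) - f y\<bar>) \<partial>lborel) \<partial>lborel)"
  proof (rule nn_integral_mono)
    fix y
    show "indicator ?B y * (\<integral>\<^sup>+z. indicator ?B z * ennreal \<bar>f z - f y\<bar> \<partial>lborel) \<le>
      (\<integral>\<^sup>+h. indicator ?B y * (indicator (ball 0 (2 * r)) h * ennreal \<bar>f (y + h) - f y\<bar>) \<partial>lborel)"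
    proof (cases "y \<in> ?B")
      case True
      have "(\<integral>\<^sup>+z. indicator ?B z * ennreal \<bar>f z - f y\<bar> \<partial>lborel) = (\<integral>\<^sup>+h. indicator ?B (h + y) * ennreal \<bar>f (h + y) - f y\<bar> \<partial>lborel)"
        by (rule lborel_nn_integral_shift[symmetric]) measurable
      also have "\<dots> \<le> (\<integral>\<^sup>+h. indicator (ball 0 (2 * r)) h * ennreal \<bar>f (y + h) - f y\<bar> \<partial>lborel)"
      proof (rule nn_integral_mono)
        fix h
        have "norm h < 2 * r" if "h + y \<in> ?B"
        proof -
          have "norm h \<le> norm (h + y - x) + norm (y - x)" using norm_triangle_ineq4[of "h + y - x" "y - x"] by simp
          then show ?thesis using that True by (simp add: dist_norm norm_minus_commute)
        qed
        then show "indicator ?B (h + y) * ennreal \<bar>f (h + y) - f y\<bar> \<le> indicator (ball 0 (2 * r)) h * ennreal \<bar>f (y + h) - f y\<bar>"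
          by (auto simp: indicator_def add.commute)
      qed
      finally show ?thesis using True by simp
    qed simp
  qed
  also have "\<dots> = (\<integral>\<^sup>+h. (\<integral>\<^sup>+y. indicator ?B y * (indicator (ball 0 (2 * r)) h * ennreal \<bar>f (y + h) - f y\<bar>) \<partial>lborel) \<partial>lborel)"
    by (rule lborel_pair.Fubini'[symmetric]) measurable
  also have "\<dots> \<le> (\<integral>\<^sup>+h. (ennreal (?n * (2 * r)) * emeasure M (ball x (5 * r))) * indicator (ball (0::real^'n) (2 * r)) h \<partial>lborel)"
  proof (rule nn_integral_mono)
    fix h :: "real ^ 'n"
    show "(\<integral>\<^sup>+y. indicator ?B y * (indicator (ball 0 (2 * r)) h * ennreal \<bar>f (y + h) - f y\<bar>) \<partial>lborel) \<le>
      (ennreal (?n * (2 * r)) * emeasure M (ball x (5 * r))) * indicator (ball 0 (2 * r)) h"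
    proof (cases "h \<in> ball 0 (2 * r) \<and> h \<noteq> 0")
      case True
      have "(\<integral>\<^sup>+y. indicator ?B y * ennreal \<bar>f (y + h) - f y\<bar> \<partial>lborel) \<le> ennreal (?n * norm h) * emeasure M (ball x (r + 2 * norm h))"
        by (rule translation_estimate) (use True in auto)
      also have "\<dots> \<le> ennreal (?n * (2 * r)) * emeasure M (ball x (5 * r))"
      proof (intro mult_mono)
        show "ennreal (?n * norm h) \<le> ennreal (?n * (2 * r))" using True by (intro ennreal_leI mult_left_mono) auto
        have "ball x (r + 2 * norm h) \<subseteq> ball x (5 * r)" using True by (intro subset_ball) simp
        then show "emeasure M (ball x (r + 2 * norm h)) \<le> emeasure M (ball x (5 * r))"
          by (rule emeasure_mono) (simp add: sets_M)
      qed auto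
      finally show ?thesis using True by simp
    next
      case False
      then show ?thesis by (auto simp: indicator_def)
    qed
  qed
  also have "\<dots> = (ennreal (?n * (2 * r)) * emeasure M (ball x (5 * r))) * emeasure lborel (ball (0::real^'n) (2 * r))"
    by (rule nn_integral_cmult_indicator) simp
  also have "emeasure lborel (ball (0::real^'n) (2 * r)) = ennreal (unit_ball_vol ?n * (2 * r) ^ CARD('n))"
    using r by (simp add: emeasure_ball)
  finally show ?thesis using r by (simp add: ennreal_mult'' mult_ac)
qed

text \<open>The exponent of the kernel is negative, so on the ball of radius 5 r it is at least (5
  r)^(1 - n - s); at the centre it is infinite by definition.\<close>

lemma ball_measure_le_potential:
  assumes r: "r > 0" and s: "s > 0" and U: "open U" "ball x (5 * r) \<subseteq> U"
  shows "emeasure M (ball x (5 * r)) \<le> ennreal ((5 * r) powr (real CARD('n) - 1 + s)) * (\<integral>\<^sup>+z\<in>U. variability_kernel s x z \<partial>M)"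
proof -
  let ?e = "- real CARD('n) + 1 - s"
  have "real CARD('n) \<ge> 1" by (simp add: Suc_leI)
  then have "?e \<le> 0" using s by linarith
  have "ennreal ((5 * r) powr ?e) * emeasure M (ball x (5 * r)) = (\<integral>\<^sup>+z. ennreal ((5 * r) powr ?e) * indicator (ball x (5 * r)) z \<partial>M)"
    by (rule nn_integral_cmult_indicator[symmetric]) (simp add: sets_M)
  also have "\<dots> \<le> (\<integral>\<^sup>+z\<in>U. variability_kernel s x z \<partial>M)"
  proof (rule nn_integral_mono)
    fix z
    show "ennreal ((5 * r) powr ?e) * indicator (ball x (5 * r)) z \<le> variability_kernel s x z * indicator U z"
    proof (cases "z \<in> ball x (5 * r)")
      case True
      then have "z \<in> U" using U by auto
      moreover have "ennreal ((5 * r) powr ?e) \<le> variability_kernel s x z"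
      proof (cases "z = x")
        case False
        have "(5 * r) powr ?e \<le> norm (x - z) powr ?e"
          using True False \<open>?e \<le> 0\<close> by (intro powr_mono2') (auto simp: dist_norm)
        then show ?thesis using False by (simp add: variability_kernel_def ennreal_leI)
      qed (simp add: variability_kernel_def)
      ultimately show ?thesis using True by simp
    qed simp
  qed
  finally have *: "ennreal ((5 * r) powr ?e) * emeasure M (ball x (5 * r)) \<le> (\<integral>\<^sup>+z\<in>U. variability_kernel s x z \<partial>M)" .
  have "(5 * r) powr (real CARD('n) - 1 + s) * (5 * r) powr ?e = 1" using r by (simp add: powr_add[symmetric])
  then have "ennreal ((5 * r) powr (real CARD('n) - 1 + s)) * (ennreal ((5 * r) powr ?e) * emeasure M (ball x (5 * r))) = emeasure M (ball x (5 * r))"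
    by (simp add: mult.assoc[symmetric] ennreal_mult''[symmetric])
  then show ?thesis using mult_left_mono[OF *, of "ennreal ((5 * r) powr (real CARD('n) - 1 + s))"] by simp
qed

text \<open>Left undivided by the volume, so that it is monotone in the ball; the volume r^n is
  carried in the exponent n + s of the bounds.\<close>

definition osc :: "real ^ 'n \<Rightarrow> real \<Rightarrow> real \<Rightarrow> real" where
  "osc x r c = (LINT y|lborel. indicat_real (ball x r) y * \<bar>f y - c\<bar>)"

lemma f_ball_integrable: "integrable lborel (\<lambda>y. indicat_real (ball x r) y * f y)"
proof (rule Bochner_Integration.integrable_bound[OF f_local[of x r]])
  have [measurable]: "ball x r \<in> sets borel" by simp
  show "(\<lambda>y. indicat_real (ball x r) y * f y) \<in> borel_measurable lborel" by measurable
qed (auto simp: indicator_def)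

lemma ball_integrable: "integrable lborel (indicat_real (ball (x::real^'n) r))"
  using emeasure_lborel_ball_finite[of x r] by (auto intro!: integrable_real_indicator)

lemma osc_integrable: "integrable lborel (\<lambda>y. indicat_real (ball x r) y * \<bar>f y - c\<bar>)"
proof -
  have "integrable lborel (\<lambda>y. \<bar>indicat_real (ball x r) y * f y - c * indicat_real (ball x r) y\<bar>)"
    by (intro integrable_abs Bochner_Integration.integrable_diff integrable_mult_right f_ball_integrable ball_integrable)
  also have "(\<lambda>y. \<bar>indicat_real (ball x r) y * f y - c * indicat_real (ball x r) y\<bar>) = (\<lambda>y. indicat_real (ball x r) y * \<bar>f y - c\<bar>)"
    by (auto simp: indicator_def)
  finally show ?thesis .
qed

lemma osc_nn: "(\<integral>\<^sup>+y. indicator (ball x r) y * ennreal \<bar>f y - c\<bar> \<partial>lborel) = ennreal (osc x r c)"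
proof -
  have "(\<integral>\<^sup>+y. indicator (ball x r) y * ennreal \<bar>f y - c\<bar> \<partial>lborel) = (\<integral>\<^sup>+y. ennreal (indicat_real (ball x r) y * \<bar>f y - c\<bar>) \<partial>lborel)"
    by (intro nn_integral_cong) (auto simp: indicator_def)
  also have "\<dots> = ennreal (osc x r c)" unfolding osc_def by (intro nn_integral_eq_integral osc_integrable) auto
  finally show ?thesis .
qed

lemma osc_mono: "ball x r \<subseteq> ball y r' \<Longrightarrow> osc x r c \<le> osc y r' c"
  unfolding osc_def by (rule integral_mono[OF osc_integrable osc_integrable]) (auto simp: indicator_def)

lemma osc_nonneg: "0 \<le> osc x r c"
  unfolding osc_def by (auto intro!: integral_nonneg_AE)

lemma osc_triangle:
  assumes "r \<ge> 0" shows "unit_ball_vol (real CARD('n)) * r ^ CARD('n) * \<bar>c - d\<bar> \<le> osc x r c + osc x r d"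
proof -
  have "unit_ball_vol (real CARD('n)) * r ^ CARD('n) * \<bar>c - d\<bar> = (LINT y|lborel. \<bar>c - d\<bar> * indicat_real (ball x r) y)"
    using assms by (simp add: measure_ball_cart)
  also have "\<dots> \<le> (LINT y|lborel. indicat_real (ball x r) y * \<bar>f y - c\<bar> + indicat_real (ball x r) y * \<bar>f y - d\<bar>)"
    by (rule integral_mono[OF integrable_mult_right[OF ball_integrable] Bochner_Integration.integrable_add[OF osc_integrable osc_integrable]])
      (auto simp: indicator_def)
  also have "\<dots> = osc x r c + osc x r d" unfolding osc_def by (rule Bochner_Integration.integral_add[OF osc_integrable osc_integrable])
  finally show ?thesis .
qed

lemma osc_change:
  assumes "r \<ge> 0" shows "osc x r d \<le> osc x r c + unit_ball_vol (real CARD('n)) * r ^ CARD('n) * \<bar>c - d\<bar>"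
proof -
  have "osc x r d \<le> (LINT y|lborel. indicat_real (ball x r) y * \<bar>f y - c\<bar> + \<bar>c - d\<bar> * indicat_real (ball x r) y)"
    unfolding osc_def
    by (rule integral_mono[OF osc_integrable Bochner_Integration.integrable_add[OF osc_integrable integrable_mult_right[OF ball_integrable]]])
      (auto simp: indicator_def)
  also have "\<dots> = osc x r c + (LINT y|lborel. \<bar>c - d\<bar> * indicat_real (ball x r) y)"
    unfolding osc_def by (rule Bochner_Integration.integral_add[OF osc_integrable integrable_mult_right[OF ball_integrable]])
  finally show ?thesis using assms by (simp add: measure_ball_cart mult_ac)
qed

text \<open>2^n is the volume ratio of the ball of shifts to the ball itself, 2 n comes from the
  translation estimate with shifts below 2 r, and the power of 5 from the potential bound at radius
  5 r.\<close>

definition osc_const :: "real \<Rightarrow> real" where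
  "osc_const s = 2 ^ CARD('n) * (real CARD('n) * 2) * 5 powr (real CARD('n) - 1 + s)"

text \<open>The witness is the mean of f over the ball: its oscillation is at most the double
  oscillation divided by the volume. The shift length r times the variation, of order r^(n - 1 + s),
  gives the exponent.\<close>

lemma mean_oscillation:
  assumes r: "r > 0" and s: "s > 0" and U: "open U" "ball x (5 * r) \<subseteq> U"
    and V: "(\<integral>\<^sup>+z\<in>U. variability_kernel s x z \<partial>M) = ennreal v" "v \<ge> 0"
  shows "\<exists>a. osc x r a \<le> osc_const s * v * r powr (real CARD('n) + s)"
proof -
  let ?B = "ball x r" and ?n = "real CARD('n)"
  have [measurable]: "?B \<in> sets borel" by simp
  define w where "w = unit_ball_vol ?n * r ^ CARD('n)"
  have w: "w > 0" using r by (simp add: w_def)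
  have mB: "measure lborel ?B = w" using r by (simp add: w_def measure_ball_cart)
  define a where "a = (LINT z|lborel. indicat_real ?B z * f z) / w"
  have pt: "ennreal \<bar>f y - a\<bar> \<le> ennreal (1 / w) * (\<integral>\<^sup>+z. indicator ?B z * ennreal \<bar>f z - f y\<bar> \<partial>lborel)" for y
  proof -
    have "w * (f y - a) = f y * (LINT z|lborel. indicat_real ?B z) - (LINT z|lborel. indicat_real ?B z * f z)"
      using w by (simp add: a_def mB algebra_simps)
    also have "\<dots> = (LINT z|lborel. f y * indicat_real ?B z - indicat_real ?B z * f z)"
      by (subst Bochner_Integration.integral_diff[OF integrable_mult_right[OF ball_integrable] f_ball_integrable]) simp
    finally have eq: "w * (f y - a) = (LINT z|lborel. f y * indicat_real ?B z - indicat_real ?B z * f z)" .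
    have "ennreal (norm (w * (f y - a))) \<le> (\<integral>\<^sup>+z. ennreal (norm (f y * indicat_real ?B z - indicat_real ?B z * f z)) \<partial>lborel)"
      unfolding eq by (rule integral_norm_bound_ennreal[OF Bochner_Integration.integrable_diff[OF integrable_mult_right[OF ball_integrable] f_ball_integrable]])
    also have "\<dots> = (\<integral>\<^sup>+z. indicator ?B z * ennreal \<bar>f z - f y\<bar> \<partial>lborel)"
      by (intro nn_integral_cong) (auto simp: indicator_def abs_minus_commute)
    finally have "ennreal (1 / w) * ennreal (norm (w * (f y - a))) \<le> ennreal (1 / w) * (\<integral>\<^sup>+z. indicator ?B z * ennreal \<bar>f z - f y\<bar> \<partial>lborel)"
      by (rule mult_left_mono) simp
    moreover have "ennreal (1 / w) * ennreal (norm (w * (f y - a))) = ennreal \<bar>f y - a\<bar>"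
      using w by (simp add: ennreal_mult''[symmetric] abs_mult)
    ultimately show ?thesis by simp
  qed
  have "ennreal (osc x r a) \<le> (\<integral>\<^sup>+y. ennreal (1 / w) * (indicator ?B y * (\<integral>\<^sup>+z. indicator ?B z * ennreal \<bar>f z - f y\<bar> \<partial>lborel)) \<partial>lborel)"
    unfolding osc_nn[symmetric]
  proof (rule nn_integral_mono)
    fix y
    show "indicator ?B y * ennreal \<bar>f y - a\<bar> \<le> ennreal (1 / w) * (indicator ?B y * (\<integral>\<^sup>+z. indicator ?B z * ennreal \<bar>f z - f y\<bar> \<partial>lborel))"
      using pt[of y] by (auto simp: indicator_def)
  qed
  also have "\<dots> = ennreal (1 / w) * (\<integral>\<^sup>+y. indicator ?B y * (\<integral>\<^sup>+z. indicator ?B z * ennreal \<bar>f z - f y\<bar> \<partial>lborel) \<partial>lborel)"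
    by (rule nn_integral_cmult) measurable
  also have "\<dots> \<le> ennreal (1 / w) * (ennreal (unit_ball_vol ?n * (2 * r) ^ CARD('n) * (?n * (2 * r))) * (ennreal ((5 * r) powr (?n - 1 + s)) * ennreal v))"
    using ball_measure_le_potential[OF r s U] unfolding V(1)
    by (intro mult_left_mono order.trans[OF double_oscillation[OF r]]) auto
  also have "\<dots> = ennreal ((1 / w) * (unit_ball_vol ?n * (2 * r) ^ CARD('n) * (?n * (2 * r)) * ((5 * r) powr (?n - 1 + s) * v)))"
  proof -
    have "ennreal a * (ennreal b * (ennreal c * ennreal d)) = ennreal (a * (b * (c * d)))"
      if "b \<ge> 0" "c \<ge> 0" "d \<ge> 0" for a b c d :: real using that by (simp add: ennreal_mult'')
    then show ?thesis using r V by simp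
  qed
  also have "(1 / w) * (unit_ball_vol ?n * (2 * r) ^ CARD('n) * (?n * (2 * r)) * ((5 * r) powr (?n - 1 + s) * v))
    = osc_const s * v * (r * r powr (?n - 1 + s))"
  proof -
    have "unit_ball_vol ?n > 0" by simp
    then have "unit_ball_vol ?n \<noteq> 0" by (metis less_irrefl)
    with r show ?thesis by (simp add: w_def osc_const_def powr_mult power_mult_distrib)
  qed
  also have "r * r powr (?n - 1 + s) = r powr (?n + s)" using r by (simp add: powr_add powr_diff)
  finally have "osc x r a \<le> osc_const s * v * r powr (?n + s)"
    using V by (subst (asm) ennreal_le_iff) (auto simp: osc_const_def)
  then show ?thesis by blast
qed

section \<open>Campanato's argument\<close>

definition campanato_const :: "real \<Rightarrow> real" where
  "campanato_const s = (1 + 2 ^ Suc CARD('n) / (1 - 2 powr (- s))) * 2 powr (real CARD('n) + s)"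

text \<open>Constants chosen on consecutive dyadic balls differ by a multiple of radius^s, so they
  converge geometrically, and the limit serves every ball. In the constant, 2^(n + 1) stands for two
  oscillations over the volume of a ball of half the radius, 1 - 2^(- s) for the geometric sum, and
  2^(n + s) for enclosing an arbitrary ball in a dyadic one of at most twice its radius.\<close>

lemma campanato:
  assumes s: "s > 0" and D: "D \<ge> 0" and r0: "r0 > 0"
    and a: "\<And>r. 0 < r \<Longrightarrow> r \<le> r0 \<Longrightarrow> \<exists>a. osc x r a \<le> D * r powr (real CARD('n) + s)"
  shows "\<exists>l. \<forall>r. 0 < r \<and> r \<le> r0 \<longrightarrow> osc x r l \<le> campanato_const s * D * r powr (real CARD('n) + s)"
proof -
  let ?n = "real CARD('n)" and ?N = "CARD('n)"
  define ub where "ub = unit_ball_vol ?n"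
  have ub: "ub > 0" by (simp add: ub_def)
  define R where "R = (\<lambda>j::nat. r0 / 2 ^ j)"
  have R: "R j > 0" "R (Suc j) = R j / 2" "R j \<le> r0" for j
    using r0 one_le_power[of "2::real" j] by (auto simp: R_def field_simps)
  have "\<forall>j. \<exists>a. osc x (R j) a \<le> D * R j powr (?n + s)" using a R by blast
  then obtain b where b: "\<And>j. osc x (R j) (b j) \<le> D * R j powr (?n + s)" by metis
  define q where "q = (2::real) powr (- s)"
  have q: "0 \<le> q" "q < 1" using s by (auto simp: q_def intro: powr_less_one)
  have Rs: "R j powr s = r0 powr s * q ^ j" for j
  proof -
    have "R j powr s = r0 powr s / (2 ^ j) powr s" using r0 by (simp add: R_def powr_divide)
    also have "(2 ^ j :: real) powr s = (2 powr s) ^ j" by (simp add: powr_realpow[symmetric] powr_powr mult.commute)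
    finally show ?thesis by (simp add: q_def powr_minus power_inverse divide_inverse)
  qed
  have Rn: "R j powr (?n + s) = R j ^ ?N * R j powr s" for j
    using R(1)[of j] by (simp add: powr_add powr_realpow)
  define c where "c = 2 ^ Suc ?N * D / ub * r0 powr s"
  have step: "\<bar>b j - b (Suc j)\<bar> \<le> c * q ^ j" for j
  proof -
    have "ub * R (Suc j) ^ ?N * \<bar>b j - b (Suc j)\<bar> \<le> osc x (R (Suc j)) (b j) + osc x (R (Suc j)) (b (Suc j))"
      unfolding ub_def using R(1)[of "Suc j"] by (intro osc_triangle) simp
    also have "\<dots> \<le> D * R j powr (?n + s) + D * R j powr (?n + s)"
    proof (rule add_mono)
      show "osc x (R (Suc j)) (b j) \<le> D * R j powr (?n + s)"
        by (rule order.trans[OF osc_mono b[of j]]) (use R[of j] in \<open>auto intro!: subset_ball\<close>)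
      show "osc x (R (Suc j)) (b (Suc j)) \<le> D * R j powr (?n + s)"
        using R(1)[of j] R(1)[of "Suc j"] R(2)[of j] D s by (intro order.trans[OF b[of "Suc j"]] mult_left_mono powr_mono2) auto
    qed
    finally have "\<bar>b j - b (Suc j)\<bar> \<le> 2 * (D * R j powr (?n + s)) / (ub * R (Suc j) ^ ?N)"
      using ub R(1)[of "Suc j"] by (simp add: pos_le_divide_eq mult.commute)
    also have "\<dots> = c * q ^ j"
      using ub R(1)[of j] unfolding Rn by (simp add: c_def R(2) Rs power_divide)
    finally show ?thesis .
  qed
  obtain l where l: "\<And>j. \<bar>b j - l\<bar> \<le> c * q ^ j / (1 - q)" using geometric_limit[OF step q] by blast
  define K where "K = 1 + 2 ^ Suc ?N / (1 - q)"
  have K: "K \<ge> 0" using q by (auto simp: K_def intro!: add_nonneg_nonneg)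
  have dy: "osc x (R j) l \<le> K * D * R j powr (?n + s)" for j
  proof -
    have "osc x (R j) l \<le> osc x (R j) (b j) + ub * R j ^ ?N * \<bar>b j - l\<bar>"
      unfolding ub_def using R(1)[of j] by (intro osc_change) simp
    also have "\<dots> \<le> D * R j powr (?n + s) + ub * R j ^ ?N * (c * q ^ j / (1 - q))"
      using ub R(1)[of j] by (intro add_mono b mult_left_mono l) auto
    also have "ub * R j ^ ?N * (c * q ^ j / (1 - q)) = 2 ^ Suc ?N / (1 - q) * D * (R j ^ ?N * R j powr s)"
      using ub by (simp add: c_def Rs)
    finally show ?thesis unfolding Rn by (simp add: K_def algebra_simps)
  qed
  have "osc x r l \<le> campanato_const s * D * r powr (?n + s)" if r: "0 < r" "r \<le> r0" for r
  proof -
    obtain i where i: "r0 / 2 ^ i \<le> r" "r \<le> 2 * (r0 / 2 ^ i)" by (rule dyadic_scale[OF r])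
    \<comment> \<open>The dyadic radius obtained so far is at most r; the one before it is at least
      r, unless the index is 0, where r = r0.\<close>
    obtain j where j: "r \<le> R j" "R j \<le> 2 * r"
    proof (cases i)
      case 0
      then show ?thesis using that[of 0] i r by (simp add: R_def)
    next
      case (Suc k)
      then show ?thesis using that[of k] i by (simp add: R_def)
    qed
    have "osc x r l \<le> osc x (R j) l" using j by (intro osc_mono subset_ball)
    also have "\<dots> \<le> K * D * R j powr (?n + s)" by (rule dy)
    also have "\<dots> \<le> K * D * (2 * r) powr (?n + s)" using j R(1)[of j] K D s by (intro mult_left_mono powr_mono2) auto
    finally show ?thesis using r by (simp add: campanato_const_def K_def q_def powr_mult mult_ac)
  qed
  then show ?thesis by blast
qed

text \<open>The ball of radius d about x lies in the ball of radius 2 d about y, so both constants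
  approximate f on it; dividing by its volume leaves d^s.\<close>

lemma osc_compare:
  assumes s: "s > 0" and d: "d = dist x y" "0 < d" "2 * d \<le> r0"
    and x: "osc x d a \<le> A * d powr (real CARD('n) + s)" and y: "osc y (2 * d) b \<le> B * (2 * d) powr (real CARD('n) + s)"
    and AB: "A \<ge> 0"
  shows "\<bar>a - b\<bar> \<le> 2 powr (real CARD('n) + s) / unit_ball_vol (real CARD('n)) * (A + B) * d powr s"
proof -
  let ?n = "real CARD('n)" and ?N = "CARD('n)"
  define ub where "ub = unit_ball_vol ?n"
  have ub: "ub > 0" by (simp add: ub_def)
  have "ub * d ^ ?N * \<bar>a - b\<bar> \<le> osc x d a + osc x d b"
    unfolding ub_def using d by (intro osc_triangle) simp
  also have "osc x d b \<le> osc y (2 * d) b"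
  proof (rule osc_mono)
    show "ball x d \<subseteq> ball y (2 * d)"
    proof
      fix z assume "z \<in> ball x d"
      then show "z \<in> ball y (2 * d)" using dist_triangle[of y z x] d by (simp add: dist_commute)
    qed
  qed
  also have "osc x d a + osc y (2 * d) b \<le> A * d powr (?n + s) + B * (2 * d) powr (?n + s)" using x y by (rule add_mono)
  also have "\<dots> \<le> 2 powr (?n + s) * A * d powr (?n + s) + B * (2 * d) powr (?n + s)"
    using AB s by (intro add_right_mono mult_right_mono) (auto intro!: mult_le_cancel_right1[THEN iffD2] simp: ge_one_powr_ge_zero)
  also have "\<dots> = 2 powr (?n + s) * (A + B) * (d ^ ?N * d powr s)"
    using d by (simp add: powr_mult powr_add powr_realpow algebra_simps)
  finally have "ub * \<bar>a - b\<bar> * d ^ ?N \<le> (2 powr (?n + s) * (A + B) * d powr s) * d ^ ?N" by (simp add: mult_ac)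
  then have "ub * \<bar>a - b\<bar> \<le> 2 powr (?n + s) * (A + B) * d powr s" using d by (simp add: mult_le_cancel_right)
  then show ?thesis using ub by (simp add: ub_def field_simps)
qed

end

section \<open>From pointwise inequalities to Hoelder continuity\<close>

text \<open>The chain approaches t through points within h / 2^k whose weights are controlled at
  that scale, so its increments have order (h / 2^k)^(a - q) and can be summed. The weight at t is
  only a fixed number: it occurs multiplied by (h / 2^k)^a when the limit along the chain is
  identified as f t, and not in the bound.\<close>

lemma hajlasz_chain:
  fixes f v :: "real \<Rightarrow> real"
  assumes haj: "\<And>x y. x \<in> G \<Longrightarrow> y \<in> G \<Longrightarrow> \<bar>x - y\<bar> \<le> 2 * h \<Longrightarrow> \<bar>f x - f y\<bar> \<le> C * \<bar>x - y\<bar> powr a * (v x + v y)"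
    and v: "\<And>x. x \<in> G \<Longrightarrow> 0 \<le> v x"
    and C: "0 \<le> C" "0 \<le> K" and q: "0 \<le> q" "q < a" and h: "0 < h"
    and good: "\<And>k::nat. \<exists>y\<in>G. \<bar>y - t\<bar> \<le> h / 2 ^ k \<and> v y \<le> K * (h / 2 ^ k) powr (- q)"
    and t: "t \<in> G" and y0: "y0 \<in> G" "\<bar>y0 - t\<bar> \<le> h" "v y0 \<le> K * h powr (- q)"
  shows "\<bar>f y0 - f t\<bar> \<le> C * K * 2 powr a * (1 + 2 powr q) / (1 - 2 powr (q - a)) * h powr (a - q)"
proof -
  define H where "H = (\<lambda>k::nat. h / 2 ^ k)"
  have H: "H k > 0" "H (Suc k) = H k / 2" for k using h by (auto simp: H_def)
  have Hh: "H k \<le> h" for k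
    using h one_le_power[of "2::real" k] by (auto simp: H_def field_simps)
  obtain y' where y': "\<And>k. y' k \<in> G \<and> \<bar>y' k - t\<bar> \<le> H k \<and> v (y' k) \<le> K * H k powr (- q)"
    using good unfolding H_def Bex_def by metis
  \<comment> \<open>The starting point is prescribed, so that chains towards two different points
    can share it.\<close>
  define y where "y = y'(0 := y0)"
  have y: "\<And>k. y k \<in> G" "\<And>k. \<bar>y k - t\<bar> \<le> H k" "\<And>k. v (y k) \<le> K * H k powr (- q)" and y00: "y 0 = y0"
    using y' y0 by (auto simp: y_def H_def)
  define r where "r = (2::real) powr (q - a)"
  have r: "0 \<le> r" "r < 1" using q by (auto simp: r_def intro: powr_less_one)
  define c where "c = C * K * 2 powr a * (1 + 2 powr q) * h powr (a - q)"
  have Hk: "H k powr (a - q) = h powr (a - q) * r ^ k" for k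
  proof -
    have "H k powr (a - q) = h powr (a - q) / (2 ^ k) powr (a - q)" using h by (simp add: H_def powr_divide)
    also have "(2 ^ k :: real) powr (a - q) = (2 powr (a - q)) ^ k"
      by (simp add: powr_realpow[symmetric] powr_powr mult.commute)
    also have "h powr (a - q) / \<dots> = h powr (a - q) * r ^ k"
      using powr_minus[of 2 "a - q"] by (simp add: r_def power_inverse divide_inverse)
    finally show ?thesis .
  qed
  have "\<bar>f (y k) - f (y (Suc k))\<bar> \<le> c * r ^ k" for k
  proof -
    have d: "\<bar>y k - y (Suc k)\<bar> \<le> 2 * H k" using y(2)[of k] y(2)[of "Suc k"] H[of k] by linarith
    have "v (y (Suc k)) \<le> K * (2 powr q * H k powr (- q))"
      using y(3)[of "Suc k"] H[of k] by (simp add: powr_divide powr_minus field_simps)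
    then have vv: "v (y k) + v (y (Suc k)) \<le> K * (1 + 2 powr q) * H k powr (- q)"
      using y(3)[of k] by (simp add: algebra_simps)
    have "\<bar>f (y k) - f (y (Suc k))\<bar> \<le> C * \<bar>y k - y (Suc k)\<bar> powr a * (v (y k) + v (y (Suc k)))"
      using d Hh[of k] by (intro haj y) auto
    also have "\<dots> \<le> C * (2 * H k) powr a * (K * (1 + 2 powr q) * H k powr (- q))"
      using C q d v[OF y(1)] by (intro mult_mono mult_left_mono powr_mono2 vv) (auto intro!: add_nonneg_nonneg)
    also have "\<dots> = C * K * 2 powr a * (1 + 2 powr q) * (H k powr a * H k powr (- q))"
      using H[of k] by (simp add: powr_mult)
    also have "H k powr a * H k powr (- q) = h powr (a - q) * r ^ k"
      by (simp add: powr_add[symmetric] Hk)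
    finally show ?thesis by (simp add: c_def mult_ac)
  qed
  then obtain l where l: "(\<lambda>k. f (y k)) \<longlonglongrightarrow> l" and le: "\<And>k. \<bar>f (y k) - l\<bar> \<le> c * r ^ k / (1 - r)"
    using geometric_limit[where x="\<lambda>k. f (y k)", OF _ r] by blast
  have H0: "H \<longlonglongrightarrow> 0" unfolding H_def by (rule LIMSEQ_divide_realpow_zero) auto
  have Ha: "(\<lambda>k. H k powr e) \<longlonglongrightarrow> 0" if "e > 0" for e
    by (rule tendsto_zero_powrI[OF H0 tendsto_const _ that]) (use H in \<open>auto intro!: always_eventually less_imp_le\<close>)
  have "(\<lambda>k. C * (H k powr a * v t + K * H k powr (a - q))) \<longlonglongrightarrow> C * (0 * v t + K * 0)"
    using q by (intro tendsto_intros Ha) auto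
  then have lim0: "(\<lambda>k. C * (H k powr a * v t + K * H k powr (a - q))) \<longlonglongrightarrow> 0" by simp
  have bound: "norm (f (y k) - f t) \<le> C * (H k powr a * v t + K * H k powr (a - q))" for k
  proof -
    have "\<bar>f (y k) - f t\<bar> \<le> C * \<bar>y k - t\<bar> powr a * (v (y k) + v t)"
      using y(2)[of k] Hh[of k] h by (intro haj y t) auto
    also have "\<dots> \<le> C * H k powr a * (K * H k powr (- q) + v t)"
      using C q v[OF y(1)] v[OF t] y by (intro mult_mono mult_left_mono powr_mono2 add_mono) (auto intro!: add_nonneg_nonneg)
    also have "\<dots> = C * (H k powr a * v t + K * (H k powr a * H k powr (- q)))" by (simp add: algebra_simps)
    also have "H k powr a * H k powr (- q) = H k powr (a - q)" by (simp add: powr_add[symmetric])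
    finally show ?thesis by simp
  qed
  have "(\<lambda>k. f (y k) - f t) \<longlonglongrightarrow> 0"
    by (rule Lim_null_comparison[OF _ lim0]) (use bound in \<open>auto intro!: always_eventually\<close>)
  then have "(\<lambda>k. f (y k)) \<longlonglongrightarrow> f t" by (simp add: LIM_zero_iff)
  then have "l = f t" using l LIMSEQ_unique by blast
  then show ?thesis using le[of 0] by (simp add: y00 c_def r_def)
qed

text \<open>Two chains start in a common good point z between x and y. The one towards x uses
  intervals to the right of x, the one towards y intervals to the left of y, so all of them stay
  within [0, T].\<close>

lemma hajlasz_holder:
  fixes f v :: "real \<Rightarrow> real"
  assumes haj: "\<And>x y. x \<in> G \<Longrightarrow> y \<in> G \<Longrightarrow> \<bar>x - y\<bar> \<le> \<eta> \<Longrightarrow> \<bar>f x - f y\<bar> \<le> C * \<bar>x - y\<bar> powr a * (v x + v y)"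
    and v: "\<And>x. x \<in> G \<Longrightarrow> 0 \<le> v x" and G: "G \<subseteq> {0<..<T}"
    and C: "0 \<le> C" "0 \<le> K" and q: "0 \<le> q" "q < a"
    and good: "\<And>c d. 0 \<le> c \<Longrightarrow> c < d \<Longrightarrow> d \<le> T \<Longrightarrow> \<exists>y\<in>G. c < y \<and> y < d \<and> v y \<le> K * (d - c) powr (- q)"
  obtains D where "D \<ge> 0" "\<And>x y. x \<in> G \<Longrightarrow> y \<in> G \<Longrightarrow> \<bar>x - y\<bar> \<le> \<eta> / 2 \<Longrightarrow> \<bar>f x - f y\<bar> \<le> D * \<bar>x - y\<bar> powr (a - q)"
proof -
  define D where "D = C * K * 2 powr a * (1 + 2 powr q) / (1 - 2 powr (q - a))"
  have D: "D \<ge> 0" unfolding D_def using C q powr_less_one[of 2 "q - a"]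
    by (intro divide_nonneg_nonneg mult_nonneg_nonneg add_nonneg_nonneg) auto
  have main: "\<bar>f x - f y\<bar> \<le> 2 * D * \<bar>x - y\<bar> powr (a - q)" if xy: "x \<in> G" "y \<in> G" "\<bar>x - y\<bar> \<le> \<eta> / 2" "x < y" for x y
  proof -
    define h where "h = y - x"
    have h: "0 < h" "2 * h \<le> \<eta>" using xy by (auto simp: h_def)
    have hk: "0 < h / 2 ^ k" "h / 2 ^ k \<le> h" for k :: nat
      using h one_le_power[of "2::real" k] by (auto simp: field_simps)
    have XY: "0 < x" "y < T" using G xy by auto
    obtain z where z: "z \<in> G" "x < z" "z < y" "v z \<le> K * h powr (- q)"
      using good[of x y] xy XY by (auto simp: h_def)
    have 1: "\<bar>f z - f x\<bar> \<le> D * h powr (a - q)" unfolding D_def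
    proof (rule hajlasz_chain[of G h f C a v K q x z])
      fix k :: nat
      show "\<exists>y\<in>G. \<bar>y - x\<bar> \<le> h / 2 ^ k \<and> v y \<le> K * (h / 2 ^ k) powr - q"
        using good[of x "x + h / 2 ^ k"] XY hk[of k] by (force simp: h_def)
    qed (use haj v C q h xy z in \<open>auto simp: h_def\<close>)
    have 2: "\<bar>f z - f y\<bar> \<le> D * h powr (a - q)" unfolding D_def
    proof (rule hajlasz_chain[of G h f C a v K q y z])
      fix k :: nat
      show "\<exists>u\<in>G. \<bar>u - y\<bar> \<le> h / 2 ^ k \<and> v u \<le> K * (h / 2 ^ k) powr - q"
        using good[of "y - h / 2 ^ k" y] XY hk[of k] by (force simp: h_def)
    qed (use haj v C q h xy z in \<open>auto simp: h_def\<close>)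
    show ?thesis using 1 2 xy by (simp add: h_def)
  qed
  show ?thesis
  proof (rule that[of "2 * D"])
    fix x y assume xy: "x \<in> G" "y \<in> G" "\<bar>x - y\<bar> \<le> \<eta> / 2"
    show "\<bar>f x - f y\<bar> \<le> 2 * D * \<bar>x - y\<bar> powr (a - q)"
      using main[of x y] main[of y x] xy by (cases x y rule: linorder_cases) (auto simp: abs_minus_commute)
  qed (use D in auto)
qed

text \<open>The local bound makes f uniformly continuous, so it extends to the closure of G, and the
  bound passes to limits. Distances of at least \<eta> are covered by boundedness of the extension
  on the compact interval.\<close>

lemma local_holder_extension:
  fixes f :: "real \<Rightarrow> real"
  assumes loc: "\<And>x y. x \<in> G \<Longrightarrow> y \<in> G \<Longrightarrow> \<bar>x - y\<bar> \<le> \<eta> \<Longrightarrow> \<bar>f x - f y\<bar> \<le> D * \<bar>x - y\<bar> powr b"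
    and G: "{0..T} \<subseteq> closure G" and "\<eta> > 0" "D \<ge> 0" "b > 0"
  obtains Z C where "\<And>x. x \<in> G \<Longrightarrow> Z x = f x"
    "\<And>x y. x \<in> {0..T} \<Longrightarrow> y \<in> {0..T} \<Longrightarrow> \<bar>Z x - Z y\<bar> \<le> C * \<bar>x - y\<bar> powr b"
proof -
  have "uniformly_continuous_on G f"
    unfolding uniformly_continuous_on_def
  proof (intro allI impI)
    fix e :: real assume "e > 0"
    define d where "d = min \<eta> ((e / (D + 1)) powr (1 / b))"
    have "d > 0" using \<open>e > 0\<close> assms by (auto simp: d_def)
    moreover have "dist (f x') (f x) < e" if "x \<in> G" "x' \<in> G" "dist x' x < d" for x x'
    proof -
      have "\<bar>f x' - f x\<bar> \<le> D * \<bar>x' - x\<bar> powr b" using that by (intro loc) (auto simp: dist_real_def d_def)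
      also have "\<dots> \<le> D * ((e / (D + 1)) powr (1 / b)) powr b"
        using that assms by (intro mult_left_mono powr_mono2) (auto simp: dist_real_def d_def)
      also have "((e / (D + 1)) powr (1 / b)) powr b = e / (D + 1)" using assms \<open>e > 0\<close> by (simp add: powr_powr)
      also have "D * (e / (D + 1)) < e" using assms \<open>e > 0\<close> by (simp add: field_simps)
      finally show ?thesis by (simp add: dist_real_def)
    qed
    ultimately show "\<exists>d>0. \<forall>x\<in>G. \<forall>x'\<in>G. dist x' x < d \<longrightarrow> dist (f x') (f x) < e" by blast
  qed
  then obtain Z where Z: "uniformly_continuous_on (closure G) Z" "\<And>x. x \<in> G \<Longrightarrow> f x = Z x"
    by (rule uniformly_continuous_on_extension_on_closure) blast
  have Zc: "continuous_on {0..T} Z"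
    using uniformly_continuous_imp_continuous[OF Z(1)] G continuous_on_subset by blast
  have Zl: "\<bar>Z x - Z y\<bar> \<le> D * \<bar>x - y\<bar> powr b" if xy: "x \<in> {0..T}" "y \<in> {0..T}" "\<bar>x - y\<bar> < \<eta>" for x y
  proof -
    have cl: "x \<in> closure G" "y \<in> closure G" using xy G by auto
    then obtain X Y where X: "\<And>n. X n \<in> G" "X \<longlonglongrightarrow> x" and Y: "\<And>n. Y n \<in> G" "Y \<longlonglongrightarrow> y"
      unfolding closure_sequential by blast
    have ZX: "(\<lambda>n. Z (X n)) \<longlonglongrightarrow> Z x" "(\<lambda>n. Z (Y n)) \<longlonglongrightarrow> Z y"
      using uniformly_continuous_imp_continuous[OF Z(1)] cl X Y closure_subset[of G]
      unfolding continuous_on_sequentially by (auto simp: o_def subset_iff)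
    have l: "(\<lambda>n. \<bar>X n - Y n\<bar>) \<longlonglongrightarrow> \<bar>x - y\<bar>" using X Y by (intro tendsto_intros)
    show ?thesis
    proof (rule tendsto_le[OF sequentially_bot])
      show "(\<lambda>n. D * \<bar>X n - Y n\<bar> powr b) \<longlonglongrightarrow> D * \<bar>x - y\<bar> powr b"
        using assms by (intro tendsto_intros l tendsto_powr' ) auto
      show "(\<lambda>n. \<bar>Z (X n) - Z (Y n)\<bar>) \<longlonglongrightarrow> \<bar>Z x - Z y\<bar>" by (intro tendsto_intros ZX)
      show "\<forall>\<^sub>F n in sequentially. \<bar>Z (X n) - Z (Y n)\<bar> \<le> D * \<bar>X n - Y n\<bar> powr b"
        using order_tendstoD(2)[OF l xy(3)] by eventually_elim (use loc X Y in \<open>auto simp: Z(2)[symmetric]\<close>)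
    qed
  qed
  have "bounded (Z ` {0..T})" using compact_continuous_image[OF Zc] by (auto intro: compact_imp_bounded)
  then obtain M where "\<forall>z\<in>Z ` {0..T}. norm z \<le> M" unfolding bounded_iff by blast
  then have M: "\<bar>Z x\<bar> \<le> M" if "x \<in> {0..T}" for x using that by auto
  show ?thesis
  \<comment> \<open>The second summand serves distances of at least \<eta>: values differ by at most
    2 \<bar>M\<bar>, and \<eta>^(- b) \<bar>x - y\<bar>^b is at least 1.\<close>
  proof (rule that[of Z "D + 2 * \<bar>M\<bar> * \<eta> powr (- b)"])
    fix x y assume xy: "x \<in> {0..T}" "y \<in> {0..T}"
    show "\<bar>Z x - Z y\<bar> \<le> (D + 2 * \<bar>M\<bar> * \<eta> powr (- b)) * \<bar>x - y\<bar> powr b"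
    proof (cases "\<bar>x - y\<bar> < \<eta>")
      case True
      then show ?thesis using Zl[OF xy True] by (auto simp: distrib_right intro: order.trans)
    next
      case False
      have "\<bar>Z x - Z y\<bar> \<le> 2 * \<bar>M\<bar> * 1" using M[OF xy(1)] M[OF xy(2)] by linarith
      also have "1 = \<eta> powr (- b) * \<eta> powr b" using \<open>\<eta> > 0\<close> by (simp add: powr_add[symmetric])
      also have "2 * \<bar>M\<bar> * (\<eta> powr (- b) * \<eta> powr b) \<le> 2 * \<bar>M\<bar> * (\<eta> powr (- b) * \<bar>x - y\<bar> powr b)"
        using False assms by (intro mult_left_mono powr_mono2) auto
      finally show ?thesis using \<open>D \<ge> 0\<close> by (simp add: distrib_right mult.assoc add_increasing)
    qed
  qed (use Z in auto)
qed

lemma AE_lebesgue_on_interval_ex: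
  assumes "AE t in lebesgue_on {0<..<T}. P t" "0 \<le> c" "c < d" "d \<le> (T::real)"
  shows "\<exists>t. c < t \<and> t < d \<and> P t"
proof (rule ccontr)
  assume n: "\<not> ?thesis"
  have "AE t in lebesgue. t \<in> {0<..<T} \<longrightarrow> P t" using assms(1) by (subst (asm) AE_restrict_space_iff) auto
  then have "AE t in lebesgue. t \<notin> {c<..<d}" by eventually_elim (use n assms in auto)
  then have "{c<..<d} \<in> null_sets lebesgue" by (subst (asm) AE_iff_null_sets[symmetric]) auto
  then have "emeasure lebesgue {c<..<d} = 0" by (rule null_setsD1)
  then show False using assms by (simp add: ennreal_eq_0_iff)
qed

text \<open>Chebyshev's inequality: if w exceeded K (d - c)^(- 1/p) at all good points of the
  interval, the integral of w^p would be at least K^p. With K = (I + 1)^(1/p), where I is the full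
  integral, this is absurd, the added 1 making the contradiction strict. For infinite p the exponent
  q is 0 and an essential bound serves as K.\<close>

lemma in_Lp_good_points:
  fixes w :: "real \<Rightarrow> ennreal"
  assumes w: "in_Lp p T w" and p: "p > 0" and "0 < T"
  defines "G \<equiv> {t \<in> {0<..<T}. w t < \<infinity>}" and "q \<equiv> enn2real (1 / p)"
  obtains K where "AE t in lebesgue_on {0<..<T}. t \<in> G" "K \<ge> 0"
    "\<And>c d. 0 \<le> c \<Longrightarrow> c < d \<Longrightarrow> d \<le> T \<Longrightarrow> \<exists>y\<in>G. c < y \<and> y < d \<and> enn2real (w y) \<le> K * (d - c) powr (- q)"
proof (cases "p = \<infinity>")
  case True
  then obtain C :: real where C: "AE t in lebesgue_on {0<..<T}. w t \<le> ennreal C" using w by (auto simp: in_Lp_def)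
  have sp: "AE t in lebesgue_on {0<..<T}. t \<in> {0<..<T}" by (rule AE_I2) (simp add: space_restrict_space)
  have q: "q = 0" using True by (simp add: q_def)
  have "AE t in lebesgue_on {0<..<T}. t \<in> G" using C sp
    by eventually_elim (auto simp: G_def intro: le_less_trans)
  moreover have "\<exists>y\<in>G. c < y \<and> y < d \<and> enn2real (w y) \<le> \<bar>C\<bar> * (d - c) powr (- q)" if cd: "0 \<le> c" "c < d" "d \<le> T" for c d
  proof -
    obtain t where t: "c < t" "t < d" "w t \<le> ennreal C" using AE_lebesgue_on_interval_ex[OF C cd] by blast
    then have "t \<in> G" using cd by (auto simp: G_def intro: le_less_trans)
    moreover have "enn2real (w t) \<le> \<bar>C\<bar>"
      using t(3) by (intro enn2real_leI) (auto intro: order.trans ennreal_leI)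
    ultimately show ?thesis using t cd by (auto simp: q)
  qed
  ultimately show ?thesis using that[of "\<bar>C\<bar>"] by auto
next
  case False
  define r where "r = enn2real p"
  have pr: "p = ennreal r" "r > 0" using False p by (auto simp: r_def enn2real_positive_iff less_top)
  have q: "q = 1 / r" using pr by (simp add: q_def divide_ennreal flip: ennreal_1)
  have fin: "AE t in lebesgue_on {0<..<T}. w t < \<infinity>"
    and int: "(\<integral>\<^sup>+t. ennreal (enn2real (w t) powr r) \<partial>lebesgue_on {0<..<T}) < \<infinity>"
    using w False by (auto simp: in_Lp_def r_def)
  define I where "I = enn2real (\<integral>\<^sup>+t. ennreal (enn2real (w t) powr r) \<partial>lebesgue_on {0<..<T})"
  have I: "(\<integral>\<^sup>+t. ennreal (enn2real (w t) powr r) \<partial>lebesgue_on {0<..<T}) = ennreal I" "I \<ge> 0"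
    using int by (auto simp: I_def)
  define K where "K = (I + 1) powr q"
  have sp: "AE t in lebesgue_on {0<..<T}. t \<in> {0<..<T}" by (rule AE_I2) (simp add: space_restrict_space)
  have GAE: "AE t in lebesgue_on {0<..<T}. t \<in> G" using fin sp by eventually_elim (auto simp: G_def)
  have "\<exists>y\<in>G. c < y \<and> y < d \<and> enn2real (w y) \<le> K * (d - c) powr (- q)" if cd: "0 \<le> c" "c < d" "d \<le> T" for c d
  proof (rule ccontr)
    assume n: "\<not> ?thesis"
    have Kp: "(K * (d - c) powr (- q)) powr r = (I + 1) / (d - c)"
    proof -
      have "((d - c) powr (- q)) powr r = 1 / (d - c)"
        using pr cd unfolding powr_powr by (simp add: q powr_minus_divide)
      then show ?thesis using cd I pr by (simp add: K_def powr_mult) (simp add: powr_powr q)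
    qed
    have "ennreal (I + 1) = ennreal ((I + 1) / (d - c)) * emeasure lebesgue {c<..<d}"
      using cd I by (simp add: ennreal_mult'[symmetric])
    also have "\<dots> = (\<integral>\<^sup>+t. ennreal ((I + 1) / (d - c)) * indicator {c<..<d} t \<partial>lebesgue)"
      by (subst nn_integral_cmult_indicator) auto
    also have "\<dots> = (\<integral>\<^sup>+t. ennreal ((I + 1) / (d - c)) * indicator {c<..<d} t * indicator {0<..<T} t \<partial>lebesgue)"
      using cd by (intro nn_integral_cong) (auto simp: indicator_def)
    also have "\<dots> = (\<integral>\<^sup>+t. ennreal ((I + 1) / (d - c)) * indicator {c<..<d} t \<partial>lebesgue_on {0<..<T})"
      by (subst nn_integral_restrict_space) auto
    also have "\<dots> \<le> (\<integral>\<^sup>+t. ennreal (enn2real (w t) powr r) \<partial>lebesgue_on {0<..<T})"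
    proof (rule nn_integral_mono_AE)
      show "AE t in lebesgue_on {0<..<T}. ennreal ((I + 1) / (d - c)) * indicator {c<..<d} t \<le> ennreal (enn2real (w t) powr r)"
        using GAE
      proof eventually_elim
        case (elim t)
        show ?case
        proof (cases "t \<in> {c<..<d}")
          case True
          then have "K * (d - c) powr (- q) \<le> enn2real (w t)" using n elim by force
          then have "(K * (d - c) powr (- q)) powr r \<le> enn2real (w t) powr r"
            using pr by (intro powr_mono2) (auto simp: K_def)
          then show ?thesis using True by (simp add: Kp ennreal_leI)
        qed auto
      qed
    qed
    finally show False unfolding I(1) using I(2) by (simp add: ennreal_le_iff)
  qed
  then show ?thesis using that[OF GAE, of K] by (auto simp: K_def)
qed

section \<open>The generalized Lebesgue-Stieltjes integral\<close>

text \<open>Kernel of the Marchaud form of the fractional derivative of order \<tau>, cut off to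
  positive arguments. It is not integrable at 0, but its tails are finite and produce the boundary
  terms.\<close>

definition frac_kernel :: "real \<Rightarrow> real \<Rightarrow> real" where
  "frac_kernel \<tau> v = (if v > 0 then \<tau> / Gamma (1 - \<tau>) * v powr (- 1 - \<tau>) else 0)"

lemma frac_kernel_measurable [measurable]: "frac_kernel \<tau> \<in> borel_measurable borel"
  unfolding frac_kernel_def[abs_def] by measurable

lemma frac_kernel_nonneg: "0 < \<tau> \<Longrightarrow> \<tau> < 1 \<Longrightarrow> 0 \<le> frac_kernel \<tau> v"
  using Gamma_real_pos[of "1 - \<tau>"] by (simp add: frac_kernel_def)

lemma frac_kernel_tail:
  assumes \<tau>: "0 < \<tau>" "\<tau> < 1" and y: "y > 0"
  shows "(\<integral>\<^sup>+v. ennreal (frac_kernel \<tau> v) * indicator {y..} v \<partial>lborel) = ennreal (y powr (- \<tau>) / Gamma (1 - \<tau>))"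
proof -
  have G: "Gamma (1 - \<tau>) > 0" using \<tau> by (intro Gamma_real_pos) auto
  have "(\<integral>\<^sup>+v. ennreal (frac_kernel \<tau> v) * indicator {y..} v \<partial>lborel) = ennreal (0 - (- (y powr (- \<tau>) / Gamma (1 - \<tau>))))"
  proof (rule nn_integral_FTC_atLeast)
    show "((\<lambda>v. - (v powr (- \<tau>) / Gamma (1 - \<tau>))) has_real_derivative frac_kernel \<tau> v) (at v)" if "y \<le> v" for v
      using that y G by (auto intro!: derivative_eq_intros simp: frac_kernel_def powr_diff powr_minus field_simps)
    have "((\<lambda>v. v powr (- \<tau>)) \<longlongrightarrow> 0) at_top" using \<tau> by (intro tendsto_neg_powr filterlim_ident) auto
    then have "((\<lambda>v. - (v powr (- \<tau>) / Gamma (1 - \<tau>))) \<longlongrightarrow> - (0 / Gamma (1 - \<tau>))) at_top"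
      using G by (intro tendsto_intros) auto
    then show "((\<lambda>v. - (v powr (- \<tau>) / Gamma (1 - \<tau>))) \<longlongrightarrow> 0) at_top" by simp
  qed (use frac_kernel_nonneg[OF \<tau>] in auto)
  then show ?thesis by simp
qed

lemma frac_kernel_tail_integral:
  assumes \<tau>: "0 < \<tau>" "\<tau> < 1" and y: "y > 0"
  shows "integrable lborel (\<lambda>v. frac_kernel \<tau> v * indicat_real {y..} v)"
    "(LINT v|lborel. frac_kernel \<tau> v * indicat_real {y..} v) = y powr (- \<tau>) / Gamma (1 - \<tau>)"
proof -
  have G: "Gamma (1 - \<tau>) > 0" using \<tau> by (intro Gamma_real_pos) auto
  have "(\<integral>\<^sup>+v. ennreal (frac_kernel \<tau> v * indicat_real {y..} v) \<partial>lborel) =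
    (\<integral>\<^sup>+v. ennreal (frac_kernel \<tau> v) * indicator {y..} v \<partial>lborel)"
    by (intro nn_integral_cong) (auto simp: indicator_def)
  then have "has_bochner_integral lborel (\<lambda>v. frac_kernel \<tau> v * indicat_real {y..} v) (y powr (- \<tau>) / Gamma (1 - \<tau>))"
    using frac_kernel_nonneg[OF \<tau>] frac_kernel_tail[OF assms] G
    by (intro has_bochner_integral_nn_integral) (auto simp: indicator_def)
  then show "integrable lborel (\<lambda>v. frac_kernel \<tau> v * indicat_real {y..} v)"
    "(LINT v|lborel. frac_kernel \<tau> v * indicat_real {y..} v) = y powr (- \<tau>) / Gamma (1 - \<tau>)"
    by (auto simp: has_bochner_integral_iff)
qed

text \<open>Extending a function by \<open>0\<close> turns the boundary term of a one-sided fractional derivative into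
  the tail of a convolution with the power kernel.\<close>

lemma marchaud:
  fixes \<phi> :: "real \<Rightarrow> real"
  assumes \<tau>: "0 < \<tau>" "\<tau> < 1" and m [measurable]: "\<phi> \<in> borel_measurable borel"
    and z: "\<And>y. y \<ge> L \<Longrightarrow> \<phi> y = 0" and x: "x < L"
  shows "(\<integral>\<^sup>+v. ennreal (frac_kernel \<tau> v * \<bar>\<phi> x - \<phi> (x + v)\<bar>) \<partial>lborel) =
     ennreal (\<tau> / Gamma (1 - \<tau>)) * (\<integral>\<^sup>+s. ennreal (\<bar>\<phi> x - \<phi> s\<bar> / (s - x) powr (1 + \<tau>)) * indicator {x<..<L} s \<partial>lborel) +
     ennreal (1 / Gamma (1 - \<tau>)) * ennreal (\<bar>\<phi> x\<bar> / (L - x) powr \<tau>)"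
   and "(\<integral>\<^sup>+v. ennreal (frac_kernel \<tau> v * \<bar>\<phi> x - \<phi> (x + v)\<bar>) \<partial>lborel) < \<infinity> \<Longrightarrow> integrable lborel (\<lambda>v. frac_kernel \<tau> v * (\<phi> x - \<phi> (x + v))) \<and>
     (LINT v|lborel. frac_kernel \<tau> v * (\<phi> x - \<phi> (x + v))) =
       1 / Gamma (1 - \<tau>) * (\<phi> x / (L - x) powr \<tau> +
         \<tau> * (LINT s|lborel. indicat_real {x<..<L} s * ((\<phi> x - \<phi> s) / (s - x) powr (\<tau> + 1))))"
proof -
  let ?N = "\<integral>\<^sup>+v. ennreal (frac_kernel \<tau> v * \<bar>\<phi> x - \<phi> (x + v)\<bar>) \<partial>lborel"
  let ?I = "ennreal (\<tau> / Gamma (1 - \<tau>)) * (\<integral>\<^sup>+s. ennreal (\<bar>\<phi> x - \<phi> s\<bar> / (s - x) powr (1 + \<tau>)) * indicator {x<..<L} s \<partial>lborel) +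
     ennreal (1 / Gamma (1 - \<tau>)) * ennreal (\<bar>\<phi> x\<bar> / (L - x) powr \<tau>)"
  define y where "y = L - x"
  have y: "y > 0" using x by (simp add: y_def)
  have G: "Gamma (1 - \<tau>) > 0" using \<tau> by (intro Gamma_real_pos) auto
  note K0 = frac_kernel_nonneg[OF \<tau>]
  define u where "u = (\<lambda>v. indicat_real {0<..<y} v * (frac_kernel \<tau> v * (\<phi> x - \<phi> (x + v))))"
  have [measurable]: "u \<in> borel_measurable borel" unfolding u_def by measurable
  have split: "frac_kernel \<tau> v * (\<phi> x - \<phi> (x + v)) = u v + \<phi> x * (frac_kernel \<tau> v * indicat_real {y..} v)" for v
    using z[of "x + v"] by (cases "v > 0"; cases "v < y") (auto simp: u_def frac_kernel_def y_def)
  have sabs: "\<bar>frac_kernel \<tau> v * (\<phi> x - \<phi> (x + v))\<bar> = \<bar>u v\<bar> + \<bar>\<phi> x\<bar> * (frac_kernel \<tau> v * indicat_real {y..} v)" for v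
    using z[of "x + v"] \<tau> G by (cases "v > 0"; cases "v < y") (auto simp: u_def frac_kernel_def y_def abs_mult)
  have us: "u (s + (- x)) = \<tau> / Gamma (1 - \<tau>) * (indicat_real {x<..<L} s * ((\<phi> x - \<phi> s) / (s - x) powr (\<tau> + 1)))" for s
  proof (cases "s \<in> {x<..<L}")
    case True
    then have "(s - x) powr (- 1 - \<tau>) = 1 / (s - x) powr (\<tau> + 1)"
      using powr_minus_divide[of "s - x" "\<tau> + 1"] by (simp add: algebra_simps)
    then show ?thesis using True by (simp add: u_def frac_kernel_def y_def)
  next
    case False
    then show ?thesis by (auto simp: u_def y_def indicator_def)
  qed
  have eqN: "?N = (\<integral>\<^sup>+v. ennreal \<bar>frac_kernel \<tau> v * (\<phi> x - \<phi> (x + v))\<bar> \<partial>lborel)"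
    using K0 by (intro nn_integral_cong) (simp add: abs_mult)
  also have "\<dots> = (\<integral>\<^sup>+v. ennreal \<bar>u v\<bar> + ennreal \<bar>\<phi> x\<bar> * (ennreal (frac_kernel \<tau> v) * indicator {y..} v) \<partial>lborel)"
    unfolding sabs using K0 by (intro nn_integral_cong) (auto simp: indicator_def ennreal_mult'')
  also have "\<dots> = (\<integral>\<^sup>+v. ennreal \<bar>u v\<bar> \<partial>lborel) + (\<integral>\<^sup>+v. ennreal \<bar>\<phi> x\<bar> * (ennreal (frac_kernel \<tau> v) * indicator {y..} v) \<partial>lborel)"
    by (rule nn_integral_add) auto
  also have "(\<integral>\<^sup>+v. ennreal \<bar>\<phi> x\<bar> * (ennreal (frac_kernel \<tau> v) * indicator {y..} v) \<partial>lborel) = ennreal \<bar>\<phi> x\<bar> * ennreal (y powr (- \<tau>) / Gamma (1 - \<tau>))"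
    unfolding frac_kernel_tail[OF \<tau> y, symmetric] by (rule nn_integral_cmult) measurable
  also have "\<dots> = ennreal (1 / Gamma (1 - \<tau>)) * ennreal (\<bar>\<phi> x\<bar> / (L - x) powr \<tau>)"
    using G y by (simp add: ennreal_mult''[symmetric] y_def powr_minus divide_inverse mult_ac)
  also have "(\<integral>\<^sup>+v. ennreal \<bar>u v\<bar> \<partial>lborel) = (\<integral>\<^sup>+s. ennreal \<bar>u (s + (- x))\<bar> \<partial>lborel)"
    by (rule lborel_nn_integral_shift[symmetric]) measurable
  also have "\<dots> = (\<integral>\<^sup>+s. ennreal (\<tau> / Gamma (1 - \<tau>)) * (ennreal (\<bar>\<phi> x - \<phi> s\<bar> / (s - x) powr (1 + \<tau>)) * indicator {x<..<L} s) \<partial>lborel)"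
    unfolding us using G \<tau> by (intro nn_integral_cong) (auto simp: indicator_def abs_mult ennreal_mult''[symmetric] add.commute)
  also have "\<dots> = ennreal (\<tau> / Gamma (1 - \<tau>)) * (\<integral>\<^sup>+s. ennreal (\<bar>\<phi> x - \<phi> s\<bar> / (s - x) powr (1 + \<tau>)) * indicator {x<..<L} s \<partial>lborel)"
    by (rule nn_integral_cmult) measurable
  finally show "?N = ?I" .
  assume fin: "?N < \<infinity>"
  have int: "integrable lborel (\<lambda>v. frac_kernel \<tau> v * (\<phi> x - \<phi> (x + v)))"
    using fin unfolding eqN by (intro integrableI_bounded) auto
  have tail: "integrable lborel (\<lambda>v. \<phi> x * (frac_kernel \<tau> v * indicat_real {y..} v))"
    by (intro integrable_mult_right frac_kernel_tail_integral \<tau> y)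
  have intu: "integrable lborel u"
    using Bochner_Integration.integrable_diff[OF int tail] unfolding split by simp
  have "(LINT v|lborel. frac_kernel \<tau> v * (\<phi> x - \<phi> (x + v))) = (LINT v|lborel. u v) + (LINT v|lborel. \<phi> x * (frac_kernel \<tau> v * indicat_real {y..} v))"
    unfolding split by (rule Bochner_Integration.integral_add[OF intu tail])
  also have "(LINT v|lborel. \<phi> x * (frac_kernel \<tau> v * indicat_real {y..} v)) = \<phi> x * (y powr (- \<tau>) / Gamma (1 - \<tau>))"
    using frac_kernel_tail_integral(2)[OF \<tau> y] by simp
  also have "(LINT v|lborel. u v) = (LINT s|lborel. u (s + (- x)))" by (rule lborel_integral_shift[symmetric]) measurable
  also have "\<dots> = \<tau> / Gamma (1 - \<tau>) * (LINT s|lborel. indicat_real {x<..<L} s * ((\<phi> x - \<phi> s) / (s - x) powr (\<tau> + 1)))"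
    unfolding us by (rule integral_mult_right_zero)
  finally show "integrable lborel (\<lambda>v. frac_kernel \<tau> v * (\<phi> x - \<phi> (x + v))) \<and>
     (LINT v|lborel. frac_kernel \<tau> v * (\<phi> x - \<phi> (x + v))) =
       1 / Gamma (1 - \<tau>) * (\<phi> x / (L - x) powr \<tau> +
         \<tau> * (LINT s|lborel. indicat_real {x<..<L} s * ((\<phi> x - \<phi> s) / (s - x) powr (\<tau> + 1))))"
    using int y by (simp add: y_def powr_minus divide_inverse algebra_simps)
qed

lemma set_lebesgue_eq_lborel:
  fixes g :: "real \<Rightarrow> real"
  assumes "g \<in> borel_measurable borel"
  shows "(LINT s:{a<..<b}|lebesgue. g s) = (LINT s|lborel. indicat_real {a<..<b} s * g s)"
  unfolding set_lebesgue_integral_def using assms by (subst integral_completion) auto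

lemma nn_integral_lborel_reflect:
  fixes u :: "real \<Rightarrow> ennreal"
  assumes [measurable]: "u \<in> borel_measurable borel"
  shows "(\<integral>\<^sup>+s. u (- s) \<partial>lborel) = (\<integral>\<^sup>+s. u s \<partial>lborel)"
  using nn_integral_real_affine[of u "- 1" 0] by simp

lemma integral_lborel_reflect: "(LINT s|lborel. u (- s)) = (LINT s|lborel. u s)" for u :: "real \<Rightarrow> real"
  using lborel_integral_real_affine[of "- 1" u 0] by simp

section \<open>The two fractional derivatives for one admissible order\<close>

lemma continuous_left_lim:
  assumes "continuous_on UNIV (g :: real \<Rightarrow> real)"
  shows "(g \<longlongrightarrow> g T) (at_left T)" "left_lim g T = g T"
proof -
  show 1: "(g \<longlongrightarrow> g T) (at_left T)"
    using assms by (auto simp: continuous_on_def intro: tendsto_within_subset)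
  show "left_lim g T = g T" unfolding left_lim_def by (intro tendsto_Lim 1) auto
qed

text \<open>The Hoelder orders a and b are not tied to \<theta>: they provide continuity, whereas
  finiteness of the fractional derivatives is drawn from \<open>W\<close>. Keeping g constant beyond
  T gives a meaning to forward shifts of g.\<close>

locale fractional_pair =
  fixes T \<theta> A a B b Mf :: real and f g :: "real \<Rightarrow> real"
  assumes T: "0 < T" and \<theta>: "0 < \<theta>" "\<theta> < 1"
    and f: "holder_bound A a f" and g: "holder_bound B b g" and ab: "0 < a" "0 < b"
    and Mf: "\<And>t. \<bar>f t\<bar> \<le> Mf" and gT: "\<And>t. t \<ge> T \<Longrightarrow> g t = g T"
    and W: "W0 \<theta> T f" "WT (1 - \<theta>) T g"
begin

text \<open>With \<open>f0\<close> vanishing outside (0, T) and \<open>g0\<close> vanishing from T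
  on, the one-sided derivatives become integrals over a whole half-line, \<open>FL\<close> and
  \<open>GR\<close>. The variants \<open>FLabs\<close> and \<open>GRabs\<close> are extended
  nonnegative and decide where these integrals converge absolutely.\<close>

definition "f0 t = (if 0 < t \<and> t < T then f t else 0)"
definition "g0 t = g t - g T"
definition "FL t = (LINT v|lborel. frac_kernel \<theta> v * (f0 t - f0 (t - v)))"
definition "GR t = (LINT w|lborel. frac_kernel (1 - \<theta>) w * (g0 t - g0 (t + w)))"
definition "FLabs t = (\<integral>\<^sup>+v. ennreal (frac_kernel \<theta> v * \<bar>f0 t - f0 (t - v)\<bar>) \<partial>lborel)"
definition "GRabs t = (\<integral>\<^sup>+w. ennreal (frac_kernel (1 - \<theta>) w * \<bar>g0 t - g0 (t + w)\<bar>) \<partial>lborel)"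

lemma f_cont: "continuous_on S f" using holder_bound_continuous[OF f ab(1)] .
lemma g_cont: "continuous_on S g" using holder_bound_continuous[OF g ab(2)] .

lemma f_meas [measurable]: "f \<in> borel_measurable borel" by (rule borel_measurable_continuous_onI[OF f_cont])
lemma g_meas [measurable]: "g \<in> borel_measurable borel" by (rule borel_measurable_continuous_onI[OF g_cont])
lemma f0_meas [measurable]: "f0 \<in> borel_measurable borel" unfolding f0_def[abs_def] by measurable
lemma g0_meas [measurable]: "g0 \<in> borel_measurable borel" unfolding g0_def[abs_def] by measurable

lemma left_lim_g: "left_lim g T = g T"
  by (rule continuous_left_lim(2)[OF g_cont])

text \<open>The reflection of t to - t turns the left-sided derivative into the right-sided one with
  endpoint 0.\<close>

lemma FL_marchaud:
  assumes t: "0 < t" "t < T"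
  shows "FLabs t = ennreal (\<theta> / Gamma (1 - \<theta>)) * (\<integral>\<^sup>+s. ennreal (\<bar>f t - f s\<bar> / (t - s) powr (1 + \<theta>)) * indicator {0<..<t} s \<partial>lborel) +
     ennreal (1 / Gamma (1 - \<theta>)) * ennreal (\<bar>f t\<bar> / t powr \<theta>)"
    and "FLabs t < \<infinity> \<Longrightarrow> integrable lborel (\<lambda>v. frac_kernel \<theta> v * (f0 t - f0 (t - v))) \<and> FL t = left_frac_deriv \<theta> f t"
proof -
  have m: "(\<lambda>x. f0 (- x)) \<in> borel_measurable borel" by measurable
  have z: "f0 (- y) = 0" if "y \<ge> 0" for y using that by (simp add: f0_def)
  note M = marchaud[OF \<theta> m z, of 0 "- t", simplified]
  have ft: "f0 t = f t" using t by (simp add: f0_def)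
  have ab: "FLabs t = (\<integral>\<^sup>+v. ennreal (frac_kernel \<theta> v * \<bar>f0 t - f0 (t - v)\<bar>) \<partial>lborel)" by (simp add: FLabs_def)
  have "(\<integral>\<^sup>+s. ennreal (\<bar>f0 t - f0 (- s)\<bar> / (s + t) powr (1 + \<theta>)) * indicator {- t<..<0} s \<partial>lborel) =
     (\<integral>\<^sup>+s. (\<lambda>s. ennreal (\<bar>f0 t - f0 s\<bar> / (t - s) powr (1 + \<theta>)) * indicator {0<..<t} s) (- s) \<partial>lborel)"
    by (intro nn_integral_cong) (auto simp: indicator_def add.commute)
  also have "\<dots> = (\<integral>\<^sup>+s. ennreal (\<bar>f0 t - f0 s\<bar> / (t - s) powr (1 + \<theta>)) * indicator {0<..<t} s \<partial>lborel)"
    by (rule nn_integral_lborel_reflect) measurable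
  also have "\<dots> = (\<integral>\<^sup>+s. ennreal (\<bar>f t - f s\<bar> / (t - s) powr (1 + \<theta>)) * indicator {0<..<t} s \<partial>lborel)"
    using t by (intro nn_integral_cong) (auto simp: indicator_def f0_def)
  finally show "FLabs t = ennreal (\<theta> / Gamma (1 - \<theta>)) * (\<integral>\<^sup>+s. ennreal (\<bar>f t - f s\<bar> / (t - s) powr (1 + \<theta>)) * indicator {0<..<t} s \<partial>lborel) +
     ennreal (1 / Gamma (1 - \<theta>)) * ennreal (\<bar>f t\<bar> / t powr \<theta>)"
    using M(1) t by (simp add: FLabs_def ft)
  assume "FLabs t < \<infinity>"
  then have M2: "integrable lborel (\<lambda>v. frac_kernel \<theta> v * (f0 t - f0 (t - v)))"
    "FL t = 1 / Gamma (1 - \<theta>) * (f0 t / t powr \<theta> + \<theta> * (LINT s|lborel. indicat_real {- t<..<0} s * ((f0 t - f0 (- s)) / (s + t) powr (\<theta> + 1))))"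
    using M(2) t by (simp_all add: FLabs_def FL_def)
  have "(LINT s|lborel. indicat_real {- t<..<0} s * ((f0 t - f0 (- s)) / (s + t) powr (\<theta> + 1))) =
     (LINT s|lborel. (\<lambda>s. indicat_real {0<..<t} s * ((f t - f s) / (t - s) powr (\<theta> + 1))) (- s))"
    using t by (intro Bochner_Integration.integral_cong) (auto simp: indicator_def f0_def add.commute)
  also have "\<dots> = (LINT s|lborel. indicat_real {0<..<t} s * ((f t - f s) / (t - s) powr (\<theta> + 1)))"
    by (rule integral_lborel_reflect)
  also have "\<dots> = (LINT s:{0<..<t}|lebesgue. (f t - f s) / (t - s) powr (\<theta> + 1))"
    by (rule set_lebesgue_eq_lborel[symmetric]) measurable
  finally show "integrable lborel (\<lambda>v. frac_kernel \<theta> v * (f0 t - f0 (t - v))) \<and> FL t = left_frac_deriv \<theta> f t"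
    using M2 by (simp add: left_frac_deriv_def ft)
qed

lemma GR_marchaud:
  assumes t: "0 < t" "t < T"
  shows "GRabs t = ennreal ((1 - \<theta>) / Gamma \<theta>) * (\<integral>\<^sup>+s. ennreal (\<bar>g t - g s\<bar> / (s - t) powr (1 + (1 - \<theta>))) * indicator {t<..<T} s \<partial>lborel) +
     ennreal (1 / Gamma \<theta>) * ennreal (\<bar>g T - g t\<bar> / (T - t) powr (1 - \<theta>))"
    and "GRabs t < \<infinity> \<Longrightarrow> integrable lborel (\<lambda>w. frac_kernel (1 - \<theta>) w * (g0 t - g0 (t + w))) \<and>
       GR t = right_frac_deriv T (1 - \<theta>) (\<lambda>u. g u - left_lim g T) t"
proof -
  have one_minus_theta: "0 < 1 - \<theta>" "1 - \<theta> < 1" using \<theta> by auto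
  have z: "g0 y = 0" if "y \<ge> T" for y using gT[OF that] by (simp add: g0_def)
  note M = marchaud[OF one_minus_theta g0_meas z t(2)]
  have sb: "g0 x - g0 y = g x - g y" for x y by (simp add: g0_def)
  show "GRabs t = ennreal ((1 - \<theta>) / Gamma \<theta>) * (\<integral>\<^sup>+s. ennreal (\<bar>g t - g s\<bar> / (s - t) powr (1 + (1 - \<theta>))) * indicator {t<..<T} s \<partial>lborel) +
     ennreal (1 / Gamma \<theta>) * ennreal (\<bar>g T - g t\<bar> / (T - t) powr (1 - \<theta>))"
  proof -
    have 1: "\<bar>g0 t\<bar> = \<bar>g T - g t\<bar>" "1 - (1 - \<theta>) = \<theta>" by (auto simp: g0_def)
    show ?thesis using M(1) unfolding sb 1 GRabs_def .
  qed
  assume "GRabs t < \<infinity>"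
  with M(2) show "integrable lborel (\<lambda>w. frac_kernel (1 - \<theta>) w * (g0 t - g0 (t + w))) \<and>
       GR t = right_frac_deriv T (1 - \<theta>) (\<lambda>u. g u - left_lim g T) t"
    unfolding right_frac_deriv_def left_lim_g GRabs_def GR_def
    by (subst set_lebesgue_eq_lborel) (auto simp: g0_def)
qed

lemma g0_zero: "t \<ge> T \<Longrightarrow> g0 t = 0"
  using gT[of t] by (simp add: g0_def)

lemma FLabs_meas [measurable]: "FLabs \<in> borel_measurable borel"
  unfolding FLabs_def[abs_def] by measurable

text \<open>The norm in \<open>W0\<close> integrates over t, so the Marchaud integral is bounded
  only in L1; its inner integral over (0, t) is dominated by the one over (0, T).\<close>

lemma FLabs_finite: "(\<integral>\<^sup>+t. FLabs t * indicator {0<..<T} t \<partial>lborel) < \<infinity>"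
proof -
  define c1 where "c1 = ennreal (\<theta> / Gamma (1 - \<theta>))"
  define c2 where "c2 = ennreal (1 / Gamma (1 - \<theta>))"
  define J where "J = (\<lambda>t. \<integral>\<^sup>+u. ennreal (\<bar>f t - f u\<bar> / \<bar>t - u\<bar> powr (1 + \<theta>)) * indicator {0<..<T} u \<partial>lborel)"
  have [measurable]: "J \<in> borel_measurable borel" unfolding J_def by measurable
  have w: "(\<integral>\<^sup>+t. ennreal (\<bar>f t\<bar> / t powr \<theta>) * indicator {0<..<T} t \<partial>lborel) < \<infinity>"
    "(\<integral>\<^sup>+t. J t * indicator {0<..<T} t \<partial>lborel) < \<infinity>"
  proof -
    have j: "(\<integral>\<^sup>+u. ennreal (\<bar>f t - f u\<bar> / \<bar>t - u\<bar> powr (1 + \<theta>)) * indicator {0<..<T} u \<partial>lebesgue) = J t" for t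
      unfolding J_def by (rule nn_integral_completion) measurable
    have "(\<integral>\<^sup>+t. ennreal (\<bar>f t\<bar> / t powr \<theta>) * indicator {0<..<T} t \<partial>lebesgue) + (\<integral>\<^sup>+t. J t * indicator {0<..<T} t \<partial>lebesgue) < \<infinity>"
      using W(1) unfolding W0_def j by auto
    moreover have "(\<integral>\<^sup>+t. ennreal (\<bar>f t\<bar> / t powr \<theta>) * indicator {0<..<T} t \<partial>lebesgue) = (\<integral>\<^sup>+t. ennreal (\<bar>f t\<bar> / t powr \<theta>) * indicator {0<..<T} t \<partial>lborel)"
      by (rule nn_integral_completion) measurable
    moreover have "(\<integral>\<^sup>+t. J t * indicator {0<..<T} t \<partial>lebesgue) = (\<integral>\<^sup>+t. J t * indicator {0<..<T} t \<partial>lborel)"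
      by (rule nn_integral_completion) measurable
    ultimately show "(\<integral>\<^sup>+t. ennreal (\<bar>f t\<bar> / t powr \<theta>) * indicator {0<..<T} t \<partial>lborel) < \<infinity>"
      "(\<integral>\<^sup>+t. J t * indicator {0<..<T} t \<partial>lborel) < \<infinity>" by auto
  qed
  have "(\<integral>\<^sup>+t. FLabs t * indicator {0<..<T} t \<partial>lborel) \<le>
     (\<integral>\<^sup>+t. c1 * (J t * indicator {0<..<T} t) + c2 * (ennreal (\<bar>f t\<bar> / t powr \<theta>) * indicator {0<..<T} t) \<partial>lborel)"
  proof (rule nn_integral_mono)
    fix t
    show "FLabs t * indicator {0<..<T} t \<le> c1 * (J t * indicator {0<..<T} t) + c2 * (ennreal (\<bar>f t\<bar> / t powr \<theta>) * indicator {0<..<T} t)"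
    proof (cases "t \<in> {0<..<T}")
      case True
      then have t: "0 < t" "t < T" by auto
      have "(\<integral>\<^sup>+s. ennreal (\<bar>f t - f s\<bar> / (t - s) powr (1 + \<theta>)) * indicator {0<..<t} s \<partial>lborel) \<le> J t"
        unfolding J_def using t by (intro nn_integral_mono) (auto simp: indicator_def)
      then show ?thesis using t unfolding FL_marchaud(1)[OF t] by (simp add: c1_def c2_def add_right_mono mult_left_mono)
    qed simp
  qed
  also have "\<dots> = c1 * (\<integral>\<^sup>+t. J t * indicator {0<..<T} t \<partial>lborel) + c2 * (\<integral>\<^sup>+t. ennreal (\<bar>f t\<bar> / t powr \<theta>) * indicator {0<..<T} t \<partial>lborel)"
    by (simp add: nn_integral_add nn_integral_cmult)
  also have "\<dots> < \<infinity>" using w by (auto simp: c1_def c2_def ennreal_mult_less_top)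
  finally show ?thesis .
qed

text \<open>The norm in \<open>WT\<close> is a supremum, so here the bound is uniform in t < T, and
  beyond T everything vanishes. An integrable factor \<open>FLabs\<close> against a bounded factor
  \<open>GRabs\<close> is what makes the product integrable.\<close>

lemma GRabs_bounded: "\<exists>C\<ge>0. \<forall>t>0. GRabs t \<le> ennreal C"
proof -
  define c1 where "c1 = ennreal ((1 - \<theta>) / Gamma \<theta>)"
  define c2 where "c2 = ennreal (1 / Gamma \<theta>)"
  define S1 where "S1 = (SUP t\<in>{0<..<T}. ennreal (\<bar>left_lim g T - g t\<bar> / (T - t) powr (1 - \<theta>)))"
  define S2 where "S2 = (SUP t\<in>{0<..<T}. \<integral>\<^sup>+u\<in>{t<..<T}. ennreal (\<bar>g t - g u\<bar> / \<bar>t - u\<bar> powr (1 + (1 - \<theta>))) \<partial>lebesgue)"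
  have fin: "S1 < \<infinity>" "S2 < \<infinity>" using W(2) by (auto simp: WT_def S1_def S2_def)
  have le: "GRabs t \<le> c1 * S2 + c2 * S1" if "t > 0" for t
  proof (cases "t < T")
    case True
    have "(\<integral>\<^sup>+s. ennreal (\<bar>g t - g s\<bar> / (s - t) powr (1 + (1 - \<theta>))) * indicator {t<..<T} s \<partial>lborel) =
      (\<integral>\<^sup>+s. ennreal (\<bar>g t - g s\<bar> / \<bar>t - s\<bar> powr (1 + (1 - \<theta>))) * indicator {t<..<T} s \<partial>lborel)"
      by (intro nn_integral_cong) (auto simp: indicator_def)
    also have "\<dots> = (\<integral>\<^sup>+u\<in>{t<..<T}. ennreal (\<bar>g t - g u\<bar> / \<bar>t - u\<bar> powr (1 + (1 - \<theta>))) \<partial>lebesgue)"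
      by (rule nn_integral_completion[symmetric]) measurable
    also have "\<dots> \<le> S2" unfolding S2_def using that True by (intro SUP_upper) auto
    finally have 1: "(\<integral>\<^sup>+s. ennreal (\<bar>g t - g s\<bar> / (s - t) powr (1 + (1 - \<theta>))) * indicator {t<..<T} s \<partial>lborel) \<le> S2" .
    have 2: "ennreal (\<bar>g T - g t\<bar> / (T - t) powr (1 - \<theta>)) \<le> S1"
      unfolding S1_def left_lim_g using that True by (intro SUP_upper) auto
    show ?thesis unfolding GR_marchaud(1)[OF that True] c1_def c2_def by (intro add_mono mult_left_mono 1 2) auto
  next
    case False
    have "GRabs t = (\<integral>\<^sup>+w. 0 \<partial>(lborel :: real measure))" unfolding GRabs_def
    proof (intro nn_integral_cong)
      fix w :: real
      show "ennreal (frac_kernel (1 - \<theta>) w * \<bar>g0 t - g0 (t + w)\<bar>) = 0"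
        using False g0_zero[of t] g0_zero[of "t + w"] by (auto simp: frac_kernel_def)
    qed
    then show ?thesis by simp
  qed
  have "c1 < \<infinity>" "c2 < \<infinity>" by (simp_all add: c1_def c2_def)
  then have "c1 * S2 < \<infinity>" "c2 * S1 < \<infinity>" using fin by (simp_all add: ennreal_mult_less_top)
  then have "c1 * S2 + c2 * S1 < \<infinity>" by simp
  then have "c1 * S2 + c2 * S1 = ennreal (enn2real (c1 * S2 + c2 * S1))" by (simp only: ennreal_enn2real infinity_ennreal_def)
  with le have "\<forall>t>0. GRabs t \<le> ennreal (enn2real (c1 * S2 + c2 * S1))" by metis
  then show ?thesis using enn2real_nonneg by blast
qed

end

section \<open>Iterated integrals on products of Euclidean spaces\<close>

lemma lborel_nn_integral_iterated:
  fixes u :: "'a::euclidean_space \<times> 'b::euclidean_space \<Rightarrow> ennreal"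
  assumes "u \<in> borel_measurable borel"
  shows "(\<integral>\<^sup>+p. u p \<partial>lborel) = (\<integral>\<^sup>+x. \<integral>\<^sup>+y. u (x, y) \<partial>lborel \<partial>lborel)"
  using lborel.nn_integral_fst[of u lborel] assms unfolding lborel_prod by simp

lemma lborel_integral_iterated:
  fixes u :: "'a::euclidean_space \<times> 'b::euclidean_space \<Rightarrow> real"
  assumes "integrable lborel u"
  shows "(LINT p|lborel. u p) = (LINT x|lborel. LINT y|lborel. u (x, y))"
    and "(LINT p|lborel. u p) = (LINT y|lborel. LINT x|lborel. u (x, y))"
    and "AE x in lborel. integrable lborel (\<lambda>y. u (x, y))" "AE y in lborel. integrable lborel (\<lambda>x. u (x, y))"
    and "integrable lborel (\<lambda>x. LINT y|lborel. u (x, y))" "integrable lborel (\<lambda>y. LINT x|lborel. u (x, y))"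
proof -
  have i: "integrable (lborel \<Otimes>\<^sub>M lborel) u" using assms by (simp add: lborel_prod)
  have c: "integrable (lborel \<Otimes>\<^sub>M lborel) (case_prod (\<lambda>x y. u (x, y)))" using i by simp
  show 1: "(LINT p|lborel. u p) = (LINT x|lborel. LINT y|lborel. u (x, y))"
    using lborel_pair.integral_fst'[OF i] by (simp add: lborel_prod)
  show "(LINT p|lborel. u p) = (LINT y|lborel. LINT x|lborel. u (x, y))"
    unfolding 1 using lborel_pair.Fubini_integral[OF c] by simp
  show "AE x in lborel. integrable lborel (\<lambda>y. u (x, y))" using lborel_pair.AE_integrable_fst'[OF i] by simp
  show "AE y in lborel. integrable lborel (\<lambda>x. u (x, y))" using lborel_pair.AE_integrable_snd[OF c] by simp
  show "integrable lborel (\<lambda>x. LINT y|lborel. u (x, y))" using lborel_pair.integrable_fst'[OF i] by simp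
  show "integrable lborel (\<lambda>y. LINT x|lborel. u (x, y))" using lborel_pair.integrable_snd[OF c] by simp
qed

lemma lborel_product_integral:
  fixes u :: "'a::euclidean_space \<Rightarrow> real" and v :: "'b::euclidean_space \<Rightarrow> real"
  assumes u: "integrable lborel u" and v: "integrable lborel v"
  shows "integrable lborel (\<lambda>(x, y). u x * v y)" "(LINT p|lborel. (case p of (x, y) \<Rightarrow> u x * v y)) = (LINT x|lborel. u x) * (LINT y|lborel. v y)"
proof -
  have [measurable]: "u \<in> borel_measurable borel" "v \<in> borel_measurable borel" using u v by auto
  have "integrable (lborel \<Otimes>\<^sub>M lborel) (\<lambda>(x, y). u x * v y)"
  proof (rule lborel_pair.Fubini_integrable)
    have "(\<lambda>x. LINT y|lborel. norm (case (x, y) of (x, y) \<Rightarrow> u x * v y)) = (\<lambda>x. \<bar>u x\<bar> * (LINT y|lborel. \<bar>v y\<bar>))"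
      by (simp add: abs_mult)
    then show "integrable lborel (\<lambda>x. LINT y|lborel. norm (case (x, y) of (x, y) \<Rightarrow> u x * v y))" using u by simp
  qed (use v in auto)
  then show i: "integrable lborel (\<lambda>(x, y). u x * v y)" by (simp add: lborel_prod)
  show "(LINT p|lborel. (case p of (x, y) \<Rightarrow> u x * v y)) = (LINT x|lborel. u x) * (LINT y|lborel. v y)"
    unfolding lborel_integral_iterated(1)[OF i] by simp
qed

lemma lborel_nn_product_integral:
  fixes u :: "'a::euclidean_space \<Rightarrow> ennreal" and v :: "'b::euclidean_space \<Rightarrow> ennreal"
  assumes [measurable]: "u \<in> borel_measurable borel" "v \<in> borel_measurable borel"
  shows "(\<integral>\<^sup>+p. (case p of (x, y) \<Rightarrow> u x * v y) \<partial>lborel) = (\<integral>\<^sup>+x. u x \<partial>lborel) * (\<integral>\<^sup>+y. v y \<partial>lborel)"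
proof -
  have m: "(\<lambda>(x, y). u x * v y) \<in> borel_measurable (borel :: ('a \<times> 'b) measure)" unfolding borel_prod[symmetric] by measurable
  show ?thesis unfolding lborel_nn_integral_iterated[OF m] by (simp add: nn_integral_cmult nn_integral_multc)
qed

text \<open>The mass of \<open>frac_kernel\<close> beyond a, which is also the Riemann-Liouville
  kernel of order 1 - \<tau>.\<close>

definition frac_tail :: "real \<Rightarrow> real \<Rightarrow> real" where
  "frac_tail \<tau> a = (if a > 0 then a powr (- \<tau>) / Gamma (1 - \<tau>) else 0)"

lemma frac_tail_measurable [measurable]: "frac_tail \<tau> \<in> borel_measurable borel"
  unfolding frac_tail_def[abs_def] by measurable

lemma frac_tail_nonneg: "0 < \<tau> \<Longrightarrow> \<tau> < 1 \<Longrightarrow> 0 \<le> frac_tail \<tau> v"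
  using Gamma_real_pos[of "1 - \<tau>"] by (simp add: frac_tail_def)

lemma frac_tail_zero: "a \<le> 0 \<Longrightarrow> frac_tail \<tau> a = 0"
  by (simp add: frac_tail_def)

text \<open>The semigroup law of the Riemann-Liouville kernels. Scaling a = s t reduces it to the
  Beta integral with value Gamma (1 - \<theta>) Gamma \<theta>; the powers of s cancel because the
  two kernels have total degree -1.\<close>

lemma frac_tail_convolution:
  assumes \<theta>: "0 < \<theta>" "\<theta> < 1" and s: "s > 0"
  shows "(\<integral>\<^sup>+a. ennreal (frac_tail \<theta> a * frac_tail (1 - \<theta>) (s - a)) \<partial>lborel) = 1"
proof -
  have G: "Gamma (1 - \<theta>) > 0" "Gamma \<theta> > 0" using \<theta> by (auto intro: Gamma_real_pos)
  let ?c = "1 / (Gamma (1 - \<theta>) * Gamma \<theta>)"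
  define w where "w = (\<lambda>t. t powr (- \<theta>) * (1 - t) powr (\<theta> - 1))"
  have [measurable]: "w \<in> borel_measurable borel" unfolding w_def by measurable
  have "(w has_integral Beta (1 - \<theta>) \<theta>) {0..1}" unfolding w_def
    using has_integral_Beta_real[of "1 - \<theta>" \<theta>] \<theta> by simp
  then have "(w has_integral Gamma (1 - \<theta>) * Gamma \<theta>) {0<..<1}"
    by (simp add: Beta_def has_integral_Icc_iff_Ioo)
  then have "((\<lambda>t. if t \<in> {0<..<1} then w t else 0) has_integral Gamma (1 - \<theta>) * Gamma \<theta>) UNIV"
    by (subst has_integral_restrict_UNIV)
  then have W: "(\<integral>\<^sup>+t. ennreal (if t \<in> {0<..<1} then w t else 0) \<partial>lborel) = ennreal (Gamma (1 - \<theta>) * Gamma \<theta>)"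
    by (intro nn_integral_has_integral_lborel) (auto simp: w_def)
  have "(\<integral>\<^sup>+a. ennreal (frac_tail \<theta> a * frac_tail (1 - \<theta>) (s - a)) \<partial>lborel) =
    ennreal \<bar>s\<bar> * (\<integral>\<^sup>+t. ennreal (frac_tail \<theta> (0 + s * t) * frac_tail (1 - \<theta>) (s - (0 + s * t))) \<partial>lborel)"
    using s by (intro nn_integral_real_affine) auto
  also have "\<dots> = ennreal \<bar>s\<bar> * (\<integral>\<^sup>+t. ennreal (?c / s) * ennreal (if t \<in> {0<..<1} then w t else 0) \<partial>lborel)"
  proof (intro arg_cong2[where f="(*)"] refl nn_integral_cong)
    fix t :: real
    show "ennreal (frac_tail \<theta> (0 + s * t) * frac_tail (1 - \<theta>) (s - (0 + s * t))) = ennreal (?c / s) * ennreal (if t \<in> {0<..<1} then w t else 0)"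
    proof (cases "t \<in> {0<..<1}")
      case True
      have "s - s * t = s * (1 - t)" by (simp add: algebra_simps)
      then have "frac_tail \<theta> (s * t) * frac_tail (1 - \<theta>) (s - s * t) = ?c * (s powr (- \<theta>) * s powr (\<theta> - 1)) * w t"
        using True s by (simp add: frac_tail_def w_def powr_mult)
      also have "s powr (- \<theta>) * s powr (\<theta> - 1) = 1 / s" using s powr_minus_divide[of s 1] unfolding powr_add[symmetric] by simp
      finally show ?thesis using True G s by (simp add: ennreal_mult''[symmetric] w_def)
    next
      case False
      have "s * t \<le> 0 \<or> s - s * t \<le> 0"
      proof (cases "t \<le> 0")
        case True
        then show ?thesis using s by (simp add: mult_nonneg_nonpos)
      next
        case f: False
        then show ?thesis using False mult_left_mono[of 1 t s] s by auto
      qed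
      then have "frac_tail \<theta> (s * t) = 0 \<or> frac_tail (1 - \<theta>) (s - s * t) = 0" using frac_tail_zero by blast
      then show ?thesis using False by auto
    qed
  qed
  also have "\<dots> = ennreal \<bar>s\<bar> * (ennreal (?c / s) * ennreal (Gamma (1 - \<theta>) * Gamma \<theta>))"
    unfolding W[symmetric] by (subst nn_integral_cmult) (auto simp: w_def)
  also have "\<dots> = ennreal (\<bar>s\<bar> * (?c / s * (Gamma (1 - \<theta>) * Gamma \<theta>)))"
    using G s by (simp add: ennreal_mult''[symmetric])
  also have "\<bar>s\<bar> * (?c / s * (Gamma (1 - \<theta>) * Gamma \<theta>)) = 1" using G s by simp
  finally show ?thesis by simp
qed

section \<open>Averages over boxes and the exchange of differences\<close>

definition box_integral :: "real \<Rightarrow> real \<Rightarrow> (real \<Rightarrow> real) \<Rightarrow> real" where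
  "box_integral v w \<phi> = (LINT p|lborel. (case p of (a, b) \<Rightarrow> indicat_real {0<..v} a * indicat_real {0<..w} b * \<phi> (a + b)))"

lemma indicator_integral_HK:
  fixes \<phi> :: "real \<Rightarrow> real"
  assumes "continuous_on UNIV \<phi>"
  shows "(LINT b|lborel. indicat_real {c<..d} b * \<phi> b) = integral {c..d} \<phi>"
proof -
  have [measurable]: "\<phi> \<in> borel_measurable borel" by (rule borel_measurable_continuous_onI[OF assms])
  have "set_integrable lborel {c..d} \<phi>" using borel_integrable_atLeastAtMost'[of c d \<phi>] continuous_on_subset[OF assms] by auto
  from set_borel_integral_eq_integral(2)[OF this] have "(LINT b|lborel. indicat_real {c..d} b * \<phi> b) = integral {c..d} \<phi>"
    by (simp add: set_lebesgue_integral_def)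
  moreover have "(LINT b|lborel. indicat_real {c<..d} b * \<phi> b) = (LINT b|lborel. indicat_real {c..d} b * \<phi> b)"
    by (rule integral_cong_AE) (use AE_lborel_singleton[of c] in \<open>auto elim!: eventually_mono simp: indicator_def\<close>)
  ultimately show ?thesis by simp
qed

lemma continuous_bounded_on_interval:
  fixes \<phi> :: "real \<Rightarrow> real"
  assumes "continuous_on UNIV \<phi>"
  obtains M where "\<And>x. x \<in> {c..d} \<Longrightarrow> \<bar>\<phi> x\<bar> \<le> M"
proof -
  have "bounded (\<phi> ` {c..d})" using continuous_on_subset[OF assms] by (intro compact_imp_bounded compact_continuous_image) auto
  then obtain M where "\<forall>y\<in>\<phi> ` {c..d}. norm y \<le> M" unfolding bounded_iff by blast
  then show ?thesis by (intro that[of M]) auto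
qed

lemma indicator_Ioc_integrable: "integrable lborel (indicat_real {c<..d::real})"
  by (cases "c \<le> d") (auto intro!: integrable_real_indicator)

lemma box_integrable:
  fixes \<phi> :: "real \<Rightarrow> real"
  assumes c: "continuous_on UNIV \<phi>"
  shows "integrable lborel (\<lambda>(a, b). indicat_real {0<..v} a * indicat_real {0<..w} b * \<phi> (a + b))"
proof -
  obtain M where M: "\<And>x. x \<in> {0..v + w} \<Longrightarrow> \<bar>\<phi> x\<bar> \<le> M" using continuous_bounded_on_interval[OF c] by blast
  have [measurable]: "\<phi> \<in> borel_measurable borel" by (rule borel_measurable_continuous_onI[OF c])
  have i: "integrable lborel (\<lambda>(a, b). indicat_real {0<..v} a * (\<bar>M\<bar> * indicat_real {0<..w} b))"
    by (rule lborel_product_integral) (auto intro!: indicator_Ioc_integrable integrable_mult_right)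
  have m: "(\<lambda>(a, b). indicat_real {0<..v} a * indicat_real {0<..w} b * \<phi> (a + b)) \<in> borel_measurable (borel :: (real \<times> real) measure)"
    unfolding borel_prod[symmetric] by measurable
  show ?thesis
  proof (rule Bochner_Integration.integrable_bound[OF i])
    show "AE p in lborel. norm (case p of (a, b) \<Rightarrow> indicat_real {0<..v} a * indicat_real {0<..w} b * \<phi> (a + b))
      \<le> norm (case p of (a, b) \<Rightarrow> indicat_real {0<..v} a * (\<bar>M\<bar> * indicat_real {0<..w} b))"
      using order.trans[OF M abs_ge_self] by (intro AE_I2) (auto simp: indicator_def)
  qed (use m in simp)
qed

lemma box_integral_iterated:
  assumes c: "continuous_on UNIV \<phi>"
  shows "box_integral v w \<phi> = integral {0..v} (\<lambda>a. integral {0..w} (\<lambda>b. \<phi> (a + b)))"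
    "box_integral v w \<phi> = integral {0..w} (\<lambda>b. integral {0..v} (\<lambda>a. \<phi> (a + b)))"
proof -
  have c1: "continuous_on UNIV (\<lambda>b. \<phi> (a + b))" "continuous_on UNIV (\<lambda>b. \<phi> (b + a))" for a
    by (rule continuous_on_compose2[OF c]; auto intro!: continuous_intros)+
  have c2: "continuous_on UNIV (\<lambda>(a, b). \<phi> (a + b))"
    unfolding split_beta' by (rule continuous_on_compose2[OF c]) (auto intro!: continuous_intros)
  have c3: "continuous_on UNIV (\<lambda>a. integral {0..w} (\<lambda>b. \<phi> (a + b)))"
    using integral_continuous_on_param[of UNIV 0 w "\<lambda>a b. \<phi> (a + b)"] continuous_on_subset[OF c2] by (auto simp: cbox_interval)
  have "box_integral v w \<phi> = (LINT a|lborel. LINT b|lborel. indicat_real {0<..v} a * (indicat_real {0<..w} b * \<phi> (a + b)))"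
    unfolding box_integral_def lborel_integral_iterated(1)[OF box_integrable[OF c]] by (simp add: mult.assoc)
  also have "\<dots> = (LINT a|lborel. indicat_real {0<..v} a * integral {0..w} (\<lambda>b. \<phi> (a + b)))"
    by (simp add: indicator_integral_HK[OF c1(1)])
  also have "\<dots> = integral {0..v} (\<lambda>a. integral {0..w} (\<lambda>b. \<phi> (a + b)))" by (rule indicator_integral_HK[OF c3])
  finally show "box_integral v w \<phi> = integral {0..v} (\<lambda>a. integral {0..w} (\<lambda>b. \<phi> (a + b)))" .
  also have "\<dots> = integral {0..w} (\<lambda>b. integral {0..v} (\<lambda>a. \<phi> (a + b)))"
    using integral_swap_continuous[of 0 0 v w "\<lambda>a b. \<phi> (a + b)"] continuous_on_subset[OF c2] by (simp add: cbox_interval)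
  finally show "box_integral v w \<phi> = integral {0..w} (\<lambda>b. integral {0..v} (\<lambda>a. \<phi> (a + b)))" .
qed

text \<open>In terms of a primitive F both sides are F (h + w) - F h - F w + F 0, which is symmetric
  in h and w.\<close>

lemma window_exchange:
  fixes \<phi> :: "real \<Rightarrow> real"
  assumes c: "continuous_on UNIV \<phi>" and "0 \<le> h" "0 \<le> w"
  shows "integral {0..h} (\<lambda>b. \<phi> (b + w) - \<phi> b) = integral {0..w} (\<lambda>b. \<phi> (b + h) - \<phi> b)"
proof -
  have i: "\<phi> integrable_on {x..y}" for x y by (rule integrable_continuous_real[OF continuous_on_subset[OF c]]) auto
  have ish: "(\<lambda>t. \<phi> (t + k)) integrable_on {x..y}" for x y k by (rule integrable_continuous_real[OF continuous_on_shift[OF c]])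
  have "integral {0..h} (\<lambda>b. \<phi> (b + w) - \<phi> b) = integral {0+w..h+w} \<phi> - integral {0..h} \<phi>"
    using integral_shift'[OF c, of 0 h w] by (simp add: Henstock_Kurzweil_Integration.integral_diff[OF ish i])
  also have "\<dots> = integral {h..h+w} \<phi> - integral {0..w} \<phi>"
    using integral_window[OF c, of 0 h w] assms by simp
  also have "\<dots> = integral {0..w} (\<lambda>b. \<phi> (b + h) - \<phi> b)"
    using integral_shift'[OF c, of 0 w h] by (simp add: Henstock_Kurzweil_Integration.integral_diff[OF ish i] add.commute)
  finally show ?thesis .
qed

text \<open>One window exchange in each variable. The gain is that the kernels, singular in v and w,
  then multiply an integral over the box of sides v and w instead of a difference with these steps,
  and this integral can be interchanged with them.\<close>

lemma box_exchange:
  assumes c: "continuous_on UNIV \<phi>" and "0 \<le> h" "0 \<le> v" "0 \<le> w"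
  shows "box_integral h h (\<lambda>y. \<phi> y - \<phi> (y + w) - \<phi> (y + v) + \<phi> (y + v + w)) =
    box_integral v w (\<lambda>y. \<phi> (y + 2 * h) - 2 * \<phi> (y + h) + \<phi> y)"
proof -
  have cs: "continuous_on UNIV (\<lambda>t. \<phi> (t + k))" for k by (rule continuous_on_shift[OF c])
  have cs': "continuous_on UNIV (\<lambda>t. \<phi> (t + k + l))" for k l using cs[of "k + l"] by (simp add: add.assoc)
  have cs'': "continuous_on UNIV (\<lambda>t. \<phi> (k + t + l))" "continuous_on UNIV (\<lambda>t. \<phi> (k + t))" for k l
    using cs[of "k + l"] cs[of k] by (simp_all add: add_ac)
  have "box_integral h h (\<lambda>y. \<phi> y - \<phi> (y + w) - \<phi> (y + v) + \<phi> (y + v + w)) =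
     integral {0..h} (\<lambda>a. integral {0..h} (\<lambda>b. (\<phi> (a + (b + w) + v) - \<phi> (a + (b + w))) - (\<phi> (a + b + v) - \<phi> (a + b))))"
    by (subst box_integral_iterated(1)) (auto intro!: continuous_intros c cs cs' simp: algebra_simps)
  also have "\<dots> = integral {0..h} (\<lambda>a. integral {0..w} (\<lambda>b. (\<phi> (a + (b + h) + v) - \<phi> (a + (b + h))) - (\<phi> (a + b + v) - \<phi> (a + b))))"
    by (subst window_exchange[of "\<lambda>b. \<phi> (a + b + v) - \<phi> (a + b)" for a]) (use assms in \<open>auto intro!: continuous_intros cs''\<close>)
  also have "\<dots> = box_integral h w (\<lambda>y. \<phi> (y + h + v) - \<phi> (y + h) - (\<phi> (y + v) - \<phi> y))"
    by (subst box_integral_iterated(1)) (auto intro!: continuous_intros c cs cs' simp: algebra_simps)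
  also have "\<dots> = integral {0..w} (\<lambda>b. integral {0..h} (\<lambda>a. (\<phi> (a + v + b + h) - \<phi> (a + v + b)) - (\<phi> (a + b + h) - \<phi> (a + b))))"
    by (subst box_integral_iterated(2)) (auto intro!: continuous_intros c cs cs' simp: algebra_simps)
  also have "\<dots> = integral {0..w} (\<lambda>b. integral {0..v} (\<lambda>a. (\<phi> (a + h + b + h) - \<phi> (a + h + b)) - (\<phi> (a + b + h) - \<phi> (a + b))))"
    by (subst window_exchange[of "\<lambda>a. \<phi> (a + b + h) - \<phi> (a + b)" for b]) (use assms in \<open>auto intro!: continuous_intros cs cs'\<close>)
  also have "\<dots> = box_integral v w (\<lambda>y. \<phi> (y + 2 * h) - 2 * \<phi> (y + h) + \<phi> y)"
    by (subst box_integral_iterated(2)) (auto intro!: continuous_intros c cs cs' simp: algebra_simps)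
  finally show ?thesis .
qed

section \<open>Cross-correlation and the value of the integral\<close>

context fractional_pair
begin

text \<open>\<open>cross 0\<close> is the integral in \<open>gls_formula\<close> up to sign; the
  shift r is what the averages are taken over. \<open>corr\<close> is the only form in which f and g
  enter after t has been integrated out.\<close>

definition "corr r = (LINT t|lborel. f0 t * g0 (t + r))"
definition "cross r = (LINT t|lborel. indicat_real {0<..<T} t * (FL t * GR (t + r)))"

lemma Mf_nonneg: "Mf \<ge> 0" using Mf[of 0] by linarith

lemma f0_bound: "\<bar>f0 t\<bar> \<le> Mf" using Mf[of t] Mf_nonneg by (auto simp: f0_def)

lemma g0_cont: "continuous_on S g0"
  unfolding g0_def[abs_def] by (intro continuous_intros g_cont)

lemma corr_integrable: "integrable lborel (\<lambda>t. f0 (t - v) * g0 (t + r))"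
proof -
  obtain M where M: "\<And>x. x \<in> {v + r..T + v + r} \<Longrightarrow> \<bar>g0 x\<bar> \<le> M"
    using continuous_bounded_on_interval[OF g0_cont] by blast
  show ?thesis
  proof (rule integrable_bounded_support[where C="Mf * \<bar>M\<bar>" and x="v + T / 2" and r="T / 2"])
    show "\<bar>f0 (t - v) * g0 (t + r)\<bar> \<le> Mf * \<bar>M\<bar>" for t
    proof (cases "0 < t - v \<and> t - v < T")
      case True
      then have "\<bar>g0 (t + r)\<bar> \<le> \<bar>M\<bar>" using M[of "t + r"] by auto
      then show ?thesis unfolding abs_mult using f0_bound[of "t - v"] Mf_nonneg by (intro mult_mono) auto
    next
      case False
      then show ?thesis using Mf_nonneg by (auto simp: f0_def)
    qed
    show "f0 (t - v) * g0 (t + r) = 0" if "t \<notin> cball (v + T / 2) (T / 2)" for t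
      using that by (auto simp: f0_def dist_real_def abs_if field_simps split: if_splits)
  qed measurable
qed

lemma corr_shift: "(LINT t|lborel. f0 (t - v) * g0 (t + r)) = corr (r + v)"
proof -
  have "corr (r + v) = (LINT t|lborel. (\<lambda>t. f0 (t - v) * g0 (t + r)) (t + v))" by (simp add: corr_def add_ac)
  also have "\<dots> = (LINT t|lborel. f0 (t - v) * g0 (t + r))" by (rule lborel_integral_shift) measurable
  finally show ?thesis by simp
qed

lemma corr_holder: "holder_bound (Mf * B * T) b corr"
  unfolding holder_bound_def
proof (intro allI)
  fix r r'
  have i: "integrable lborel (\<lambda>t. f0 t * g0 (t + r))" for r using corr_integrable[of 0 r] by simp
  have "corr r - corr r' = (LINT t|lborel. f0 t * g0 (t + r) - f0 t * g0 (t + r'))"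
    unfolding corr_def by (rule Bochner_Integration.integral_diff[OF i i, symmetric])
  then have "\<bar>corr r - corr r'\<bar> \<le> (LINT t|lborel. \<bar>f0 t * g0 (t + r) - f0 t * g0 (t + r')\<bar>)" by simp
  also have "\<dots> \<le> (LINT t|lborel. Mf * B * \<bar>r - r'\<bar> powr b * indicat_real {0..T} t)"
  proof (rule integral_mono)
    show "integrable lborel (\<lambda>t. \<bar>f0 t * g0 (t + r) - f0 t * g0 (t + r')\<bar>)" by (intro integrable_abs Bochner_Integration.integrable_diff i)
    show "integrable lborel (\<lambda>t::real. Mf * B * \<bar>r - r'\<bar> powr b * indicat_real {0..T} t)"
      by (intro integrable_mult_right integrable_real_indicator) (auto simp: emeasure_lborel_Icc_eq)
    fix t
    have "\<bar>g0 (t + r) - g0 (t + r')\<bar> \<le> B * \<bar>r - r'\<bar> powr b" using holder_boundD[OF g, of "t + r" "t + r'"] by (simp add: g0_def)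
    then have "\<bar>f0 t\<bar> * \<bar>g0 (t + r) - g0 (t + r')\<bar> \<le> Mf * (B * \<bar>r - r'\<bar> powr b)" using f0_bound[of t] Mf_nonneg by (intro mult_mono) auto
    then show "\<bar>f0 t * g0 (t + r) - f0 t * g0 (t + r')\<bar> \<le> Mf * B * \<bar>r - r'\<bar> powr b * indicat_real {0..T} t"
      by (auto simp: indicator_def abs_mult right_diff_distrib[symmetric] mult.assoc) (auto simp: f0_def)
  qed
  also have "\<dots> = Mf * B * T * \<bar>r - r'\<bar> powr b" using T by simp
  finally show "\<bar>corr r - corr r'\<bar> \<le> Mf * B * T * \<bar>r - r'\<bar> powr b" .
qed

lemma corr_cont: "continuous_on S corr" by (rule holder_bound_continuous[OF corr_holder ab(2)])

lemma corr_zero: "r \<ge> T \<Longrightarrow> corr r = 0"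
proof -
  assume "r \<ge> T"
  then have "(\<lambda>t. f0 t * g0 (t + r)) = (\<lambda>_. 0)" using g0_zero by (auto simp: f0_def fun_eq_iff)
  then show ?thesis unfolding corr_def by simp
qed

lemma corr_second_difference:
  assumes "0 \<le> r" "0 \<le> v" "0 \<le> w"
  shows "(LINT t|lborel. indicat_real {0<..<T} t * ((f0 t - f0 (t - v)) * (g0 (t + r) - g0 (t + r + w))))
    = corr r - corr (r + w) - corr (r + v) + corr (r + v + w)"
proof -
  have "indicat_real {0<..<T} t * ((f0 t - f0 (t - v)) * (g0 (t + r) - g0 (t + r + w))) =
     f0 (t - 0) * g0 (t + r) - f0 (t - 0) * g0 (t + (r + w)) - f0 (t - v) * g0 (t + r) + f0 (t - v) * g0 (t + (r + w))" for t
  proof -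
    consider "t \<le> 0" | "t \<ge> T" | "0 < t" "t < T" by linarith
    then show ?thesis
    proof cases
      case 2
      then show ?thesis using assms g0_zero[of "t + r"] g0_zero[of "t + (r + w)"] by (simp add: f0_def)
    qed (use assms in \<open>auto simp: f0_def algebra_simps\<close>)
  qed
  then have "(LINT t|lborel. indicat_real {0<..<T} t * ((f0 t - f0 (t - v)) * (g0 (t + r) - g0 (t + r + w)))) =
    (LINT t|lborel. f0 (t - 0) * g0 (t + r) - f0 (t - 0) * g0 (t + (r + w)) - f0 (t - v) * g0 (t + r) + f0 (t - v) * g0 (t + (r + w)))"
    by simp
  also have "\<dots> = corr (r + 0) - corr (r + w + 0) - corr (r + v) + corr (r + w + v)"
    unfolding corr_shift[symmetric]
    by (subst Bochner_Integration.integral_add Bochner_Integration.integral_diff;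
        (intro Bochner_Integration.integrable_add Bochner_Integration.integrable_diff corr_integrable)?)+ simp
  finally show ?thesis by (simp add: add_ac)
qed

lemma FL_meas [measurable]: "FL \<in> borel_measurable borel" unfolding FL_def[abs_def] by measurable
lemma GR_meas [measurable]: "GR \<in> borel_measurable borel" unfolding GR_def[abs_def] by measurable

lemma GRabs_meas [measurable]: "GRabs \<in> borel_measurable borel"
  unfolding GRabs_def[abs_def] by measurable

text \<open>The integrand in all five variables: (a, b) averages the shift, t is time, (v, w) are
  the kernel variables. The nesting of pairs fixes the two orders of integration to be compared: (v,
  w) innermost leads to \<open>cross\<close>, and ((a, b), t) innermost to
  \<open>corr\<close>.\<close>

definition kernel_prod :: "real \<Rightarrow> ((real \<times> real) \<times> real) \<times> (real \<times> real) \<Rightarrow> real" where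
  "kernel_prod h = (\<lambda>(((a, b), t), (v, w)). (indicat_real {0<..h} a * indicat_real {0<..h} b * indicat_real {0<..<T} t) *
     ((frac_kernel \<theta> v * (f0 t - f0 (t - v))) * (frac_kernel (1 - \<theta>) w * (g0 (t + (a + b)) - g0 (t + (a + b) + w)))))"

lemma one_minus_theta: "0 < 1 - \<theta>" "1 - \<theta> < 1" using \<theta> by auto

text \<open>\<open>FLabs\<close> is integrable in t, \<open>GRabs\<close> is bounded because t + (a
  + b) > 0 on the support, and the square of the averages has finite area.\<close>

lemma kernel_prod_integrable: "integrable lborel (kernel_prod h)"
proof (rule integrableI_bounded)
  have [measurable]: "kernel_prod h \<in> borel_measurable borel"
    unfolding kernel_prod_def split_beta' borel_prod[symmetric] by measurable
  then show "kernel_prod h \<in> borel_measurable lborel" by simp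
  obtain C where C: "C \<ge> 0" "\<And>t. t > 0 \<Longrightarrow> GRabs t \<le> ennreal C" using GRabs_bounded by blast
  have "(\<integral>\<^sup>+p. ennreal (norm (kernel_prod h p)) \<partial>lborel) = (\<integral>\<^sup>+X. \<integral>\<^sup>+Y. ennreal (norm (kernel_prod h (X, Y))) \<partial>lborel \<partial>lborel)"
    by (rule lborel_nn_integral_iterated) measurable
  also have "\<dots> \<le> (\<integral>\<^sup>+X. (case X of (p, t) \<Rightarrow> (ennreal C * (case p of (a, b) \<Rightarrow> indicator {0<..h} a * indicator {0<..h} b)) * (FLabs t * indicator {0<..<T} t)) \<partial>lborel)"
  proof (rule nn_integral_mono)
    fix X :: "(real \<times> real) \<times> real"
    obtain a b t where X: "X = ((a, b), t)" by (metis surj_pair)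
    let ?i = "indicat_real {0<..h} a * indicat_real {0<..h} b * indicat_real {0<..<T} t"
    have "(\<integral>\<^sup>+Y. ennreal (norm (kernel_prod h (X, Y))) \<partial>lborel) =
      (\<integral>\<^sup>+Y. (case Y of (v, w) \<Rightarrow> (ennreal ?i * ennreal (frac_kernel \<theta> v * \<bar>f0 t - f0 (t - v)\<bar>)) * ennreal (frac_kernel (1 - \<theta>) w * \<bar>g0 (t + (a + b)) - g0 (t + (a + b) + w)\<bar>)) \<partial>lborel)"
      using frac_kernel_nonneg[OF \<theta>] frac_kernel_nonneg[OF one_minus_theta]
      by (intro nn_integral_cong) (auto simp: X kernel_prod_def abs_mult ennreal_mult''[symmetric] mult.assoc split: prod.splits)
    also have "\<dots> = (ennreal ?i * FLabs t) * GRabs (t + (a + b))"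
      unfolding GRabs_def FLabs_def by (subst lborel_nn_product_integral) (auto simp: nn_integral_cmult)
    also have "\<dots> \<le> (ennreal ?i * FLabs t) * ennreal C"
    proof (cases "?i = 0")
      case False
      then have "t + (a + b) > 0" by (auto simp: indicator_def split: if_splits)
      then show ?thesis by (intro mult_left_mono C) auto
    next
      case True
      show ?thesis unfolding True by simp
    qed
    also have "\<dots> = (case X of (p, t) \<Rightarrow> (ennreal C * (case p of (a, b) \<Rightarrow> indicator {0<..h} a * indicator {0<..h} b)) * (FLabs t * indicator {0<..<T} t))"
      by (auto simp: X indicator_def mult_ac)
    finally show "(\<integral>\<^sup>+Y. ennreal (norm (kernel_prod h (X, Y))) \<partial>lborel) \<le> (case X of (p, t) \<Rightarrow> (ennreal C * (case p of (a, b) \<Rightarrow> indicator {0<..h} a * indicator {0<..h} b)) * (FLabs t * indicator {0<..<T} t))" .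
  qed
  also have "\<dots> = (\<integral>\<^sup>+p. ennreal C * (case p of (a, b) \<Rightarrow> indicator {0<..h} a * indicator {0<..h} b) \<partial>lborel) * (\<integral>\<^sup>+t. FLabs t * indicator {0<..<T} t \<partial>lborel)"
  proof (rule lborel_nn_product_integral)
    show "(\<lambda>p. ennreal C * (case p of (a, b) \<Rightarrow> indicator {0<..h} a * indicator {0<..h} b)) \<in> borel_measurable (borel :: (real \<times> real) measure)"
      unfolding borel_prod[symmetric] by measurable
  qed measurable
  also have "(\<integral>\<^sup>+p. ennreal C * (case p of (a, b) \<Rightarrow> indicator {0<..h} a * indicator {0<..h} b) \<partial>lborel) =
     ennreal C * ((\<integral>\<^sup>+a. indicator {0<..h} a \<partial>lborel) * (\<integral>\<^sup>+b. indicator {0<..h} b \<partial>lborel))"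
  proof (subst nn_integral_cmult)
    show "(\<lambda>p. case p of (a, b) \<Rightarrow> (indicator {0<..h} a * indicator {0<..h} b :: ennreal)) \<in> borel_measurable (lborel :: (real \<times> real) measure)"
      unfolding split_beta' lborel_prod[symmetric] by measurable
  qed (subst lborel_nn_product_integral, auto)
  also have "\<dots> * (\<integral>\<^sup>+t. FLabs t * indicator {0<..<T} t \<partial>lborel) < \<infinity>"
  proof -
    have "emeasure lborel {0<..h} < \<infinity>" by (cases "0 \<le> h") auto
    then show ?thesis using FLabs_finite by (auto simp: ennreal_mult_less_top)
  qed
  finally show "(\<integral>\<^sup>+p. ennreal (norm (kernel_prod h p)) \<partial>lborel) < \<infinity>" .
qed

lemma FLabs_AE: "AE t in lborel. t \<in> {0<..<T} \<longrightarrow> FLabs t < \<infinity>"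
proof -
  have "AE t in lborel. FLabs t * indicator {0<..<T} t \<noteq> \<infinity>"
    using FLabs_finite by (intro nn_integral_noteq_infinite) auto
  then show ?thesis by eventually_elim (auto simp: less_top)
qed

lemma GR_integrable: "t > 0 \<Longrightarrow> integrable lborel (\<lambda>w. frac_kernel (1 - \<theta>) w * (g0 t - g0 (t + w)))"
proof -
  assume t: "t > 0"
  obtain C where C: "C \<ge> 0" "\<And>t. t > 0 \<Longrightarrow> GRabs t \<le> ennreal C" using GRabs_bounded by blast
  have "(\<integral>\<^sup>+w. ennreal (norm (frac_kernel (1 - \<theta>) w * (g0 t - g0 (t + w)))) \<partial>lborel) = GRabs t"
    unfolding GRabs_def using frac_kernel_nonneg[OF one_minus_theta] by (intro nn_integral_cong) (simp add: abs_mult)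
  also have "\<dots> < \<infinity>" using C(2)[OF t] by (auto intro: le_less_trans)
  finally show ?thesis by (intro integrableI_bounded) auto
qed

lemma GR_bound: "\<exists>C\<ge>0. \<forall>t>0. \<bar>GR t\<bar> \<le> C"
proof -
  obtain C where C: "C \<ge> 0" "\<And>t. t > 0 \<Longrightarrow> GRabs t \<le> ennreal C" using GRabs_bounded by blast
  have "\<bar>GR t\<bar> \<le> C" if t: "t > 0" for t
  proof -
    have "ennreal (norm (GR t)) \<le> (\<integral>\<^sup>+w. ennreal (norm (frac_kernel (1 - \<theta>) w * (g0 t - g0 (t + w)))) \<partial>lborel)"
      unfolding GR_def by (rule integral_norm_bound_ennreal[OF GR_integrable[OF t]])
    also have "\<dots> = GRabs t"
      unfolding GRabs_def using frac_kernel_nonneg[OF one_minus_theta] by (intro nn_integral_cong) (simp add: abs_mult)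
    also have "\<dots> \<le> ennreal C" by (rule C(2)[OF t])
    finally show ?thesis using C(1) by simp
  qed
  then show ?thesis using C(1) by blast
qed

text \<open>Integrating over (v, w) factorises the integrand into FL t and GR (t + (a + b)). The
  integral defining \<open>FL\<close> is known to converge for almost every t only, so the inner
  identity holds almost everywhere.\<close>

lemma kernel_prod_left:
  "(LINT p|lborel. kernel_prod h p) = (LINT p|lborel. (case p of (a, b) \<Rightarrow> indicat_real {0<..h} a * indicat_real {0<..h} b * cross (a + b)))"
proof -
  note I = lborel_integral_iterated[OF kernel_prod_integrable[of h]]
  have "(LINT p|lborel. kernel_prod h p) = (LINT X|lborel. LINT Y|lborel. kernel_prod h (X, Y))" by (rule I(1))
  also have "\<dots> = (LINT p|lborel. LINT t|lborel. LINT Y|lborel. kernel_prod h ((p, t), Y))"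
    by (rule lborel_integral_iterated(1)[OF I(5)])
  also have "\<dots> = (LINT p|lborel. (case p of (a, b) \<Rightarrow> indicat_real {0<..h} a * indicat_real {0<..h} b * cross (a + b)))"
  proof (intro Bochner_Integration.integral_cong refl)
    fix p :: "real \<times> real"
    obtain a b where p: "p = (a, b)" by (metis surj_pair)
    let ?i = "indicat_real {0<..h} a * indicat_real {0<..h} b"
    have [measurable]: "kernel_prod h \<in> borel_measurable (lborel \<Otimes>\<^sub>M lborel)" using kernel_prod_integrable[of h] by (auto simp: lborel_prod)
    have "(LINT t|lborel. LINT Y|lborel. kernel_prod h ((p, t), Y)) =
      (LINT t|lborel. ?i * (indicat_real {0<..<T} t * (FL t * GR (t + (a + b)))))"
    proof (rule integral_cong_AE)
      have m: "(\<lambda>X. LINT Y|lborel. kernel_prod h (X, Y)) \<in> borel_measurable borel" using I(5) by auto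
      have "Pair p \<in> (borel :: real measure) \<rightarrow>\<^sub>M borel \<Otimes>\<^sub>M borel" by (rule measurable_Pair1') simp
      then have "Pair p \<in> borel_measurable (borel :: real measure)" by (simp add: borel_prod)
      then show "(\<lambda>t. LINT Y|lborel. kernel_prod h ((p, t), Y)) \<in> borel_measurable lborel"
        using measurable_compose[OF _ m] by simp
      show "AE t in lborel. (LINT Y|lborel. kernel_prod h ((p, t), Y)) = ?i * (indicat_real {0<..<T} t * (FL t * GR (t + (a + b))))"
        using FLabs_AE
      proof eventually_elim
        case (elim t)
        show ?case
        proof (cases "?i * indicat_real {0<..<T} t = 0")
          case True
          then show ?thesis by (auto simp: kernel_prod_def p)
        next
          case False
          then have t: "0 < t" "t < T" "0 < t + (a + b)" by (auto simp: indicator_def split: if_splits)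
          then have fi: "integrable lborel (\<lambda>v. frac_kernel \<theta> v * (f0 t - f0 (t - v)))" using FL_marchaud(2)[OF t(1,2)] elim by auto
          have "(LINT Y|lborel. kernel_prod h ((p, t), Y)) =
            (LINT Y|lborel. (?i * indicat_real {0<..<T} t) * (case Y of (v, w) \<Rightarrow> (frac_kernel \<theta> v * (f0 t - f0 (t - v))) * (frac_kernel (1 - \<theta>) w * (g0 (t + (a + b)) - g0 (t + (a + b) + w)))))"
            by (intro Bochner_Integration.integral_cong) (auto simp: kernel_prod_def p split: prod.splits)
          also have "\<dots> = (?i * indicat_real {0<..<T} t) * (FL t * GR (t + (a + b)))"
            unfolding integral_mult_right_zero lborel_product_integral(2)[OF fi GR_integrable[OF t(3)]] FL_def GR_def ..
          finally show ?thesis by (simp add: mult.assoc)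
        qed
      qed
    qed measurable
    also have "\<dots> = ?i * cross (a + b)" unfolding cross_def by (rule integral_mult_right_zero)
    finally show "(LINT t|lborel. LINT Y|lborel. kernel_prod h ((p, t), Y)) = (case p of (a, b) \<Rightarrow> indicat_real {0<..h} a * indicat_real {0<..h} b * cross (a + b))"
      by (simp add: p)
  qed
  finally show ?thesis .
qed

text \<open>Integrating over t gives a second difference of \<open>corr\<close> with steps v and w,
  averaged over the square; \<open>box_exchange\<close> moves the steps to h. The integral over ((a,
  b), t) may be iterated where the section is integrable, that is for almost every (v, w).\<close>

lemma kernel_prod_right:
  assumes h: "h > 0"
  shows "(LINT p|lborel. kernel_prod h p) =
    (LINT Y|lborel. (case Y of (v, w) \<Rightarrow> frac_kernel \<theta> v * frac_kernel (1 - \<theta>) w * box_integral v w (\<lambda>y. corr (y + 2 * h) - 2 * corr (y + h) + corr y)))"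
proof -
  note I = lborel_integral_iterated[OF kernel_prod_integrable[of h]]
  let ?R = "\<lambda>Y. (case Y of (v, w) \<Rightarrow> frac_kernel \<theta> v * frac_kernel (1 - \<theta>) w * box_integral v w (\<lambda>y. corr (y + 2 * h) - 2 * corr (y + h) + corr y))"
  have "AE Y in lborel. (LINT X|lborel. kernel_prod h (X, Y)) = ?R Y"
    using I(4)
  proof eventually_elim
    case (elim Y)
    obtain v w where Y: "Y = (v, w)" by (metis surj_pair)
    show ?case
    proof (cases "v > 0 \<and> w > 0")
      case False
      then show ?thesis by (auto simp: Y kernel_prod_def frac_kernel_def case_prod_beta)
    next
      case vw: True
      let ?K = "frac_kernel \<theta> v * frac_kernel (1 - \<theta>) w"
      have "(LINT X|lborel. kernel_prod h (X, Y)) = (LINT p|lborel. LINT t|lborel. kernel_prod h ((p, t), Y))"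
        by (rule lborel_integral_iterated(1)[OF elim])
      also have "\<dots> = (LINT p|lborel. ?K * (case p of (a, b) \<Rightarrow> indicat_real {0<..h} a * indicat_real {0<..h} b *
         (corr (a + b) - corr (a + b + w) - corr (a + b + v) + corr (a + b + v + w))))"
      proof (intro Bochner_Integration.integral_cong refl)
        fix p :: "real \<times> real"
        obtain a b where p: "p = (a, b)" by (metis surj_pair)
        let ?i = "indicat_real {0<..h} a * indicat_real {0<..h} b"
        have "(LINT t|lborel. kernel_prod h ((p, t), Y)) =
          (LINT t|lborel. (?i * ?K) * (indicat_real {0<..<T} t * ((f0 t - f0 (t - v)) * (g0 (t + (a + b)) - g0 (t + (a + b) + w)))))"
          by (intro Bochner_Integration.integral_cong) (auto simp: kernel_prod_def p Y)
        also have "\<dots> = (?i * ?K) * (LINT t|lborel. indicat_real {0<..<T} t * ((f0 t - f0 (t - v)) * (g0 (t + (a + b)) - g0 (t + (a + b) + w))))"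
          by (rule integral_mult_right_zero)
        also have "\<dots> = (?i * ?K) * (corr (a + b) - corr (a + b + w) - corr (a + b + v) + corr (a + b + v + w))"
        proof (cases "?i = 0")
          case False
          then have "a + b \<ge> 0" by (auto simp: indicator_def split: if_splits)
          then show ?thesis using vw by (subst corr_second_difference) auto
        qed simp
        finally show "(LINT t|lborel. kernel_prod h ((p, t), Y)) = ?K * (case p of (a, b) \<Rightarrow> indicat_real {0<..h} a * indicat_real {0<..h} b *
         (corr (a + b) - corr (a + b + w) - corr (a + b + v) + corr (a + b + v + w)))"
          by (simp add: p)
      qed
      also have "\<dots> = ?K * box_integral h h (\<lambda>y. corr y - corr (y + w) - corr (y + v) + corr (y + v + w))"
        unfolding box_integral_def by (rule integral_mult_right_zero)
      also have "box_integral h h (\<lambda>y. corr y - corr (y + w) - corr (y + v) + corr (y + v + w)) =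
         box_integral v w (\<lambda>y. corr (y + 2 * h) - 2 * corr (y + h) + corr y)"
        using vw h by (intro box_exchange corr_cont) auto
      finally show ?thesis by (simp add: Y)
    qed
  qed
  moreover have "(\<lambda>Y. LINT X|lborel. kernel_prod h (X, Y)) \<in> borel_measurable lborel" using I(6) by auto
  moreover have "?R \<in> borel_measurable lborel"
  proof -
    have [measurable]: "corr \<in> borel_measurable borel" by (rule borel_measurable_continuous_onI[OF corr_cont])
    have ind: "indicat_real {0<..x} y = (if 0 < y \<and> y \<le> x then 1 else 0)" for x y by (auto simp: indicator_def)
    show ?thesis unfolding box_integral_def ind split_beta' measurable_lborel1 lborel_prod[symmetric] borel_prod[symmetric] by measurable
  qed
  ultimately have "(LINT Y|lborel. LINT X|lborel. kernel_prod h (X, Y)) = (LINT Y|lborel. ?R Y)"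
    by (intro integral_cong_AE)
  then show ?thesis unfolding I(2) .
qed

text \<open>As a function of v, the indicator of \<open>{0<..v}\<close> at a positive x is the
  indicator of \<open>{x..}\<close>, so integrating it against the kernel gives the tail.\<close>

lemma kernel_tail:
  assumes \<tau>: "0 < \<tau>" "\<tau> < 1"
  shows "(\<integral>\<^sup>+v. ennreal (frac_kernel \<tau> v * indicat_real {0<..v} x) \<partial>lborel) = ennreal (frac_tail \<tau> x)"
    "(LINT v|lborel. frac_kernel \<tau> v * indicat_real {0<..v} x) = frac_tail \<tau> x"
    "integrable lborel (\<lambda>v. frac_kernel \<tau> v * indicat_real {0<..v} x)"
proof -
  have eq: "frac_kernel \<tau> v * indicat_real {0<..v} x = (if x > 0 then frac_kernel \<tau> v * indicat_real {x..} v else 0)" for v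
    by (auto simp: indicator_def)
  show "(LINT v|lborel. frac_kernel \<tau> v * indicat_real {0<..v} x) = frac_tail \<tau> x"
    "integrable lborel (\<lambda>v. frac_kernel \<tau> v * indicat_real {0<..v} x)"
    unfolding eq using frac_kernel_tail_integral[OF \<tau>, of x] by (cases "x > 0"; simp add: frac_tail_def)+
  then show "(\<integral>\<^sup>+v. ennreal (frac_kernel \<tau> v * indicat_real {0<..v} x) \<partial>lborel) = ennreal (frac_tail \<tau> x)"
    using frac_kernel_nonneg[OF \<tau>] by (subst nn_integral_eq_integral) auto
qed

text \<open>Integrating the kernels over v and w turns them into their tails at a and b. In the
  variable s = a + b the tails convolve to 1, and the integral of D over (0, T] remains. Absolute
  convergence comes from D being bounded on [0, T] and zero beyond.\<close>

lemma kernel_average: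
  assumes c: "continuous_on UNIV D" and z: "\<And>y. y \<ge> T \<Longrightarrow> D y = 0"
  shows "(LINT Y|lborel. (case Y of (v, w) \<Rightarrow> frac_kernel \<theta> v * frac_kernel (1 - \<theta>) w * box_integral v w D)) = integral {0..T} D"
proof -
  have [measurable]: "D \<in> borel_measurable borel" by (rule borel_measurable_continuous_onI[OF c])
  obtain M where M: "\<And>x. x \<in> {0..T} \<Longrightarrow> \<bar>D x\<bar> \<le> M" using continuous_bounded_on_interval[OF c] by blast
  let ?k = "frac_tail \<theta>" and ?l = "frac_tail (1 - \<theta>)"
  note k0 = frac_tail_nonneg[OF \<theta>] and l0 = frac_tail_nonneg[OF one_minus_theta]
  have ind: "indicat_real {0<..x} y = (if 0 < y \<and> y \<le> x then 1 else 0)" for x y by (auto simp: indicator_def)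
  \<comment> \<open>The integrand once the tails are formed and s = a + b is substituted. Its
    integrability follows from the convolution identity and is carried back to the four-variable
    integrand \<open>\<Theta>\<close>.\<close>
  define S where "S = (\<lambda>(s, a). D s * (?k a * ?l (s - a)))"
  have Sm [measurable]: "S \<in> borel_measurable borel" unfolding S_def split_beta' borel_prod[symmetric] by measurable
  have conv: "(\<integral>\<^sup>+a. ennreal (?k a * ?l (s - a)) \<partial>lborel) = indicator {0<..} s" for s
  proof (cases "s > 0")
    case True
    then show ?thesis using frac_tail_convolution[OF \<theta>, of s] by simp
  next
    case False
    have eq: "?k a * ?l (s - a) = 0" for a
      using False frac_tail_zero[of a \<theta>] frac_tail_zero[of "s - a" "1 - \<theta>"] by (cases "a \<le> 0") auto
    show ?thesis unfolding eq using False by simp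
  qed
  have fin: "(\<integral>\<^sup>+s. \<integral>\<^sup>+a. ennreal \<bar>S (s, a)\<bar> \<partial>lborel \<partial>lborel) < \<infinity>"
  proof -
    have "(\<integral>\<^sup>+s. \<integral>\<^sup>+a. ennreal \<bar>S (s, a)\<bar> \<partial>lborel \<partial>lborel) = (\<integral>\<^sup>+s. ennreal \<bar>D s\<bar> * indicator {0<..} s \<partial>lborel)"
    proof (rule nn_integral_cong)
      fix s
      have "(\<integral>\<^sup>+a. ennreal \<bar>S (s, a)\<bar> \<partial>lborel) = (\<integral>\<^sup>+a. ennreal \<bar>D s\<bar> * ennreal (?k a * ?l (s - a)) \<partial>lborel)"
        using k0 l0 by (intro nn_integral_cong) (simp add: S_def abs_mult ennreal_mult''[symmetric])
      also have "\<dots> = ennreal \<bar>D s\<bar> * (\<integral>\<^sup>+a. ennreal (?k a * ?l (s - a)) \<partial>lborel)" by (rule nn_integral_cmult) measurable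
      finally show "(\<integral>\<^sup>+a. ennreal \<bar>S (s, a)\<bar> \<partial>lborel) = ennreal \<bar>D s\<bar> * indicator {0<..} s" unfolding conv .
    qed
    also have "\<dots> \<le> (\<integral>\<^sup>+s. ennreal M * indicator {0..T} s \<partial>lborel)"
    proof (rule nn_integral_mono)
      fix s show "ennreal \<bar>D s\<bar> * indicator {0<..} s \<le> ennreal M * indicator {0..T} s"
        using M[of s] z[of s] by (cases "s < T") (auto simp: indicator_def intro: ennreal_leI)
    qed
    also have "\<dots> = ennreal M * emeasure lborel {0..T}" by (rule nn_integral_cmult_indicator) simp
    also have "\<dots> < \<infinity>" using T by (simp add: ennreal_mult_less_top)
    finally show ?thesis .
  qed
  have Sint: "integrable lborel S"
    using fin by (intro integrableI_bounded) (simp_all add: lborel_nn_integral_iterated)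
  define \<Theta> where "\<Theta> = (\<lambda>((a, b), (v, w)). D (a + b) * ((frac_kernel \<theta> v * indicat_real {0<..v} a) * (frac_kernel (1 - \<theta>) w * indicat_real {0<..w} b)))"
  have \<Theta>m [measurable]: "\<Theta> \<in> borel_measurable borel" unfolding \<Theta>_def ind split_beta' borel_prod[symmetric] by measurable
  have abD [measurable]: "(\<lambda>(a, b). D (a + b) * (?k a * ?l b)) \<in> borel_measurable (borel :: (real \<times> real) measure)"
    unfolding split_beta' borel_prod[symmetric] by measurable
  have shiftN: "(\<integral>\<^sup>+b. ennreal \<bar>D (a + b) * (?k a * ?l b)\<bar> \<partial>lborel) = (\<integral>\<^sup>+s. ennreal \<bar>S (s, a)\<bar> \<partial>lborel)" for a
  proof -
    have "(\<integral>\<^sup>+b. ennreal \<bar>D (a + b) * (?k a * ?l b)\<bar> \<partial>lborel) = (\<integral>\<^sup>+b. (\<lambda>s. ennreal \<bar>S (s, a)\<bar>) (b + a) \<partial>lborel)"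
      by (simp add: S_def add.commute)
    also have "\<dots> = (\<integral>\<^sup>+s. ennreal \<bar>S (s, a)\<bar> \<partial>lborel)"
    proof (rule lborel_nn_integral_shift)
      have "(\<lambda>s. (s, a)) \<in> (borel :: real measure) \<rightarrow>\<^sub>M borel \<Otimes>\<^sub>M borel" by measurable
      then show "(\<lambda>s. ennreal \<bar>S (s, a)\<bar>) \<in> borel_measurable borel" by (simp add: borel_prod)
    qed
    finally show ?thesis .
  qed
  have \<Theta>int: "integrable lborel \<Theta>"
  proof (rule integrableI_bounded)
    have "(\<integral>\<^sup>+p. ennreal (norm (\<Theta> p)) \<partial>lborel) = (\<integral>\<^sup>+X. \<integral>\<^sup>+Y. ennreal (norm (\<Theta> (X, Y))) \<partial>lborel \<partial>lborel)"
      by (rule lborel_nn_integral_iterated) measurable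
    also have "\<dots> = (\<integral>\<^sup>+X. (case X of (a, b) \<Rightarrow> ennreal \<bar>D (a + b) * (?k a * ?l b)\<bar>) \<partial>lborel)"
    proof (rule nn_integral_cong)
      fix X :: "real \<times> real"
      obtain a b where X: "X = (a, b)" by (metis surj_pair)
      have "(\<integral>\<^sup>+Y. ennreal (norm (\<Theta> (X, Y))) \<partial>lborel) =
        (\<integral>\<^sup>+Y. (case Y of (v, w) \<Rightarrow> (ennreal \<bar>D (a + b)\<bar> * ennreal (frac_kernel \<theta> v * indicat_real {0<..v} a)) * ennreal (frac_kernel (1 - \<theta>) w * indicat_real {0<..w} b)) \<partial>lborel)"
        using frac_kernel_nonneg[OF \<theta>] frac_kernel_nonneg[OF one_minus_theta]
        by (intro nn_integral_cong) (auto simp: X \<Theta>_def abs_mult ennreal_mult''[symmetric] mult.assoc split: prod.splits)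
      also have "\<dots> = (ennreal \<bar>D (a + b)\<bar> * ennreal (?k a)) * ennreal (?l b)"
        using borel_measurable_integrable[OF kernel_tail(3)[OF \<theta>, of a]] borel_measurable_integrable[OF kernel_tail(3)[OF one_minus_theta, of b]]
        by (subst lborel_nn_product_integral) (auto simp: nn_integral_cmult kernel_tail(1)[OF \<theta>] kernel_tail(1)[OF one_minus_theta])
      finally show "(\<integral>\<^sup>+Y. ennreal (norm (\<Theta> (X, Y))) \<partial>lborel) = (case X of (a, b) \<Rightarrow> ennreal \<bar>D (a + b) * (?k a * ?l b)\<bar>)"
        using k0 l0 by (simp add: X abs_mult ennreal_mult''[symmetric] mult.assoc)
    qed
    also have "\<dots> = (\<integral>\<^sup>+a. \<integral>\<^sup>+b. ennreal \<bar>D (a + b) * (?k a * ?l b)\<bar> \<partial>lborel \<partial>lborel)"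
    proof (subst lborel_nn_integral_iterated)
      have "(\<lambda>X. ennreal \<bar>(case X of (a, b) \<Rightarrow> D (a + b) * (?k a * ?l b))\<bar>) \<in> borel_measurable borel" by measurable
      then show "(\<lambda>X. case X of (a, b) \<Rightarrow> ennreal \<bar>D (a + b) * (?k a * ?l b)\<bar>) \<in> borel_measurable borel" by (simp add: split_beta')
    qed simp
    also have "\<dots> = (\<integral>\<^sup>+a. \<integral>\<^sup>+s. ennreal \<bar>S (s, a)\<bar> \<partial>lborel \<partial>lborel)" unfolding shiftN ..
    also have "\<dots> = (\<integral>\<^sup>+s. \<integral>\<^sup>+a. ennreal \<bar>S (s, a)\<bar> \<partial>lborel \<partial>lborel)"
      by (rule lborel_pair.Fubini') (simp add: lborel_prod split_beta')
    finally show "(\<integral>\<^sup>+p. ennreal (norm (\<Theta> p)) \<partial>lborel) < \<infinity>" using fin by simp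
  qed simp
  note I = lborel_integral_iterated[OF \<Theta>int]
  have inner: "(LINT Y|lborel. \<Theta> ((a, b), Y)) = D (a + b) * (?k a * ?l b)" for a b
  proof -
    have "(LINT Y|lborel. \<Theta> ((a, b), Y)) = (LINT Y|lborel. D (a + b) * (case Y of (v, w) \<Rightarrow> (frac_kernel \<theta> v * indicat_real {0<..v} a) * (frac_kernel (1 - \<theta>) w * indicat_real {0<..w} b)))"
      by (intro Bochner_Integration.integral_cong) (auto simp: \<Theta>_def split: prod.splits)
    also have "\<dots> = D (a + b) * (?k a * ?l b)"
      unfolding integral_mult_right_zero lborel_product_integral(2)[OF kernel_tail(3)[OF \<theta>] kernel_tail(3)[OF one_minus_theta]]
        kernel_tail(2)[OF \<theta>] kernel_tail(2)[OF one_minus_theta] ..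
    finally show ?thesis .
  qed
  have "(LINT Y|lborel. (case Y of (v, w) \<Rightarrow> frac_kernel \<theta> v * frac_kernel (1 - \<theta>) w * box_integral v w D)) = (LINT Y|lborel. LINT X|lborel. \<Theta> (X, Y))"
  proof (intro Bochner_Integration.integral_cong refl)
    fix Y :: "real \<times> real"
    obtain v w where Y: "Y = (v, w)" by (metis surj_pair)
    have "(LINT X|lborel. \<Theta> (X, Y)) = (LINT X|lborel. (frac_kernel \<theta> v * frac_kernel (1 - \<theta>) w) * (case X of (a, b) \<Rightarrow> indicat_real {0<..v} a * indicat_real {0<..w} b * D (a + b)))"
      by (intro Bochner_Integration.integral_cong) (auto simp: \<Theta>_def Y split: prod.splits)
    also have "\<dots> = (frac_kernel \<theta> v * frac_kernel (1 - \<theta>) w) * box_integral v w D"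
      unfolding box_integral_def by (rule integral_mult_right_zero)
    finally show "(case Y of (v, w) \<Rightarrow> frac_kernel \<theta> v * frac_kernel (1 - \<theta>) w * box_integral v w D) = (LINT X|lborel. \<Theta> (X, Y))"
      by (simp add: Y)
  qed
  also have "\<dots> = (LINT X|lborel. LINT Y|lborel. \<Theta> (X, Y))" using I(1,2) by simp
  also have "\<dots> = (LINT a|lborel. LINT b|lborel. LINT Y|lborel. \<Theta> ((a, b), Y))"
    by (rule lborel_integral_iterated(1)[OF I(5)])
  also have "\<dots> = (LINT a|lborel. LINT s|lborel. S (s, a))"
  proof (rule Bochner_Integration.integral_cong[OF refl])
    fix a
    have "(LINT b|lborel. LINT Y|lborel. \<Theta> ((a, b), Y)) = (LINT b|lborel. (\<lambda>s. S (s, a)) (b + a))"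
      unfolding inner by (simp add: S_def add.commute)
    also have "\<dots> = (LINT s|lborel. S (s, a))"
    proof (rule lborel_integral_shift)
      have "(\<lambda>s. (s, a)) \<in> (borel :: real measure) \<rightarrow>\<^sub>M borel \<Otimes>\<^sub>M borel" by measurable
      then show "(\<lambda>s. S (s, a)) \<in> borel_measurable borel" by (simp add: borel_prod)
    qed
    finally show "(LINT b|lborel. LINT Y|lborel. \<Theta> ((a, b), Y)) = (LINT s|lborel. S (s, a))" .
  qed
  also have "\<dots> = (LINT s|lborel. LINT a|lborel. S (s, a))" using lborel_integral_iterated(1,2)[OF Sint] by simp
  also have "\<dots> = (LINT s|lborel. indicat_real {0<..T} s * D s)"
  proof (intro Bochner_Integration.integral_cong refl)
    fix s
    have "(LINT a|lborel. ?k a * ?l (s - a)) = enn2real (\<integral>\<^sup>+a. ennreal (?k a * ?l (s - a)) \<partial>lborel)"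
      using k0 l0 by (intro integral_eq_nn_integral) auto
    also have "\<dots> = indicat_real {0<..} s" unfolding conv by (simp add: indicator_def)
    finally have "(LINT a|lborel. S (s, a)) = D s * indicat_real {0<..} s" by (simp add: S_def)
    then show "(LINT a|lborel. S (s, a)) = indicat_real {0<..T} s * D s"
      using z[of s] by (auto simp: indicator_def)
  qed
  also have "\<dots> = integral {0..T} D" by (rule indicator_integral_HK[OF c])
  finally show ?thesis .
qed

text \<open>The second difference of \<open>corr\<close> is the first difference of \<phi>.
  Exchanging the windows T and h replaces the integral over [0, T] by one over [0, h], where only -
  \<phi> survives, since \<phi> vanishes beyond T.\<close>

lemma cross_average:
  assumes h: "h > 0"
  shows "(LINT p|lborel. (case p of (a, b) \<Rightarrow> indicat_real {0<..h} a * indicat_real {0<..h} b * cross (a + b)))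
    = - integral {0..h} (\<lambda>s. corr (s + h) - corr s)"
proof -
  define \<phi> where "\<phi> = (\<lambda>y. corr (y + h) - corr y)"
  have cs: "continuous_on UNIV (\<lambda>y. corr (y + k))" for k by (rule continuous_on_shift[OF corr_cont])
  have c\<phi>: "continuous_on UNIV \<phi>" unfolding \<phi>_def by (intro continuous_intros cs corr_cont)
  have z: "\<phi> y = 0" if "y \<ge> T" for y using that h corr_zero[of y] corr_zero[of "y + h"] by (simp add: \<phi>_def)
  have "(LINT p|lborel. (case p of (a, b) \<Rightarrow> indicat_real {0<..h} a * indicat_real {0<..h} b * cross (a + b)))
    = integral {0..T} (\<lambda>y. corr (y + 2 * h) - 2 * corr (y + h) + corr y)"
    unfolding kernel_prod_left[symmetric] kernel_prod_right[OF h]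
  proof (rule kernel_average)
    show "continuous_on UNIV (\<lambda>y. corr (y + 2 * h) - 2 * corr (y + h) + corr y)" by (intro continuous_intros cs corr_cont)
    show "corr (y + 2 * h) - 2 * corr (y + h) + corr y = 0" if "y \<ge> T" for y using that h by (simp add: corr_zero)
  qed
  also have "\<dots> = integral {0..T} (\<lambda>y. \<phi> (y + h) - \<phi> y)"
    by (intro Henstock_Kurzweil_Integration.integral_cong) (simp add: \<phi>_def algebra_simps)
  also have "\<dots> = integral {0..h} (\<lambda>y. \<phi> (y + T) - \<phi> y)"
    using T h by (intro window_exchange c\<phi>) auto
  also have "\<dots> = integral {0..h} (\<lambda>y. - \<phi> y)"
    by (intro Henstock_Kurzweil_Integration.integral_cong) (simp add: z)
  also have "\<dots> = - integral {0..h} \<phi>" by (rule integral_neg)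
  finally show ?thesis by (simp add: \<phi>_def)
qed

lemma FL_integrable: "integrable lborel (\<lambda>t. indicat_real {0<..<T} t * FL t)"
proof (rule integrableI_bounded)
  have "ennreal (norm (indicat_real {0<..<T} t * FL t)) \<le> FLabs t * indicator {0<..<T} t" if "t \<in> {0<..<T} \<longrightarrow> FLabs t < \<infinity>" for t
  proof (cases "t \<in> {0<..<T}")
    case True
    then have i: "integrable lborel (\<lambda>v. frac_kernel \<theta> v * (f0 t - f0 (t - v)))" using FL_marchaud(2)[of t] that by auto
    have "ennreal (norm (FL t)) \<le> (\<integral>\<^sup>+v. ennreal (norm (frac_kernel \<theta> v * (f0 t - f0 (t - v)))) \<partial>lborel)"
      unfolding FL_def by (rule integral_norm_bound_ennreal[OF i])
    also have "\<dots> = FLabs t"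
      unfolding FLabs_def using frac_kernel_nonneg[OF \<theta>] by (intro nn_integral_cong) (simp add: abs_mult)
    finally show ?thesis using True by simp
  qed simp
  then have "(\<integral>\<^sup>+t. ennreal (norm (indicat_real {0<..<T} t * FL t)) \<partial>lborel) \<le> (\<integral>\<^sup>+t. FLabs t * indicator {0<..<T} t \<partial>lborel)"
    by (intro nn_integral_mono_AE) (use FLabs_AE in \<open>auto elim!: eventually_mono\<close>)
  also have "\<dots> < \<infinity>" by (rule FLabs_finite)
  finally show "(\<integral>\<^sup>+t. ennreal (norm (indicat_real {0<..<T} t * FL t)) \<partial>lborel) < \<infinity>" .
qed measurable

text \<open>Of \<open>GR\<close> nothing but boundedness is at hand, so the shift is moved onto the
  integrable factor \<open>FL\<close>, where translation is continuous in L1.\<close>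

lemma cross_right_continuous:
  assumes "\<epsilon> > 0" shows "\<exists>d>0. \<forall>r. 0 \<le> r \<and> r < d \<longrightarrow> \<bar>cross r - cross 0\<bar> \<le> \<epsilon>"
proof -
  define F1 where "F1 = (\<lambda>t. indicat_real {0<..<T} t * FL t)"
  have F1: "integrable lborel F1" unfolding F1_def by (rule FL_integrable)
  have [measurable]: "F1 \<in> borel_measurable borel" using F1 by auto
  obtain C where C: "C \<ge> 0" "\<And>t. t > 0 \<Longrightarrow> \<bar>GR t\<bar> \<le> C" using GR_bound by blast
  \<comment> \<open>For r \<ge> 0 the argument of \<open>GR\<close> stays positive, so the cut-off
    at 0 does not alter \<open>cross\<close>, while it makes the factor bounded on the whole
    line.\<close>
  define G1 where "G1 = (\<lambda>t. if t > 0 then GR t else 0)"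
  have [measurable]: "G1 \<in> borel_measurable borel" unfolding G1_def by measurable
  have G1: "\<bar>G1 t\<bar> \<le> C" for t using C by (auto simp: G1_def)
  have FG: "integrable lborel (\<lambda>t. F1 (t + k) * G1 t)" for k
  proof (rule Bochner_Integration.integrable_bound)
    show "integrable lborel (\<lambda>t. C * \<bar>F1 (t + k)\<bar>)" using F1 by (intro integrable_mult_right integrable_abs) (simp add: lborel_integrable_shift)
    show "AE t in lborel. norm (F1 (t + k) * G1 t) \<le> norm (C * \<bar>F1 (t + k)\<bar>)"
    proof (intro AE_I2)
      fix t show "norm (F1 (t + k) * G1 t) \<le> norm (C * \<bar>F1 (t + k)\<bar>)"
        using mult_right_mono[OF G1[of t], of "\<bar>F1 (t + k)\<bar>"] C by (simp add: abs_mult mult.commute)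
    qed
  qed measurable
  have cr: "cross r = (LINT t|lborel. F1 (t + (- r)) * G1 t)" if "r \<ge> 0" for r
  proof -
    have "cross r = (LINT t|lborel. (\<lambda>t. F1 (t + (- r)) * G1 t) (t + r))"
      unfolding cross_def using that by (intro Bochner_Integration.integral_cong) (auto simp: F1_def G1_def indicator_def)
    also have "\<dots> = (LINT t|lborel. F1 (t + (- r)) * G1 t)" by (rule lborel_integral_shift) measurable
    finally show ?thesis .
  qed
  obtain d where d: "d > 0" "\<And>k. norm k < d \<Longrightarrow> (LINT t|lborel. \<bar>F1 (t + k) - F1 t\<bar>) < \<epsilon> / (C + 1)"
    using L1_shift_small[OF F1, of "\<epsilon> / (C + 1)"] assms C by auto
  have "\<bar>cross r - cross 0\<bar> \<le> \<epsilon>" if r: "0 \<le> r" "r < d" for r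
  proof -
    have FG0: "integrable lborel (\<lambda>t. F1 t * G1 t)" using FG[of 0] by simp
    have c0: "cross 0 = (LINT t|lborel. F1 t * G1 t)" using cr[of 0] by simp
    have iF: "integrable lborel (\<lambda>t. \<bar>F1 (t + (- r)) - F1 t\<bar>)"
      using F1 by (intro integrable_abs Bochner_Integration.integrable_diff) (simp_all add: lborel_integrable_shift del: add_uminus_conv_diff)
    have "cross r - cross 0 = (LINT t|lborel. F1 (t + (- r)) * G1 t - F1 t * G1 t)"
      unfolding cr[OF r(1)] c0 by (rule Bochner_Integration.integral_diff[OF FG FG0, symmetric])
    then have "\<bar>cross r - cross 0\<bar> \<le> (LINT t|lborel. \<bar>F1 (t + (- r)) * G1 t - F1 t * G1 t\<bar>)" by simp
    also have "\<dots> \<le> (LINT t|lborel. C * \<bar>F1 (t + (- r)) - F1 t\<bar>)"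
    proof (rule integral_mono)
      show "integrable lborel (\<lambda>t. \<bar>F1 (t + (- r)) * G1 t - F1 t * G1 t\<bar>)"
        by (intro integrable_abs Bochner_Integration.integrable_diff FG FG0)
      show "integrable lborel (\<lambda>t. C * \<bar>F1 (t + (- r)) - F1 t\<bar>)" by (intro integrable_mult_right iF)
      fix t
      show "\<bar>F1 (t + (- r)) * G1 t - F1 t * G1 t\<bar> \<le> C * \<bar>F1 (t + (- r)) - F1 t\<bar>"
        unfolding left_diff_distrib[symmetric] abs_mult using mult_right_mono[OF G1[of t], of "\<bar>F1 (t + (- r)) - F1 t\<bar>"] by (simp add: mult.commute)
    qed
    also have "\<dots> = C * (LINT t|lborel. \<bar>F1 (t + (- r)) - F1 t\<bar>)" by simp
    also have "\<dots> \<le> C * (\<epsilon> / (C + 1))" using d(2)[of "- r"] r C by (intro mult_left_mono) auto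
    also have "\<dots> \<le> \<epsilon>" using C assms by (simp add: field_simps)
    finally show ?thesis .
  qed
  then show ?thesis using d(1) by blast
qed

text \<open>The constant subtracted in g0 cancels, and f0 is f on (0, T), so the forward averages
  are exactly the difference quotients of \<open>corr\<close> at 0.\<close>

lemma corr_quotient: "h > 0 \<Longrightarrow> (corr h - corr 0) / h = diff_integral f g h 0 T"
proof -
  assume h: "h > 0"
  have i: "integrable lborel (\<lambda>t. f0 t * g0 (t + r))" for r using corr_integrable[of 0 r] by simp
  have cg: "continuous_on UNIV (\<lambda>t. g (t + h))" by (rule continuous_on_shift[OF g_cont])
  have "corr h - corr 0 = (LINT t|lborel. f0 t * g0 (t + h) - f0 t * g0 (t + 0))"
    unfolding corr_def by (rule Bochner_Integration.integral_diff[OF i i, symmetric])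
  also have "\<dots> = (LINT t|lborel. indicat_real {0<..T} t * (f t * (g (t + h) - g t)))"
  proof (rule integral_cong_AE)
    show "AE t in lborel. f0 t * g0 (t + h) - f0 t * g0 (t + 0) = indicat_real {0<..T} t * (f t * (g (t + h) - g t))"
      using AE_lborel_singleton[of T]
      by eventually_elim (auto simp: f0_def g0_def indicator_def algebra_simps)
  qed measurable
  also have "\<dots> = integral {0..T} (\<lambda>t. f t * (g (t + h) - g t))"
    by (rule indicator_integral_HK) (intro continuous_intros f_cont g_cont cg)
  finally show ?thesis by (simp add: diff_integral_def)
qed

text \<open>Both sides of \<open>cross_average\<close> are compared with their leading terms of
  order h^2: the left one with h^2 times \<open>cross 0\<close> by right continuity, the right one
  with - h^2 I, because corr s - corr 0 equals s I up to s e. Division by h^2 gives cross 0 = -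
  I.\<close>

lemma gls_value:
  assumes I: "((\<lambda>h. diff_integral f g h 0 T) \<longlongrightarrow> I) (at_right 0)"
  shows "gls_formula \<theta> T f g = I"
proof -
  have "\<bar>cross 0 + I\<bar> \<le> 0 + \<epsilon>" if "\<epsilon> > 0" for \<epsilon>
  proof -
    \<comment> \<open>An error e will come from the left side and 3 e from the right side.\<close>
    define e where "e = \<epsilon> / 4"
    have e: "e > 0" using that by (simp add: e_def)
    obtain d1 where d1: "d1 > 0" "\<And>r. 0 \<le> r \<Longrightarrow> r < d1 \<Longrightarrow> \<bar>cross r - cross 0\<bar> \<le> e"
      using cross_right_continuous[OF e] by blast
    have "\<forall>\<^sub>F h in at_right 0. dist (diff_integral f g h 0 T) I < e" using I e by (rule tendstoD)
    then obtain d2 where d2: "d2 > 0" "\<And>h. 0 < h \<Longrightarrow> h < d2 \<Longrightarrow> dist (diff_integral f g h 0 T) I < e"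
      unfolding eventually_at_right_field by blast
    \<comment> \<open>Arguments up to 2 h occur, both as a + b and as s + h.\<close>
    define h where "h = min d1 d2 / 4"
    have h: "h > 0" "2 * h < d1" "2 * h < d2" using d1(1) d2(1) by (auto simp: h_def min_def)
    have ci: "integrable lborel (\<lambda>p. case p of (a, b) \<Rightarrow> indicat_real {0<..h} a * indicat_real {0<..h} b * cross (a + b))"
    proof -
      have i2: "integrable lborel (\<lambda>(a, b). indicat_real {0<..h} a * ((\<bar>cross 0\<bar> + e) * indicat_real {0<..h} b))"
        by (intro lborel_product_integral indicator_Ioc_integrable integrable_mult_right)
      have [measurable]: "cross \<in> borel_measurable borel" unfolding cross_def[abs_def] by measurable
      show ?thesis
      proof (rule Bochner_Integration.integrable_bound[OF i2])
        show "(\<lambda>p. case p of (a, b) \<Rightarrow> indicat_real {0<..h} a * indicat_real {0<..h} b * cross (a + b)) \<in> borel_measurable lborel"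
          unfolding split_beta' lborel_prod[symmetric] by measurable
        show "AE p in lborel. norm (case p of (a, b) \<Rightarrow> indicat_real {0<..h} a * indicat_real {0<..h} b * cross (a + b))
          \<le> norm (case p of (a, b) \<Rightarrow> indicat_real {0<..h} a * ((\<bar>cross 0\<bar> + e) * indicat_real {0<..h} b))"
        proof (intro AE_I2)
          fix p :: "real \<times> real"
          obtain a b where p: "p = (a, b)" by (metis surj_pair)
          show "norm (case p of (a, b) \<Rightarrow> indicat_real {0<..h} a * indicat_real {0<..h} b * cross (a + b))
            \<le> norm (case p of (a, b) \<Rightarrow> indicat_real {0<..h} a * ((\<bar>cross 0\<bar> + e) * indicat_real {0<..h} b))"
            using d1(2)[of "a + b"] h e by (auto simp: p indicator_def)
        qed
      qed
    qed
    have hh: "(LINT p|lborel. (case p of (a, b) \<Rightarrow> indicat_real {0<..h} a * indicat_real {0<..h} b)) = h * h"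
      "integrable lborel (\<lambda>p. case p of (a, b) \<Rightarrow> indicat_real {0<..h} a * indicat_real {0<..h} b)"
      using lborel_product_integral[OF indicator_Ioc_integrable[of 0 h] indicator_Ioc_integrable[of 0 h]] h by auto
    have "\<bar>(LINT p|lborel. (case p of (a, b) \<Rightarrow> indicat_real {0<..h} a * indicat_real {0<..h} b * cross (a + b))) - h * h * cross 0\<bar>
      = \<bar>LINT p|lborel. (case p of (a, b) \<Rightarrow> indicat_real {0<..h} a * indicat_real {0<..h} b * cross (a + b)) - (case p of (a, b) \<Rightarrow> indicat_real {0<..h} a * indicat_real {0<..h} b) * cross 0\<bar>"
      using ci hh by simp
    also have "\<dots> \<le> (LINT p|lborel. \<bar>(case p of (a, b) \<Rightarrow> indicat_real {0<..h} a * indicat_real {0<..h} b * cross (a + b)) - (case p of (a, b) \<Rightarrow> indicat_real {0<..h} a * indicat_real {0<..h} b) * cross 0\<bar>)"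
      by simp
    also have "\<dots> \<le> (LINT p|lborel. (case p of (a, b) \<Rightarrow> indicat_real {0<..h} a * indicat_real {0<..h} b) * e)"
    proof (rule integral_mono)
      fix p :: "real \<times> real"
      obtain a b where p: "p = (a, b)" by (metis surj_pair)
      show "\<bar>(case p of (a, b) \<Rightarrow> indicat_real {0<..h} a * indicat_real {0<..h} b * cross (a + b)) - (case p of (a, b) \<Rightarrow> indicat_real {0<..h} a * indicat_real {0<..h} b) * cross 0\<bar>
        \<le> (case p of (a, b) \<Rightarrow> indicat_real {0<..h} a * indicat_real {0<..h} b) * e"
        using d1(2)[of "a + b"] h by (auto simp: p indicator_def)
    qed (use ci hh in auto)
    also have "\<dots> = h * h * e" using hh by simp
    finally have A: "\<bar>- integral {0..h} (\<lambda>s. corr (s + h) - corr s) - h * h * cross 0\<bar> \<le> h * h * e"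
      unfolding cross_average[OF h(1)] .
    have cd: "\<bar>corr s - corr 0 - s * I\<bar> \<le> s * e" if "0 \<le> s" "s \<le> 2 * h" for s
    proof (cases "s = 0")
      case False
      then have s: "s > 0" using that by simp
      have "\<bar>(corr s - corr 0) / s - I\<bar> \<le> e" using d2(2)[of s] s that h unfolding corr_quotient[OF s] by (simp add: dist_real_def)
      then have "s * \<bar>(corr s - corr 0) / s - I\<bar> \<le> s * e" using s by simp
      moreover have "s * \<bar>(corr s - corr 0) / s - I\<bar> = \<bar>corr s - corr 0 - s * I\<bar>"
        using s by (simp add: abs_mult_pos[symmetric] abs_mult[symmetric] algebra_simps) (simp add: field_simps)
      ultimately show ?thesis by simp
    qed simp
    have ck: "continuous_on {0..h} (\<lambda>s. corr (s + h) - corr s)"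
      by (intro continuous_intros corr_cont continuous_on_shift[OF corr_cont])
    have "\<bar>integral {0..h} (\<lambda>s. (corr (s + h) - corr s) - h * I)\<bar> \<le> (3 * h * e) * (h - 0)"
    proof (rule abs_integral_le)
      fix s assume s: "s \<in> {0..h}"
      have "(s + h) * e + s * e \<le> 3 * h * e" using s e h by (simp add: algebra_simps)
      then show "\<bar>(corr (s + h) - corr s) - h * I\<bar> \<le> 3 * h * e"
        using cd[of s] cd[of "s + h"] s h by (simp add: algebra_simps abs_le_iff)
    qed (use h in \<open>auto intro!: continuous_intros ck\<close>)
    also have "integral {0..h} (\<lambda>s. (corr (s + h) - corr s) - h * I) = integral {0..h} (\<lambda>s. corr (s + h) - corr s) - h * h * I"
      using h by (subst Henstock_Kurzweil_Integration.integral_diff) (auto intro!: integrable_continuous_real ck)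
    finally have Bd: "\<bar>integral {0..h} (\<lambda>s. corr (s + h) - corr s) - h * h * I\<bar> \<le> h * h * (3 * e)" by (simp add: algebra_simps)
    have "h * h * \<bar>cross 0 + I\<bar> = \<bar>h * h * cross 0 + h * h * I\<bar>" by (simp add: abs_mult distrib_left[symmetric])
    also have "\<dots> \<le> h * h * e + h * h * (3 * e)" using A Bd by linarith
    also have "\<dots> = h * h * \<epsilon>" by (simp add: e_def)
    finally show ?thesis using h by (simp add: mult_le_cancel_left)
  qed
  then have "\<bar>cross 0 + I\<bar> \<le> 0" by (rule field_le_epsilon)
  then have c: "cross 0 = - I" by simp
  have [measurable]: "(\<lambda>t. indicat_real {0<..<T} t * (FL t * GR t)) \<in> borel_measurable borel" by measurable
  have "(LINT t:{0<..<T}|lebesgue. left_frac_deriv \<theta> f t * right_frac_deriv T (1 - \<theta>) (\<lambda>u. g u - left_lim g T) t) = (LINT t|lebesgue. indicat_real {0<..<T} t * (FL t * GR t))"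
    unfolding set_lebesgue_integral_def
  proof (rule integral_cong_AE)
    obtain C where C: "C \<ge> 0" "\<And>t. t > 0 \<Longrightarrow> GRabs t \<le> ennreal C" using GRabs_bounded by blast
    have "AE t in lborel. indicat_real {0<..<T} t *\<^sub>R (left_frac_deriv \<theta> f t * right_frac_deriv T (1 - \<theta>) (\<lambda>u. g u - left_lim g T) t) = indicat_real {0<..<T} t * (FL t * GR t)"
      using FLabs_AE
    proof eventually_elim
      case (elim t)
      show ?case
      proof (cases "t \<in> {0<..<T}")
        case True
        then have "GRabs t < \<infinity>" using C(2)[of t] by (auto intro: le_less_trans)
        then show ?thesis using True elim FL_marchaud(2)[of t] GR_marchaud(2)[of t] by auto
      qed simp
    qed
    then show AE: "AE t in lebesgue. indicat_real {0<..<T} t *\<^sub>R (left_frac_deriv \<theta> f t * right_frac_deriv T (1 - \<theta>) (\<lambda>u. g u - left_lim g T) t) = indicat_real {0<..<T} t * (FL t * GR t)"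
      by (rule AE_completion)
    have m: "(\<lambda>t. indicat_real {0<..<T} t * (FL t * GR t)) \<in> borel_measurable lebesgue" by (rule measurable_completion) simp
    then show "(\<lambda>t. indicat_real {0<..<T} t * (FL t * GR t)) \<in> borel_measurable lebesgue" .
    \<comment> \<open>Indicators of intervals with variable endpoints are rewritten as conditionals,
      for which joint measurability in t and s can be derived.\<close>
    have ind: "indicat_real {x<..<y} s = (if x < s \<and> s < y then 1 else 0)" for x y s :: real by (auto simp: indicator_def)
    have "left_frac_deriv \<theta> f = (\<lambda>t. 1 / Gamma (1 - \<theta>) * (f t / t powr \<theta> +
       \<theta> * (LINT s|lborel. (if 0 < s \<and> s < t then 1 else 0) * ((f t - f s) / (t - s) powr (\<theta> + 1)))))"
    proof (rule ext)
      fix t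
      have "(LINT s:{0<..<t}|lebesgue. (f t - f s) / (t - s) powr (\<theta> + 1)) = (LINT s|lborel. (if 0 < s \<and> s < t then 1 else 0) * ((f t - f s) / (t - s) powr (\<theta> + 1)))"
        unfolding ind[symmetric] by (rule set_lebesgue_eq_lborel) measurable
      then show "left_frac_deriv \<theta> f t = 1 / Gamma (1 - \<theta>) * (f t / t powr \<theta> +
       \<theta> * (LINT s|lborel. (if 0 < s \<and> s < t then 1 else 0) * ((f t - f s) / (t - s) powr (\<theta> + 1))))"
        unfolding left_frac_deriv_def by simp
    qed
    then have "left_frac_deriv \<theta> f \<in> borel_measurable borel" by (simp only:) measurable
    moreover have "right_frac_deriv T (1 - \<theta>) (\<lambda>u. g u - left_lim g T) = (\<lambda>t. 1 / Gamma (1 - (1 - \<theta>)) * ((g t - left_lim g T) / (T - t) powr (1 - \<theta>) +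
       (1 - \<theta>) * (LINT s|lborel. (if t < s \<and> s < T then 1 else 0) * ((g t - left_lim g T - (g s - left_lim g T)) / (s - t) powr (1 - \<theta> + 1)))))"
    proof (rule ext)
      fix t
      have "(LINT s:{t<..<T}|lebesgue. (g t - left_lim g T - (g s - left_lim g T)) / (s - t) powr (1 - \<theta> + 1)) =
        (LINT s|lborel. (if t < s \<and> s < T then 1 else 0) * ((g t - left_lim g T - (g s - left_lim g T)) / (s - t) powr (1 - \<theta> + 1)))"
        unfolding ind[symmetric] by (rule set_lebesgue_eq_lborel) measurable
      then show "right_frac_deriv T (1 - \<theta>) (\<lambda>u. g u - left_lim g T) t = 1 / Gamma (1 - (1 - \<theta>)) * ((g t - left_lim g T) / (T - t) powr (1 - \<theta>) +
       (1 - \<theta>) * (LINT s|lborel. (if t < s \<and> s < T then 1 else 0) * ((g t - left_lim g T - (g s - left_lim g T)) / (s - t) powr (1 - \<theta> + 1))))"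
        unfolding right_frac_deriv_def by simp
    qed
    then have "right_frac_deriv T (1 - \<theta>) (\<lambda>u. g u - left_lim g T) \<in> borel_measurable borel" by (simp only:) measurable
    ultimately have "(\<lambda>t. indicat_real {0<..<T} t *\<^sub>R (left_frac_deriv \<theta> f t * right_frac_deriv T (1 - \<theta>) (\<lambda>u. g u - left_lim g T) t)) \<in> borel_measurable lborel"
      by measurable
    then show "(\<lambda>t. indicat_real {0<..<T} t *\<^sub>R (left_frac_deriv \<theta> f t * right_frac_deriv T (1 - \<theta>) (\<lambda>u. g u - left_lim g T) t)) \<in> borel_measurable lebesgue"
      by (rule measurable_completion)
  qed
  also have "\<dots> = (LINT t|lborel. indicat_real {0<..<T} t * (FL t * GR t))" by (rule integral_completion) simp
  also have "\<dots> = cross 0" by (simp add: cross_def)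
  finally show ?thesis by (simp add: gls_formula_def c)
qed

end

section \<open>Hoelder functions have admissible orders\<close>

lemma power_nn_integral:
  assumes e: "e > - 1" and T: "T > (0::real)"
  shows "(\<integral>\<^sup>+v. ennreal (v powr e) * indicator {0<..<T} v \<partial>lborel) \<le> ennreal (T powr (e + 1) / (e + 1))"
proof -
  have "((\<lambda>x. x powr e) has_integral (T powr (e + 1) / (e + 1))) {0..T}"
    using has_integral_powr_from_0[OF e, of T] T by simp
  then have "((\<lambda>x. if x \<in> {0..T} then x powr e else 0) has_integral (T powr (e + 1) / (e + 1))) UNIV"
    by (subst has_integral_restrict_UNIV)
  then have "(\<integral>\<^sup>+x. ennreal (if x \<in> {0..T} then x powr e else 0) \<partial>lborel) = ennreal (T powr (e + 1) / (e + 1))"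
    by (intro nn_integral_has_integral_lborel) auto
  moreover have "(\<integral>\<^sup>+v. ennreal (v powr e) * indicator {0<..<T} v \<partial>lborel) \<le> (\<integral>\<^sup>+x. ennreal (if x \<in> {0..T} then x powr e else 0) \<partial>lborel)"
    by (intro nn_integral_mono) (auto simp: indicator_def)
  ultimately show ?thesis by simp
qed

lemma abs_power_nn_integral:
  assumes e: "e > - 1" and T: "T > 0" and t: "0 < t" "t < T"
  shows "(\<integral>\<^sup>+u. ennreal (\<bar>t - u\<bar> powr e) * indicator {0<..<T} u \<partial>lborel) \<le> ennreal (2 * (T powr (e + 1) / (e + 1)))"
proof -
  let ?P = "ennreal (T powr (e + 1) / (e + 1))"
  let ?h = "\<lambda>v::real. ennreal (\<bar>v\<bar> powr e) * indicator {- T<..<T} v"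
  have "(\<integral>\<^sup>+u. ennreal (\<bar>t - u\<bar> powr e) * indicator {0<..<T} u \<partial>lborel) \<le> (\<integral>\<^sup>+u. ?h (u + (- t)) \<partial>lborel)"
    using t by (intro nn_integral_mono) (auto simp: indicator_def abs_minus_commute)
  also have "\<dots> = (\<integral>\<^sup>+v. ?h v \<partial>lborel)" by (rule lborel_nn_integral_shift) measurable
  also have "\<dots> \<le> (\<integral>\<^sup>+v. ennreal (v powr e) * indicator {0<..<T} v + (\<lambda>v. ennreal (v powr e) * indicator {0<..<T} v) (- v) \<partial>lborel)"
    by (intro nn_integral_mono) (auto simp: indicator_def abs_if)
  also have "\<dots> = (\<integral>\<^sup>+v. ennreal (v powr e) * indicator {0<..<T} v \<partial>lborel) + (\<integral>\<^sup>+v. (\<lambda>v. ennreal (v powr e) * indicator {0<..<T} v) (- v) \<partial>lborel)"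
    by (rule nn_integral_add) measurable
  also have "(\<integral>\<^sup>+v. (\<lambda>v. ennreal (v powr e) * indicator {0<..<T} v) (- v) \<partial>lborel) = (\<integral>\<^sup>+v. ennreal (v powr e) * indicator {0<..<T} v \<partial>lborel)"
    by (rule nn_integral_lborel_reflect) measurable
  also have "(\<integral>\<^sup>+v. ennreal (v powr e) * indicator {0<..<T} v \<partial>lborel) + (\<integral>\<^sup>+v. ennreal (v powr e) * indicator {0<..<T} v \<partial>lborel) \<le> ?P + ?P"
    by (intro add_mono power_nn_integral e T)
  also have "?P + ?P = ennreal (2 * (T powr (e + 1) / (e + 1)))"
    using e by (subst ennreal_plus[symmetric]) auto
  finally show ?thesis .
qed

lemma holder_kernel_le:
  assumes "holder_bound A a f"
  shows "ennreal (\<bar>f t - f u\<bar> / \<bar>t - u\<bar> powr (1 + \<theta>)) \<le> ennreal A * ennreal (\<bar>t - u\<bar> powr (a - 1 - \<theta>))"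
proof (cases "t = u")
  case False
  have "\<bar>f t - f u\<bar> / \<bar>t - u\<bar> powr (1 + \<theta>) \<le> A * \<bar>t - u\<bar> powr a / \<bar>t - u\<bar> powr (1 + \<theta>)"
    by (intro divide_right_mono holder_boundD[OF assms]) auto
  also have "\<dots> = A * \<bar>t - u\<bar> powr (a - 1 - \<theta>)" using False by (simp add: powr_diff powr_add)
  finally show ?thesis by (simp add: ennreal_mult''[symmetric] ennreal_leI)
qed simp

lemma measurable_lebesgue_on:
  assumes "f \<in> borel_measurable borel" shows "f \<in> borel_measurable (lebesgue_on S)"
  by (rule measurable_restrict_space1, rule measurable_completion) (use assms in simp)

text \<open>The double integral converges because \<bar>t - u\<bar>^(a - 1 - \<theta>) is integrable
  for \<theta> < a; the boundary term uses boundedness of f and \<theta> < 1.\<close>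

lemma holder_W0:
  assumes f: "holder_bound A a f" and a: "0 < \<theta>" "\<theta> < a" "a \<le> 1" and M: "\<And>t. \<bar>f t\<bar> \<le> M" and T: "T > 0"
  shows "W0 \<theta> T f"
proof -
  have [measurable]: "f \<in> borel_measurable borel"
    using a by (intro borel_measurable_continuous_onI holder_bound_continuous[OF f]) auto
  have M0: "M \<ge> 0" using M[of 0] by linarith
  let ?P = "\<lambda>e. T powr (e + 1) / (e + 1)"
  have 1: "(\<integral>\<^sup>+t\<in>{0<..<T}. ennreal (\<bar>f t\<bar> / t powr \<theta>) \<partial>lebesgue) < \<infinity>"
  proof -
    have "(\<integral>\<^sup>+t\<in>{0<..<T}. ennreal (\<bar>f t\<bar> / t powr \<theta>) \<partial>lebesgue) = (\<integral>\<^sup>+t. ennreal (\<bar>f t\<bar> / t powr \<theta>) * indicator {0<..<T} t \<partial>lborel)"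
      by (rule nn_integral_completion) measurable
    also have "\<dots> \<le> (\<integral>\<^sup>+t. ennreal M * (ennreal (t powr (- \<theta>)) * indicator {0<..<T} t) \<partial>lborel)"
    proof (rule nn_integral_mono)
      fix t
      have "\<bar>f t\<bar> / t powr \<theta> \<le> M * t powr (- \<theta>)"
        using mult_right_mono[OF M[of t], of "t powr (- \<theta>)"] by (simp add: powr_minus divide_inverse)
      then show "ennreal (\<bar>f t\<bar> / t powr \<theta>) * indicator {0<..<T} t \<le> ennreal M * (ennreal (t powr (- \<theta>)) * indicator {0<..<T} t)"
        by (auto simp: indicator_def ennreal_mult''[symmetric] intro: ennreal_leI)
    qed
    also have "\<dots> = ennreal M * (\<integral>\<^sup>+t. ennreal (t powr (- \<theta>)) * indicator {0<..<T} t \<partial>lborel)" by (rule nn_integral_cmult) measurable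
    also have "\<dots> \<le> ennreal M * ennreal (?P (- \<theta>))" using a T by (intro mult_left_mono power_nn_integral) auto
    also have "\<dots> < \<infinity>" by (simp add: ennreal_mult_less_top)
    finally show ?thesis .
  qed
  have e: "a - 1 - \<theta> > - 1" using a by simp
  have 2: "(\<integral>\<^sup>+t\<in>{0<..<T}. (\<integral>\<^sup>+u\<in>{0<..<T}. ennreal (\<bar>f t - f u\<bar> / \<bar>t - u\<bar> powr (1 + \<theta>)) \<partial>lebesgue) \<partial>lebesgue) < \<infinity>"
  proof -
    have i: "(\<integral>\<^sup>+u\<in>{0<..<T}. ennreal (\<bar>f t - f u\<bar> / \<bar>t - u\<bar> powr (1 + \<theta>)) \<partial>lebesgue) \<le> ennreal A * ennreal (2 * ?P (a - 1 - \<theta>))"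
      if t: "0 < t" "t < T" for t
    proof -
      have "(\<integral>\<^sup>+u\<in>{0<..<T}. ennreal (\<bar>f t - f u\<bar> / \<bar>t - u\<bar> powr (1 + \<theta>)) \<partial>lebesgue) =
        (\<integral>\<^sup>+u. ennreal (\<bar>f t - f u\<bar> / \<bar>t - u\<bar> powr (1 + \<theta>)) * indicator {0<..<T} u \<partial>lborel)"
        by (rule nn_integral_completion) measurable
      also have "\<dots> \<le> (\<integral>\<^sup>+u. ennreal A * (ennreal (\<bar>t - u\<bar> powr (a - 1 - \<theta>)) * indicator {0<..<T} u) \<partial>lborel)"
        using holder_kernel_le[OF f, of t _ \<theta>] by (intro nn_integral_mono) (auto simp: indicator_def)
      also have "\<dots> = ennreal A * (\<integral>\<^sup>+u. ennreal (\<bar>t - u\<bar> powr (a - 1 - \<theta>)) * indicator {0<..<T} u \<partial>lborel)" by (rule nn_integral_cmult) measurable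
      also have "\<dots> \<le> ennreal A * ennreal (2 * ?P (a - 1 - \<theta>))" by (intro mult_left_mono abs_power_nn_integral e T t) auto
      finally show ?thesis .
    qed
    have "(\<integral>\<^sup>+t\<in>{0<..<T}. (\<integral>\<^sup>+u\<in>{0<..<T}. ennreal (\<bar>f t - f u\<bar> / \<bar>t - u\<bar> powr (1 + \<theta>)) \<partial>lebesgue) \<partial>lebesgue)
      \<le> (\<integral>\<^sup>+t. (ennreal A * ennreal (2 * ?P (a - 1 - \<theta>))) * indicator {0<..<T} t \<partial>lebesgue)"
      using i by (intro nn_integral_mono) (auto simp: indicator_def)
    also have "\<dots> = (ennreal A * ennreal (2 * ?P (a - 1 - \<theta>))) * emeasure lebesgue {0<..<T}"
      by (rule nn_integral_cmult_indicator) simp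
    also have "\<dots> < \<infinity>" using T by (simp add: ennreal_mult_less_top)
    finally show ?thesis .
  qed
  show ?thesis unfolding W0_def using 1 2 by (simp add: measurable_lebesgue_on)
qed

lemma holder_WT:
  assumes g: "holder_bound B b g" and b: "0 < \<tau>" "\<tau> < b" "b \<le> 1" and T: "T > 0"
  shows "WT \<tau> T g"
proof -
  have cg: "continuous_on S g" for S using b by (intro holder_bound_continuous[OF g]) auto
  have [measurable]: "g \<in> borel_measurable borel" by (rule borel_measurable_continuous_onI[OF cg])
  have B: "B \<ge> 0" by (rule holder_bound_nonneg[OF g])
  note l = continuous_left_lim[OF cg, of T]
  let ?P = "\<lambda>e. T powr (e + 1) / (e + 1)"
  have 1: "(SUP t\<in>{0<..<T}. ennreal (\<bar>left_lim g T - g t\<bar> / (T - t) powr \<tau>)) < \<infinity>"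
  proof -
    have "(SUP t\<in>{0<..<T}. ennreal (\<bar>left_lim g T - g t\<bar> / (T - t) powr \<tau>)) \<le> ennreal (B * T powr (b - \<tau>))"
    proof (rule SUP_least)
      fix t assume t: "t \<in> {0<..<T}"
      have "\<bar>g T - g t\<bar> / (T - t) powr \<tau> \<le> B * (T - t) powr b / (T - t) powr \<tau>"
        using holder_boundD[OF g, of T t] t by (intro divide_right_mono) auto
      also have "\<dots> = B * (T - t) powr (b - \<tau>)" by (simp add: powr_diff)
      also have "\<dots> \<le> B * T powr (b - \<tau>)" using t b B by (intro mult_left_mono powr_mono2) auto
      finally show "ennreal (\<bar>left_lim g T - g t\<bar> / (T - t) powr \<tau>) \<le> ennreal (B * T powr (b - \<tau>))"
        unfolding l(2) by (rule ennreal_leI)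
    qed
    also have "\<dots> < \<infinity>" by simp
    finally show ?thesis .
  qed
  have e: "b - 1 - \<tau> > - 1" using b by simp
  have 2: "(SUP t\<in>{0<..<T}. \<integral>\<^sup>+u\<in>{t<..<T}. ennreal (\<bar>g t - g u\<bar> / \<bar>t - u\<bar> powr (1 + \<tau>)) \<partial>lebesgue) < \<infinity>"
  proof -
    have "(SUP t\<in>{0<..<T}. \<integral>\<^sup>+u\<in>{t<..<T}. ennreal (\<bar>g t - g u\<bar> / \<bar>t - u\<bar> powr (1 + \<tau>)) \<partial>lebesgue) \<le> ennreal B * ennreal (2 * ?P (b - 1 - \<tau>))"
    proof (rule SUP_least)
      fix t assume t: "t \<in> {0<..<T}"
      have "(\<integral>\<^sup>+u\<in>{t<..<T}. ennreal (\<bar>g t - g u\<bar> / \<bar>t - u\<bar> powr (1 + \<tau>)) \<partial>lebesgue) =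
        (\<integral>\<^sup>+u. ennreal (\<bar>g t - g u\<bar> / \<bar>t - u\<bar> powr (1 + \<tau>)) * indicator {t<..<T} u \<partial>lborel)"
        by (rule nn_integral_completion) measurable
      also have "\<dots> \<le> (\<integral>\<^sup>+u. ennreal B * (ennreal (\<bar>t - u\<bar> powr (b - 1 - \<tau>)) * indicator {0<..<T} u) \<partial>lborel)"
      proof (rule nn_integral_mono)
        fix u
        show "ennreal (\<bar>g t - g u\<bar> / \<bar>t - u\<bar> powr (1 + \<tau>)) * indicator {t<..<T} u \<le> ennreal B * (ennreal (\<bar>t - u\<bar> powr (b - 1 - \<tau>)) * indicator {0<..<T} u)"
          using holder_kernel_le[OF g, of t u \<tau>] t by (cases "u \<in> {t<..<T}") auto
      qed
      also have "\<dots> = ennreal B * (\<integral>\<^sup>+u. ennreal (\<bar>t - u\<bar> powr (b - 1 - \<tau>)) * indicator {0<..<T} u \<partial>lborel)" by (rule nn_integral_cmult) measurable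
      also have "\<dots> \<le> ennreal B * ennreal (2 * ?P (b - 1 - \<tau>))" using t by (intro mult_left_mono abs_power_nn_integral e T) auto
      finally show "(\<integral>\<^sup>+u\<in>{t<..<T}. ennreal (\<bar>g t - g u\<bar> / \<bar>t - u\<bar> powr (1 + \<tau>)) \<partial>lebesgue) \<le> ennreal B * ennreal (2 * ?P (b - 1 - \<tau>))" .
    qed
    also have "\<dots> < \<infinity>" by (simp add: ennreal_mult_less_top)
    finally show ?thesis .
  qed
  show ?thesis unfolding WT_def using 1 2 l(1) by (auto simp: measurable_lebesgue_on)
qed

section \<open>Integrators that agree on the interval\<close>

lemma left_lim_cong:
  assumes T: "T > 0" and eq: "\<And>t. 0 < t \<Longrightarrow> t < T \<Longrightarrow> g t = h t"
  shows "((g \<longlongrightarrow> l) (at_left T)) = ((h \<longlongrightarrow> l) (at_left T))" "left_lim g T = left_lim h T"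
proof -
  have "\<forall>\<^sub>F t in at_left T. g t = h t"
    using eventually_at_left_field[of "\<lambda>t. g t = h t" T] T eq by auto
  then show *: "((g \<longlongrightarrow> l) (at_left T)) = ((h \<longlongrightarrow> l) (at_left T))" for l by (rule tendsto_cong)
  \<comment> \<open>\<open>Lim\<close> is a choice determined by the limit predicate, so the two
    values agree even where no limit exists.\<close>
  show "left_lim g T = left_lim h T" unfolding left_lim_def t2_space_class.Lim_def by (simp add: *)
qed

lemma WT_cong:
  assumes T: "T > 0" and eq: "\<And>t. 0 < t \<Longrightarrow> t < T \<Longrightarrow> g t = h t"
  shows "WT \<tau> T g = WT \<tau> T h"
proof -
  note c = left_lim_cong[of T g h, OF T eq]
  have m: "(g \<in> borel_measurable (lebesgue_on {0<..<T})) = (h \<in> borel_measurable (lebesgue_on {0<..<T}))"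
    using eq by (intro measurable_cong) (auto simp: space_restrict_space)
  have s: "(SUP t\<in>{0<..<T}. ennreal (\<bar>left_lim h T - g t\<bar> / (T - t) powr \<tau>)) = (SUP t\<in>{0<..<T}. ennreal (\<bar>left_lim h T - h t\<bar> / (T - t) powr \<tau>))"
    using eq by (intro SUP_cong refl) auto
  have i: "(SUP t\<in>{0<..<T}. \<integral>\<^sup>+u\<in>{t<..<T}. ennreal (\<bar>g t - g u\<bar> / \<bar>t - u\<bar> powr (1 + \<tau>)) \<partial>lebesgue) =
    (SUP t\<in>{0<..<T}. \<integral>\<^sup>+u\<in>{t<..<T}. ennreal (\<bar>h t - h u\<bar> / \<bar>t - u\<bar> powr (1 + \<tau>)) \<partial>lebesgue)"
    using eq by (intro SUP_cong refl nn_integral_cong) (auto simp: indicator_def)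
  have "(\<exists>l. (g \<longlongrightarrow> l) (at_left T)) = (\<exists>l. (h \<longlongrightarrow> l) (at_left T))" using c(1) by blast
  then show ?thesis using m s i c(2) by (simp only: WT_def)
qed

lemma gls_formula_cong:
  assumes T: "T > 0" and eq: "\<And>t. 0 < t \<Longrightarrow> t < T \<Longrightarrow> g t = h t"
  shows "gls_formula \<theta> T f g = gls_formula \<theta> T f h"
proof -
  note c = left_lim_cong(2)[of T g h, OF T eq]
  have "right_frac_deriv T (1 - \<theta>) (\<lambda>u. g u - left_lim h T) t = right_frac_deriv T (1 - \<theta>) (\<lambda>u. h u - left_lim h T) t"
    if t: "0 < t" "t < T" for t
  proof -
    have "(LINT s:{t<..<T}|lebesgue. (g t - left_lim h T - (g s - left_lim h T)) / (s - t) powr (1 - \<theta> + 1)) =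
      (LINT s:{t<..<T}|lebesgue. (h t - left_lim h T - (h s - left_lim h T)) / (s - t) powr (1 - \<theta> + 1))"
      unfolding set_lebesgue_integral_def using t eq by (intro Bochner_Integration.integral_cong) (auto simp: indicator_def)
    then show ?thesis using eq[OF t] by (simp add: right_frac_deriv_def)
  qed
  then show ?thesis unfolding gls_formula_def set_lebesgue_integral_def
    by (intro arg_cong[where f=uminus] Bochner_Integration.integral_cong) (auto simp: indicator_def c)
qed

lemma rs_sum_cong:
  assumes P: "is_partition T N t" "T > 0" and eq: "\<And>t. t \<in> {0..T} \<Longrightarrow> g t = h t"
  shows "rs_sum f g N t \<xi> = rs_sum f h N t \<xi>"
proof -
  have "t i \<in> {0..T}" if "i \<le> N" for i
    using partition_facts(3)[OF P, of 0 i] partition_facts(3)[OF P, of i N] that P(1) by (auto simp: is_partition_def)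
  then show ?thesis unfolding rs_sum_def using eq by (intro sum.cong) auto
qed

text \<open>The retraction onto [0, T]. It is 1-Lipschitz, so composing with it extends a Hoelder
  function to the whole line with the same constant and order, and constantly beyond T, as the
  shifted averages require.\<close>

definition clamp_to :: "real \<Rightarrow> real \<Rightarrow> real" where
  "clamp_to T t = max 0 (min T t)"

lemma clamp_to_in: "T \<ge> 0 \<Longrightarrow> clamp_to T t \<in> {0..T}"
  by (auto simp: clamp_to_def)

lemma clamp_to_id: "t \<in> {0..T} \<Longrightarrow> clamp_to T t = t"
  by (auto simp: clamp_to_def)

lemma holder_clamp:
  assumes h: "\<And>t u. t \<in> {0..T} \<Longrightarrow> u \<in> {0..T} \<Longrightarrow> \<bar>f t - f u\<bar> \<le> C * \<bar>t - u\<bar> powr b"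
    and T: "T > 0" and b: "b > 0"
  shows "holder_bound C b (\<lambda>t. f (clamp_to T t))"
proof -
  have C: "C \<ge> 0"
  proof -
    have "0 \<le> C * \<bar>0 - T\<bar> powr b" using h[of 0 T] T by (intro order.trans[OF abs_ge_zero]) auto
    then show ?thesis using T by (simp add: zero_le_mult_iff)
  qed
  show ?thesis unfolding holder_bound_def
  proof (intro allI)
    fix t u
    have "\<bar>clamp_to T t - clamp_to T u\<bar> \<le> \<bar>t - u\<bar>" by (auto simp: clamp_to_def)
    then have "C * \<bar>clamp_to T t - clamp_to T u\<bar> powr b \<le> C * \<bar>t - u\<bar> powr b"
      using C b by (intro mult_left_mono powr_mono2) auto
    then show "\<bar>f (clamp_to T t) - f (clamp_to T u)\<bar> \<le> C * \<bar>t - u\<bar> powr b"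
      using h[OF clamp_to_in clamp_to_in, of t u] T by auto
  qed
qed

text \<open>Replacing Y by its clamped extension changes neither the sums nor the fractional
  derivatives inside the interval. The limit of the forward averages is the common value:
  Riemann-Stieltjes sums converge to it, and every admissible order yields it.\<close>

lemma holder_integrals_agree:
  assumes T: "T > 0" and f: "holder_bound A a f" and M: "\<And>t. \<bar>f t\<bar> \<le> M"
    and Y: "holder_on b {0..T} Y" and ab: "0 < a" "a \<le> 1" "0 < b" "b \<le> 1" "1 < a + b"
  obtains I C where "C \<ge> 0" "has_gls_integral T f Y I" "has_rs_integral T f Y I"
    "\<And>N t \<xi>. is_partition T N t \<Longrightarrow> are_tags N t \<xi> \<Longrightarrow> \<bar>I - rs_sum f Y N t \<xi>\<bar> \<le> C * mesh N t powr (a + b - 1)"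
proof -
  obtain B where B: "\<And>t u. t \<in> {0..T} \<Longrightarrow> u \<in> {0..T} \<Longrightarrow> \<bar>Y t - Y u\<bar> \<le> B * \<bar>t - u\<bar> powr b"
    using Y unfolding holder_on_def dist_real_def by blast
  define g where "g = (\<lambda>t. Y (clamp_to T t))"
  have g: "holder_bound B b g" unfolding g_def by (rule holder_clamp[OF B T ab(3)])
  have gY: "g t = Y t" if "t \<in> {0..T}" for t using that by (simp add: g_def clamp_to_id)
  have gT: "g t = g T" if "t \<ge> T" for t using that T by (simp add: g_def clamp_to_def)
  obtain I C where C: "C \<ge> 0"
    and rs: "\<And>N t \<xi>. is_partition T N t \<Longrightarrow> are_tags N t \<xi> \<Longrightarrow> \<bar>I - rs_sum f g N t \<xi>\<bar> \<le> C * mesh N t powr (a + b - 1)"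
    and lim: "((\<lambda>h. diff_integral f g h 0 T) \<longlongrightarrow> I) (at_right 0)"
    by (rule young_integral[OF f g ab M T]) (rule that)
  have rsY: "\<bar>I - rs_sum f Y N t \<xi>\<bar> \<le> C * mesh N t powr (a + b - 1)" if "is_partition T N t" "are_tags N t \<xi>" for N t \<xi>
    using rs[OF that] rs_sum_cong[OF that(1) T, of g Y f \<xi>] gY by simp
  have adm: "gls_admissible \<theta> T f Y = gls_admissible \<theta> T f g" for \<theta>
    using WT_cong[OF T, of Y g "1 - \<theta>"] gY by (simp add: gls_admissible_def)
  have gls: "has_gls_integral T f Y I"
    unfolding has_gls_integral_def
  proof (intro conjI exI allI impI)
    \<comment> \<open>The midpoint between 1 - b and a; that this interval is nonempty is exactly 1
      < a + b.\<close>
    let ?\<theta> = "(a + (1 - b)) / 2"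
    have "0 < ?\<theta>" "?\<theta> < a" "1 - ?\<theta> < b" "0 < 1 - ?\<theta>" "?\<theta> < 1" using ab by (auto simp: field_simps)
    then show "gls_admissible ?\<theta> T f Y"
      unfolding adm unfolding gls_admissible_def using holder_W0[OF f _ _ ab(2) M T] holder_WT[OF g _ _ ab(4) T] by simp
    fix \<theta> assume "gls_admissible \<theta> T f Y"
    then have \<theta>: "gls_admissible \<theta> T f g" by (simp add: adm)
    then interpret fractional_pair T \<theta> A a B b M f g
    proof unfold_locales
      show "g t = g T" if "T \<le> t" for t by (rule gT[OF that])
    qed (use T f g ab M in \<open>auto simp: gls_admissible_def\<close>)
    have "gls_formula \<theta> T f Y = gls_formula \<theta> T f g" using gY by (intro gls_formula_cong T) auto
    then show "gls_formula \<theta> T f Y = I" using gls_value[OF lim] by simp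
  qed
  have rsI: "has_rs_integral T f Y I"
    unfolding has_rs_integral_def
  proof (intro allI impI)
    fix e :: real assume e: "e > 0"
    \<comment> \<open>Solves d^(a + b - 1) = e / (C + 1); the added 1 covers C = 0 and makes the
      final inequality strict.\<close>
    define d where "d = (e / (C + 1)) powr (1 / (a + b - 1))"
    have d: "d > 0" using e C by (simp add: d_def)
    have "\<bar>rs_sum f Y N t \<xi> - I\<bar> < e" if P: "is_partition T N t" "are_tags N t \<xi>" "mesh N t < d" for N t \<xi>
    proof -
      have "mesh N t powr (a + b - 1) \<le> d powr (a + b - 1)"
        using partition_facts(4)[OF P(1) T] P(3) ab by (intro powr_mono2) auto
      also have "\<dots> = e / (C + 1)" using e C ab by (simp add: d_def powr_powr)
      finally have "C * mesh N t powr (a + b - 1) \<le> C * (e / (C + 1))" using C by (rule mult_left_mono)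
      also have "\<dots> < e" using C e by (simp add: field_simps)
      finally show ?thesis using rsY[OF P(1,2)] by linarith
    qed
    then show "\<exists>d>0. \<forall>N t \<xi>. is_partition T N t \<and> are_tags N t \<xi> \<and> mesh N t < d \<longrightarrow> \<bar>rs_sum f Y N t \<xi> - I\<bar> < e"
      using d by blast
  qed
  show ?thesis by (rule that[OF C gls rsI rsY])
qed

section \<open>Composition with a variable path\<close>

lemma locally_integrable_measurable:
  assumes "locally_integrable (\<phi> :: real ^ 'n \<Rightarrow> real)"
  shows "\<phi> \<in> borel_measurable lebesgue"
proof (rule borel_measurable_LIMSEQ_real)
  have int: "integrable lebesgue (\<lambda>z. indicat_real (cball x r) z * \<phi> z)" for x r
    using assms compact_cball[of x r] by (auto simp: locally_integrable_def set_integrable_def)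
  show "(\<lambda>z. indicat_real (cball 0 (real k)) z * \<phi> z) \<in> borel_measurable lebesgue" for k using int by blast
  show "(\<lambda>k. indicat_real (cball 0 (real k)) z * \<phi> z) \<longlonglongrightarrow> \<phi> z" for z
  proof (rule tendsto_eventually)
    obtain k0 :: nat where "norm z \<le> real k0" using real_arch_simple by blast
    then show "\<forall>\<^sub>F k in sequentially. indicat_real (cball 0 (real k)) z * \<phi> z = \<phi> z"
      unfolding eventually_sequentially by (intro exI[of _ k0]) auto
  qed
qed

lemma locally_integrable_borel_version:
  fixes \<phi> :: "real ^ 'n \<Rightarrow> real"
  assumes "locally_integrable \<phi>"
  obtains f where "f \<in> borel_measurable borel" "AE x in lborel. \<phi> x = f x"
    "\<And>x r. integrable lborel (\<lambda>z. indicat_real (cball x r) z * f z)"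
proof -
  have int: "integrable lebesgue (\<lambda>z. indicat_real (cball x r) z * \<phi> z)" for x r
    using assms compact_cball[of x r] by (auto simp: locally_integrable_def set_integrable_def)
  have "\<phi> \<in> borel_measurable lebesgue" by (rule locally_integrable_measurable[OF assms])
  then obtain f where f: "f \<in> borel_measurable lborel" "AE x in lborel. \<phi> x = f x"
    using completion_ex_borel_measurable_real by blast
  have fm [measurable]: "f \<in> borel_measurable borel" using f(1) by simp
  show ?thesis
  proof (rule that[OF fm f(2)])
    fix x r
    have m: "(\<lambda>z. indicat_real (cball x r) z * f z) \<in> borel_measurable lborel"
    proof -
      have [measurable]: "cball x r \<in> sets borel" by simp
      show ?thesis by measurable
    qed
    have "AE z in lebesgue. indicat_real (cball x r) z * \<phi> z = indicat_real (cball x r) z * f z"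
      using AE_completion[OF f(2)] by eventually_elim simp
    then have "integrable lebesgue (\<lambda>z. indicat_real (cball x r) z * f z)"
      using int[of x r] measurable_completion[OF m] by (subst integrable_cong_AE[symmetric]) auto
    then show "integrable lborel (\<lambda>z. indicat_real (cball x r) z * f z)"
      using m by (subst (asm) integrable_completion)
  qed
qed

lemma test_function_partial_measurable:
  assumes "test_function (\<psi> :: real ^ 'n \<Rightarrow> real)"
  shows "(\<lambda>z. frechet_derivative \<psi> (at z) (axis i 1)) \<in> borel_measurable borel"
proof -
  have "Ck (Suc 0) \<psi>" using assms unfolding test_function_def by blast
  moreover have "axis i (1::real) \<in> Basis" by (simp add: axis_in_Basis_iff)
  ultimately have "continuous_on UNIV (\<lambda>z. frechet_derivative \<psi> (at z) (axis i 1))" by auto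
  then show ?thesis by (rule borel_measurable_continuous_onI)
qed

text \<open>Closed balls of integer radius have finite variation and exhaust the space, which gives
  sigma-finiteness. The weak formulation passes from \<open>\<phi>\<close> to its Borel version
  because they agree almost everywhere.\<close>

lemma BV_loc_variation_dominated:
  fixes \<phi> :: "real ^ 'n \<Rightarrow> real"
  assumes BV: "BV_loc \<phi>"
  obtains f P N where "variation_dominated f (total_variation \<phi>) P N" "AE x in lborel. \<phi> x = f x"
proof -
  obtain f where f: "f \<in> borel_measurable borel" "AE x in lborel. \<phi> x = f x"
    "\<And>x r. integrable lborel (\<lambda>z. indicat_real (cball x r) z * f z)"
    using BV by (auto simp: BV_loc_def elim!: locally_integrable_borel_version)
  obtain P N where PN: "\<And>i. distr_partial_deriv \<phi> i (P i) (N i)"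
    "\<And>i A. A \<in> sets borel \<Longrightarrow> emeasure (P i) A \<le> emeasure (N i) A + emeasure (total_variation \<phi>) A"
    "\<And>i A. A \<in> sets borel \<Longrightarrow> emeasure (N i) A \<le> emeasure (P i) A + emeasure (total_variation \<phi>) A"
    and fin: "\<And>A. A \<in> sets borel \<Longrightarrow> bounded A \<Longrightarrow> emeasure (total_variation \<phi>) A < \<infinity>"
    by (rule total_variation_properties[OF BV]) (rule that)
  have sf: "sigma_finite_measure (total_variation \<phi>)"
  proof
    have sp: "space (total_variation \<phi>) = UNIV" using sets_eq_imp_space_eq[OF sets_total_variation] by simp
    have "(\<Union>k::nat. cball (0 :: real ^ 'n) (real k)) = UNIV" using real_arch_simple by auto
    then show "\<exists>A. countable A \<and> A \<subseteq> sets (total_variation \<phi>) \<and> \<Union> A = space (total_variation \<phi>) \<and> (\<forall>a\<in>A. emeasure (total_variation \<phi>) a \<noteq> \<infinity>)"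
      using fin[of "cball 0 _"] by (intro exI[of _ "range (\<lambda>k::nat. cball 0 (real k))"]) (auto simp: sp sets_total_variation less_top)
  qed
  have "variation_dominated f (total_variation \<phi>) P N"
  proof (rule variation_dominated.intro)
    fix i and \<psi> :: "real ^ 'n \<Rightarrow> real" assume \<psi>: "test_function \<psi>"
    have [measurable]: "(\<lambda>z. frechet_derivative \<psi> (at z) (axis i 1)) \<in> borel_measurable borel"
      by (rule test_function_partial_measurable[OF \<psi>])
    have [measurable]: "f \<in> borel_measurable borel" by (rule f(1))
    have m: "(\<lambda>z. f z * frechet_derivative \<psi> (at z) (axis i 1)) \<in> borel_measurable lborel" by measurable
    have ae: "AE z in lebesgue. f z * frechet_derivative \<psi> (at z) (axis i 1) = \<phi> z * frechet_derivative \<psi> (at z) (axis i 1)"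
      using AE_completion[OF f(2)] by eventually_elim simp
    have "(LINT z|lborel. f z * frechet_derivative \<psi> (at z) (axis i 1)) = (LINT z|lebesgue. f z * frechet_derivative \<psi> (at z) (axis i 1))"
      by (rule integral_completion[symmetric, OF m])
    also have "\<dots> = (LINT z|lebesgue. \<phi> z * frechet_derivative \<psi> (at z) (axis i 1))"
    proof (rule integral_cong_AE[OF measurable_completion[OF m] _ ae])
      have "\<phi> \<in> borel_measurable lebesgue"
        using BV by (intro locally_integrable_measurable) (simp add: BV_loc_def)
      moreover have "(\<lambda>z. frechet_derivative \<psi> (at z) (axis i 1)) \<in> borel_measurable lebesgue" by (rule measurable_completion) simp
      ultimately show "(\<lambda>z. \<phi> z * frechet_derivative \<psi> (at z) (axis i 1)) \<in> borel_measurable lebesgue" by measurable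
    qed
    also have "\<dots> = - ((LINT x|P i. \<psi> x) - (LINT x|N i. \<psi> x))" using PN(1)[of i] \<psi> by (auto simp: distr_partial_deriv_def)
    finally show "(LINT z|lborel. f z * frechet_derivative \<psi> (at z) (axis i 1)) = - ((LINT x|P i. \<psi> x) - (LINT x|N i. \<psi> x))" .
  next
    show "radon_measure (P i)" "radon_measure (N i)" for i using PN(1)[of i] by (auto simp: distr_partial_deriv_def)
  qed (rule f(1) f(3) sets_total_variation sf PN(2) PN(3); assumption)+
  then show ?thesis using that f(2) by blast
qed

lemma approx_limit_osc:
  assumes "variation_dominated f M P N" and ae: "AE x in lborel. \<phi> x = f x" and m: "\<phi> \<in> borel_measurable lebesgue"
  shows "approx_limit \<phi> x l \<longleftrightarrow>
    ((\<lambda>r. variation_dominated.osc f x r l / measure lborel (ball x r)) \<longlongrightarrow> 0) (at_right 0)"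
proof -
  interpret variation_dominated f M P N by fact
  have "(LINT y:ball x r|lebesgue. \<bar>\<phi> y - l\<bar>) = osc x r l" for r
  proof -
    have [measurable]: "ball x r \<in> sets borel" by simp
    have m2: "(\<lambda>y. indicat_real (ball x r) y * \<bar>f y - l\<bar>) \<in> borel_measurable lborel" by measurable
    have [measurable]: "ball x r \<in> sets lebesgue" by simp
    have [measurable]: "\<phi> \<in> borel_measurable lebesgue" by fact
    have m3: "(\<lambda>y. indicat_real (ball x r) y * \<bar>\<phi> y - l\<bar>) \<in> borel_measurable lebesgue" by measurable
    have "(LINT y:ball x r|lebesgue. \<bar>\<phi> y - l\<bar>) = (LINT y|lebesgue. indicat_real (ball x r) y * \<bar>f y - l\<bar>)"
      unfolding set_lebesgue_integral_def real_scaleR_def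
    proof (rule integral_cong_AE[OF m3 measurable_completion[OF m2]])
      show "AE y in lebesgue. indicat_real (ball x r) y * \<bar>\<phi> y - l\<bar> = indicat_real (ball x r) y * \<bar>f y - l\<bar>"
        using AE_completion[OF ae] by eventually_elim simp
    qed
    then show ?thesis unfolding osc_def integral_completion[OF m2] .
  qed
  moreover have "measure lebesgue (ball x r) = measure lborel (ball x r)" for r by (rule measure_completion) simp
  ultimately show ?thesis by (simp add: approx_limit_def)
qed

text \<open>The limit of the ball averages over the radii 1 / (k + 1) is a Borel function, whatever
  \<open>lim\<close> returns where they diverge, and it equals the approximate limit wherever that
  exists.\<close>

lemma exists_lebesgue_representative:
  assumes "variation_dominated f M P N" and ae: "AE x in lborel. \<phi> x = f x" and m: "\<phi> \<in> borel_measurable lebesgue"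
  shows "\<exists>\<phi>'. lebesgue_representative (\<phi> :: real ^ 'n \<Rightarrow> real) \<phi>'"
proof -
  interpret variation_dominated f M P N by fact
  define R where "R = (\<lambda>k::nat. 1 / real (Suc k))"
  have R: "R k > 0" for k by (simp add: R_def)
  \<comment> \<open>The condition on \<open>dist\<close> replaces the indicator of the ball, so that
    joint measurability in x and y can be derived.\<close>
  define av where "av = (\<lambda>k x. (LINT y|lborel. (if dist x y < R k then 1 else 0) * f y) / (unit_ball_vol (real CARD('n)) * R k ^ CARD('n)))"
  have avm: "av k \<in> borel_measurable borel" for k unfolding av_def by measurable
  have "(\<lambda>x. lim (\<lambda>k. av k x)) \<in> borel_measurable borel" by (rule borel_measurable_lim_metric[OF avm])
  moreover have "lim (\<lambda>k. av k x) = l" if al: "approx_limit \<phi> x l" for x l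
  proof (rule limI)
    have "((\<lambda>r. osc x r l / measure lborel (ball x r)) \<longlongrightarrow> 0) (at_right 0)"
      using al approx_limit_osc[OF assms] by simp
    moreover have "filterlim R (at_right 0) sequentially"
    proof (rule tendsto_imp_filterlim_at_right)
      show "R \<longlonglongrightarrow> 0" using LIMSEQ_inverse_real_of_nat by (simp add: R_def inverse_eq_divide)
      show "\<forall>\<^sub>F k in sequentially. R k > 0" using R by (intro always_eventually) auto
    qed
    ultimately have 0: "(\<lambda>k. osc x (R k) l / measure lborel (ball x (R k))) \<longlonglongrightarrow> 0" by (rule filterlim_compose)
    have "norm (av k x - l) \<le> osc x (R k) l / measure lborel (ball x (R k))" for k
    proof -
      let ?B = "ball x (R k)"
      have mB: "measure lborel ?B = unit_ball_vol (real CARD('n)) * R k ^ CARD('n)" using R[of k] by (simp add: measure_ball_cart)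
      have pos: "measure lborel ?B > 0" unfolding mB using R[of k] by simp
      have "(LINT y|lborel. (if dist x y < R k then 1 else 0) * f y) = (LINT y|lborel. indicat_real ?B y * f y)"
        by (intro Bochner_Integration.integral_cong) (auto simp: indicator_def)
      then have "av k x - l = ((LINT y|lborel. indicat_real ?B y * f y) - l * measure lborel ?B) / measure lborel ?B"
        unfolding av_def mB[symmetric] using pos by (simp add: field_simps)
      also have "(LINT y|lborel. indicat_real ?B y * f y) - l * measure lborel ?B = (LINT y|lborel. indicat_real ?B y * f y - l * indicat_real ?B y)"
        by (subst Bochner_Integration.integral_diff[OF f_ball_integrable integrable_mult_right[OF ball_integrable]]) simp
      finally have "norm (av k x - l) = \<bar>LINT y|lborel. indicat_real ?B y * f y - l * indicat_real ?B y\<bar> / measure lborel ?B"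
        using pos by simp
      also have "\<dots> \<le> (LINT y|lborel. \<bar>indicat_real ?B y * f y - l * indicat_real ?B y\<bar>) / measure lborel ?B"
        using pos by (intro divide_right_mono integral_abs_bound) auto
      also have "(LINT y|lborel. \<bar>indicat_real ?B y * f y - l * indicat_real ?B y\<bar>) = osc x (R k) l"
        unfolding osc_def by (intro Bochner_Integration.integral_cong) (auto simp: indicator_def)
      finally show ?thesis .
    qed
    then have "(\<lambda>k. av k x - l) \<longlonglongrightarrow> 0" by (intro Lim_null_comparison[OF always_eventually 0]) auto
    then show "(\<lambda>k. av k x) \<longlonglongrightarrow> l" by (simp add: LIM_zero_iff)
  qed
  ultimately show ?thesis unfolding lebesgue_representative_def by blast
qed

section \<open>Density of good times and uniqueness of continuous versions\<close>

lemma dense_in_interval: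
  assumes "\<And>c d. 0 \<le> c \<Longrightarrow> c < d \<Longrightarrow> d \<le> T \<Longrightarrow> \<exists>y\<in>S. c < y \<and> y < (d::real)" and "T > 0"
  shows "{0..T} \<subseteq> closure S"
proof
  fix x assume x: "x \<in> {0..T}"
  show "x \<in> closure S" unfolding closure_approachable
  proof (intro allI impI)
    fix e :: real assume "e > 0"
    then have "\<exists>y\<in>S. max 0 (x - e) < y \<and> y < min T (x + e)" using x assms(2) by (intro assms(1)) auto
    then obtain y where "y \<in> S" "max 0 (x - e) < y" "y < min T (x + e)" by blast
    then show "\<exists>y\<in>S. dist y x < e" by (intro bexI[of _ y]) (auto simp: dist_real_def abs_less_iff)
  qed
qed

text \<open>The set of equality has full measure, so it meets every subinterval and is dense; the
  identity passes to limits, the endpoints included.\<close>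

lemma continuous_eq_of_AE:
  fixes Z Z' :: "real \<Rightarrow> real"
  assumes "continuous_on {0..T} Z" "continuous_on {0..T} Z'" and ae: "AE t in lebesgue_on {0..T}. Z t = Z' t" and T: "T > 0" and t: "t \<in> {0..T}"
  shows "Z t = Z' t"
proof -
  define S where "S = {t \<in> {0<..<T}. Z t = Z' t}"
  have "AE t in lebesgue_on {0<..<T}. Z t = Z' t"
  proof -
    have "AE t in lebesgue. t \<in> {0..T} \<longrightarrow> Z t = Z' t" using ae by (subst (asm) AE_restrict_space_iff) auto
    then have "AE t in lebesgue. t \<in> {0<..<T} \<longrightarrow> Z t = Z' t" by eventually_elim auto
    then show ?thesis by (subst AE_restrict_space_iff) auto
  qed
  note ex = AE_lebesgue_on_interval_ex[OF this]
  have "\<exists>y\<in>S. c < y \<and> y < d" if cd: "0 \<le> c" "c < d" "d \<le> T" for c d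
  proof -
    obtain y where y: "c < y" "y < d" "Z y = Z' y" using ex[OF cd] by blast
    then have "y \<in> S" using cd by (simp add: S_def)
    with y show ?thesis by blast
  qed
  then have "{0..T} \<subseteq> closure S" using T by (rule dense_in_interval)
  then have "t \<in> closure S" using t by (rule subsetD)
  then obtain X where X: "\<And>n. X n \<in> S" "X \<longlonglongrightarrow> t" unfolding closure_sequential by blast
  have X0: "\<forall>n. X n \<in> {0..T}" using X(1) by (auto simp: S_def less_imp_le)
  have 1: "(Z \<circ> X) \<longlonglongrightarrow> Z t" using assms(1) X0 X(2) t unfolding continuous_on_sequentially by blast
  have 2: "(Z' \<circ> X) \<longlonglongrightarrow> Z' t" using assms(2) X0 X(2) t unfolding continuous_on_sequentially by blast
  have "Z \<circ> X = Z' \<circ> X" using X(1) by (auto simp: S_def fun_eq_iff)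
  then show ?thesis using 1 2 LIMSEQ_unique by metis
qed

text \<open>Dividing the bound by the volume, of order r^n, leaves a multiple of r^s.\<close>

lemma osc_tendsto_zero:
  assumes "variation_dominated (f :: real ^ 'n \<Rightarrow> real) M P N" and s: "s > 0" and r0: "r0 > 0"
    and b: "\<And>r. 0 < r \<Longrightarrow> r \<le> r0 \<Longrightarrow> variation_dominated.osc f x r l \<le> D * r powr (real CARD('n) + s)"
  shows "((\<lambda>r. variation_dominated.osc f x r l / measure lborel (ball x r)) \<longlongrightarrow> 0) (at_right 0)"
proof (rule Lim_null_comparison)
  interpret variation_dominated f M P N by fact
  let ?u = "unit_ball_vol (real CARD('n))"
  have u: "?u > 0" by simp
  show "((\<lambda>r. D / ?u * r powr s) \<longlongrightarrow> 0) (at_right 0)"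
    by (intro tendsto_mult_right_zero tendsto_zero_powrI[OF tendsto_ident_at tendsto_const _ s])
      (auto simp: eventually_at_filter)
  have "\<forall>\<^sub>F r in at_right 0. r \<in> {0<..<r0}" using r0 by (rule eventually_at_right_real)
  then show "\<forall>\<^sub>F r in at_right 0. norm (osc x r l / measure lborel (ball x r)) \<le> D / ?u * r powr s"
  proof eventually_elim
    case (elim r)
    then have r: "0 < r" "r \<le> r0" by auto
    have m: "measure lborel (ball x r) = ?u * r ^ CARD('n)" using r by (simp add: measure_ball_cart)
    have "norm (osc x r l / measure lborel (ball x r)) = osc x r l / (?u * r ^ CARD('n))"
      unfolding m using osc_nonneg[of x r l] u r by simp
    also have "\<dots> \<le> D * r powr (real CARD('n) + s) / (?u * r ^ CARD('n))"
      using b[OF r] u r by (intro divide_right_mono) auto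
    also have "\<dots> = D / ?u * r powr s" using r by (simp add: powr_add powr_realpow)
    finally show ?case .
  qed
qed

lemma holder_on_continuous:
  assumes "holder_on \<theta> S f" "\<theta> > 0"
  shows "continuous_on S (f :: real \<Rightarrow> 'a::metric_space)"
proof -
  obtain C where C: "\<And>t u. t \<in> S \<Longrightarrow> u \<in> S \<Longrightarrow> dist (f t) (f u) \<le> C * \<bar>t - u\<bar> powr \<theta>"
    using assms(1) unfolding holder_on_def by blast
  have "(f \<longlongrightarrow> f u) (at u within S)" if u: "u \<in> S" for u
  proof -
    have "((\<lambda>t. C * \<bar>t - u\<bar> powr \<theta>) \<longlongrightarrow> C * 0) (at u within S)"
      using assms(2) by (intro tendsto_intros tendsto_zero_powrI[where b=\<theta>]) (auto intro!: tendsto_eq_intros)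
    then have 0: "((\<lambda>t. C * \<bar>t - u\<bar> powr \<theta>) \<longlongrightarrow> 0) (at u within S)" by simp
    have "((\<lambda>t. dist (f t) (f u)) \<longlongrightarrow> 0) (at u within S)"
      by (rule tendsto_sandwich[OF _ _ tendsto_const 0]) (use C u in \<open>auto simp: eventually_at_filter\<close>)
    then show ?thesis by (subst tendsto_dist_iff)
  qed
  then show ?thesis by (simp add: continuous_on_def)
qed

text \<open>A finite potential at X t bounds the oscillation on all small balls about X t, which
  yields the approximate limit together with a rate. Two such points are compared on balls with
  radii comparable to their distance, and the Hoelder bound of X turns distance^s into \<bar>t -
  u\<bar>^(\<alpha> s).\<close>

lemma variable_path_hajlasz:
  fixes \<phi> :: "real ^ 'n \<Rightarrow> real" and X :: "real \<Rightarrow> real ^ 'n"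
  assumes T: "0 < T" and \<alpha>: "0 < \<alpha>" and BV: "BV_loc \<phi>" and X: "holder_on \<alpha> {0..T} X" and s: "0 < s"
    and U: "open U" "X ` {0..T} \<subseteq> U"
    and w: "w = (\<lambda>t. \<integral>\<^sup>+z\<in>U. variability_kernel s (X t) z \<partial>total_variation \<phi>)"
  obtains L C \<eta> where "\<eta> > 0" "C \<ge> 0"
    "\<And>t. t \<in> {0<..<T} \<Longrightarrow> w t < \<infinity> \<Longrightarrow> approx_limit \<phi> (X t) (L t)"
    "\<And>t u. t \<in> {0<..<T} \<Longrightarrow> u \<in> {0<..<T} \<Longrightarrow> w t < \<infinity> \<Longrightarrow> w u < \<infinity> \<Longrightarrow> \<bar>t - u\<bar> \<le> \<eta> \<Longrightarrow>
       \<bar>L t - L u\<bar> \<le> C * \<bar>t - u\<bar> powr (\<alpha> * s) * (enn2real (w t) + enn2real (w u))"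
proof -
  obtain f P N where vd: "variation_dominated f (total_variation \<phi>) P N" and ae: "AE x in lborel. \<phi> x = f x"
    by (rule BV_loc_variation_dominated[OF BV]) (rule that)
  have m\<phi>: "\<phi> \<in> borel_measurable lebesgue" using BV by (intro locally_integrable_measurable) (simp add: BV_loc_def)
  interpret variation_dominated f "total_variation \<phi>" P N by (rule vd)
  obtain A0 where A0: "\<And>t u. t \<in> {0..T} \<Longrightarrow> u \<in> {0..T} \<Longrightarrow> dist (X t) (X u) \<le> A0 * \<bar>t - u\<bar> powr \<alpha>"
    using X unfolding holder_on_def by blast
  have A0': "0 \<le> A0"
  proof -
    have "0 \<le> A0 * \<bar>0 - T\<bar> powr \<alpha>" using A0[of 0 T] T by (intro order.trans[OF zero_le_dist]) auto
    then show ?thesis using T by (simp add: zero_le_mult_iff)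
  qed
  have "compact (X ` {0..T})" using holder_on_continuous[OF X \<alpha>] by (intro compact_continuous_image) auto
  then obtain \<delta> where \<delta>: "\<delta> > 0" "(\<Union>x\<in>X ` {0..T}. ball x \<delta>) \<subseteq> U"
    using compact_subset_open_imp_ball_epsilon_subset[of "X ` {0..T}" U] U by blast
  \<comment> \<open>The oscillation on a ball is controlled by the variation on the ball of five
    times the radius, which has to stay in U.\<close>
  define r0 where "r0 = \<delta> / 5"
  have r0: "r0 > 0" using \<delta> by (simp add: r0_def)
  have bU: "ball (X t) (5 * r) \<subseteq> U" if "t \<in> {0..T}" "r \<le> r0" for t r
  proof -
    have "ball (X t) (5 * r) \<subseteq> ball (X t) \<delta>" using that by (intro subset_ball) (simp add: r0_def)
    also have "\<dots> \<subseteq> U" using \<delta>(2) imageI[OF that(1), of X] by blast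
    finally show ?thesis .
  qed
  define n where "n = real CARD('n)"
  define K where "K = campanato_const s * osc_const s"
  have oc: "osc_const s \<ge> 0" by (simp add: osc_const_def)
  have K: "K \<ge> 0"
  proof -
    have "campanato_const s \<ge> 0" using powr_less_one[of 2 "- s"] s
      by (auto simp: campanato_const_def intro!: mult_nonneg_nonneg add_nonneg_nonneg divide_nonneg_nonneg)
    then show ?thesis using oc by (simp add: K_def)
  qed
  define v where "v = (\<lambda>t. enn2real (w t))"
  have v0: "v t \<ge> 0" for t by (simp add: v_def)
  have ex: "\<exists>l. \<forall>r. 0 < r \<and> r \<le> r0 \<longrightarrow> osc (X t) r l \<le> K * v t * r powr (n + s)"
    if t: "t \<in> {0<..<T}" "w t < \<infinity>" for t
  proof -
    have wt: "(\<integral>\<^sup>+z\<in>U. variability_kernel s (X t) z \<partial>total_variation \<phi>) = ennreal (v t)"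
      using t(2) by (simp add: v_def w)
    have "\<exists>l. \<forall>r. 0 < r \<and> r \<le> r0 \<longrightarrow> osc (X t) r l \<le> campanato_const s * (osc_const s * v t) * r powr (n + s)"
      unfolding n_def
    proof (rule campanato[OF s _ r0])
      show "osc_const s * v t \<ge> 0" using oc v0 by simp
      show "\<exists>a. osc (X t) r a \<le> osc_const s * v t * r powr (real CARD('n) + s)" if "0 < r" "r \<le> r0" for r
        by (rule mean_oscillation[OF that(1) s U(1) bU wt v0]) (use t that in auto)
    qed
    then show ?thesis by (simp add: K_def mult.assoc)
  qed
  \<comment> \<open>The choice depends on t only through the point X t. This settles the case X t =
    X u, where no ball of radius the distance is available for comparison.\<close>
  define lam where "lam = (\<lambda>t. SOME l. \<forall>r. 0 < r \<and> r \<le> r0 \<longrightarrow> osc (X t) r l \<le> K * v t * r powr (n + s))"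
  have lam: "osc (X t) r (lam t) \<le> K * v t * r powr (n + s)" if "t \<in> {0<..<T}" "w t < \<infinity>" "0 < r" "r \<le> r0" for t r
    using someI_ex[OF ex[OF that(1,2)]] that(3,4) by (simp add: lam_def)
  have lamX: "lam t = lam u" if "X t = X u" for t u
    using that by (simp add: lam_def v_def w)
  \<comment> \<open>Makes A0 \<eta>^\<alpha> \<le> r0 / 2, so that the radius 2 d used in the
    comparison stays at most r0; the added 1 covers A0 = 0.\<close>
  define \<eta> where "\<eta> = (r0 / (2 * (A0 + 1))) powr (1 / \<alpha>)"
  have \<eta>: "\<eta> > 0" using r0 A0' by (simp add: \<eta>_def)
  define C where "C = 2 powr (n + s) / unit_ball_vol n * K * A0 powr s"
  have up: "unit_ball_vol n > 0" by (simp add: n_def)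
  have C: "C \<ge> 0" using K up by (simp add: C_def)
  show ?thesis
  proof (rule that[OF \<eta> C, of lam])
    fix t assume t: "t \<in> {0<..<T}" "w t < \<infinity>"
    show "approx_limit \<phi> (X t) (lam t)"
      unfolding approx_limit_osc[OF vd ae m\<phi>]
      by (rule osc_tendsto_zero[OF vd s r0]) (use lam[OF t] in \<open>simp add: n_def\<close>)
  next
    fix t u assume t: "t \<in> {0<..<T}" "u \<in> {0<..<T}" "w t < \<infinity>" "w u < \<infinity>" "\<bar>t - u\<bar> \<le> \<eta>"
    define d where "d = dist (X t) (X u)"
    have dA: "d \<le> A0 * \<bar>t - u\<bar> powr \<alpha>" unfolding d_def using t by (intro A0) auto
    show "\<bar>lam t - lam u\<bar> \<le> C * \<bar>t - u\<bar> powr (\<alpha> * s) * (enn2real (w t) + enn2real (w u))"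
    proof (cases "d = 0")
      case True
      then have "lam t = lam u" by (intro lamX) (simp add: d_def)
      then show ?thesis using C by simp
    next
      case False
      then have d0: "d > 0" by (simp add: d_def)
      have "\<bar>t - u\<bar> powr \<alpha> \<le> \<eta> powr \<alpha>" using t \<alpha> by (intro powr_mono2) auto
      also have "\<dots> = r0 / (2 * (A0 + 1))" using \<alpha> r0 A0' by (simp add: \<eta>_def powr_powr)
      finally have "A0 * \<bar>t - u\<bar> powr \<alpha> \<le> A0 * (r0 / (2 * (A0 + 1)))" using A0' by (rule mult_left_mono)
      also have "\<dots> \<le> r0 / 2" using A0' r0 by (simp add: field_simps)
      finally have d2: "2 * d \<le> r0" using dA by simp
      have "\<bar>lam t - lam u\<bar> \<le> 2 powr (real CARD('n) + s) / unit_ball_vol (real CARD('n)) * (K * v t + K * v u) * d powr s"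
      proof (rule osc_compare[OF s d_def d0 d2])
        show "osc (X t) d (lam t) \<le> K * v t * d powr (real CARD('n) + s)" using lam[OF t(1,3), of d] d0 d2 by (simp add: n_def)
        show "osc (X u) (2 * d) (lam u) \<le> K * v u * (2 * d) powr (real CARD('n) + s)" using lam[OF t(2,4), of "2 * d"] d0 d2 by (simp add: n_def)
      qed (use K v0 in auto)
      also have "\<dots> = 2 powr (n + s) / unit_ball_vol n * (K * (v t + v u)) * d powr s" by (simp add: n_def distrib_left)
      also have "\<dots> \<le> 2 powr (n + s) / unit_ball_vol n * (K * (v t + v u)) * (A0 * \<bar>t - u\<bar> powr \<alpha>) powr s"
        using dA d0 s K up v0 by (intro mult_left_mono powr_mono2) auto
      also have "(A0 * \<bar>t - u\<bar> powr \<alpha>) powr s = A0 powr s * \<bar>t - u\<bar> powr (\<alpha> * s)" using A0' by (simp add: powr_mult powr_powr)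
      finally show ?thesis by (simp add: C_def v_def mult_ac)
    qed
  qed
qed

theorem theorem2p14:
  fixes T \<alpha> s :: real and p :: ennreal
    and \<phi> :: "real ^ 'n \<Rightarrow> real" and X :: "real \<Rightarrow> real ^ 'n"
  assumes "0 < T" and "0 < \<alpha>" and "\<alpha> < 1"
    and "BV_loc \<phi>"
    and "holder_on \<alpha> {0..T} X"
    and "0 < s" and "s < 1"
    and "ennreal (1 / (\<alpha> * s)) < p"
    and "variable_wrt s p T \<phi> X"
  shows "\<exists>Z. regular_version T \<phi> X (\<alpha> * s - enn2real (1 / p)) Z \<and>
    (\<forall>Z'. regular_version T \<phi> X (\<alpha> * s - enn2real (1 / p)) Z' \<longrightarrow> (\<forall>t\<in>{0..T}. Z' t = Z t)) \<and>
    (\<forall>\<gamma> Y. 0 < \<gamma> \<and> \<gamma> < 1 \<and> 1 - \<alpha> * s + enn2real (1 / p) < \<gamma> \<and> holder_on \<gamma> {0..T} Y \<longrightarrow>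
      (\<exists>I. has_gls_integral T Z Y I \<and> has_rs_integral T Z Y I \<and>
        (\<forall>\<epsilon>. 0 < \<epsilon> \<and> \<epsilon> < \<alpha> * s - enn2real (1 / p) - 1 + \<gamma> \<longrightarrow>
          (\<exists>c>0. \<forall>N t \<xi>. refining_partitions T N t \<and> (\<forall>k\<ge>1. are_tags (N k) (t k) (\<xi> k)) \<longrightarrow>
            (\<forall>k\<ge>1. \<bar>I - rs_sum Z Y (N k) (t k) (\<xi> k)\<bar>
              \<le> c * mesh (N k) (t k) powr (\<alpha> * s - enn2real (1 / p) - 1 + \<gamma> - \<epsilon>))))))"
proof -
  note T = assms(1) and \<alpha> = assms(2) and BV = assms(4) and X = assms(5) and s = assms(6)
  define q where "q = enn2real (1 / p)"
  define \<beta> where "\<beta> = \<alpha> * s - q"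
  have as: "\<alpha> * s > 0" "\<alpha> * s < 1" using assms mult_strict_mono[of \<alpha> 1 s 1] by auto
  have q: "0 \<le> q" "q < \<alpha> * s"
  proof -
    show "0 \<le> q" by (simp add: q_def)
    \<comment> \<open>For finite p this is the strict lower bound on p, inverted; for infinite p the
      value of q is 0.\<close>
    show "q < \<alpha> * s"
    proof (cases "p = \<infinity>")
      case True
      then show ?thesis using as by (simp add: q_def)
    next
      case False
      define r where "r = enn2real p"
      have pr: "p = ennreal r" using False by (simp add: r_def less_top)
      have r: "1 / (\<alpha> * s) < r" using assms(8) as unfolding pr by (subst (asm) ennreal_less_iff) auto
      then have "r > 0" using as by (auto intro: less_trans[rotated])
      moreover have "q = 1 / r" using \<open>r > 0\<close> by (simp add: q_def pr divide_ennreal flip: ennreal_1)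
      moreover have "1 / r < \<alpha> * s" using r as \<open>r > 0\<close> by (simp add: field_simps)
      ultimately show ?thesis by simp
    qed
  qed
  have \<beta>: "0 < \<beta>" "\<beta> \<le> 1" using q as by (auto simp: \<beta>_def)
  have p0: "p > 0" using assms(8) by (rule le_less_trans[rotated]) simp
  obtain U where U: "open U" "X ` {0..T} \<subseteq> U"
    and Lp: "in_Lp p T (\<lambda>t. \<integral>\<^sup>+z\<in>U. variability_kernel s (X t) z \<partial>total_variation \<phi>)"
    using assms(9) unfolding variable_wrt_def by blast
  define w where "w = (\<lambda>t. \<integral>\<^sup>+z\<in>U. variability_kernel s (X t) z \<partial>total_variation \<phi>)"
  define G where "G = {t \<in> {0<..<T}. w t < \<infinity>}"
  obtain K where GAE: "AE t in lebesgue_on {0<..<T}. t \<in> G" and K: "K \<ge> 0"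
    and good: "\<And>c d. 0 \<le> c \<Longrightarrow> c < d \<Longrightarrow> d \<le> T \<Longrightarrow> \<exists>y\<in>G. c < y \<and> y < d \<and> enn2real (w y) \<le> K * (d - c) powr (- q)"
    by (rule in_Lp_good_points[OF Lp[folded w_def] p0 T, folded G_def q_def]) (rule that)
  obtain L C \<eta> where \<eta>: "\<eta> > 0" and C: "C \<ge> 0"
    and al: "\<And>t. t \<in> {0<..<T} \<Longrightarrow> w t < \<infinity> \<Longrightarrow> approx_limit \<phi> (X t) (L t)"
    and haj: "\<And>t u. t \<in> {0<..<T} \<Longrightarrow> u \<in> {0<..<T} \<Longrightarrow> w t < \<infinity> \<Longrightarrow> w u < \<infinity> \<Longrightarrow> \<bar>t - u\<bar> \<le> \<eta> \<Longrightarrow>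
       \<bar>L t - L u\<bar> \<le> C * \<bar>t - u\<bar> powr (\<alpha> * s) * (enn2real (w t) + enn2real (w u))"
    by (rule variable_path_hajlasz[OF T \<alpha> BV X s U w_def]) (rule that)
  obtain D where D: "D \<ge> 0" "\<And>x y. x \<in> G \<Longrightarrow> y \<in> G \<Longrightarrow> \<bar>x - y\<bar> \<le> \<eta> / 2 \<Longrightarrow> \<bar>L x - L y\<bar> \<le> D * \<bar>x - y\<bar> powr \<beta>"
    unfolding \<beta>_def
  proof (rule hajlasz_holder[of G \<eta> L C "\<alpha> * s" "\<lambda>t. enn2real (w t)" T K q])
    show "\<bar>L x - L y\<bar> \<le> C * \<bar>x - y\<bar> powr (\<alpha> * s) * (enn2real (w x) + enn2real (w y))" if "x \<in> G" "y \<in> G" "\<bar>x - y\<bar> \<le> \<eta>" for x y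
      using that by (intro haj) (auto simp: G_def)
  qed (use C K q good in \<open>auto simp: G_def\<close>)
  \<comment> \<open>Every subinterval contains a good time, so the values at good times determine a
    continuous version on all of [0, T].\<close>
  have clG: "{0..T} \<subseteq> closure G" using good T by (intro dense_in_interval) blast+
  obtain Z0 C' where Z0: "\<And>x. x \<in> G \<Longrightarrow> Z0 x = L x"
    and Z0h: "\<And>x y. x \<in> {0..T} \<Longrightarrow> y \<in> {0..T} \<Longrightarrow> \<bar>Z0 x - Z0 y\<bar> \<le> C' * \<bar>x - y\<bar> powr \<beta>"
  proof (rule local_holder_extension[of G "\<eta> / 2" L D \<beta> T])
    show "\<bar>L x - L y\<bar> \<le> D * \<bar>x - y\<bar> powr \<beta>" if "x \<in> G" "y \<in> G" "\<bar>x - y\<bar> \<le> \<eta> / 2" for x y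
      using that by (rule D(2))
    show "{0..T} \<subseteq> closure G" "D \<ge> 0" "\<beta> > 0" by (rule clG D(1) \<beta>(1))+
    show "\<eta> / 2 > 0" using \<eta> by simp
  qed (rule that)
  define Z where "Z = (\<lambda>t. Z0 (clamp_to T t))"
  have Zh: "holder_bound C' \<beta> Z" unfolding Z_def by (rule holder_clamp[OF Z0h T \<beta>(1)])
  have Zc: "continuous_on S Z" for S by (rule holder_bound_continuous[OF Zh \<beta>(1)])
  have ZL: "Z t = L t" if "t \<in> G" for t using that Z0[OF that] by (auto simp: Z_def G_def clamp_to_id)
  have C': "C' \<ge> 0" by (rule holder_bound_nonneg[OF Zh])
  obtain f P N where vd: "variation_dominated f (total_variation \<phi>) P N" and ae: "AE x in lborel. \<phi> x = f x"
    by (rule BV_loc_variation_dominated[OF BV]) (rule that)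
  have m\<phi>: "\<phi> \<in> borel_measurable lebesgue" using BV by (intro locally_integrable_measurable) (simp add: BV_loc_def)
  obtain \<phi>0 where \<phi>0: "lebesgue_representative \<phi> \<phi>0" using exists_lebesgue_representative[OF vd ae m\<phi>] by blast
  have cv: "composition_version T \<phi> X Z"
    unfolding composition_version_def
  proof (intro conjI allI impI)
    show "\<exists>\<phi>'. lebesgue_representative \<phi> \<phi>'" using \<phi>0 by blast
    show "Z \<in> borel_measurable (restrict_space borel {0..T})"
      by (rule measurable_restrict_space1[OF borel_measurable_continuous_onI[OF Zc]])
    fix \<phi>' assume rep: "lebesgue_representative \<phi> \<phi>'"
    have "AE t in lebesgue. t \<in> {0<..<T} \<longrightarrow> t \<in> G" using GAE by (subst (asm) AE_restrict_space_iff) auto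
    \<comment> \<open>The good times lie in the open interval, while the composition is compared on
      the closed one; the endpoints form a null set.\<close>
    moreover have "AE t in lebesgue. t \<noteq> 0" "AE t in lebesgue. t \<noteq> T"
      by (rule AE_completion[OF AE_lborel_singleton])+
    ultimately have "AE t in lebesgue. t \<in> {0..T} \<longrightarrow> Z t = \<phi>' (X t)"
    proof eventually_elim
      case (elim t)
      show ?case
      proof
        assume "t \<in> {0..T}"
        then have tG: "t \<in> G" using elim by auto
        then have "approx_limit \<phi> (X t) (L t)" by (intro al) (auto simp: G_def)
        then have "\<phi>' (X t) = L t" using rep unfolding lebesgue_representative_def by blast
        then show "Z t = \<phi>' (X t)" using ZL[OF tG] by simp
      qed
    qed
    then show "AE t in lebesgue_on {0..T}. Z t = \<phi>' (X t)" by (subst AE_restrict_space_iff) auto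
  qed
  have hold: "holder_on \<theta> {0..T} Z" if \<theta>: "0 < \<theta>" "\<theta> < \<beta>" for \<theta>
    unfolding holder_on_def
  proof (intro exI ballI)
    fix t u assume tu: "t \<in> {0..T}" "u \<in> {0..T}"
    \<comment> \<open>On a bounded interval order \<beta> implies every lower order, at the cost of
      the factor T^(\<beta> - \<theta>).\<close>
    have "\<bar>t - u\<bar> powr \<beta> = \<bar>t - u\<bar> powr (\<beta> - \<theta>) * \<bar>t - u\<bar> powr \<theta>" by (simp add: powr_add[symmetric])
    also have "\<dots> \<le> T powr (\<beta> - \<theta>) * \<bar>t - u\<bar> powr \<theta>"
      using tu \<theta> by (intro mult_right_mono powr_mono2) auto
    finally have "C' * \<bar>t - u\<bar> powr \<beta> \<le> C' * (T powr (\<beta> - \<theta>) * \<bar>t - u\<bar> powr \<theta>)" using C' by (rule mult_left_mono)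
    then show "dist (Z t) (Z u) \<le> (C' * T powr (\<beta> - \<theta>)) * \<bar>t - u\<bar> powr \<theta>"
      using holder_boundD[OF Zh, of t u] by (simp add: dist_real_def mult.assoc)
  qed
  have reg: "regular_version T \<phi> X \<beta> Z" using cv hold by (simp add: regular_version_def)
  have uniq: "Z' t = Z t" if Z': "regular_version T \<phi> X \<beta> Z'" and t: "t \<in> {0..T}" for Z' t
  proof (rule continuous_eq_of_AE[OF _ _ _ T t])
    \<comment> \<open>Regularity of Z' is given for orders strictly below \<beta>; one of them is
      picked to obtain continuity.\<close>
    have "holder_on (\<beta> / 2) {0..T} Z'" using Z' \<beta> by (simp add: regular_version_def)
    then show "continuous_on {0..T} Z'" by (rule holder_on_continuous) (use \<beta> in simp)
    show "continuous_on {0..T} Z" by (rule Zc)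
    have "AE t in lebesgue_on {0..T}. Z' t = \<phi>0 (X t)" using Z' \<phi>0 by (simp add: regular_version_def composition_version_def)
    moreover have "AE t in lebesgue_on {0..T}. Z t = \<phi>0 (X t)" using cv \<phi>0 by (simp add: composition_version_def)
    ultimately show "AE t in lebesgue_on {0..T}. Z' t = Z t" by eventually_elim simp
  qed
  obtain M where M: "\<And>t. \<bar>Z t\<bar> \<le> M"
  proof -
    have "bounded (Z ` {0..T})" using Zc by (intro compact_imp_bounded compact_continuous_image) auto
    then obtain M where M: "\<forall>z\<in>Z ` {0..T}. norm z \<le> M" unfolding bounded_iff by blast
    have "\<bar>Z t\<bar> \<le> M" for t
    proof -
      have "Z t = Z (clamp_to T t)" using T by (simp add: Z_def clamp_to_id[OF clamp_to_in])
      then show ?thesis using M clamp_to_in[of T t] T by auto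
    qed
    then show ?thesis by (rule that)
  qed
  have int: "\<exists>I. has_gls_integral T Z Y I \<and> has_rs_integral T Z Y I \<and>
        (\<forall>\<epsilon>. 0 < \<epsilon> \<and> \<epsilon> < \<beta> - 1 + \<gamma> \<longrightarrow>
          (\<exists>c>0. \<forall>N t \<xi>. refining_partitions T N t \<and> (\<forall>k\<ge>1. are_tags (N k) (t k) (\<xi> k)) \<longrightarrow>
            (\<forall>k\<ge>1. \<bar>I - rs_sum Z Y (N k) (t k) (\<xi> k)\<bar> \<le> c * mesh (N k) (t k) powr (\<beta> - 1 + \<gamma> - \<epsilon>))))"
    if \<gamma>: "0 < \<gamma>" "\<gamma> < 1" "1 - \<alpha> * s + q < \<gamma>" and Y: "holder_on \<gamma> {0..T} Y" for \<gamma> Y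
  proof -
    have sum1: "1 < \<beta> + \<gamma>" using \<gamma> by (simp add: \<beta>_def)
    obtain I C where C: "C \<ge> 0" and gls: "has_gls_integral T Z Y I" and rs: "has_rs_integral T Z Y I"
      and rate: "\<And>N t \<xi>. is_partition T N t \<Longrightarrow> are_tags N t \<xi> \<Longrightarrow> \<bar>I - rs_sum Z Y N t \<xi>\<bar> \<le> C * mesh N t powr (\<beta> + \<gamma> - 1)"
      by (rule holder_integrals_agree[OF T Zh M Y \<beta> \<gamma>(1) less_imp_le[OF \<gamma>(2)] sum1]) (rule that)
    have "\<exists>c>0. \<forall>N t \<xi>. refining_partitions T N t \<and> (\<forall>k\<ge>1. are_tags (N k) (t k) (\<xi> k)) \<longrightarrow>
            (\<forall>k\<ge>1. \<bar>I - rs_sum Z Y (N k) (t k) (\<xi> k)\<bar> \<le> c * mesh (N k) (t k) powr (\<beta> - 1 + \<gamma> - \<epsilon>))"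
      if \<epsilon>: "0 < \<epsilon>" for \<epsilon>
    proof (intro exI conjI allI impI)
      \<comment> \<open>The mesh is at most T, so T^\<epsilon> absorbs the surplus factor
        mesh^\<epsilon>; the added 1 makes the constant positive also for C = 0. It is fixed before
        the partitions and the tags.\<close>
      show "C * T powr \<epsilon> + 1 > 0" using C by (intro add_nonneg_pos mult_nonneg_nonneg) auto
      fix N t \<xi> k
      assume h: "refining_partitions T N t \<and> (\<forall>k\<ge>1. are_tags (N k) (t k) (\<xi> k))" and k: "1 \<le> (k::nat)"
      have P: "is_partition T (N k) (t k)" and tg: "are_tags (N k) (t k) (\<xi> k)"
        using h k by (auto simp: refining_partitions_def)
      let ?m = "mesh (N k) (t k)"
      have m: "0 < ?m" "?m \<le> T" using partition_facts(4,5)[OF P T] by auto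
      have "?m powr (\<beta> + \<gamma> - 1) = ?m powr \<epsilon> * ?m powr (\<beta> - 1 + \<gamma> - \<epsilon>)" by (simp add: powr_add[symmetric] algebra_simps)
      also have "\<dots> \<le> T powr \<epsilon> * ?m powr (\<beta> - 1 + \<gamma> - \<epsilon>)" using m \<epsilon> by (intro mult_right_mono powr_mono2) auto
      finally have "C * ?m powr (\<beta> + \<gamma> - 1) \<le> C * (T powr \<epsilon> * ?m powr (\<beta> - 1 + \<gamma> - \<epsilon>))" using C by (rule mult_left_mono)
      also have "\<dots> \<le> (C * T powr \<epsilon> + 1) * ?m powr (\<beta> - 1 + \<gamma> - \<epsilon>)" by (simp add: distrib_right mult.assoc)
      finally show "\<bar>I - rs_sum Z Y (N k) (t k) (\<xi> k)\<bar> \<le> (C * T powr \<epsilon> + 1) * ?m powr (\<beta> - 1 + \<gamma> - \<epsilon>)"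
        using rate[OF P tg] by linarith
    qed
    then show ?thesis using gls rs by blast
  qed
  show ?thesis
    unfolding q_def[symmetric] \<beta>_def[symmetric]
  proof (intro exI[of _ Z] conjI allI impI ballI)
    show "regular_version T \<phi> X \<beta> Z" by (rule reg)
    show "Z' t = Z t" if "regular_version T \<phi> X \<beta> Z'" "t \<in> {0..T}" for Z' t by (rule uniq[OF that])
    fix \<gamma> :: real and Y :: "real \<Rightarrow> real" assume "0 < \<gamma> \<and> \<gamma> < 1 \<and> 1 - \<alpha> * s + q < \<gamma> \<and> holder_on \<gamma> {0..T} Y"
    then show "\<exists>I. has_gls_integral T Z Y I \<and> has_rs_integral T Z Y I \<and>
        (\<forall>\<epsilon>. 0 < \<epsilon> \<and> \<epsilon> < \<beta> - 1 + \<gamma> \<longrightarrow>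
          (\<exists>c>0. \<forall>N t \<xi>. refining_partitions T N t \<and> (\<forall>k\<ge>1. are_tags (N k) (t k) (\<xi> k)) \<longrightarrow>
            (\<forall>k\<ge>1. \<bar>I - rs_sum Z Y (N k) (t k) (\<xi> k)\<bar> \<le> c * mesh (N k) (t k) powr (\<beta> - 1 + \<gamma> - \<epsilon>))))"
      by (elim conjE) (rule int)
  qed
qed

end
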